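(* Let $0<\alpha\le1$, let $S$ be one of the spaces $l^p_{(\beta_i)}$ ($1\le p<\infty$), $l^\infty_{(\beta_i)}$, $\mathbb{R}^{\mathbb N}$, let $\mu$ be a Borel probability measure on $S$, and let $(\mathcal{E}_{(\alpha)},\mathcal{D}(\mathcal{E}_{(\alpha)}))$ be the Dirichlet form on $L^2(S;\mu)$ obtained as the closure of $(\mathcal{E}_{(\alpha)},\mathcal{F}C_0^\infty)$. i) Let $S=l^p_{(\beta_i)}$ for some $1\le p<\infty$. If there exist a positive sequence $\{\gamma_i\}_{i\in\mathbb N}$ with $\sum_{i=1}^\infty\gamma_i^{-1}<\infty$ and an $M_0\in(0,\infty)$ such that both $$\sum_{i=1}^\infty(\beta_i\gamma_i)^{\frac{\alpha+1}{p}}\,\mu\big(\beta_i^{\frac1p}|X_i|>M_0\,\gamma_i^{-\frac1p}\big)<\infty$$ and $$\mu\Big(\bigcup_{M\in\mathbb N}\big\{|X_i|\le M\,\beta_i^{-\frac1p}\gamma_i^{-\frac1p},\ \forall i\in\mathbb N\big\}\Big)=1$$ hold, then $(\mathcal{E}_{(\alpha)},\mathcal{D}(\mathcal{E}_{(\alpha)}))$ is a quasi-regular Dirichlet form. ii) Let $S=l^\infty_{(\beta_i)}$. If there exist a sequence $0<\gamma_1\le\gamma_2\le\cdots\to\infty$ and an $M_0\in(0,\infty)$ such that both $$\sum_{i=1}^\infty(\beta_i\gamma_i)^{\alpha+1}\,\mu\big(\beta_i|X_i|>M_0\,\gamma_i^{-1}\big)<\infty$$ and $$\mu\Big(\bigcup_{M\in\mathbb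 N}\big\{|X_i|\le M\,\beta_i^{-1}\gamma_i^{-1},\ \forall i\in\mathbb N\big\}\Big)=1$$ hold, then $(\mathcal{E}_{(\alpha)},\mathcal{D}(\mathcal{E}_{(\alpha)}))$ is a quasi-regular Dirichlet form. iii) If $S=\mathbb{R}^{\mathbb N}$, then $(\mathcal{E}_{(\alpha)},\mathcal{D}(\mathcal{E}_{(\alpha)}))$ is a quasi-regular Dirichlet form. iv) The forms $(\mathcal{E}_{(\alpha)},\mathcal{D}(\mathcal{E}_{(\alpha)}))$ in i), ii), iii) are strictly quasi-regular Dirichlet forms.
   Context: **State spaces.** For weights $\beta_i>0$: $l^p_{(\beta_i)}=\{\mathbf{x}=(x_1,x_2,\dots)\in\mathbb{R}^{\mathbb N}:\|\mathbf{x}\|=(\sum_i\beta_i|x_i|^p)^{1/p}<\infty\}$ ($1\le p<\infty$), $l^\infty_{(\beta_i)}=\{\mathbf{x}\in\mathbb{R}^{\mathbb N}:\|\mathbf{x}\|=\sup_i\beta_i|x_i|<\infty\}$, with norm topologies; $\mathbb{R}^{\mathbb N}$ carries the product topology. $X_i:S\to\mathbb{R}$, $X_i(\mathbf{x})=x_i$, is the $i$-th coordinate, regarded as a random variable on $(S,\mathcal{B}(S),\mu)$. **Conditional distributions.** $\sigma_{i^c}\subset\mathcal{B}(S)$ is the sub-$\sigma$-field generated by the coordinates $x_j$, $j\neq i$; $\mu(\cdot\,|\,\sigma_{i^c})$ is the regular conditional distribution of $x_i$ given $\sigma_{i^c}$, i.e. $\mu(\{x_i\in A\}\cap B)=\int_B\mu(A\,|\,\sigma_{i^c})\,\mu(d\mathbf{x})$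 for Borel $A\subset\mathbb{R}$, $B\in\sigma_{i^c}$. **The form.** $\mathcal{F}C_0^\infty\subset L^2(S;\mu)$ (real $L^2$) is the linear span of the $\mu$-classes of functions $\mathbf{x}\mapsto f(x_1,\dots,x_n)$, $n\in\mathbb N$, $f\in C_0^\infty(\mathbb{R}^n\to\mathbb{R})$. For $y_i\ne y_i'$ put $$\Phi_\alpha(u,v;y_i,y_i',\mathbf{x}\setminus x_i)=\frac{\{u(\dots,x_{i-1},y_i,x_{i+1},\dots)-u(\dots,x_{i-1},y_i',x_{i+1},\dots)\}\{v(\dots,x_{i-1},y_i,x_{i+1},\dots)-v(\dots,x_{i-1},y_i',x_{i+1},\dots)\}}{|y_i-y_i'|^{\alpha+1}},$$ $$\mathcal{E}^{(i)}_{(\alpha)}(u,v)=\int_S\Big\{\int_{\mathbb{R}}I_{\{y_i\ne x_i\}}\Phi_\alpha(u,v;y_i,x_i,\mathbf{x}\setminus x_i)\,\mu(dy_i\,|\,\sigma_{i^c})\Big\}\mu(d\mathbf{x}),\qquad\mathcal{E}_{(\alpha)}=\sum_{i\in\mathbb N}\mathcal{E}^{(i)}_{(\alpha)}.$$ For $0<\alpha\le1$ the form $(\mathcal{E}_{(\alpha)},\mathcal{F}C_0^\infty)$ is well-defined, Markovian and closable in $L^2(S;\mu)$; its closure is the Dirichlet form $(\mathcal{E}_{(\alpha)},\mathcal{D}(\mathcal{E}_{(\alpha)}))$. **Quasi-regularity** (Ma–Röckner, Section IV.3). Write $\mathcal{E}=\mathcal{E}_{(\alpha)}$ and equip $\mathcal{D}(\mathcal{E})$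 with the norm $\|\cdot\|_{L^2(S;\mu)}+\sqrt{\mathcal{E}(\cdot,\cdot)}$. For closed $F\subset S$ let $\mathcal{D}(\mathcal{E})_F=\{u\in\mathcal{D}(\mathcal{E}):u=0\ \mu\text{-a.e. on }S\setminus F\}$. An $\mathcal{E}$-nest is an increasing sequence $(F_k)$ of closed sets with $\bigcup_k\mathcal{D}(\mathcal{E})_{F_k}$ dense in $\mathcal{D}(\mathcal{E})$. A set $N$ is $\mathcal{E}$-exceptional if $N\subset\bigcap_k(S\setminus F_k)$ for some $\mathcal{E}$-nest $(F_k)$. A function is $\mathcal{E}$-quasi-continuous if there is an $\mathcal{E}$-nest $(F_k)$ such that it is defined on $\bigcup_kF_k$ and its restriction to each $F_k$ is continuous. $\mathcal{E}$ is quasi-regular if: (a) there is an $\mathcal{E}$-nest of compact sets; (b) there is a dense subset of $\mathcal{D}(\mathcal{E})$ whose elements have $\mathcal{E}$-quasi-continuous $\mu$-versions; (c) there are $u_n\in\mathcal{D}(\mathcal{E})$, $n\in\mathbb N$, with $\mathcal{E}$-quasi-continuous $\mu$-versions $\tilde u_n$ and an $\mathcal{E}$-exceptional set $N$ such that $\{\tilde u_n\}$ separates the points of $S\setminus N$. **Strict quasi-regularity** (Ma–Röckner, Section V.2). Adjoin an isolated point $\triangle$ to $S$, $S_\triangle=S\cup\{\triangle\}$, and extend functions by $0$ at $\triangle$. Let $\mathcal{E}_1=\mathcal{E}+(\cdot,\cdot)_{L^2}$, let $G_1$ be the $1$-resolvent operator, and fix $\varphi\in L^2(S;\mu)$ with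 $0<\varphi\le1$. For open $U$ and $1$-excessive $h\in\mathcal{D}(\mathcal{E})$ let $h_U$ be the smallest $1$-excessive function in $\mathcal{D}(\mathcal{E})$ with $h_U\ge h$ $\mu$-a.e. on $U$, and put $\mathrm{Cap}(U)=\sup\{\mathcal{E}_1(h_U,G_1\varphi): h\in\mathcal{D}(\mathcal{E})\ 1\text{-excessive},\ h\le1\}$. A strict $\mathcal{E}$-nest is an increasing sequence of closed sets $F_k$ with $\mathrm{Cap}(S\setminus F_k)\to0$. A set $N\subset S$ is strictly $\mathcal{E}$-exceptional if $N\subset\bigcap_k(S\setminus F_k)$ for some strict $\mathcal{E}$-nest $(F_k)$. A function is strictly $\mathcal{E}$-quasi-continuous if there is a strict $\mathcal{E}$-nest $(F_k)$ such that it is defined on $\bigcup_kF_k$ and (extended by $0$ at $\triangle$) its restriction to each $F_k\cup\{\triangle\}$ is continuous. $\mathcal{E}$ is strictly quasi-regular if (a), (b), (c) hold with all notions replaced by the strict ones (compactness of $F_k\cup\{\triangle\}$ in (a), separation of points of $S_\triangle\setminus N$ in (c)). *)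

theory Defs
  imports "HOL-Probability.Probability"
begin

section \<open>State spaces\<close>

text \<open>Sequences are functions on \<^typ>\<open>nat\<close>, so the coordinates are numbered from 0.
  The norm on \<open>l\<^sup>\<infinity>\<close> is set to 0 off the space because the supremum of an unbounded set of reals is
  unspecified.\<close>

definition lp_space :: "(nat \<Rightarrow> real) \<Rightarrow> real \<Rightarrow> (nat \<Rightarrow> real) set" where
  "lp_space \<beta> p = {x. summable (\<lambda>i. \<beta> i * \<bar>x i\<bar> powr p)}"

definition lp_norm :: "(nat \<Rightarrow> real) \<Rightarrow> real \<Rightarrow> (nat \<Rightarrow> real) \<Rightarrow> real" where
  "lp_norm \<beta> p x = (\<Sum>i. \<beta> i * \<bar>x i\<bar> powr p) powr (1 / p)"

definition linf_space :: "(nat \<Rightarrow> real) \<Rightarrow> (nat \<Rightarrow> real) set" where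
  "linf_space \<beta> = {x. bdd_above (range (\<lambda>i. \<beta> i * \<bar>x i\<bar>))}"

definition linf_norm :: "(nat \<Rightarrow> real) \<Rightarrow> (nat \<Rightarrow> real) \<Rightarrow> real" where
  "linf_norm \<beta> x = (if x \<in> linf_space \<beta> then (SUP i. \<beta> i * \<bar>x i\<bar>) else 0)"

definition lp_topology :: "(nat \<Rightarrow> real) \<Rightarrow> real \<Rightarrow> (nat \<Rightarrow> real) topology" where
  "lp_topology \<beta> p =
     Metric_space.mtopology (lp_space \<beta> p) (\<lambda>x y. lp_norm \<beta> p (\<lambda>i. x i - y i))"

definition linf_topology :: "(nat \<Rightarrow> real) \<Rightarrow> (nat \<Rightarrow> real) topology" where
  "linf_topology \<beta> =
     Metric_space.mtopology (linf_space \<beta>) (\<lambda>x y. linf_norm \<beta> (\<lambda>i. x i - y i))"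

definition borel_of :: "'a topology \<Rightarrow> 'a measure" where
  "borel_of X = sigma (topspace X) {U. openin X U}"


section \<open>Conditional distributions\<close>

definition sigma_compl :: "(nat \<Rightarrow> real) measure \<Rightarrow> nat \<Rightarrow> (nat \<Rightarrow> real) measure" where
  "sigma_compl M i =
     sigma (space M) {{x \<in> space M. x j \<in> A} | j A. j \<noteq> i \<and> A \<in> sets borel}"

definition regular_cond_dist ::
  "(nat \<Rightarrow> real) measure \<Rightarrow> nat \<Rightarrow> ((nat \<Rightarrow> real) \<Rightarrow> real measure) \<Rightarrow> bool" where
  "regular_cond_dist M i K \<longleftrightarrow>
     K \<in> measurable (sigma_compl M i) (prob_algebra borel) \<and>
     (\<forall>A \<in> sets borel. \<forall>B \<in> sets (sigma_compl M i).
        emeasure M ({x \<in> space M. x i \<in> A} \<inter> B) =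
          (\<integral>\<^sup>+ x \<in> B. emeasure (K x) A \<partial>M))"


section \<open>Smooth cylinder functions and the form on them\<close>

text \<open>In \<^const>\<open>Euclidean_space\<close> \<open>n\<close>, a point of $\mathbb{R}^n$ is a sequence vanishing from index
  \<open>n\<close> on.\<close>

definition partial_deriv :: "nat \<Rightarrow> ((nat \<Rightarrow> real) \<Rightarrow> real) \<Rightarrow> (nat \<Rightarrow> real) \<Rightarrow> real" where
  "partial_deriv i f x = deriv (\<lambda>t. f (x(i := t))) (x i)"

primrec C_k :: "nat \<Rightarrow> nat \<Rightarrow> ((nat \<Rightarrow> real) \<Rightarrow> real) \<Rightarrow> bool" where
  "C_k n 0 f \<longleftrightarrow> continuous_map (Euclidean_space n) euclideanreal f"
| "C_k n (Suc k) f \<longleftrightarrow> continuous_map (Euclidean_space n) euclideanreal f \<and>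
     (\<forall>i<n. (\<forall>x \<in> topspace (Euclidean_space n). (\<lambda>t. f (x(i := t))) differentiable (at (x i))) \<and>
            C_k n k (partial_deriv i f))"

definition C0_infinity :: "nat \<Rightarrow> ((nat \<Rightarrow> real) \<Rightarrow> real) set" where
  "C0_infinity n = {f. (\<forall>k. C_k n k f) \<and>
     compactin (Euclidean_space n)
       (Euclidean_space n closure_of {x \<in> topspace (Euclidean_space n). f x \<noteq> 0})}"

definition cylinder :: "((nat \<Rightarrow> real) \<Rightarrow> real) set" where
  "cylinder = {\<lambda>x. f (\<lambda>i. if i < n then x i else 0) | f n. n \<ge> 1 \<and> f \<in> C0_infinity n}"

definition FC0_infinity :: "((nat \<Rightarrow> real) \<Rightarrow> real) set" where
  "FC0_infinity = {\<lambda>x. \<Sum>j<k. c j * g j x | (k::nat) (c :: nat \<Rightarrow> real) g. \<forall>j<k. g j \<in> cylinder}"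

definition Phi :: "real \<Rightarrow> nat \<Rightarrow> ((nat \<Rightarrow> real) \<Rightarrow> real) \<Rightarrow> ((nat \<Rightarrow> real) \<Rightarrow> real) \<Rightarrow>
    real \<Rightarrow> real \<Rightarrow> (nat \<Rightarrow> real) \<Rightarrow> real" where
  "Phi \<alpha> i u v y y' x =
     (u (x(i := y)) - u (x(i := y'))) * (v (x(i := y)) - v (x(i := y'))) / \<bar>y - y'\<bar> powr (\<alpha> + 1)"

definition energy_i :: "real \<Rightarrow> (nat \<Rightarrow> real) measure \<Rightarrow> (nat \<Rightarrow> (nat \<Rightarrow> real) \<Rightarrow> real measure) \<Rightarrow>
    nat \<Rightarrow> ((nat \<Rightarrow> real) \<Rightarrow> real) \<Rightarrow> ((nat \<Rightarrow> real) \<Rightarrow> real) \<Rightarrow> real" where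
  "energy_i \<alpha> M \<kappa> i u v =
     (\<integral>x. (\<integral>y. indicator {y. y \<noteq> x i} y * Phi \<alpha> i u v y (x i) x \<partial>\<kappa> i x) \<partial>M)"

definition energy :: "real \<Rightarrow> (nat \<Rightarrow> real) measure \<Rightarrow> (nat \<Rightarrow> (nat \<Rightarrow> real) \<Rightarrow> real measure) \<Rightarrow>
    ((nat \<Rightarrow> real) \<Rightarrow> real) \<Rightarrow> ((nat \<Rightarrow> real) \<Rightarrow> real) \<Rightarrow> real" where
  "energy \<alpha> M \<kappa> u v = (\<Sum>i. energy_i \<alpha> M \<kappa> i u v)"


section \<open>Dirichlet forms\<close>

text \<open>Elements of \<open>L\<^sup>2\<close> are represented by functions; classes appear through almost-everywhere
  equality. A form is given by its domain \<open>D\<close> and its values \<open>E\<close>.\<close>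

type_synonym 'a form = "('a \<Rightarrow> real) \<Rightarrow> ('a \<Rightarrow> real) \<Rightarrow> real"

definition L2 :: "'a measure \<Rightarrow> ('a \<Rightarrow> real) set" where
  "L2 M = {u \<in> borel_measurable M. integrable M (\<lambda>x. (u x)\<^sup>2)}"

definition L2_inner :: "'a measure \<Rightarrow> 'a form" where
  "L2_inner M u v = (\<integral>x. u x * v x \<partial>M)"

definition L2_norm :: "'a measure \<Rightarrow> ('a \<Rightarrow> real) \<Rightarrow> real" where
  "L2_norm M u = sqrt (L2_inner M u u)"

definition form_norm :: "'a measure \<Rightarrow> 'a form \<Rightarrow> ('a \<Rightarrow> real) \<Rightarrow> real" where
  "form_norm M E u = L2_norm M u + sqrt (E u u)"

definition form_approx ::
  "'a measure \<Rightarrow> ('a \<Rightarrow> real) set \<Rightarrow> 'a form \<Rightarrow> ('a \<Rightarrow> real) \<Rightarrow> (nat \<Rightarrow> 'a \<Rightarrow> real) \<Rightarrow> bool" where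
  "form_approx M D0 E0 u w \<longleftrightarrow>
     (\<forall>n. w n \<in> D0) \<and>
     (\<forall>e>0. \<exists>N. \<forall>m\<ge>N. \<forall>n\<ge>N. E0 (\<lambda>x. w m x - w n x) (\<lambda>x. w m x - w n x) < e) \<and>
     (\<lambda>n. L2_norm M (\<lambda>x. w n x - u x)) \<longlonglongrightarrow> 0"

definition closure_dom ::
  "'a measure \<Rightarrow> ('a \<Rightarrow> real) set \<Rightarrow> 'a form \<Rightarrow> ('a \<Rightarrow> real) set" where
  "closure_dom M D0 E0 = {u \<in> L2 M. \<exists>w. form_approx M D0 E0 u w}"

text \<open>The limit is required for every choice of approximating sequences; it exists and is
  unique for \<open>u\<close>, \<open>v\<close> in \<^const>\<open>closure_dom\<close> exactly when the form is closable.\<close>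

definition closure_form :: "'a measure \<Rightarrow> ('a \<Rightarrow> real) set \<Rightarrow> 'a form \<Rightarrow> 'a form" where
  "closure_form M D0 E0 u v =
     (THE l. \<forall>w w'. form_approx M D0 E0 u w \<longrightarrow> form_approx M D0 E0 v w' \<longrightarrow>
        (\<lambda>n. E0 (w n) (w' n)) \<longlonglongrightarrow> l)"

definition dirichlet_form :: "'a measure \<Rightarrow> ('a \<Rightarrow> real) set \<Rightarrow> 'a form \<Rightarrow> bool" where
  "dirichlet_form M D E \<longleftrightarrow>
     D \<subseteq> L2 M \<and>
     (\<forall>u\<in>D. \<forall>v\<in>L2 M. (AE x in M. v x = u x) \<longrightarrow> v \<in> D \<and> (\<forall>w\<in>D. E v w = E u w)) \<and>
     (\<forall>u\<in>D. \<forall>v\<in>D. \<forall>a b. (\<lambda>x. a * u x + b * v x) \<in> D \<and>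
        (\<forall>w\<in>D. E (\<lambda>x. a * u x + b * v x) w = a * E u w + b * E v w)) \<and>
     (\<forall>u\<in>D. \<forall>v\<in>D. E u v = E v u) \<and>
     (\<forall>u\<in>D. 0 \<le> E u u) \<and>
     (\<forall>f\<in>L2 M. \<forall>e>0. \<exists>u\<in>D. L2_norm M (\<lambda>x. f x - u x) < e) \<and>
     (\<forall>w. (\<forall>n. w n \<in> D) \<and>
        (\<forall>e>0. \<exists>N. \<forall>m\<ge>N. \<forall>n\<ge>N. form_norm M E (\<lambda>x. w m x - w n x) < e) \<longrightarrow>
        (\<exists>u\<in>D. (\<lambda>n. form_norm M E (\<lambda>x. w n x - u x)) \<longlonglongrightarrow> 0)) \<and>
     (\<forall>u\<in>D. (\<lambda>x. min (max (u x) 0) 1) \<in> D \<and>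
        E (\<lambda>x. min (max (u x) 0) 1) (\<lambda>x. min (max (u x) 0) 1) \<le> E u u)"

definition form_dense_in ::
  "'a measure \<Rightarrow> 'a form \<Rightarrow> ('a \<Rightarrow> real) set \<Rightarrow> ('a \<Rightarrow> real) set \<Rightarrow> bool" where
  "form_dense_in M E C D \<longleftrightarrow>
     C \<subseteq> D \<and> (\<forall>u\<in>D. \<forall>e>0. \<exists>v\<in>C. form_norm M E (\<lambda>x. u x - v x) < e)"


section \<open>Quasi-regularity\<close>

text \<open>A function defined on part of the space is represented by a total function with arbitrary
  values elsewhere, so being defined on the union of a nest is no condition.\<close>

definition separates_points :: "(nat \<Rightarrow> 'a \<Rightarrow> real) \<Rightarrow> 'a set \<Rightarrow> bool" where
  "separates_points f A \<longleftrightarrow> (\<forall>x\<in>A. \<forall>y\<in>A. x \<noteq> y \<longrightarrow> (\<exists>n. f n x \<noteq> f n y))"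

definition vanishing_off ::
  "'a measure \<Rightarrow> ('a \<Rightarrow> real) set \<Rightarrow> 'a set \<Rightarrow> ('a \<Rightarrow> real) set" where
  "vanishing_off M D F = {u \<in> D. AE x in M. x \<notin> F \<longrightarrow> u x = 0}"

definition nest ::
  "'a topology \<Rightarrow> 'a measure \<Rightarrow> ('a \<Rightarrow> real) set \<Rightarrow> 'a form \<Rightarrow> (nat \<Rightarrow> 'a set) \<Rightarrow> bool" where
  "nest X M D E F \<longleftrightarrow> incseq F \<and> (\<forall>k. closedin X (F k)) \<and>
     form_dense_in M E (\<Union>k. vanishing_off M D (F k)) D"

definition exceptional ::
  "'a topology \<Rightarrow> 'a measure \<Rightarrow> ('a \<Rightarrow> real) set \<Rightarrow> 'a form \<Rightarrow> 'a set \<Rightarrow> bool" where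
  "exceptional X M D E N \<longleftrightarrow>
     (\<exists>F. nest X M D E F \<and> N \<subseteq> (\<Inter>k. topspace X - F k))"

definition quasi_continuous ::
  "'a topology \<Rightarrow> 'a measure \<Rightarrow> ('a \<Rightarrow> real) set \<Rightarrow> 'a form \<Rightarrow> ('a \<Rightarrow> real) \<Rightarrow> bool" where
  "quasi_continuous X M D E f \<longleftrightarrow>
     (\<exists>F. nest X M D E F \<and> (\<forall>k. continuous_map (subtopology X (F k)) euclideanreal f))"

definition quasi_regular ::
  "'a topology \<Rightarrow> 'a measure \<Rightarrow> ('a \<Rightarrow> real) set \<Rightarrow> 'a form \<Rightarrow> bool" where
  "quasi_regular X M D E \<longleftrightarrow>
     (\<exists>F. nest X M D E F \<and> (\<forall>k. compactin X (F k))) \<and>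
     (\<exists>C. form_dense_in M E C D \<and>
        (\<forall>u\<in>C. \<exists>f. quasi_continuous X M D E f \<and> (AE x in M. f x = u x))) \<and>
     (\<exists>u f N. (\<forall>n. u n \<in> D \<and> quasi_continuous X M D E (f n) \<and> (AE x in M. f n x = u n x)) \<and>
        exceptional X M D E N \<and> separates_points f (topspace X - N))"


section \<open>Strict quasi-regularity\<close>

text \<open>The added isolated point is \<^const>\<open>None\<close>.\<close>

definition adjoin_point :: "'a topology \<Rightarrow> 'a option topology" where
  "adjoin_point X = topology (\<lambda>U. openin X (Some -` U))"

lemma openin_adjoin_point: "openin (adjoin_point X) U \<longleftrightarrow> openin X (Some -` U)"
proof -
  have "istopology (\<lambda>U. openin X (Some -` U))"
    by (auto simp: istopology_def vimage_Int vimage_Union)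
  then show ?thesis
    by (simp add: adjoin_point_def)
qed

lemma topspace_adjoin_point: "topspace (adjoin_point X) = insert None (Some ` topspace X)"
proof
  show "topspace (adjoin_point X) \<subseteq> insert None (Some ` topspace X)"
  proof
    fix z assume z: "z \<in> topspace (adjoin_point X)"
    show "z \<in> insert None (Some ` topspace X)"
    proof (cases z)
      case (Some x)
      have "Some -` topspace (adjoin_point X) \<subseteq> topspace X"
        by (rule openin_subset) (simp flip: openin_adjoin_point)
      with z Some show ?thesis by auto
    qed simp
  qed
  have "Some -` insert None (Some ` topspace X) = topspace X"
    by auto
  then have "openin (adjoin_point X) (insert None (Some ` topspace X))"
    by (simp add: openin_adjoin_point)
  then show "insert None (Some ` topspace X) \<subseteq> topspace (adjoin_point X)"
    by (rule openin_subset)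
qed

definition extend0 :: "('a \<Rightarrow> real) \<Rightarrow> 'a option \<Rightarrow> real" where
  "extend0 f z = (case z of None \<Rightarrow> 0 | Some x \<Rightarrow> f x)"

definition E1 :: "'a measure \<Rightarrow> 'a form \<Rightarrow> 'a form" where
  "E1 M E u v = E u v + L2_inner M u v"

text \<open>The resolvent of a Dirichlet form: the representative of \<open>G\<^sub>a f\<close> is unique up to null sets.\<close>

definition resolvent ::
  "'a measure \<Rightarrow> ('a \<Rightarrow> real) set \<Rightarrow> 'a form \<Rightarrow> real \<Rightarrow> ('a \<Rightarrow> real) \<Rightarrow> 'a \<Rightarrow> real" where
  "resolvent M D E a f =
     (SOME g. g \<in> D \<and> (\<forall>v\<in>D. E g v + a * L2_inner M g v = L2_inner M f v))"

definition excessive1 ::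
  "'a measure \<Rightarrow> ('a \<Rightarrow> real) set \<Rightarrow> 'a form \<Rightarrow> ('a \<Rightarrow> real) \<Rightarrow> bool" where
  "excessive1 M D E h \<longleftrightarrow>
     h \<in> L2 M \<and> (\<forall>b>0. AE x in M. b * resolvent M D E (b + 1) h x \<le> h x)"

definition excessive_majorants ::
  "'a measure \<Rightarrow> ('a \<Rightarrow> real) set \<Rightarrow> 'a form \<Rightarrow> ('a \<Rightarrow> real) \<Rightarrow> 'a set \<Rightarrow> ('a \<Rightarrow> real) set" where
  "excessive_majorants M D E h U =
     {g \<in> D. excessive1 M D E g \<and> (AE x in M. x \<in> U \<longrightarrow> h x \<le> g x)}"

definition reduced ::
  "'a measure \<Rightarrow> ('a \<Rightarrow> real) set \<Rightarrow> 'a form \<Rightarrow> ('a \<Rightarrow> real) \<Rightarrow> 'a set \<Rightarrow> 'a \<Rightarrow> real" where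
  "reduced M D E h U =
     (SOME g. g \<in> excessive_majorants M D E h U \<and>
        (\<forall>g' \<in> excessive_majorants M D E h U. AE x in M. g x \<le> g' x))"

definition Cap ::
  "'a measure \<Rightarrow> ('a \<Rightarrow> real) set \<Rightarrow> 'a form \<Rightarrow> ('a \<Rightarrow> real) \<Rightarrow> 'a set \<Rightarrow> ereal" where
  "Cap M D E \<phi> U =
     (SUP h \<in> {h \<in> D. excessive1 M D E h \<and> (AE x in M. h x \<le> 1)}.
        ereal (E1 M E (reduced M D E h U) (resolvent M D E 1 \<phi>)))"

definition strict_nest ::
  "'a topology \<Rightarrow> 'a measure \<Rightarrow> ('a \<Rightarrow> real) set \<Rightarrow> 'a form \<Rightarrow> ('a \<Rightarrow> real) \<Rightarrow> (nat \<Rightarrow> 'a set) \<Rightarrow> bool"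
  where
  "strict_nest X M D E \<phi> F \<longleftrightarrow> incseq F \<and> (\<forall>k. closedin X (F k)) \<and>
     (\<lambda>k. Cap M D E \<phi> (topspace X - F k)) \<longlonglongrightarrow> 0"

definition strictly_exceptional ::
  "'a topology \<Rightarrow> 'a measure \<Rightarrow> ('a \<Rightarrow> real) set \<Rightarrow> 'a form \<Rightarrow> ('a \<Rightarrow> real) \<Rightarrow> 'a set \<Rightarrow> bool" where
  "strictly_exceptional X M D E \<phi> N \<longleftrightarrow>
     (\<exists>F. strict_nest X M D E \<phi> F \<and> N \<subseteq> (\<Inter>k. topspace X - F k))"

definition strictly_quasi_continuous ::
  "'a topology \<Rightarrow> 'a measure \<Rightarrow> ('a \<Rightarrow> real) set \<Rightarrow> 'a form \<Rightarrow> ('a \<Rightarrow> real) \<Rightarrow> ('a \<Rightarrow> real) \<Rightarrow> bool"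
  where
  "strictly_quasi_continuous X M D E \<phi> f \<longleftrightarrow>
     (\<exists>F. strict_nest X M D E \<phi> F \<and>
        (\<forall>k. continuous_map (subtopology (adjoin_point X) (insert None (Some ` F k)))
               euclideanreal (extend0 f)))"

definition strictly_quasi_regular ::
  "'a topology \<Rightarrow> 'a measure \<Rightarrow> ('a \<Rightarrow> real) set \<Rightarrow> 'a form \<Rightarrow> ('a \<Rightarrow> real) \<Rightarrow> bool" where
  "strictly_quasi_regular X M D E \<phi> \<longleftrightarrow>
     (\<exists>F. strict_nest X M D E \<phi> F \<and>
        (\<forall>k. compactin (adjoin_point X) (insert None (Some ` F k)))) \<and>
     (\<exists>C. form_dense_in M E C D \<and>
        (\<forall>u\<in>C. \<exists>f. strictly_quasi_continuous X M D E \<phi> f \<and> (AE x in M. f x = u x))) \<and>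
     (\<exists>u f N.
        (\<forall>n. u n \<in> D \<and> strictly_quasi_continuous X M D E \<phi> (f n) \<and> (AE x in M. f n x = u n x)) \<and>
        strictly_exceptional X M D E \<phi> N \<and>
        separates_points (\<lambda>n. extend0 (f n)) (insert None (Some ` topspace X) - Some ` N))"


section \<open>The closed form and the tightness conditions\<close>

definition energy_dom :: "real \<Rightarrow> (nat \<Rightarrow> real) measure \<Rightarrow>
    (nat \<Rightarrow> (nat \<Rightarrow> real) \<Rightarrow> real measure) \<Rightarrow> ((nat \<Rightarrow> real) \<Rightarrow> real) set" where
  "energy_dom \<alpha> M \<kappa> = closure_dom M FC0_infinity (energy \<alpha> M \<kappa>)"

definition energy_form :: "real \<Rightarrow> (nat \<Rightarrow> real) measure \<Rightarrow>
    (nat \<Rightarrow> (nat \<Rightarrow> real) \<Rightarrow> real measure) \<Rightarrow> (nat \<Rightarrow> real) form" where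
  "energy_form \<alpha> M \<kappa> = closure_form M FC0_infinity (energy \<alpha> M \<kappa>)"

definition lp_condition :: "real \<Rightarrow> real \<Rightarrow> (nat \<Rightarrow> real) \<Rightarrow> (nat \<Rightarrow> real) measure \<Rightarrow> bool" where
  "lp_condition \<alpha> p \<beta> M \<longleftrightarrow>
     (\<exists>\<gamma> :: nat \<Rightarrow> real. \<exists>M0 > 0. (\<forall>i. \<gamma> i > 0) \<and> summable (\<lambda>i. 1 / \<gamma> i) \<and>
        summable (\<lambda>i. (\<beta> i * \<gamma> i) powr ((\<alpha> + 1) / p) *
          measure M {x \<in> space M. \<beta> i powr (1 / p) * \<bar>x i\<bar> > M0 * \<gamma> i powr (- 1 / p)}) \<and>
        measure M (\<Union>m::nat. {x \<in> space M.
          \<forall>i. \<bar>x i\<bar> \<le> real m * \<beta> i powr (- 1 / p) * \<gamma> i powr (- 1 / p)}) = 1)"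

definition linf_condition :: "real \<Rightarrow> (nat \<Rightarrow> real) \<Rightarrow> (nat \<Rightarrow> real) measure \<Rightarrow> bool" where
  "linf_condition \<alpha> \<beta> M \<longleftrightarrow>
     (\<exists>\<gamma> :: nat \<Rightarrow> real. \<exists>M0 > 0. 0 < \<gamma> 0 \<and> incseq \<gamma> \<and> filterlim \<gamma> at_top sequentially \<and>
        summable (\<lambda>i. (\<beta> i * \<gamma> i) powr (\<alpha> + 1) *
          measure M {x \<in> space M. \<beta> i * \<bar>x i\<bar> > M0 * inverse (\<gamma> i)}) \<and>
        measure M (\<Union>m::nat. {x \<in> space M.
          \<forall>i. \<bar>x i\<bar> \<le> real m * inverse (\<beta> i) * inverse (\<gamma> i)}) = 1)"

end

theory Submission
  imports Defs
begin

text \<open>The \<open>i\<close>-th coordinate of \<open>x\<close> is resampled from its conditional distribution. Weighting the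
  resulting pairs (new point, old point) by \<open>|y - x\<^sub>i|\<^bsup>-(\<alpha>+1)\<^esup>\<close> gives a measure \<open>Lam\<close> for which
  \<open>E(u,v)\<close> is the \<open>L\<^sup>2(Lam)\<close> inner product of the increments of \<open>u\<close> and \<open>v\<close>; hence the closure is
  a restriction of a closed form, and smooth approximations of contractions give the Markov property.

  All three state spaces provide scales \<open>b\<^sub>i > 0\<close> with \<open>\<Sum>\<^sub>i b\<^sub>i\<^bsup>-(\<alpha>+1)\<^esup> \<mu>(|X\<^sub>i| > M\<^sub>0 b\<^sub>i) < \<infinity>\<close> whose
  boxes \<open>{|x\<^sub>i| \<le> m b\<^sub>i for all i}\<close> are compact and exhaust the space up to a null set. The cutoffs
  \<open>\<Prod>\<^sub>i bump(x\<^sub>i/(k b\<^sub>i))\<close> are supported in boxes, and their energy is at most a constant times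
  \<open>k\<^bsup>-(\<alpha>+1)\<^esup> \<Sum>\<^sub>i b\<^sub>i\<^bsup>-(\<alpha>+1)\<^esup> \<mu>(|X\<^sub>i| > M\<^sub>0 b\<^sub>i)\<close>, so that the boxes form a nest. Since the capacity of an
  open set is bounded by the \<open>E\<^sub>1\<close>-norm of any \<open>v\<close> in the domain with \<open>v \<ge> 1\<close> on it, and one minus a
  cutoff is such a function for the complement of a box, the nest is strict.\<close>

section \<open>Convergence in \<open>L\<^sup>2\<close>\<close>

text \<open>Elements of the domain are represented by functions, so increments must respect null
  sets. They do because resampling one coordinate preserves the law. That invariance is available on
  the sigma-field of the coordinates, which on a nonseparable space may be smaller than the Borel
  field; the gap is closed by the boxes, on which both topologies agree and which carry the whole
  mass. The bound \<alpha> \<le> 1 enters through (min 1 t)^2 \<le> t^(\<alpha>+1): with it the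
  weighted squared increments of a bounded Lipschitz function stay bounded. The constant 1 is no sum
  of compactly supported cylinder functions. It is reached as the energy limit of the cutoffs, and
  truncation at 1 as well as the capacity estimate depend on it. The capacity is defined through
  excessive functions and smallest majorants. Both are brought back to the form: on the domain,
  excessive means that E_1(e, w) is nonnegative for all w \<ge> 0, and the smallest majorant is a
  minimiser of E_1.\<close>

lemma L2_measurable: "f \<in> L2 M \<Longrightarrow> f \<in> borel_measurable M"
  and L2_integrable_square: "f \<in> L2 M \<Longrightarrow> integrable M (\<lambda>x. (f x)\<^sup>2)"
  by (auto simp: L2_def)

lemma L2_integrable_mult:
  assumes "f \<in> L2 M" "g \<in> L2 M"
  shows "integrable M (\<lambda>x. f x * g x)"
proof (rule Bochner_Integration.integrable_bound)
  show "integrable M (\<lambda>x. (f x)\<^sup>2 + (g x)\<^sup>2)"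
    using assms by (auto simp: L2_def)
  show "(\<lambda>x. f x * g x) \<in> borel_measurable M"
    using assms by (auto simp: L2_def)
  have "\<bar>s * t\<bar> \<le> s\<^sup>2 + t\<^sup>2" for s t :: real
  proof -
    have "0 \<le> (\<bar>s\<bar> - \<bar>t\<bar>)\<^sup>2" by simp
    then have "2 * (\<bar>s\<bar> * \<bar>t\<bar>) \<le> s\<^sup>2 + t\<^sup>2" by (simp add: power2_diff)
    moreover have "0 \<le> \<bar>s\<bar> * \<bar>t\<bar>" by simp
    ultimately show ?thesis unfolding abs_mult by linarith
  qed
  then show "AE x in M. norm (f x * g x) \<le> norm ((f x)\<^sup>2 + (g x)\<^sup>2)"
    by (auto intro!: AE_I2 simp del: abs_mult)
qed

lemma L2_bound:
  assumes "g \<in> L2 M" "f \<in> borel_measurable M" "AE x in M. \<bar>f x\<bar> \<le> \<bar>g x\<bar>"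
  shows "f \<in> L2 M"
  unfolding L2_def
proof (safe intro!: assms(2))
  show "integrable M (\<lambda>x. (f x)\<^sup>2)"
    using assms(2,3)
    by (intro Bochner_Integration.integrable_bound[OF L2_integrable_square[OF assms(1)]])
       (auto simp: abs_le_square_iff)
qed

lemma L2_lin:
  assumes "f \<in> L2 M" "g \<in> L2 M"
  shows "(\<lambda>x. s * f x + t * g x) \<in> L2 M"
proof -
  have "integrable M (\<lambda>x. s\<^sup>2 * (f x)\<^sup>2 + 2 * s * t * (f x * g x) + t\<^sup>2 * (g x)\<^sup>2)"
    using assms L2_integrable_mult[OF assms] by (auto simp: L2_def)
  then have "integrable M (\<lambda>x. (s * f x + t * g x)\<^sup>2)"
    by (rule back_subst[of "integrable M"]) (auto simp: power2_eq_square algebra_simps)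
  then show ?thesis using assms by (auto simp: L2_def)
qed

lemma L2_scale: "f \<in> L2 M \<Longrightarrow> (\<lambda>x. s * f x) \<in> L2 M"
  using L2_lin[of f M f s 0] by simp
lemma L2_add: "f \<in> L2 M \<Longrightarrow> g \<in> L2 M \<Longrightarrow> (\<lambda>x. f x + g x) \<in> L2 M"
  using L2_lin[of f M g 1 1] by simp
lemma L2_diff: "f \<in> L2 M \<Longrightarrow> g \<in> L2 M \<Longrightarrow> (\<lambda>x. f x - g x) \<in> L2 M"
  using L2_lin[of f M g 1 "-1"] by simp

lemma L2_inner_commute: "L2_inner M f g = L2_inner M g f"
  by (simp add: L2_inner_def mult.commute)

lemma L2_inner_lin:
  assumes "f \<in> L2 M" "g \<in> L2 M" "h \<in> L2 M"
  shows "L2_inner M (\<lambda>x. s * f x + t * g x) h = s * L2_inner M f h + t * L2_inner M g h"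
proof -
  have "L2_inner M (\<lambda>x. s * f x + t * g x) h = (\<integral>x. s * (f x * h x) + t * (g x * h x) \<partial>M)"
    by (simp add: L2_inner_def algebra_simps)
  also have "\<dots> = s * L2_inner M f h + t * L2_inner M g h"
    using L2_integrable_mult[OF assms(1,3)] L2_integrable_mult[OF assms(2,3)]
    by (simp add: L2_inner_def)
  finally show ?thesis .
qed

lemma L2_inner_square: "L2_inner M f f = (\<integral>x. (f x)\<^sup>2 \<partial>M)"
  by (simp add: L2_inner_def power2_eq_square)

lemma L2_inner_nonneg: "0 \<le> L2_inner M f f"
  by (simp add: L2_inner_square)

lemma L2_inner_cong:
  assumes "AE x in M. f x = f' x" "AE x in M. g x = g' x"
    "f \<in> borel_measurable M" "f' \<in> borel_measurable M" "g \<in> borel_measurable M" "g' \<in> borel_measurable M"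
  shows "L2_inner M f g = L2_inner M f' g'"
  unfolding L2_inner_def using assms by (intro integral_cong_AE) auto

lemma L2_inner_zero_AE:
  assumes "f \<in> L2 M" "L2_inner M f f \<le> 0"
  shows "AE x in M. f x = 0"
proof -
  have "(\<integral>x. (f x)\<^sup>2 \<partial>M) = 0"
    using assms(2) L2_inner_nonneg[of M f] unfolding L2_inner_square by linarith
  then show ?thesis
    using integral_nonneg_eq_0_iff_AE[of M "\<lambda>x. (f x)\<^sup>2"] assms(1) by (auto simp: L2_def)
qed

text \<open>The parabola is evaluated at its vertex -B/A. In the degenerate case a line with B
  different from 0 takes the value -1 at the chosen point.\<close>

lemma quadratic_nonneg_discriminant:
  assumes "\<And>t::real. 0 \<le> A * t\<^sup>2 + 2 * B * t + C" and "0 \<le> A"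
  shows "B\<^sup>2 \<le> A * C"
proof (cases "A = 0")
  case True
  have "B = 0"
  proof (rule ccontr)
    assume "B \<noteq> 0"
    with assms(1)[of "- (C + 1) / (2 * B)"] True show False by (simp add: field_simps)
  qed
  then show ?thesis using True by simp
next
  case False
  then have "A > 0" using assms(2) by simp
  with assms(1)[of "- B / A"] show ?thesis
    by (simp add: field_simps power2_eq_square)
qed

lemma L2_Cauchy_Schwarz:
  assumes "f \<in> L2 M" "g \<in> L2 M"
  shows "\<bar>L2_inner M f g\<bar> \<le> sqrt (L2_inner M f f) * sqrt (L2_inner M g g)"
proof -
  have "(L2_inner M f g)\<^sup>2 \<le> L2_inner M f f * L2_inner M g g"
  proof (rule quadratic_nonneg_discriminant)
    fix t
    have eq: "L2_inner M (\<lambda>x. t * f x + 1 * g x) (\<lambda>x. t * f x + 1 * g x)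
      = L2_inner M f f * t\<^sup>2 + 2 * L2_inner M f g * t + L2_inner M g g"
      using assms L2_lin[OF assms, of t 1]
      by (subst L2_inner_lin, simp_all, subst (1 2) L2_inner_commute,
          subst (1 2) L2_inner_lin[of _ _ _ _ _ 1, simplified])
         (simp_all add: L2_inner_commute[of M g f] power2_eq_square algebra_simps)
    show "0 \<le> L2_inner M f f * t\<^sup>2 + 2 * L2_inner M f g * t + L2_inner M g g"
      using L2_inner_nonneg[of M "\<lambda>x. t * f x + 1 * g x"] unfolding eq .
  qed (rule L2_inner_nonneg)
  then show ?thesis
    by (metis real_sqrt_abs real_sqrt_le_iff real_sqrt_mult)
qed

lemma L2_inner_add_square_le:
  assumes "f \<in> L2 M" "g \<in> L2 M"
  shows "L2_inner M (\<lambda>x. f x + g x) (\<lambda>x. f x + g x) \<le> 2 * L2_inner M f f + 2 * L2_inner M g g"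
proof -
  have "(\<integral>x. (f x + g x)\<^sup>2 \<partial>M) \<le> (\<integral>x. 2 * (f x)\<^sup>2 + 2 * (g x)\<^sup>2 \<partial>M)"
  proof (rule integral_mono)
    show "integrable M (\<lambda>x. (f x + g x)\<^sup>2)"
      using L2_add[OF assms] by (auto simp: L2_def)
    show "integrable M (\<lambda>x. 2 * (f x)\<^sup>2 + 2 * (g x)\<^sup>2)"
      using assms by (auto simp: L2_def)
    show "(f x + g x)\<^sup>2 \<le> 2 * (f x)\<^sup>2 + 2 * (g x)\<^sup>2" for x
      using sum_squares_bound[of "f x" "g x"] by (simp add: power2_sum)
  qed
  also have "\<dots> = 2 * (\<integral>x. (f x)\<^sup>2 \<partial>M) + 2 * (\<integral>x. (g x)\<^sup>2 \<partial>M)"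
    using assms by (simp add: L2_def)
  finally show ?thesis by (simp add: L2_inner_square)
qed

text \<open>The limit is only assumed measurable; its square-integrability comes with the bound.
  Asking for the bound from an index \<open>K\<close> on fits the tails of Cauchy sequences.\<close>

lemma L2_Fatou:
  assumes f: "\<And>k. f k \<in> L2 M" and g: "g \<in> borel_measurable M"
    and lim: "AE x in M. (\<lambda>k. f k x) \<longlonglongrightarrow> g x"
    and bd: "\<And>k. k \<ge> K \<Longrightarrow> L2_inner M (f k) (f k) \<le> C"
  shows "g \<in> L2 M" and "L2_inner M g g \<le> C"
proof -
  note [measurable] = g
  have [measurable]: "f k \<in> borel_measurable M" for k using f by (simp add: L2_def)
  have C: "0 \<le> C" using bd[of K] L2_inner_nonneg[of M "f K"] by simp
  have "(\<integral>\<^sup>+x. ennreal ((g x)\<^sup>2) \<partial>M) = (\<integral>\<^sup>+x. liminf (\<lambda>k. ennreal ((f k x)\<^sup>2)) \<partial>M)"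
  proof (rule nn_integral_cong_AE)
    show "AE x in M. ennreal ((g x)\<^sup>2) = liminf (\<lambda>k. ennreal ((f k x)\<^sup>2))"
      using lim
    proof eventually_elim
      case (elim x)
      then have "(\<lambda>k. ennreal ((f k x)\<^sup>2)) \<longlonglongrightarrow> ennreal ((g x)\<^sup>2)"
        by (intro tendsto_ennrealI tendsto_power)
      then show ?case by (intro lim_imp_Liminf[symmetric]) simp
    qed
  qed
  also have "\<dots> \<le> liminf (\<lambda>k. \<integral>\<^sup>+x. ennreal ((f k x)\<^sup>2) \<partial>M)"
    by (rule nn_integral_liminf) measurable
  also have "\<dots> \<le> ennreal C"
  proof (rule Liminf_le)
    show "\<forall>\<^sub>F k in sequentially. (\<integral>\<^sup>+x. ennreal ((f k x)\<^sup>2) \<partial>M) \<le> ennreal C"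
      using eventually_ge_at_top[of K]
    proof eventually_elim
      case (elim k)
      have "(\<integral>\<^sup>+x. ennreal ((f k x)\<^sup>2) \<partial>M) = ennreal (\<integral>x. (f k x)\<^sup>2 \<partial>M)"
        using f[of k] by (intro nn_integral_eq_integral) (auto simp: L2_def)
      then show ?case using bd[OF elim] by (simp add: L2_inner_square ennreal_leI)
    qed
  qed simp
  finally have le: "(\<integral>\<^sup>+x. ennreal ((g x)\<^sup>2) \<partial>M) \<le> ennreal C" .
  have int: "integrable M (\<lambda>x. (g x)\<^sup>2)"
    using le by (intro integrableI_nonneg) (auto simp: less_top[symmetric] top_unique)
  then show "g \<in> L2 M" using g by (simp add: L2_def)
  have "ennreal (\<integral>x. (g x)\<^sup>2 \<partial>M) \<le> ennreal C"
    using le nn_integral_eq_integral[OF int] by simp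
  then show "L2_inner M g g \<le> C" using C by (simp add: L2_inner_square)
qed

lemma L2_AE_subseq:
  assumes f: "\<And>k. f k \<in> L2 M" and g: "g \<in> L2 M"
    and lim: "(\<lambda>k. L2_inner M (\<lambda>x. f k x - g x) (\<lambda>x. f k x - g x)) \<longlonglongrightarrow> 0"
  obtains r where "strict_mono (r :: nat \<Rightarrow> nat)" "AE x in M. (\<lambda>k. f (r k) x) \<longlonglongrightarrow> g x"
proof -
  have "\<exists>r::nat\<Rightarrow>nat. strict_mono r \<and> (AE x in M. (\<lambda>n. (f (r n) x - g x)\<^sup>2) \<longlonglongrightarrow> 0)"
  proof (rule tendsto_L1_AE_subseq)
    show "integrable M (\<lambda>x. (f n x - g x)\<^sup>2)" for n
      using L2_diff[OF f g] by (simp add: L2_def)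
    show "(\<lambda>n. \<integral>x. norm ((f n x - g x)\<^sup>2) \<partial>M) \<longlonglongrightarrow> 0"
      using lim by (simp add: L2_inner_square)
  qed
  then obtain r where r: "strict_mono (r::nat\<Rightarrow>nat)" "AE x in M. (\<lambda>n. (f (r n) x - g x)\<^sup>2) \<longlonglongrightarrow> 0"
    by blast
  from r(2) have "AE x in M. (\<lambda>k. f (r k) x) \<longlonglongrightarrow> g x"
  proof eventually_elim
    case (elim x)
    then have "(\<lambda>n. sqrt ((f (r n) x - g x)\<^sup>2)) \<longlonglongrightarrow> sqrt 0" by (rule tendsto_real_sqrt)
    then have "(\<lambda>n. \<bar>f (r n) x - g x\<bar>) \<longlonglongrightarrow> 0" by simp
    then show ?case by (simp add: tendsto_rabs_zero_iff LIM_zero_iff)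
  qed
  with r(1) show ?thesis by (rule that)
qed

text \<open>The dominating functions themselves may vary, provided that they converge in \<open>L\<^sup>2\<close>: Fatou is
  applied to \<open>2 (g k)\<^sup>2 + 2 g\<^sup>2 - (f k - f)\<^sup>2\<close>.\<close>

lemma L2_dominated_convergence:
  assumes f: "\<And>k. f k \<in> borel_measurable M" "f' \<in> borel_measurable M"
    and lim: "AE x in M. (\<lambda>k. f k x) \<longlonglongrightarrow> f' x"
    and g: "\<And>k. g k \<in> L2 M" "g' \<in> L2 M" "AE x in M. (\<lambda>k. g k x) \<longlonglongrightarrow> g' x"
    and glim: "(\<lambda>k. L2_inner M (\<lambda>x. g k x - g' x) (\<lambda>x. g k x - g' x)) \<longlonglongrightarrow> 0"
    and bd: "\<And>k. AE x in M. \<bar>f k x\<bar> \<le> \<bar>g k x\<bar>"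
  shows "f' \<in> L2 M" and "(\<lambda>k. L2_inner M (\<lambda>x. f k x - f' x) (\<lambda>x. f k x - f' x)) \<longlonglongrightarrow> 0"
proof -
  have bd': "AE x in M. \<forall>k. \<bar>f k x\<bar> \<le> \<bar>g k x\<bar>" using bd by (simp add: AE_all_countable)
  have fL: "f k \<in> L2 M" for k
    using L2_bound[OF g(1) f(1) bd] .
  have "AE x in M. \<bar>f' x\<bar> \<le> \<bar>g' x\<bar>"
    using lim g(3) bd'
  proof eventually_elim
    case (elim x)
    show ?case
      by (rule LIMSEQ_le[OF tendsto_rabs[OF elim(1)] tendsto_rabs[OF elim(2)]]) (use elim(3) in auto)
  qed
  then show f'L: "f' \<in> L2 M" using L2_bound[OF g(2) f(2)] by blast
  define e where "e k = L2_inner M (\<lambda>x. g k x - g' x) (\<lambda>x. g k x - g' x)" for k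
  define h where "h k x = (f k x - f' x)\<^sup>2" for k x
  \<comment> \<open>Written through g_k - g', so that \<open>glim\<close> alone gives the limit of
    its integrals. It dominates \<open>h\<close> because |f_k - f'| is at most |g_k - g'| + 2
    |g'|.\<close>
  define G where "G k x = 4 * (g k x - g' x)\<^sup>2 + 8 * (g' x)\<^sup>2" for k x
  have hint: "integrable M (h k)" for k
    using L2_diff[OF fL f'L] by (simp add: L2_def h_def[abs_def])
  have g'int: "integrable M (\<lambda>x. (g' x)\<^sup>2)" and gint: "integrable M (\<lambda>x. (g k x - g' x)\<^sup>2)" for k
    using g(2) L2_diff[OF g(1) g(2)] by (auto simp: L2_def)
  have Gint: "integrable M (G k)" for k
    unfolding G_def using g'int gint by auto
  note [measurable] = f
  have [measurable]: "g k \<in> borel_measurable M" "g' \<in> borel_measurable M" for k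
    using g by (auto simp: L2_def)
  have hm[measurable]: "h k \<in> borel_measurable M" and Gm[measurable]: "G k \<in> borel_measurable M" for k
    unfolding h_def[abs_def] G_def[abs_def] by measurable
  have hG: "AE x in M. \<forall>k. h k x \<le> G k x"
    using bd' \<open>AE x in M. \<bar>f' x\<bar> \<le> \<bar>g' x\<bar>\<close>
  proof eventually_elim
    case (elim x)
    show ?case
    proof
      fix k
      have "\<bar>f k x - f' x\<bar> \<le> \<bar>g k x - g' x\<bar> + 2 * \<bar>g' x\<bar>"
        using elim(2) elim(1)[rule_format, of k] by linarith
      then have "h k x \<le> (\<bar>g k x - g' x\<bar> + 2 * \<bar>g' x\<bar>)\<^sup>2"
        unfolding h_def by (metis abs_ge_zero power2_abs power_mono)
      also have "\<dots> \<le> 2 * \<bar>g k x - g' x\<bar>\<^sup>2 + 2 * (2 * \<bar>g' x\<bar>)\<^sup>2"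
        using sum_squares_bound[of "\<bar>g k x - g' x\<bar>" "2 * \<bar>g' x\<bar>"] by (simp add: power2_sum)
      also have "\<dots> \<le> G k x" by (simp add: G_def power_mult_distrib)
      finally show "h k x \<le> G k x" .
    qed
  qed
  have intG: "integral\<^sup>L M (G k) = 4 * e k + 8 * (\<integral>x. (g' x)\<^sup>2 \<partial>M)" for k
    unfolding G_def e_def L2_inner_square using g'int gint by simp
  define I where "I = 8 * (\<integral>x. (g' x)\<^sup>2 \<partial>M)"
  have I: "0 \<le> I" by (simp add: I_def)
  have "ennreal I = (\<integral>\<^sup>+x. ennreal (8 * (g' x)\<^sup>2) \<partial>M)"
    unfolding I_def using g'int by (subst nn_integral_eq_integral) auto
  also have "\<dots> = (\<integral>\<^sup>+x. liminf (\<lambda>k. ennreal (G k x - h k x)) \<partial>M)"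
  proof (rule nn_integral_cong_AE)
    show "AE x in M. ennreal (8 * (g' x)\<^sup>2) = liminf (\<lambda>k. ennreal (G k x - h k x))"
      using lim g(3)
    proof eventually_elim
      case (elim x)
      have "(\<lambda>k. G k x - h k x) \<longlonglongrightarrow> (4 * (g' x - g' x)\<^sup>2 + 8 * (g' x)\<^sup>2) - (f' x - f' x)\<^sup>2"
        unfolding G_def h_def by (intro tendsto_intros elim)
      then have "(\<lambda>k. ennreal (G k x - h k x)) \<longlonglongrightarrow> ennreal (8 * (g' x)\<^sup>2)"
        by (intro tendsto_ennrealI) simp
      then show ?case by (intro lim_imp_Liminf[symmetric]) simp
    qed
  qed
  also have "\<dots> \<le> liminf (\<lambda>k. \<integral>\<^sup>+x. ennreal (G k x - h k x) \<partial>M)"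
    by (rule nn_integral_liminf) measurable
  finally have Fat: "ennreal I \<le> liminf (\<lambda>k. \<integral>\<^sup>+x. ennreal (G k x - h k x) \<partial>M)" .
  have val: "(\<integral>\<^sup>+x. ennreal (G k x - h k x) \<partial>M) = ennreal (4 * e k + I - integral\<^sup>L M (h k))" for k
    using hG hint Gint by (subst nn_integral_eq_integral) (auto simp: intG I_def elim: eventually_mono)
  show "(\<lambda>k. L2_inner M (\<lambda>x. f k x - f' x) (\<lambda>x. f k x - f' x)) \<longlonglongrightarrow> 0"
  proof (rule LIMSEQ_I)
    fix d :: real assume d: "d > 0"
    have "\<forall>\<^sub>F k in sequentially. 4 * e k + I - integral\<^sup>L M (h k) > I - d / 2"
    \<comment> \<open>\<open>ennreal\<close> sends negative reals to 0, so the strict inequality I -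
      d/2 < I survives the passage to \<open>ennreal\<close> only for a nonnegative left side.
      Otherwise the claim holds because \<open>h\<close> integrates to at most the integral of
      \<open>G\<close>.\<close>
    proof (cases "I - d / 2 < 0")
      case True
      have "0 \<le> 4 * e k + I - integral\<^sup>L M (h k)" for k
      proof -
        have "integral\<^sup>L M (h k) \<le> integral\<^sup>L M (G k)"
          using hG by (intro integral_mono_AE hint Gint) (auto elim: eventually_mono)
        then show ?thesis by (simp add: intG I_def)
      qed
      then show ?thesis using True by (intro always_eventually allI) (meson less_le_trans)
    next
      case False
      have "ennreal (I - d / 2) < ennreal I" using d False by (intro ennreal_lessI) auto
      with Fat have "ennreal (I - d / 2) < liminf (\<lambda>k. \<integral>\<^sup>+x. ennreal (G k x - h k x) \<partial>M)" by simp
      from less_LiminfD[OF this] show ?thesis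
        unfolding val by eventually_elim (use False in \<open>auto simp: ennreal_less_iff\<close>)
    qed
    moreover have "\<forall>\<^sub>F k in sequentially. e k < d / 8"
      using order_tendstoD(2)[OF glim, of "d/8"] d by (simp add: e_def)
    ultimately have "\<forall>\<^sub>F k in sequentially. integral\<^sup>L M (h k) < d"
      by eventually_elim linarith
    then obtain N where "\<forall>k\<ge>N. integral\<^sup>L M (h k) < d" by (auto simp: eventually_sequentially)
    moreover have "0 \<le> integral\<^sup>L M (h k)" for k by (simp add: h_def)
    ultimately show "\<exists>N. \<forall>k\<ge>N. norm (L2_inner M (\<lambda>x. f k x - f' x) (\<lambda>x. f k x - f' x) - 0) < d"
      by (auto simp: L2_inner_square h_def[symmetric])
  qed
qed

text \<open>Along a fast subsequence the increments have a finite expected sum, hence converge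
  absolutely almost everywhere. Only the pointwise limit is extracted; in
  \<open>Dmax_complete\<close> Fatou then treats the function and its increment together.\<close>

lemma L2_Cauchy_AE_subseq:
  assumes "prob_space M" and f: "\<And>k. f k \<in> L2 M"
    and cau: "\<And>e. e > 0 \<Longrightarrow> \<exists>N. \<forall>m\<ge>N. \<forall>n\<ge>N. L2_inner M (\<lambda>x. f m x - f n x) (\<lambda>x. f m x - f n x) < e"
  obtains r g where "strict_mono (r :: nat \<Rightarrow> nat)" "g \<in> borel_measurable M"
    "AE x in M. (\<lambda>k. f (r k) x) \<longlonglongrightarrow> g x"
proof -
  interpret prob_space M by fact
  have [measurable]: "f k \<in> borel_measurable M" for k using f by (simp add: L2_def)
  have "\<forall>k. \<exists>N. \<forall>m\<ge>N. \<forall>n\<ge>N. L2_inner M (\<lambda>x. f m x - f n x) (\<lambda>x. f m x - f n x) < (1/4)^k"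
    using cau by simp
  then obtain N where N: "\<And>k m n. m \<ge> N k \<Longrightarrow> n \<ge> N k \<Longrightarrow>
      L2_inner M (\<lambda>x. f m x - f n x) (\<lambda>x. f m x - f n x) < (1/4)^k"
    by metis
  \<comment> \<open>Strictly increasing and at least \<open>N k\<close> at stage k, so consecutive
    terms along \<open>r\<close> have squared distance below 4^(-k).\<close>
  define r where "r = rec_nat (N 0) (\<lambda>k v. max (Suc v) (N (Suc k)))"
  have r0: "r 0 = N 0" and rS: "r (Suc k) = max (Suc (r k)) (N (Suc k))" for k by (simp_all add: r_def)
  have r: "strict_mono r" by (rule strict_monoI_Suc) (simp add: rS)
  have rN: "r k \<ge> N k" for k by (cases k) (simp_all add: r0 rS)
  define d where "d k x = \<bar>f (r (Suc k)) x - f (r k) x\<bar>" for k x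
  have [measurable]: "d k \<in> borel_measurable M" for k unfolding d_def[abs_def] by measurable
  have dint: "(\<integral>\<^sup>+x. ennreal (d k x) \<partial>M) \<le> ennreal ((1/2)^k)" for k
  proof -
    have L: "(\<lambda>x. f (r (Suc k)) x - f (r k) x) \<in> L2 M" by (intro L2_diff f)
    then have i1: "integrable M (\<lambda>x. (1/2)^k/2 + 2^k / 2 * (f (r (Suc k)) x - f (r k) x)\<^sup>2)"
      by (auto simp: L2_def)
    \<comment> \<open>Young's inequality with weight 2^k turns the bound 4^(-k) on the second moment
      into 2^(-k) on the first; this uses that the total mass is 1.\<close>
    have le: "d k x \<le> (1/2)^k/2 + 2^k / 2 * (f (r (Suc k)) x - f (r k) x)\<^sup>2" for x
    proof -
      have "t \<le> 1 / P / 2 + P / 2 * t\<^sup>2" if "P > 0" for P t :: real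
      proof -
        have "0 \<le> (1 - P * t)\<^sup>2 / (2 * P)" using that by simp
        also have "\<dots> = 1 / P / 2 + P / 2 * t\<^sup>2 - t"
          using that by (simp add: field_simps power2_eq_square)
        finally show ?thesis by simp
      qed
      from this[of "2^k" "d k x"] show ?thesis by (simp add: d_def power_one_over)
    qed
    have "(\<integral>\<^sup>+x. ennreal (d k x) \<partial>M) \<le>
        (\<integral>\<^sup>+x. ennreal ((1/2)^k/2 + 2^k / 2 * (f (r (Suc k)) x - f (r k) x)\<^sup>2) \<partial>M)"
      by (intro nn_integral_mono ennreal_leI le)
    also have "\<dots> = ennreal ((1/2)^k/2 + 2^k / 2 *
        L2_inner M (\<lambda>x. f (r (Suc k)) x - f (r k) x) (\<lambda>x. f (r (Suc k)) x - f (r k) x))"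
      using i1 L by (subst nn_integral_eq_integral) (auto simp: L2_inner_square L2_def prob_space)
    also have "\<dots> \<le> ennreal ((1/2)^k/2 + 2^k / 2 * (1/4)^k)"
      using less_imp_le[OF N[OF order.trans[OF rN[of k] less_imp_le[OF strict_monoD[OF r lessI]]] rN[of k]]]
      by (intro ennreal_leI add_left_mono mult_left_mono) auto
    also have "(1/2)^k/2 + 2^k / 2 * (1/4)^k = (1/2::real)^k"
    proof -
      have "(2::real)^k * (1/4)^k = (1/2)^k" by (simp flip: power_mult_distrib)
      then show ?thesis by simp
    qed
    finally show ?thesis .
  qed
  have "(\<integral>\<^sup>+x. (\<Sum>k. ennreal (d k x)) \<partial>M) = (\<Sum>k. \<integral>\<^sup>+x. ennreal (d k x) \<partial>M)"
    by (rule nn_integral_suminf) measurable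
  also have "\<dots> \<le> (\<Sum>k. ennreal ((1/2)^k))" by (intro suminf_le dint) auto
  also have "\<dots> = ennreal (\<Sum>k. (1/2)^k)" by (intro suminf_ennreal2) auto
  also have "\<dots> < \<infinity>" by simp
  finally have "AE x in M. (\<Sum>k. ennreal (d k x)) \<noteq> \<infinity>"
    by (intro nn_integral_PInf_AE) auto
  then have cauchy: "AE x in M. convergent (\<lambda>k. f (r k) x)"
  proof eventually_elim
    case (elim x)
    then have "summable (\<lambda>k. d k x)"
      by (intro summable_suminf_not_top) (auto simp: d_def)
    then have "summable (\<lambda>k. f (r (Suc k)) x - f (r k) x)"
      unfolding d_def by (rule summable_rabs_cancel)
    then have "summable (\<lambda>k. f (r k) x - f (r (Suc k)) x)"
      using summable_minus_iff[of "\<lambda>k. f (r (Suc k)) x - f (r k) x"] by (simp add: minus_diff_eq)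
    then have "convergent (\<lambda>n. \<Sum>k<n. f (r (Suc k)) x - f (r k) x)"
      using \<open>summable (\<lambda>k. f (r (Suc k)) x - f (r k) x)\<close> by (simp add: summable_iff_convergent)
    then have "convergent (\<lambda>n. f (r n) x - f (r 0) x)"
      by (simp add: sum_lessThan_telescope[of "\<lambda>k. f (r k) x"])
    then show ?case by (simp add: convergent_diff_const_right_iff)
  qed
  define g where "g x = lim (\<lambda>k. f (r k) x)" for x
  have "g \<in> borel_measurable M" unfolding g_def[abs_def] by measurable
  moreover have "AE x in M. (\<lambda>k. f (r k) x) \<longlonglongrightarrow> g x"
    using cauchy unfolding g_def by eventually_elim (simp add: convergent_LIMSEQ_iff)
  ultimately show ?thesis using r by (rule that[rotated])
qed

lemma L2_inner_tendsto:
  assumes f: "\<And>n. f n \<in> L2 M" "f' \<in> L2 M" and g: "\<And>n. g n \<in> L2 M" "g' \<in> L2 M"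
    and fl: "(\<lambda>n. L2_inner M (\<lambda>x. f n x - f' x) (\<lambda>x. f n x - f' x)) \<longlonglongrightarrow> 0"
    and gl: "(\<lambda>n. L2_inner M (\<lambda>x. g n x - g' x) (\<lambda>x. g n x - g' x)) \<longlonglongrightarrow> 0"
  shows "(\<lambda>n. L2_inner M (f n) (g n)) \<longlonglongrightarrow> L2_inner M f' g'"
proof -
  define F where "F n x = f n x - f' x" for n x
  define G where "G n x = g n x - g' x" for n x
  have FL: "F n \<in> L2 M" and GL: "G n \<in> L2 M" for n
    unfolding F_def[abs_def] G_def[abs_def] using f g by (auto intro: L2_diff)
  have *: "L2_inner M (f n) (g n) = L2_inner M (F n) (G n) + L2_inner M (F n) g' + L2_inner M f' (G n)
      + L2_inner M f' g'" for n
  proof -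
    have "L2_inner M (f n) (g n) = (\<integral>x. F n x * G n x + F n x * g' x + f' x * G n x + f' x * g' x \<partial>M)"
      by (simp add: L2_inner_def F_def G_def algebra_simps)
    then show ?thesis
      using L2_integrable_mult[OF FL GL] L2_integrable_mult[OF FL g(2)] L2_integrable_mult[OF f(2) GL]
        L2_integrable_mult[OF f(2) g(2)] by (simp add: L2_inner_def)
  qed
  have Fl: "(\<lambda>n. sqrt (L2_inner M (F n) (F n))) \<longlonglongrightarrow> 0"
    and Gl: "(\<lambda>n. sqrt (L2_inner M (G n) (G n))) \<longlonglongrightarrow> 0"
    using tendsto_real_sqrt[OF fl] tendsto_real_sqrt[OF gl] by (simp_all add: F_def[abs_def] G_def[abs_def])
  have 1: "(\<lambda>n. L2_inner M (F n) (G n)) \<longlonglongrightarrow> 0"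
    by (rule Lim_null_comparison[OF _ tendsto_mult_zero[OF Fl Gl]])
       (use L2_Cauchy_Schwarz[OF FL GL] in \<open>simp add: always_eventually\<close>)
  have 2: "(\<lambda>n. L2_inner M (F n) g') \<longlonglongrightarrow> 0"
    by (rule Lim_null_comparison[OF _ tendsto_mult_left_zero[OF Fl, of "sqrt (L2_inner M g' g')"]])
       (use L2_Cauchy_Schwarz[OF FL g(2)] in \<open>simp add: always_eventually\<close>)
  have 3: "(\<lambda>n. L2_inner M f' (G n)) \<longlonglongrightarrow> 0"
    by (rule Lim_null_comparison[OF _ tendsto_mult_right_zero[OF Gl, of "sqrt (L2_inner M f' f')"]])
       (use L2_Cauchy_Schwarz[OF f(2) GL] in \<open>simp add: always_eventually\<close>)
  show ?thesis
    unfolding * using tendsto_add[OF tendsto_add[OF tendsto_add[OF 1 2] 3] tendsto_const[of "L2_inner M f' g'"]]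
    by simp
qed

section \<open>Forms given by increments\<close>

text \<open>A point of \<open>Lam\<close> is a jump, with new position \<open>a\<close> and old
  position \<open>b\<close>. The two conditions on null sets make increments independent of the
  chosen representative of a class.\<close>

locale jump_space = prob_space M for M :: "'a measure" +
  fixes Lam :: "'b measure" and a b :: "'b \<Rightarrow> 'a"
  assumes a_measurable[measurable]: "a \<in> Lam \<rightarrow>\<^sub>M M"
    and b_measurable[measurable]: "b \<in> Lam \<rightarrow>\<^sub>M M"
    and a_null: "A \<in> null_sets M \<Longrightarrow> a -` A \<inter> space Lam \<in> null_sets Lam"
    and b_null: "A \<in> null_sets M \<Longrightarrow> b -` A \<inter> space Lam \<in> null_sets Lam"
begin

definition grad :: "('a \<Rightarrow> real) \<Rightarrow> 'b \<Rightarrow> real" where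
  "grad u z = u (a z) - u (b z)"

text \<open>The largest space on which the increment form is finite. It is complete for
  \<open>nrg1\<close>, so every restriction of the form to a subspace is closable and its closure
  can be taken inside \<open>Dmax\<close>.\<close>

definition Dmax :: "('a \<Rightarrow> real) set" where
  "Dmax = {u \<in> L2 M. grad u \<in> L2 Lam}"

definition nrg :: "('a \<Rightarrow> real) \<Rightarrow> ('a \<Rightarrow> real) \<Rightarrow> real" where
  "nrg u v = L2_inner Lam (grad u) (grad v)"

definition nrg1 :: "('a \<Rightarrow> real) \<Rightarrow> real" where
  "nrg1 u = nrg u u + L2_inner M u u"

definition nconv :: "(nat \<Rightarrow> 'a \<Rightarrow> real) \<Rightarrow> ('a \<Rightarrow> real) \<Rightarrow> bool" where
  "nconv w u \<longleftrightarrow> (\<lambda>n. nrg1 (\<lambda>x. w n x - u x)) \<longlonglongrightarrow> 0"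

lemma AE_ab:
  assumes "AE x in M. P x"
  shows "AE z in Lam. P (a z) \<and> P (b z)"
proof -
  from assms obtain N where N: "N \<in> null_sets M" "{x \<in> space M. \<not> P x} \<subseteq> N"
    by (auto elim!: AE_E3)
  have "AE z in Lam. z \<notin> a -` N \<inter> space Lam" "AE z in Lam. z \<notin> b -` N \<inter> space Lam"
    by (rule AE_not_in[OF a_null[OF N(1)]], rule AE_not_in[OF b_null[OF N(1)]])
  then show ?thesis
    using AE_space
  proof eventually_elim
    case (elim z)
    then show ?case
      using N(2) measurable_space[OF a_measurable, of z] measurable_space[OF b_measurable, of z] by blast
  qed
qed

lemma grad_lin: "grad (\<lambda>x. s * u x + t * v x) = (\<lambda>z. s * grad u z + t * grad v z)"
  by (auto simp: grad_def algebra_simps)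

lemma grad_diff: "grad (\<lambda>x. u x - v x) = (\<lambda>z. grad u z - grad v z)"
  by (auto simp: grad_def)

lemma grad_measurable[measurable]: "u \<in> borel_measurable M \<Longrightarrow> grad u \<in> borel_measurable Lam"
  unfolding grad_def[abs_def]
  by (intro borel_measurable_diff measurable_compose[OF a_measurable] measurable_compose[OF b_measurable])

lemma DmaxD: "u \<in> Dmax \<Longrightarrow> u \<in> L2 M" "u \<in> Dmax \<Longrightarrow> grad u \<in> L2 Lam"
    "u \<in> Dmax \<Longrightarrow> u \<in> borel_measurable M"
  by (auto simp: Dmax_def L2_def)

lemma Dmax_lin: "u \<in> Dmax \<Longrightarrow> v \<in> Dmax \<Longrightarrow> (\<lambda>x. s * u x + t * v x) \<in> Dmax"
  by (auto simp: Dmax_def grad_lin intro: L2_lin)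

lemma Dmax_diff: "u \<in> Dmax \<Longrightarrow> v \<in> Dmax \<Longrightarrow> (\<lambda>x. u x - v x) \<in> Dmax"
  using Dmax_lin[of u v 1 "-1"] by simp

lemma nrg_commute: "nrg u v = nrg v u"
  by (simp add: nrg_def L2_inner_commute)

lemma nrg_nonneg: "0 \<le> nrg u u"
  by (simp add: nrg_def L2_inner_nonneg)

lemma nrg1_nonneg: "0 \<le> nrg1 u"
  by (simp add: nrg1_def nrg_nonneg L2_inner_nonneg)

lemma nrg_lin:
  "u \<in> Dmax \<Longrightarrow> v \<in> Dmax \<Longrightarrow> w \<in> Dmax \<Longrightarrow>
    nrg (\<lambda>x. s * u x + t * v x) w = s * nrg u w + t * nrg v w"
  by (simp add: nrg_def grad_lin L2_inner_lin DmaxD)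

lemma grad_cong_AE:
  assumes "AE x in M. v x = u x"
  shows "AE z in Lam. grad v z = grad u z"
  using AE_ab[OF assms] by eventually_elim (simp add: grad_def)

lemma Dmax_cong_AE:
  assumes "u \<in> Dmax" "v \<in> borel_measurable M" "AE x in M. v x = u x"
  shows "v \<in> Dmax"
proof -
  have "v \<in> L2 M"
    by (rule L2_bound[OF DmaxD(1)[OF assms(1)] assms(2)]) (use assms(3) in \<open>auto elim: eventually_mono\<close>)
  moreover have "grad v \<in> L2 Lam"
    by (rule L2_bound[OF DmaxD(2)[OF assms(1)] grad_measurable[OF assms(2)]])
       (use grad_cong_AE[OF assms(3)] in \<open>auto elim: eventually_mono\<close>)
  ultimately show ?thesis by (simp add: Dmax_def)
qed

lemma nrg_cong_AE:
  assumes "AE x in M. v x = u x" "u \<in> borel_measurable M" "v \<in> borel_measurable M" "w \<in> borel_measurable M"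
  shows "nrg v w = nrg u w"
  unfolding nrg_def using assms grad_cong_AE[OF assms(1)] by (intro L2_inner_cong) auto

lemma nrg1_cong_AE:
  assumes "AE x in M. v x = u x" "u \<in> borel_measurable M" "v \<in> borel_measurable M"
  shows "nrg1 v = nrg1 u"
proof -
  have "nrg v v = nrg u u"
    using nrg_cong_AE[OF assms assms(3)] nrg_cong_AE[OF assms assms(2)] by (simp add: nrg_commute)
  moreover have "L2_inner M v v = L2_inner M u u"
    using assms by (intro L2_inner_cong) auto
  ultimately show ?thesis by (simp add: nrg1_def)
qed

text \<open>\<open>nrg1\<close> is a squared norm. This weak triangle inequality, with factor 2, is
  the version used in all limit arguments and keeps square roots out of them.\<close>

lemma nrg1_add_le:
  assumes "u \<in> Dmax" "v \<in> Dmax"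
  shows "nrg1 (\<lambda>x. u x + v x) \<le> 2 * nrg1 u + 2 * nrg1 v"
proof -
  have "grad (\<lambda>x. u x + v x) = (\<lambda>z. grad u z + grad v z)" by (auto simp: grad_def)
  then show ?thesis
    using L2_inner_add_square_le[OF DmaxD(1)[OF assms(1)] DmaxD(1)[OF assms(2)]]
      L2_inner_add_square_le[OF DmaxD(2)[OF assms(1)] DmaxD(2)[OF assms(2)]]
    by (simp add: nrg1_def nrg_def)
qed

lemma nrg1_diff_commute: "nrg1 (\<lambda>x. u x - v x) = nrg1 (\<lambda>x. v x - u x)"
  by (simp add: nrg1_def nrg_def grad_diff L2_inner_square power2_commute)

lemma nrg1_triangle:
  assumes "u \<in> Dmax" "v \<in> Dmax" "w \<in> Dmax"
  shows "nrg1 (\<lambda>x. u x - w x) \<le> 2 * nrg1 (\<lambda>x. u x - v x) + 2 * nrg1 (\<lambda>x. v x - w x)"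
  using nrg1_add_le[OF Dmax_diff[OF assms(1,2)] Dmax_diff[OF assms(2,3)]] by simp

lemma nconvD:
  assumes "nconv w u"
  shows "(\<lambda>n. L2_inner M (\<lambda>x. w n x - u x) (\<lambda>x. w n x - u x)) \<longlonglongrightarrow> 0"
    and "(\<lambda>n. L2_inner Lam (\<lambda>z. grad (w n) z - grad u z) (\<lambda>z. grad (w n) z - grad u z)) \<longlonglongrightarrow> 0"
proof -
  have l: "(\<lambda>n. nrg1 (\<lambda>x. w n x - u x)) \<longlonglongrightarrow> 0" using assms by (simp add: nconv_def)
  show "(\<lambda>n. L2_inner M (\<lambda>x. w n x - u x) (\<lambda>x. w n x - u x)) \<longlonglongrightarrow> 0"
    by (rule Lim_null_comparison[OF _ l]) (simp add: nrg1_def nrg_nonneg L2_inner_nonneg always_eventually)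
  have "(\<lambda>n. nrg (\<lambda>x. w n x - u x) (\<lambda>x. w n x - u x)) \<longlonglongrightarrow> 0"
    by (rule Lim_null_comparison[OF _ l]) (simp add: nrg1_def nrg_nonneg L2_inner_nonneg always_eventually)
  then show "(\<lambda>n. L2_inner Lam (\<lambda>z. grad (w n) z - grad u z) (\<lambda>z. grad (w n) z - grad u z)) \<longlonglongrightarrow> 0"
    by (simp add: nrg_def grad_diff)
qed

lemma nconvI:
  assumes "(\<lambda>n. L2_inner M (\<lambda>x. w n x - u x) (\<lambda>x. w n x - u x)) \<longlonglongrightarrow> 0"
    and "(\<lambda>n. L2_inner Lam (\<lambda>z. grad (w n) z - grad u z) (\<lambda>z. grad (w n) z - grad u z)) \<longlonglongrightarrow> 0"
  shows "nconv w u"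
  using tendsto_add[OF assms(2,1)] by (simp add: nconv_def nrg1_def nrg_def grad_diff)

lemma nrg_tendsto:
  assumes "\<And>n. w n \<in> Dmax" "u \<in> Dmax" "\<And>n. w' n \<in> Dmax" "v \<in> Dmax" "nconv w u" "nconv w' v"
  shows "(\<lambda>n. nrg (w n) (w' n)) \<longlonglongrightarrow> nrg u v"
  unfolding nrg_def
  by (rule L2_inner_tendsto) (use assms nconvD DmaxD in auto)

lemma L2_inner_nconv_tendsto:
  assumes "\<And>n. w n \<in> Dmax" "u \<in> Dmax" "\<And>n. w' n \<in> Dmax" "v \<in> Dmax" "nconv w u" "nconv w' v"
  shows "(\<lambda>n. L2_inner M (w n) (w' n)) \<longlonglongrightarrow> L2_inner M u v"
  by (rule L2_inner_tendsto) (use assms nconvD DmaxD in auto)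

lemma nconv_const: "nconv (\<lambda>n. u) u"
  by (simp add: nconv_def nrg1_def nrg_def grad_def[abs_def] L2_inner_def)

lemma nconv_AE_subseq:
  assumes "\<And>n. w n \<in> Dmax" "u \<in> Dmax" "nconv w u"
  obtains r where "strict_mono (r::nat\<Rightarrow>nat)" "AE x in M. (\<lambda>k. w (r k) x) \<longlonglongrightarrow> u x"
    "nconv (\<lambda>k. w (r k)) u"
proof -
  obtain r where r: "strict_mono (r::nat\<Rightarrow>nat)" "AE x in M. (\<lambda>k. w (r k) x) \<longlonglongrightarrow> u x"
    using L2_AE_subseq[OF DmaxD(1)[OF assms(1)] DmaxD(1)[OF assms(2)] nconvD(1)[OF assms(3)]] by metis
  moreover have "nconv (\<lambda>k. w (r k)) u"
    using LIMSEQ_subseq_LIMSEQ[OF assms(3)[unfolded nconv_def] r(1)] by (simp add: nconv_def comp_def)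
  ultimately show ?thesis by (rule that)
qed

lemma grad_tendsto_AE:
  assumes "AE x in M. (\<lambda>k. w k x) \<longlonglongrightarrow> u x"
  shows "AE z in Lam. (\<lambda>k. grad (w k) z) \<longlonglongrightarrow> grad u z"
  using AE_ab[OF assms] unfolding grad_def by eventually_elim (auto intro: tendsto_diff)

text \<open>An almost everywhere limit for \<open>M\<close> is one for the increments under
  \<open>Lam\<close>, by the conditions on null sets. So a single subsequence produces both limits,
  and Fatou bounds both errors.\<close>

lemma Dmax_complete:
  assumes w: "\<And>n. w n \<in> Dmax"
    and cau: "\<And>e. e > 0 \<Longrightarrow> \<exists>N. \<forall>m\<ge>N. \<forall>n\<ge>N. nrg1 (\<lambda>x. w m x - w n x) < e"
  shows "\<exists>u\<in>Dmax. nconv w u"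
proof -
  note wL = DmaxD(1)[OF w] and gL = DmaxD(2)[OF w]
  have cauM: "\<exists>N. \<forall>m\<ge>N. \<forall>n\<ge>N. L2_inner M (\<lambda>x. w m x - w n x) (\<lambda>x. w m x - w n x) < e" if e: "e > 0" for e
  proof -
    obtain N where "\<forall>m\<ge>N. \<forall>n\<ge>N. nrg1 (\<lambda>x. w m x - w n x) < e" using cau[OF e] by blast
    then show ?thesis
      by (intro exI[of _ N]) (smt (verit) nrg1_def nrg_nonneg)
  qed
  obtain r g where r: "strict_mono (r::nat\<Rightarrow>nat)" and g: "g \<in> borel_measurable M"
      and lim: "AE x in M. (\<lambda>k. w (r k) x) \<longlonglongrightarrow> g x"
    using L2_Cauchy_AE_subseq[OF prob_space_axioms wL cauM] by metis
  note glim = grad_tendsto_AE[OF lim]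
  \<comment> \<open>For fixed \<open>n\<close>, Fatou is applied to w_n - w_(r k) as k grows: the
    Cauchy bound passes to w_n - g and places the difference in \<open>L2\<close> at the same
    time.\<close>
  have key: "\<exists>N. \<forall>n\<ge>N. (\<lambda>x. w n x - g x) \<in> L2 M \<and> L2_inner M (\<lambda>x. w n x - g x) (\<lambda>x. w n x - g x) \<le> e \<and>
    (\<lambda>z. grad (w n) z - grad g z) \<in> L2 Lam \<and>
    L2_inner Lam (\<lambda>z. grad (w n) z - grad g z) (\<lambda>z. grad (w n) z - grad g z) \<le> e" if e: "e > 0" for e
  proof -
    obtain N where N: "\<forall>m\<ge>N. \<forall>n\<ge>N. nrg1 (\<lambda>x. w m x - w n x) < e" using cau[OF e] by blast
    have bd: "L2_inner M (\<lambda>x. w n x - w (r k) x) (\<lambda>x. w n x - w (r k) x) \<le> e \<and>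
       L2_inner Lam (\<lambda>z. grad (w n) z - grad (w (r k)) z) (\<lambda>z. grad (w n) z - grad (w (r k)) z) \<le> e"
      if "n \<ge> N" "k \<ge> N" for n k
    proof -
      have "r k \<ge> N" using seq_suble[OF r, of k] that by simp
      then have "nrg1 (\<lambda>x. w n x - w (r k) x) < e" using N that by blast
      then show ?thesis
        using L2_inner_nonneg[of M "\<lambda>x. w n x - w (r k) x"]
          L2_inner_nonneg[of Lam "\<lambda>z. grad (w n) z - grad (w (r k)) z"]
        by (simp add: nrg1_def nrg_def grad_diff)
    qed
    show ?thesis
    proof (intro exI[of _ N] allI impI)
      fix n assume n: "n \<ge> N"
      have 1: "(\<lambda>x. w n x - w (r k) x) \<in> L2 M" for k by (intro L2_diff wL)
      have 2: "(\<lambda>z. grad (w n) z - grad (w (r k)) z) \<in> L2 Lam" for k by (intro L2_diff gL)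
      have m1: "(\<lambda>x. w n x - g x) \<in> borel_measurable M"
        using L2_measurable[OF wL[of n]] g by measurable
      have m2: "(\<lambda>z. grad (w n) z - grad g z) \<in> borel_measurable Lam"
        using L2_measurable[OF gL[of n]] grad_measurable[OF g] by measurable
      have l1: "AE x in M. (\<lambda>k. w n x - w (r k) x) \<longlonglongrightarrow> w n x - g x"
        using lim by eventually_elim (intro tendsto_intros)
      have l2: "AE z in Lam. (\<lambda>k. grad (w n) z - grad (w (r k)) z) \<longlonglongrightarrow> grad (w n) z - grad g z"
        using glim by eventually_elim (intro tendsto_intros)
      have b1: "\<And>k. k \<ge> N \<Longrightarrow> L2_inner M (\<lambda>x. w n x - w (r k) x) (\<lambda>x. w n x - w (r k) x) \<le> e"
        and b2: "\<And>k. k \<ge> N \<Longrightarrow> L2_inner Lam (\<lambda>z. grad (w n) z - grad (w (r k)) z) (\<lambda>z. grad (w n) z - grad (w (r k)) z) \<le> e"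
        using bd[OF n] by blast+
      note F1 = L2_Fatou[OF 1 m1 l1 b1] and F2 = L2_Fatou[OF 2 m2 l2 b2]
      show "(\<lambda>x. w n x - g x) \<in> L2 M \<and> L2_inner M (\<lambda>x. w n x - g x) (\<lambda>x. w n x - g x) \<le> e \<and>
        (\<lambda>z. grad (w n) z - grad g z) \<in> L2 Lam \<and>
        L2_inner Lam (\<lambda>z. grad (w n) z - grad g z) (\<lambda>z. grad (w n) z - grad g z) \<le> e"
        using F1 F2 by blast
    qed
  qed
  obtain N where N: "\<forall>n\<ge>N. (\<lambda>x. w n x - g x) \<in> L2 M \<and> (\<lambda>z. grad (w n) z - grad g z) \<in> L2 Lam"
    using key[of 1] by auto
  have "g \<in> L2 M" using L2_diff[OF wL[of N] N[rule_format, of N, THEN conjunct1]] by simp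
  moreover have "grad g \<in> L2 Lam" using L2_diff[OF gL[of N] N[rule_format, of N, THEN conjunct2]] by simp
  ultimately have gD: "g \<in> Dmax" by (simp add: Dmax_def)
  have "nconv w g"
  proof (rule nconvI; rule LIMSEQ_I)
    fix e :: real assume e: "e > 0"
    obtain N where "\<forall>n\<ge>N. L2_inner M (\<lambda>x. w n x - g x) (\<lambda>x. w n x - g x) \<le> e / 2"
      using key[of "e/2"] e by auto
    then show "\<exists>no. \<forall>n\<ge>no. norm (L2_inner M (\<lambda>x. w n x - g x) (\<lambda>x. w n x - g x) - 0) < e"
      using e L2_inner_nonneg[of M] by (intro exI[of _ N]) fastforce
  next
    fix e :: real assume e: "e > 0"
    obtain N where "\<forall>n\<ge>N. L2_inner Lam (\<lambda>z. grad (w n) z - grad g z) (\<lambda>z. grad (w n) z - grad g z) \<le> e / 2"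
      using key[of "e/2"] e by auto
    then show "\<exists>no. \<forall>n\<ge>no. norm (L2_inner Lam (\<lambda>z. grad (w n) z - grad g z) (\<lambda>z. grad (w n) z - grad g z) - 0) < e"
      using e L2_inner_nonneg[of Lam] by (intro exI[of _ N]) fastforce
  qed
  with gD show ?thesis by blast
qed

lemma nconv_Cauchy:
  assumes "\<And>n. w n \<in> Dmax" "u \<in> Dmax" "nconv w u" "e > 0"
  shows "\<exists>N. \<forall>m\<ge>N. \<forall>n\<ge>N. nrg1 (\<lambda>x. w m x - w n x) < e"
proof -
  have "\<forall>\<^sub>F n in sequentially. nrg1 (\<lambda>x. w n x - u x) < e / 4"
    using order_tendstoD(2)[OF assms(3)[unfolded nconv_def], of "e/4"] assms(4) by simp
  then obtain N where N: "\<forall>n\<ge>N. nrg1 (\<lambda>x. w n x - u x) < e / 4" by (auto simp: eventually_sequentially)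
  have "nrg1 (\<lambda>x. w m x - w n x) < e" if "m \<ge> N" "n \<ge> N" for m n
    using nrg1_triangle[OF assms(1) assms(2) assms(1), of m n] N[rule_format, OF that(1)] N[rule_format, OF that(2)]
    by (simp add: nrg1_diff_commute[of u])
  then show ?thesis by blast
qed

text \<open>Energy convergence contains \<open>L2\<close> convergence, and \<open>L2\<close> limits
  are unique up to null sets. Applied to approximating sequences this is the closability of the
  form.\<close>

lemma nconv_AE_eq:
  assumes "\<And>n. w n \<in> Dmax" "u \<in> L2 M" "v \<in> Dmax" "nconv w v"
    and "(\<lambda>n. L2_inner M (\<lambda>x. w n x - u x) (\<lambda>x. w n x - u x)) \<longlonglongrightarrow> 0"
  shows "AE x in M. u x = v x"
proof -
  have "L2_inner M (\<lambda>x. u x - v x) (\<lambda>x. u x - v x) \<le> 0"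
  proof (rule LIMSEQ_le_const)
    show "(\<lambda>n. 2 * L2_inner M (\<lambda>x. w n x - u x) (\<lambda>x. w n x - u x) +
        2 * L2_inner M (\<lambda>x. w n x - v x) (\<lambda>x. w n x - v x)) \<longlonglongrightarrow> 0"
      using tendsto_add[OF tendsto_mult_right_zero[OF assms(5), of 2]
          tendsto_mult_right_zero[OF nconvD(1)[OF assms(4)], of 2]] by simp
    have "L2_inner M (\<lambda>x. u x - v x) (\<lambda>x. u x - v x) \<le>
        2 * L2_inner M (\<lambda>x. w n x - u x) (\<lambda>x. w n x - u x) + 2 * L2_inner M (\<lambda>x. w n x - v x) (\<lambda>x. w n x - v x)" for n
      using L2_inner_add_square_le[OF L2_diff[OF assms(2) DmaxD(1)[OF assms(1)[of n]]]
          L2_diff[OF DmaxD(1)[OF assms(1)[of n]] DmaxD(1)[OF assms(3)]]]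
      by (simp add: L2_inner_square power2_commute[of "w n _" "u _"])
    then show "\<exists>N. \<forall>n\<ge>N. L2_inner M (\<lambda>x. u x - v x) (\<lambda>x. u x - v x) \<le>
        2 * L2_inner M (\<lambda>x. w n x - u x) (\<lambda>x. w n x - u x) + 2 * L2_inner M (\<lambda>x. w n x - v x) (\<lambda>x. w n x - v x)"
      by blast
  qed
  then show ?thesis
    using L2_inner_zero_AE[OF L2_diff[OF assms(2) DmaxD(1)[OF assms(3)]]] by (auto elim: eventually_mono)
qed

text \<open>Both summands of \<open>form_norm\<close> are at most the square root of
  \<open>nrg1 u\<close>, and the factor 4 makes this root smaller than e/2.\<close>

lemma form_norm_less:
  assumes "E u u = nrg u u" "e > 0" "nrg1 u < e\<^sup>2 / 4"
  shows "form_norm M E u < e"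
proof -
  have "sqrt (nrg1 u) < e / 2"
    using assms(2,3) by (intro real_less_lsqrt) (auto simp: power2_eq_square nrg1_nonneg)
  moreover have "L2_norm M u \<le> sqrt (nrg1 u)" "sqrt (E u u) \<le> sqrt (nrg1 u)"
    by (auto simp: L2_norm_def nrg1_def assms(1) nrg_nonneg L2_inner_nonneg)
  ultimately show ?thesis unfolding form_norm_def by linarith
qed

lemma nrg1_less:
  assumes "E u u = nrg u u" "form_norm M E u < e"
  shows "nrg1 u < 2 * e\<^sup>2"
proof -
  have "0 \<le> L2_norm M u" "0 \<le> sqrt (E u u)"
    by (auto simp: L2_norm_def assms(1) nrg_nonneg L2_inner_nonneg)
  then have "L2_norm M u < e" "sqrt (E u u) < e"
    using assms(2) unfolding form_norm_def by linarith+
  then have "(L2_norm M u)\<^sup>2 < e\<^sup>2" "(sqrt (E u u))\<^sup>2 < e\<^sup>2"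
    using \<open>0 \<le> L2_norm M u\<close> \<open>0 \<le> sqrt (E u u)\<close> by (intro power_strict_mono; simp)+
  then show ?thesis by (simp add: L2_norm_def nrg1_def assms(1) nrg_nonneg L2_inner_nonneg)
qed

lemma nrg_contraction:
  assumes "u \<in> Dmax" "v \<in> borel_measurable M" "\<And>z. z \<in> space Lam \<Longrightarrow> \<bar>grad v z\<bar> \<le> \<bar>grad u z\<bar>"
  shows "nrg v v \<le> nrg u u"
  unfolding nrg_def L2_inner_square
proof (rule integral_mono)
  show "integrable Lam (\<lambda>x. (grad u x)\<^sup>2)" using DmaxD(2)[OF assms(1)] by (simp add: L2_def)
  have "grad v \<in> L2 Lam"
    by (rule L2_bound[OF DmaxD(2)[OF assms(1)] grad_measurable[OF assms(2)]]) (use assms(3) in auto)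
  then show "integrable Lam (\<lambda>x. (grad v x)\<^sup>2)" by (simp add: L2_def)
  show "(grad v z)\<^sup>2 \<le> (grad u z)\<^sup>2" if "z \<in> space Lam" for z
    using assms(3)[OF that] by (simp add: abs_le_square_iff)
qed

end

section \<open>Closure and Markov property\<close>

lemma L2_inner_square_lin:
  assumes "f \<in> L2 M" "g \<in> L2 M"
  shows "L2_inner M (\<lambda>x. s * f x + t * g x) (\<lambda>x. s * f x + t * g x) =
    s\<^sup>2 * L2_inner M f f + 2 * s * t * L2_inner M f g + t\<^sup>2 * L2_inner M g g"
proof -
  have "(\<integral>x. (s * f x + t * g x) * (s * f x + t * g x) \<partial>M) =
    (\<integral>x. s\<^sup>2 * (f x * f x) + 2 * s * t * (f x * g x) + t\<^sup>2 * (g x * g x) \<partial>M)"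
    by (intro Bochner_Integration.integral_cong) (auto simp: algebra_simps power2_eq_square)
  then show ?thesis
    using L2_integrable_mult[OF assms(1,1)] L2_integrable_mult[OF assms] L2_integrable_mult[OF assms(2,2)]
    by (simp add: L2_inner_def)
qed

locale jump_core = jump_space +
  fixes D0 :: "('a \<Rightarrow> real) set" and E0 :: "('a \<Rightarrow> real) \<Rightarrow> ('a \<Rightarrow> real) \<Rightarrow> real"
  assumes D0_Dmax: "u \<in> D0 \<Longrightarrow> u \<in> Dmax"
    and D0_lin: "u \<in> D0 \<Longrightarrow> v \<in> D0 \<Longrightarrow> (\<lambda>x. s * u x + t * v x) \<in> D0"
    and E0_eq: "u \<in> D0 \<Longrightarrow> v \<in> D0 \<Longrightarrow> E0 u v = nrg u v"
begin

abbreviation D :: "('a \<Rightarrow> real) set" where "D \<equiv> closure_dom M D0 E0"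
abbreviation E :: "('a \<Rightarrow> real) \<Rightarrow> ('a \<Rightarrow> real) \<Rightarrow> real" where "E \<equiv> closure_form M D0 E0"

lemma D0_diff: "u \<in> D0 \<Longrightarrow> v \<in> D0 \<Longrightarrow> (\<lambda>x. u x - v x) \<in> D0"
  using D0_lin[of u v 1 "-1"] by simp

text \<open>Being \<open>E0\<close>-Cauchy and \<open>L2\<close>-convergent makes \<open>w\<close>
  Cauchy for \<open>nrg1\<close>; its limit in \<open>Dmax\<close> must agree with \<open>u\<close>
  almost everywhere. From here on the abstract closure is the \<open>nconv\<close>-closure of
  \<open>D0\<close> inside \<open>Dmax\<close>.\<close>

lemma form_approx_iff:
  assumes u: "u \<in> L2 M"
  shows "form_approx M D0 E0 u w \<longleftrightarrow> (\<forall>n. w n \<in> D0) \<and> u \<in> Dmax \<and> nconv w u" (is "?L \<longleftrightarrow> ?R")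
proof
  assume L: ?L
  have w: "w n \<in> D0" for n using L by (simp add: form_approx_def)
  have lim: "(\<lambda>n. L2_norm M (\<lambda>x. w n x - u x)) \<longlonglongrightarrow> 0" using L by (simp add: form_approx_def)
  have q: "(\<lambda>n. L2_inner M (\<lambda>x. w n x - u x) (\<lambda>x. w n x - u x)) \<longlonglongrightarrow> 0"
    using tendsto_power[OF lim, of 2] by (simp add: L2_norm_def L2_inner_nonneg)
  have "\<exists>N. \<forall>m\<ge>N. \<forall>n\<ge>N. nrg1 (\<lambda>x. w m x - w n x) < e" if e: "e > 0" for e
  proof -
    have "\<exists>N. \<forall>m\<ge>N. \<forall>n\<ge>N. E0 (\<lambda>x. w m x - w n x) (\<lambda>x. w m x - w n x) < e / 2"
      using L half_gt_zero[OF e] unfolding form_approx_def by blast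
    then obtain N1 where N1: "\<forall>m\<ge>N1. \<forall>n\<ge>N1. E0 (\<lambda>x. w m x - w n x) (\<lambda>x. w m x - w n x) < e / 2" ..
    have "\<forall>\<^sub>F n in sequentially. L2_inner M (\<lambda>x. w n x - u x) (\<lambda>x. w n x - u x) < e / 8"
      using order_tendstoD(2)[OF q, of "e/8"] e by simp
    then obtain N2 where N2: "\<forall>n\<ge>N2. L2_inner M (\<lambda>x. w n x - u x) (\<lambda>x. w n x - u x) < e / 8"
      by (auto simp: eventually_sequentially)
    have "nrg1 (\<lambda>x. w m x - w n x) < e" if "m \<ge> max N1 N2" "n \<ge> max N1 N2" for m n
    proof -
      have "nrg (\<lambda>x. w m x - w n x) (\<lambda>x. w m x - w n x) < e / 2"
        using N1 that w by (simp add: E0_eq[symmetric] D0_diff)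
      moreover have "L2_inner M (\<lambda>x. w m x - w n x) (\<lambda>x. w m x - w n x) \<le> 2 * (e / 8) + 2 * (e / 8)"
      proof -
        have "L2_inner M (\<lambda>x. w m x - w n x) (\<lambda>x. w m x - w n x) \<le>
           2 * L2_inner M (\<lambda>x. w m x - u x) (\<lambda>x. w m x - u x) + 2 * L2_inner M (\<lambda>x. u x - w n x) (\<lambda>x. u x - w n x)"
          using L2_inner_add_square_le[OF L2_diff[OF DmaxD(1)[OF D0_Dmax[OF w]] u]
            L2_diff[OF u DmaxD(1)[OF D0_Dmax[OF w]]], of m n] by simp
        then show ?thesis
          using N2[rule_format, of m] N2[rule_format, of n] that
          by (simp add: L2_inner_square power2_commute[of "u _"])
      qed
      ultimately show ?thesis by (simp add: nrg1_def)
    qed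
    then show ?thesis by blast
  qed
  then obtain v where v: "v \<in> Dmax" "nconv w v" using Dmax_complete[of w] w D0_Dmax by blast
  have AE: "AE x in M. u x = v x" by (rule nconv_AE_eq[OF D0_Dmax[OF w] u v q])
  have uD: "u \<in> Dmax" using Dmax_cong_AE[OF v(1) L2_measurable[OF u] AE] .
  have "nrg1 (\<lambda>x. w n x - u x) = nrg1 (\<lambda>x. w n x - v x)" for n
    using DmaxD(3)[OF D0_Dmax[OF w[of n]]] DmaxD(3)[OF uD] DmaxD(3)[OF v(1)] AE
    by (intro nrg1_cong_AE) (auto elim: eventually_mono)
  then have "nconv w u" using v(2) by (simp add: nconv_def)
  with w uD show ?R by blast
next
  assume R: ?R
  have w: "w n \<in> D0" for n using R by simp
  show ?L
    unfolding form_approx_def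
  proof (intro conjI allI impI)
    show "w n \<in> D0" for n by fact
    show "\<exists>N. \<forall>m\<ge>N. \<forall>n\<ge>N. E0 (\<lambda>x. w m x - w n x) (\<lambda>x. w m x - w n x) < e" if e: "e > 0" for e
    proof -
      obtain N where N: "\<forall>m\<ge>N. \<forall>n\<ge>N. nrg1 (\<lambda>x. w m x - w n x) < e"
        using nconv_Cauchy[of w u e] R e D0_Dmax by blast
      have "E0 (\<lambda>x. w m x - w n x) (\<lambda>x. w m x - w n x) \<le> nrg1 (\<lambda>x. w m x - w n x)" for m n
        using w by (simp add: E0_eq D0_diff nrg1_def L2_inner_nonneg)
      then show ?thesis using N by (meson le_less_trans)
    qed
    show "(\<lambda>n. L2_norm M (\<lambda>x. w n x - u x)) \<longlonglongrightarrow> 0"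
      using tendsto_real_sqrt[OF nconvD(1)[of w u]] R by (simp add: L2_norm_def)
  qed
qed

lemma D_iff: "u \<in> D \<longleftrightarrow> u \<in> Dmax \<and> (\<exists>w. (\<forall>n. w n \<in> D0) \<and> nconv w u)"
  unfolding closure_dom_def using form_approx_iff[of u] DmaxD(1)[of u] by auto

lemma D_Dmax: "u \<in> D \<Longrightarrow> u \<in> Dmax"
  by (simp add: D_iff)

lemma D_L2: "u \<in> D \<Longrightarrow> u \<in> L2 M"
  by (simp add: closure_dom_def)

lemma D0_D: "u \<in> D0 \<Longrightarrow> u \<in> D"
  unfolding D_iff using D0_Dmax nconv_const[of u] by (auto intro!: exI[of _ "\<lambda>n. u"])

text \<open>The definite description in \<open>closure_form\<close> has a value: along all
  approximating sequences the energies tend to \<open>nrg u v\<close>, and one pair of such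
  sequences exists, which forces uniqueness.\<close>

lemma E_eq:
  assumes "u \<in> D" "v \<in> D"
  shows "E u v = nrg u v"
proof -
  note uv = D_L2[OF assms(1)] D_L2[OF assms(2)]
  note * = form_approx_iff[OF uv(1)] form_approx_iff[OF uv(2)]
  have lim: "(\<lambda>n. E0 (w n) (w' n)) \<longlonglongrightarrow> nrg u v"
    if "form_approx M D0 E0 u w" "form_approx M D0 E0 v w'" for w w'
    using that nrg_tendsto[of w u w' v] by (simp add: * E0_eq D0_Dmax)
  obtain w w' where w: "form_approx M D0 E0 u w" "form_approx M D0 E0 v w'"
    using assms by (auto simp: closure_dom_def)
  show ?thesis
    unfolding closure_form_def
  proof (rule the_equality)
    fix l assume "\<forall>w w'. form_approx M D0 E0 u w \<longrightarrow> form_approx M D0 E0 v w' \<longrightarrow>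
      (\<lambda>n. E0 (w n) (w' n)) \<longlonglongrightarrow> l"
    then show "l = nrg u v" using w lim[OF w] LIMSEQ_unique by blast
  qed (use lim in blast)
qed

text \<open>Diagonal choice: each w_n is replaced by an element of \<open>D0\<close> at squared
  distance below 1/(n+1).\<close>

lemma D_closed:
  assumes w: "\<And>n. w n \<in> D" and u: "u \<in> Dmax" and lim: "nconv w u"
  shows "u \<in> D"
proof -
  have "\<forall>n. \<exists>v\<in>D0. nrg1 (\<lambda>x. v x - w n x) < 1 / (real n + 1)"
  proof
    fix n
    obtain v where v: "\<forall>k. v k \<in> D0" "nconv v (w n)" using w[of n] by (auto simp: D_iff)
    have "\<forall>\<^sub>F k in sequentially. nrg1 (\<lambda>x. v k x - w n x) < 1 / (real n + 1)"
      using order_tendstoD(2)[OF v(2)[unfolded nconv_def], of "1 / (real n + 1)"] by simp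
    then show "\<exists>v\<in>D0. nrg1 (\<lambda>x. v x - w n x) < 1 / (real n + 1)"
      using v(1) by (auto simp: eventually_sequentially)
  qed
  then obtain v where v: "\<And>n. v n \<in> D0" "\<And>n. nrg1 (\<lambda>x. v n x - w n x) < 1 / (real n + 1)" by metis
  have "nconv v u"
    unfolding nconv_def
  proof (rule Lim_null_comparison)
    have "nrg1 (\<lambda>x. v n x - u x) \<le> 2 * (1 / (real n + 1)) + 2 * nrg1 (\<lambda>x. w n x - u x)" for n
      using nrg1_triangle[OF D0_Dmax[OF v(1)] D_Dmax[OF w] u, of n n] v(2)[of n] by linarith
    then show "\<forall>\<^sub>F n in sequentially. norm (nrg1 (\<lambda>x. v n x - u x)) \<le>
        2 * (1 / (real n + 1)) + 2 * nrg1 (\<lambda>x. w n x - u x)"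
      by (simp add: nrg1_nonneg)
    have "(\<lambda>n. 1 / (real n + 1)) \<longlonglongrightarrow> 0"
      using LIMSEQ_inverse_real_of_nat by (simp add: inverse_eq_divide add.commute)
    from tendsto_add[OF tendsto_mult_right_zero[OF this, of 2] tendsto_mult_right_zero[OF lim[unfolded nconv_def], of 2]]
    show "(\<lambda>n. 2 * (1 / (real n + 1)) + 2 * nrg1 (\<lambda>x. w n x - u x)) \<longlonglongrightarrow> 0" by simp
  qed
  then show ?thesis unfolding D_iff using u v(1) by blast
qed

lemma D_lin:
  assumes "u \<in> D" "v \<in> D"
  shows "(\<lambda>x. s * u x + t * v x) \<in> D"
proof -
  obtain w w' where w: "\<forall>n. w n \<in> D0" "nconv w u" and w': "\<forall>n. w' n \<in> D0" "nconv w' v"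
    using assms by (auto simp: D_iff)
  have "nconv (\<lambda>n x. s * w n x + t * w' n x) (\<lambda>x. s * u x + t * v x)"
    unfolding nconv_def
  proof (rule Lim_null_comparison)
    let ?B = "\<lambda>n. 2 * (s\<^sup>2 * nrg1 (\<lambda>x. w n x - u x)) + 2 * (t\<^sup>2 * nrg1 (\<lambda>x. w' n x - v x))"
    have sc: "nrg1 (\<lambda>x. c * h x) = c\<^sup>2 * nrg1 h" for c h
    proof -
      have "grad (\<lambda>x. c * h x) = (\<lambda>z. c * grad h z)" by (auto simp: grad_def algebra_simps)
      then show ?thesis
        by (simp add: nrg1_def nrg_def L2_inner_square power_mult_distrib distrib_left)
    qed
    have "nrg1 (\<lambda>x. (s * w n x + t * w' n x) - (s * u x + t * v x)) \<le> ?B n" for n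
    proof -
      note d = Dmax_diff[OF D0_Dmax[OF w(1)[rule_format, of n]] D_Dmax[OF assms(1)]]
        Dmax_diff[OF D0_Dmax[OF w'(1)[rule_format, of n]] D_Dmax[OF assms(2)]]
      have "nrg1 (\<lambda>x. s * (w n x - u x) + t * (w' n x - v x)) \<le>
          2 * nrg1 (\<lambda>x. s * (w n x - u x)) + 2 * nrg1 (\<lambda>x. t * (w' n x - v x))"
        using Dmax_lin[OF d(1,1), of s 0] Dmax_lin[OF d(2,2), of t 0] by (intro nrg1_add_le) simp_all
      then have "nrg1 (\<lambda>x. s * (w n x - u x) + t * (w' n x - v x)) \<le> ?B n" by (simp only: sc)
      moreover have "(\<lambda>x. s * (w n x - u x) + t * (w' n x - v x)) = (\<lambda>x. (s * w n x + t * w' n x) - (s * u x + t * v x))"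
        by (auto simp: algebra_simps)
      ultimately show ?thesis by simp
    qed
    then show "\<forall>\<^sub>F n in sequentially. norm (nrg1 (\<lambda>x. (s * w n x + t * w' n x) - (s * u x + t * v x))) \<le> ?B n"
      by (simp add: nrg1_nonneg)
    show "?B \<longlonglongrightarrow> 0"
      using tendsto_add[OF tendsto_mult_right_zero[OF tendsto_mult_right_zero[OF w(2)[unfolded nconv_def], of "s\<^sup>2"], of 2]
          tendsto_mult_right_zero[OF tendsto_mult_right_zero[OF w'(2)[unfolded nconv_def], of "t\<^sup>2"], of 2]] by simp
  qed
  moreover have "\<forall>n. (\<lambda>x. s * w n x + t * w' n x) \<in> D0" using w(1) w'(1) by (auto intro: D0_lin)
  ultimately show ?thesis
    unfolding D_iff using Dmax_lin[OF D_Dmax[OF assms(1)] D_Dmax[OF assms(2)], of s t]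
    by (auto intro!: exI[of _ "\<lambda>n x. s * w n x + t * w' n x"])
qed

lemma D_diff: "u \<in> D \<Longrightarrow> v \<in> D \<Longrightarrow> (\<lambda>x. u x - v x) \<in> D"
  using D_lin[of u v 1 "-1"] by simp
lemma D_add: "u \<in> D \<Longrightarrow> v \<in> D \<Longrightarrow> (\<lambda>x. u x + v x) \<in> D"
  using D_lin[of u v 1 1] by simp
lemma D_scale: "u \<in> D \<Longrightarrow> (\<lambda>x. s * u x) \<in> D"
  using D_lin[of u u s 0] by simp

lemma D_cong_AE:
  assumes "u \<in> D" "v \<in> borel_measurable M" "AE x in M. v x = u x"
  shows "v \<in> D"
proof (rule D_closed[of "\<lambda>n. u" v])
  show vD: "v \<in> Dmax" using Dmax_cong_AE[OF D_Dmax[OF assms(1)] assms(2,3)] .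
  have "nrg1 (\<lambda>x. u x - v x) = nrg1 (\<lambda>x. u x - u x)"
    using assms DmaxD(3)[OF D_Dmax[OF assms(1)]]
    by (intro nrg1_cong_AE) (auto elim: eventually_mono)
  then show "nconv (\<lambda>n. u) v" using nconv_const[of u] by (simp add: nconv_def)
qed fact

text \<open>The criterion by which limits are shown to stay in the domain: if values and increments
  are both dominated by sequences converging in \<open>L2\<close>, pointwise convergence already is
  convergence in energy.\<close>

lemma D_dominated:
  assumes v: "\<And>n. v n \<in> D" "v' \<in> borel_measurable M" "AE x in M. (\<lambda>n. v n x) \<longlonglongrightarrow> v' x"
    and H: "\<And>n. H n \<in> L2 M" "H' \<in> L2 M" "AE x in M. (\<lambda>n. H n x) \<longlonglongrightarrow> H' x"
      "(\<lambda>n. L2_inner M (\<lambda>x. H n x - H' x) (\<lambda>x. H n x - H' x)) \<longlonglongrightarrow> 0"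
    and G: "\<And>n. G n \<in> L2 Lam" "G' \<in> L2 Lam" "AE x in Lam. (\<lambda>n. G n x) \<longlonglongrightarrow> G' x"
      "(\<lambda>n. L2_inner Lam (\<lambda>x. G n x - G' x) (\<lambda>x. G n x - G' x)) \<longlonglongrightarrow> 0"
    and bd: "\<And>n. AE x in M. \<bar>v n x\<bar> \<le> \<bar>H n x\<bar>" "\<And>n. AE z in Lam. \<bar>grad (v n) z\<bar> \<le> \<bar>G n z\<bar>"
  shows "v' \<in> D" and "nconv v v'"
proof -
  note vm = DmaxD(3)[OF D_Dmax[OF v(1)]]
  note 1 = L2_dominated_convergence[OF vm v(2,3) H bd(1)]
  note 2 = L2_dominated_convergence[OF grad_measurable[OF vm] grad_measurable[OF v(2)] grad_tendsto_AE[OF v(3)] G bd(2)]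
  have "v' \<in> Dmax" using 1(1) 2(1) by (simp add: Dmax_def)
  moreover show "nconv v v'" by (rule nconvI[OF 1(2) 2(2)])
  ultimately show "v' \<in> D" by (rule D_closed[of v, OF v(1)])
qed

lemma D_dominated_fixed:
  assumes v: "\<And>n. v n \<in> D" "v' \<in> borel_measurable M" "AE x in M. (\<lambda>n. v n x) \<longlonglongrightarrow> v' x"
    and H: "H \<in> L2 M" "G \<in> L2 Lam"
    and bd: "\<And>n. AE x in M. \<bar>v n x\<bar> \<le> \<bar>H x\<bar>" "\<And>n. AE z in Lam. \<bar>grad (v n) z\<bar> \<le> \<bar>G z\<bar>"
  shows "v' \<in> D" and "nconv v v'"
  using D_dominated[OF v, of "\<lambda>n. H" H "\<lambda>n. G" G] H bd by (auto simp: L2_inner_def)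

text \<open>The approximants w of u serve as their own majorants, since |T w| \<le> |w| and the
  increments of T w are at most those of w. They vary with the index, which is why dominated
  convergence was set up with moving bounds.\<close>

lemma D_contraction:
  fixes T :: "real \<Rightarrow> real"
  assumes T: "\<And>s t. \<bar>T s - T t\<bar> \<le> \<bar>s - t\<bar>" "T 0 = 0"
    and T0: "\<And>w. w \<in> D0 \<Longrightarrow> (\<lambda>x. T (w x)) \<in> D"
    and u: "u \<in> D"
  shows "(\<lambda>x. T (u x)) \<in> D"
proof -
  obtain w where w: "\<And>n. w n \<in> D0" "nconv w u" using u by (auto simp: D_iff)
  obtain r where r: "AE x in M. (\<lambda>k. w (r k) x) \<longlonglongrightarrow> u x" "nconv (\<lambda>k. w (r k)) u"
    using nconv_AE_subseq[OF D0_Dmax[OF w(1)] D_Dmax[OF u] w(2)] by metis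
  have "continuous_on UNIV T"
    by (rule lipschitz_on_continuous_on[of 1]) (auto intro!: lipschitz_onI simp: dist_real_def T)
  then have Tm: "T \<in> borel_measurable borel" by (rule borel_measurable_continuous_onI)
  have T': "\<bar>T s\<bar> \<le> \<bar>s\<bar>" for s using T(1)[of s 0] T(2) by simp
  show ?thesis
  proof (rule D_dominated(1)[where H = "\<lambda>k. w (r k)" and G = "\<lambda>k. grad (w (r k))" and H' = u and G' = "grad u"])
    show "(\<lambda>x. T (w (r n) x)) \<in> D" for n by (rule T0[OF w(1)])
    show "(\<lambda>x. T (u x)) \<in> borel_measurable M"
      by (rule measurable_compose[OF DmaxD(3)[OF D_Dmax[OF u]] Tm])
    show "AE x in M. (\<lambda>n. T (w (r n) x)) \<longlonglongrightarrow> T (u x)"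
      using r(1)
    proof eventually_elim
      case (elim x)
      show ?case
        by (rule continuous_on_tendsto_compose[OF \<open>continuous_on UNIV T\<close> elim]) auto
    qed
    show "w (r n) \<in> L2 M" "grad (w (r n)) \<in> L2 Lam" for n using DmaxD[OF D0_Dmax[OF w(1)]] by auto
    show "u \<in> L2 M" "grad u \<in> L2 Lam" using DmaxD[OF D_Dmax[OF u]] by auto
    show "AE x in M. (\<lambda>n. w (r n) x) \<longlonglongrightarrow> u x" by fact
    show "AE x in Lam. (\<lambda>n. grad (w (r n)) x) \<longlonglongrightarrow> grad u x" by (rule grad_tendsto_AE[OF r(1)])
  qed (use nconvD[OF r(2)] T' in \<open>auto simp: grad_def T(1)\<close>)
qed

end

text \<open>The reverse triangle inequality in the plane for the points (s, e) and (t, e).\<close>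

lemma sqrt_smoothing_contraction: "\<bar>sqrt (s\<^sup>2 + e\<^sup>2) - sqrt (t\<^sup>2 + e\<^sup>2)\<bar> \<le> \<bar>s - t\<bar>"
  using norm_triangle_ineq3[of "(s, e)" "(t, e)"] by (simp add: norm_Pair)

text \<open>Smooth approximations of the absolute value are enough for all truncations: they give
  the positive part, and together with the constant 1 the clamp to [0, 1]. Subtracting
  \<open>e\<close> makes the smoothed function vanish at 0, without which the composition would
  leave the span of compactly supported functions.\<close>

locale jump_dirichlet = jump_core +
  assumes D0_smoothing: "w \<in> D0 \<Longrightarrow> e > 0 \<Longrightarrow> (\<lambda>x. sqrt ((w x)\<^sup>2 + e\<^sup>2) - e) \<in> D0"
    and D0_dense: "f \<in> L2 M \<Longrightarrow> e > 0 \<Longrightarrow> \<exists>u\<in>D0. L2_norm M (\<lambda>x. f x - u x) < e"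
    and one_D: "(\<lambda>x. 1) \<in> D"
begin

lemma D_const: "(\<lambda>x. c) \<in> D"
  using D_scale[OF one_D, of c] by simp

lemma D_abs:
  assumes "u \<in> D"
  shows "(\<lambda>x. \<bar>u x\<bar>) \<in> D"
proof (rule D_contraction[OF _ _ _ assms])
  fix w assume w: "w \<in> D0"
  let ?e = "\<lambda>n. 1 / (real n + 1)"
  note wD = D_Dmax[OF D0_D[OF w]]
  have e0: "?e \<longlonglongrightarrow> 0"
    using LIMSEQ_inverse_real_of_nat by (simp add: inverse_eq_divide add.commute)
  show "(\<lambda>x. \<bar>w x\<bar>) \<in> D"
  proof (rule D_dominated_fixed(1)[where v = "\<lambda>n x. sqrt ((w x)\<^sup>2 + (?e n)\<^sup>2) - ?e n"])
    show "(\<lambda>x. sqrt ((w x)\<^sup>2 + (?e n)\<^sup>2) - ?e n) \<in> D" for n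
      by (intro D0_D D0_smoothing w) simp
    show "(\<lambda>x. \<bar>w x\<bar>) \<in> borel_measurable M" using DmaxD(3)[OF wD] by measurable
    have "(\<lambda>n. sqrt ((w x)\<^sup>2 + (?e n)\<^sup>2) - ?e n) \<longlonglongrightarrow> sqrt ((w x)\<^sup>2 + 0\<^sup>2) - 0" for x
      by (intro tendsto_intros e0)
    then show "AE x in M. (\<lambda>n. sqrt ((w x)\<^sup>2 + (?e n)\<^sup>2) - ?e n) \<longlonglongrightarrow> \<bar>w x\<bar>" by simp
    show "w \<in> L2 M" "grad w \<in> L2 Lam" using DmaxD[OF wD] by auto
    have "\<bar>sqrt ((w x)\<^sup>2 + (?e n)\<^sup>2) - ?e n\<bar> \<le> \<bar>w x\<bar>" for n x
      using sqrt_smoothing_contraction[of "w x" "?e n" 0] by simp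
    then show "AE x in M. \<bar>sqrt ((w x)\<^sup>2 + (?e n)\<^sup>2) - ?e n\<bar> \<le> \<bar>w x\<bar>" for n by blast
    show "AE z in Lam. \<bar>grad (\<lambda>x. sqrt ((w x)\<^sup>2 + (?e n)\<^sup>2) - ?e n) z\<bar> \<le> \<bar>grad w z\<bar>" for n
      using sqrt_smoothing_contraction by (auto simp: grad_def)
  qed
qed auto

lemma D_pos:
  assumes "u \<in> D"
  shows "(\<lambda>x. max 0 (u x)) \<in> D"
proof -
  have "max 0 t = (1/2) * t + (1/2) * \<bar>t\<bar>" for t :: real by (auto simp: max_def abs_if)
  then show ?thesis using D_lin[OF assms D_abs[OF assms], of "1/2" "1/2"] by simp
qed

lemma D_clamp:
  assumes "u \<in> D"
  shows "(\<lambda>x. min (max (u x) 0) 1) \<in> D"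
proof -
  have "min (max t 0) 1 = max 0 t - max 0 (t - 1)" for t :: real by (auto simp: max_def min_def)
  then show ?thesis
    using D_diff[OF D_pos[OF assms] D_pos[OF D_diff[OF assms one_D]]] by simp
qed

lemma dirichlet: "dirichlet_form M D E"
  unfolding dirichlet_form_def
proof (intro conjI ballI allI impI)
  show "D \<subseteq> L2 M" using D_L2 by blast
next
  fix u v assume u: "u \<in> D" and v: "v \<in> L2 M" and AE: "AE x in M. v x = u x"
  show vD: "v \<in> D" by (rule D_cong_AE[OF u L2_measurable[OF v] AE])
  fix w assume "w \<in> D"
  then show "E v w = E u w"
    using u vD nrg_cong_AE[OF AE] by (simp add: E_eq DmaxD(3)[OF D_Dmax])
next
  fix u v a b assume uv: "u \<in> D" "v \<in> D"
  show lin: "(\<lambda>x. a * u x + b * v x) \<in> D" by (rule D_lin[OF uv])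
  fix w assume "w \<in> D"
  then show "E (\<lambda>x. a * u x + b * v x) w = a * E u w + b * E v w"
    using uv lin by (simp add: E_eq nrg_lin D_Dmax)
next
  show "E u v = E v u" if "u \<in> D" "v \<in> D" for u v using that by (simp add: E_eq nrg_commute)
  show "0 \<le> E u u" if "u \<in> D" for u using that by (simp add: E_eq nrg_nonneg)
  show "\<exists>u\<in>D. L2_norm M (\<lambda>x. f x - u x) < e" if "f \<in> L2 M" "e > 0" for f e
    using D0_dense[OF that] D0_D by blast
next
  fix w :: "nat \<Rightarrow> 'a \<Rightarrow> real" assume w': "(\<forall>n. w n \<in> D) \<and>
      (\<forall>e>0. \<exists>N. \<forall>m\<ge>N. \<forall>n\<ge>N. form_norm M E (\<lambda>x. w m x - w n x) < e)"
  then have w: "w n \<in> D" for n by simp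
  have "\<exists>u\<in>Dmax. nconv w u"
  proof (rule Dmax_complete[OF D_Dmax[OF w]])
    fix e :: real assume e: "e > 0"
    obtain N where N: "\<forall>m\<ge>N. \<forall>n\<ge>N. form_norm M E (\<lambda>x. w m x - w n x) < sqrt (e / 2)"
      using w' e by (meson half_gt_zero real_sqrt_gt_zero)
    have "nrg1 (\<lambda>x. w m x - w n x) < 2 * (sqrt (e / 2))\<^sup>2" if "m \<ge> N" "n \<ge> N" for m n
      using N that by (intro nrg1_less[where E = E]) (auto intro!: E_eq D_diff w)
    then show "\<exists>N. \<forall>m\<ge>N. \<forall>n\<ge>N. nrg1 (\<lambda>x. w m x - w n x) < e" using e by auto
  qed
  then obtain u where u: "u \<in> Dmax" "nconv w u" by blast
  have uD: "u \<in> D" by (rule D_closed[OF w u])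
  have "(\<lambda>n. form_norm M E (\<lambda>x. w n x - u x)) \<longlonglongrightarrow> 0"
    using tendsto_add[OF tendsto_real_sqrt[OF nconvD(1)[OF u(2)]] tendsto_real_sqrt[OF nconvD(2)[OF u(2)]]]
    by (simp add: form_norm_def L2_norm_def E_eq[OF D_diff[OF w uD] D_diff[OF w uD]] nrg_def grad_diff)
  with uD show "\<exists>u\<in>D. (\<lambda>n. form_norm M E (\<lambda>x. w n x - u x)) \<longlonglongrightarrow> 0" by blast
next
  fix u assume u: "u \<in> D"
  show c: "(\<lambda>x. min (max (u x) 0) 1) \<in> D" by (rule D_clamp[OF u])
  show "E (\<lambda>x. min (max (u x) 0) 1) (\<lambda>x. min (max (u x) 0) 1) \<le> E u u"
    unfolding E_eq[OF c c] E_eq[OF u u]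
    by (rule nrg_contraction[OF D_Dmax[OF u] DmaxD(3)[OF D_Dmax[OF c]]])
       (auto simp: grad_def min_def max_def)
qed

lemma D0_form_dense: "form_dense_in M E D0 D"
  unfolding form_dense_in_def
proof (intro conjI ballI allI impI)
  show "D0 \<subseteq> D" using D0_D by blast
  fix u and e :: real assume u: "u \<in> D" and e: "e > 0"
  obtain w where w: "\<And>n. w n \<in> D0" "nconv w u" using u by (auto simp: D_iff)
  have "\<forall>\<^sub>F n in sequentially. nrg1 (\<lambda>x. w n x - u x) < e\<^sup>2 / 4"
    using order_tendstoD(2)[OF w(2)[unfolded nconv_def], of "e\<^sup>2/4"] e by simp
  then obtain n where "nrg1 (\<lambda>x. w n x - u x) < e\<^sup>2 / 4" by (auto simp: eventually_sequentially)
  then have "form_norm M E (\<lambda>x. u x - w n x) < e"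
    using e by (intro form_norm_less E_eq D_diff u D0_D w) (auto simp: nrg1_diff_commute)
  then show "\<exists>v\<in>D0. form_norm M E (\<lambda>x. u x - v x) < e" using w(1) by blast
qed

end

section \<open>Potential theory\<close>

text \<open>The first order condition at the endpoint t = 0 of a segment.\<close>

lemma nonneg_of_quadratic_nonneg:
  fixes X Y :: real
  assumes "\<And>t. 0 < t \<Longrightarrow> t \<le> 1 \<Longrightarrow> 0 \<le> 2 * t * X + t\<^sup>2 * Y"
  shows "0 \<le> X"
proof (rule ccontr)
  assume "\<not> 0 \<le> X"
  then have X: "X < 0" by simp
  \<comment> \<open>Small enough for t Y \<le> -X, so that the linear term 2 t X wins.\<close>
  define t where "t = min 1 (- X / (\<bar>Y\<bar> + 1))"
  have t: "0 < t" "t \<le> 1" using X by (auto simp: t_def divide_neg_pos)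
  have "t * \<bar>Y\<bar> \<le> t * (\<bar>Y\<bar> + 1)" using t by simp
  also have "\<dots> \<le> - X / (\<bar>Y\<bar> + 1) * (\<bar>Y\<bar> + 1)" by (intro mult_right_mono) (auto simp: t_def)
  also have "\<dots> = - X" by simp
  finally have "t * Y \<le> - X" using t abs_ge_self[of Y] by (meson order_trans mult_left_mono less_imp_le)
  then have "t * (2 * X + t * Y) < 0" using t X by (intro mult_pos_neg) auto
  with assms[OF t] show False by (simp add: power2_eq_square algebra_simps)
qed

lemma L2_inner_diff_swap: "L2_inner M (\<lambda>x. f x - g x) h = - L2_inner M (\<lambda>x. g x - f x) h"
proof -
  have "(\<lambda>x. (f x - g x) * h x) = (\<lambda>x. - ((g x - f x) * h x))" by (auto simp: algebra_simps)
  then show ?thesis by (simp add: L2_inner_def)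
qed

section \<open>Resolvents, excessive functions and capacity by minimisation\<close>

context jump_dirichlet
begin

definition Ea :: "real \<Rightarrow> ('a \<Rightarrow> real) \<Rightarrow> ('a \<Rightarrow> real) \<Rightarrow> real" where
  "Ea c u v = nrg u v + c * L2_inner M u v"

lemma Ea_commute: "Ea c u v = Ea c v u"
  by (simp add: Ea_def nrg_commute L2_inner_commute)

lemma Ea_lin:
  "u \<in> D \<Longrightarrow> v \<in> D \<Longrightarrow> w \<in> D \<Longrightarrow> Ea c (\<lambda>x. s * u x + t * v x) w = s * Ea c u w + t * Ea c v w"
  by (simp add: Ea_def nrg_lin L2_inner_lin D_Dmax D_L2 algebra_simps)

lemma Ea_diff: "u \<in> D \<Longrightarrow> v \<in> D \<Longrightarrow> w \<in> D \<Longrightarrow> Ea c (\<lambda>x. u x - v x) w = Ea c u w - Ea c v w"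
  using Ea_lin[of u v w c 1 "-1"] by simp

lemma Ea_scale: "u \<in> D \<Longrightarrow> w \<in> D \<Longrightarrow> Ea c (\<lambda>x. s * u x) w = s * Ea c u w"
  using Ea_lin[of u u w c s 0] by simp

lemma Ea_square_lin:
  assumes "u \<in> D" "v \<in> D"
  shows "Ea c (\<lambda>x. s * u x + t * v x) (\<lambda>x. s * u x + t * v x) =
    s\<^sup>2 * Ea c u u + 2 * s * t * Ea c u v + t\<^sup>2 * Ea c v v"
proof -
  note d = DmaxD[OF D_Dmax[OF assms(1)]] DmaxD[OF D_Dmax[OF assms(2)]]
  show ?thesis
    using L2_inner_square_lin[OF d(1,4), of s t] L2_inner_square_lin[OF d(2,5), of s t]
    by (simp add: Ea_def nrg_def grad_lin algebra_simps)
qed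

lemma Ea_diff_square:
  "u \<in> D \<Longrightarrow> v \<in> D \<Longrightarrow> Ea c (\<lambda>x. u x - v x) (\<lambda>x. u x - v x) = Ea c u u - 2 * Ea c u v + Ea c v v"
  using Ea_square_lin[of u v c 1 "-1"] by simp

lemma Ea_nonneg: "0 \<le> c \<Longrightarrow> 0 \<le> Ea c u u"
  by (simp add: Ea_def nrg_nonneg L2_inner_nonneg)

lemma Ea_1: "Ea 1 u u = nrg1 u"
  by (simp add: Ea_def nrg1_def)

lemma Ea_tendsto:
  assumes "\<And>n. w n \<in> D" "u \<in> D" "\<And>n. w' n \<in> D" "v \<in> D" "nconv w u" "nconv w' v"
  shows "(\<lambda>n. Ea c (w n) (w' n)) \<longlonglongrightarrow> Ea c u v"
  unfolding Ea_def using assms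
  by (intro tendsto_intros nrg_tendsto L2_inner_nconv_tendsto) (auto intro: D_Dmax)

text \<open>A minimising sequence of the quadratic functional \<open>J\<close> is Cauchy by the
  parallelogram law, its limit minimises \<open>J\<close>, and differentiating along segments in
  \<open>C\<close> gives the inequality. With C = D it yields the resolvent, with f = 0 and an
  obstacle set the smallest majorants.\<close>

lemma variational:
  assumes C: "C \<subseteq> D" "C \<noteq> {}"
    and conv: "\<And>u v t. u \<in> C \<Longrightarrow> v \<in> C \<Longrightarrow> 0 \<le> t \<Longrightarrow> t \<le> 1 \<Longrightarrow> (\<lambda>x. (1 - t) * u x + t * v x) \<in> C"
    and closed: "\<And>w u. (\<And>n. w n \<in> C) \<Longrightarrow> u \<in> D \<Longrightarrow> nconv w u \<Longrightarrow> u \<in> C"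
    and c: "0 < c" and f: "f \<in> L2 M"
  shows "\<exists>u\<in>C. \<forall>v\<in>C. L2_inner M f (\<lambda>x. v x - u x) \<le> Ea c u (\<lambda>x. v x - u x)"
proof -
  define J where "J v = Ea c v v - 2 * L2_inner M f v" for v
  have CD: "u \<in> D" if "u \<in> C" for u using that C(1) by blast
  have J_lin: "J (\<lambda>x. s * u x + t * v x) = s\<^sup>2 * Ea c u u + 2 * s * t * Ea c u v + t\<^sup>2 * Ea c v v
      - 2 * s * L2_inner M f u - 2 * t * L2_inner M f v" if "u \<in> D" "v \<in> D" for u v s t
    using Ea_square_lin[OF that, of c s t] L2_inner_lin[OF D_L2[OF that(1)] D_L2[OF that(2)] f, of s t]
    by (simp add: J_def L2_inner_commute[of M f u] L2_inner_commute[of M f v]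
        L2_inner_commute[of M f "\<lambda>x. s * u x + t * v x"])
  \<comment> \<open>Completing the square: c |v|^2 - 2 (f, v) is at least -|f|^2 / c.\<close>
  have lower: "- L2_inner M f f / c \<le> J v" if "v \<in> D" for v
  proof -
    have "0 \<le> L2_inner M (\<lambda>x. c * v x + (-1) * f x) (\<lambda>x. c * v x + (-1) * f x)" by (rule L2_inner_nonneg)
    also have "\<dots> = c\<^sup>2 * L2_inner M v v - 2 * c * L2_inner M v f + L2_inner M f f"
      by (subst L2_inner_square_lin[OF D_L2[OF that] f]) simp
    finally have "0 \<le> (c\<^sup>2 * L2_inner M v v - 2 * c * L2_inner M v f + L2_inner M f f) / c" using c by simp
    also have "\<dots> = c * L2_inner M v v - 2 * L2_inner M v f + L2_inner M f f / c"
      using c by (simp add: field_simps power2_eq_square)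
    finally show ?thesis using nrg_nonneg[of v] by (simp add: J_def Ea_def L2_inner_commute[of M f v])
  qed
  define I where "I = Inf (J ` C)"
  have bdd: "bdd_below (J ` C)" using lower CD by (intro bdd_belowI2) auto
  have I: "I \<le> J v" if "v \<in> C" for v unfolding I_def using that bdd by (intro cINF_lower) auto
  have "\<exists>v\<in>C. J v < I + 1 / (real n + 1)" for n
  proof -
    have "Inf (J ` C) < I + 1 / (real n + 1)" by (simp add: I_def)
    then show ?thesis using cInf_lessD[of "J ` C"] C(2) by auto
  qed
  then obtain w where w: "\<And>n. w n \<in> C" "\<And>n. J (w n) < I + 1 / (real n + 1)" by metis
  \<comment> \<open>The midpoint of w_m and w_n lies in \<open>C\<close>, so \<open>J\<close> there
    is at least \<open>I\<close>; the parallelogram law converts this into a bound on the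
    distance.\<close>
  have par: "Ea c (\<lambda>x. w m x - w n x) (\<lambda>x. w m x - w n x) \<le> 2 / (real m + 1) + 2 / (real n + 1)" for m n
  proof -
    have "(\<lambda>x. (1 - 1/2) * w m x + (1/2) * w n x) \<in> C" by (intro conv w) auto
    then have "I \<le> J (\<lambda>x. (1/2) * w m x + (1/2) * w n x)" using I by simp
    then have "I \<le> 1 / 4 * Ea c (w m) (w m) + 1 / 2 * Ea c (w m) (w n) + 1 / 4 * Ea c (w n) (w n)
        - L2_inner M f (w m) - L2_inner M f (w n)"
      unfolding J_lin[OF CD[OF w(1)] CD[OF w(1)]] by (simp add: power2_eq_square)
    moreover have "Ea c (w m) (w m) - 2 * L2_inner M f (w m) < I + 1 / (real m + 1)"
      "Ea c (w n) (w n) - 2 * L2_inner M f (w n) < I + 1 / (real n + 1)"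
      using w(2)[of m] w(2)[of n] by (simp_all add: J_def)
    ultimately show ?thesis
      unfolding Ea_diff_square[OF CD[OF w(1)] CD[OF w(1)]] by argo
  qed
  \<comment> \<open>\<open>Ea c\<close> and \<open>nrg1\<close> are equivalent for c > 0, so
    completeness of \<open>Dmax\<close> applies.\<close>
  have nrg1_le: "nrg1 v \<le> Ea c v v / min 1 c" for v
  proof -
    have "min 1 c * nrg1 v \<le> 1 * nrg v v + c * L2_inner M v v"
      unfolding nrg1_def distrib_left
      by (intro add_mono mult_right_mono nrg_nonneg L2_inner_nonneg) auto
    then show ?thesis using c by (simp add: Ea_def field_simps)
  qed
  have "\<exists>u\<in>Dmax. nconv w u"
  proof (rule Dmax_complete[OF D_Dmax[OF CD[OF w(1)]]])
    fix e :: real assume e: "e > 0"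
    define d where "d = e * min 1 c / 4"
    have d: "d > 0" using e c by (simp add: d_def)
    obtain N where N: "1 / (real N + 1) < d"
      using reals_Archimedean[OF d] by (auto simp: inverse_eq_divide add.commute)
    have "nrg1 (\<lambda>x. w m x - w n x) < e" if "m \<ge> N" "n \<ge> N" for m n
    proof -
      have "1 / (real m + 1) \<le> 1 / (real N + 1)" "1 / (real n + 1) \<le> 1 / (real N + 1)"
        using that by (auto intro!: divide_left_mono)
      then have "2 / (real m + 1) + 2 / (real n + 1) < 4 * d" using N by linarith
      then have "Ea c (\<lambda>x. w m x - w n x) (\<lambda>x. w m x - w n x) < e * min 1 c"
        using par[of m n] by (simp add: d_def)
      then have "Ea c (\<lambda>x. w m x - w n x) (\<lambda>x. w m x - w n x) / min 1 c < e"
        using c by (subst pos_divide_less_eq) auto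
      then show ?thesis using nrg1_le by (meson le_less_trans)
    qed
    then show "\<exists>N. \<forall>m\<ge>N. \<forall>n\<ge>N. nrg1 (\<lambda>x. w m x - w n x) < e" by blast
  qed
  then obtain u where u: "u \<in> Dmax" "nconv w u" by blast
  have uD: "u \<in> D" by (rule D_closed[OF CD[OF w(1)] u])
  have uC: "u \<in> C" by (rule closed[OF w(1) uD u(2)])
  have "(\<lambda>n. J (w n)) \<longlonglongrightarrow> J u"
    unfolding J_def
  proof (intro tendsto_intros Ea_tendsto CD[OF w(1)] uD u(2))
    show "(\<lambda>n. L2_inner M f (w n)) \<longlonglongrightarrow> L2_inner M f u"
      using D_L2[OF CD[OF w(1)]] D_L2[OF uD] nconvD(1)[OF u(2)] f
      by (intro L2_inner_tendsto) (auto simp: L2_inner_def)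
  qed
  moreover have "(\<lambda>n. I + 1 / (real n + 1)) \<longlonglongrightarrow> I + 0"
    using LIMSEQ_inverse_real_of_nat by (intro tendsto_intros) (simp add: inverse_eq_divide add.commute)
  ultimately have "J u \<le> I + 0"
    using w(2) by (intro LIMSEQ_le[of "\<lambda>n. J (w n)"]) (auto intro: less_imp_le)
  then have min: "J u \<le> J v" if "v \<in> C" for v using I[OF that] by simp
  show ?thesis
  proof (intro bexI[OF _ uC] ballI)
    fix v assume v: "v \<in> C"
    let ?d = "\<lambda>x. v x - u x"
    have dD: "?d \<in> D" by (rule D_diff[OF CD[OF v] uD])
    have "0 \<le> Ea c u ?d - L2_inner M f ?d"
    proof (rule nonneg_of_quadratic_nonneg[where Y = "Ea c ?d ?d"])
      fix t :: real assume t: "0 < t" "t \<le> 1"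
      have "J u \<le> J (\<lambda>x. (1 - t) * u x + t * v x)" using t by (intro min conv uC v) auto
      also have "(\<lambda>x. (1 - t) * u x + t * v x) = (\<lambda>x. 1 * u x + t * ?d x)" by (auto simp: algebra_simps)
      finally show "0 \<le> 2 * t * (Ea c u ?d - L2_inner M f ?d) + t\<^sup>2 * Ea c ?d ?d"
        unfolding J_lin[OF uD dD] by (simp add: J_def algebra_simps)
    qed
    then show "L2_inner M f ?d \<le> Ea c u ?d" by simp
  qed
qed

text \<open>On the linear space \<open>D\<close> the variational inequality may be tested with u + v
  and u - v, which turns it into an equation.\<close>

lemma resolvent_exists:
  assumes "0 < c" "f \<in> L2 M"
  shows "\<exists>u\<in>D. \<forall>v\<in>D. Ea c u v = L2_inner M f v"
proof -
  have "\<exists>u\<in>D. \<forall>v\<in>D. L2_inner M f (\<lambda>x. v x - u x) \<le> Ea c u (\<lambda>x. v x - u x)"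
    using one_D assms by (intro variational) (auto intro: D_lin)
  then obtain u where u: "u \<in> D" "\<And>v. v \<in> D \<Longrightarrow> L2_inner M f (\<lambda>x. v x - u x) \<le> Ea c u (\<lambda>x. v x - u x)"
    by blast
  have "Ea c u v = L2_inner M f v" if v: "v \<in> D" for v
  proof (rule antisym)
    show "L2_inner M f v \<le> Ea c u v" using u(2)[OF D_add[OF v u(1)]] by simp
    have "- L2_inner M f v = L2_inner M f (\<lambda>x. (-1) * v x)" by (simp add: L2_inner_def)
    also have "\<dots> \<le> Ea c u (\<lambda>x. (-1) * v x)" using u(2)[OF D_diff[OF u(1) v]] by simp
    also have "\<dots> = - Ea c u v" using Ea_scale[OF v u(1), of c "-1"]
      unfolding Ea_commute[of c u "\<lambda>x. (-1) * v x"] Ea_commute[of c u v] by simp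
    finally show "Ea c u v \<le> L2_inner M f v" by simp
  qed
  with u(1) show ?thesis by blast
qed

lemma resolvent:
  assumes "0 < c" "f \<in> L2 M"
  shows "resolvent M D E c f \<in> D" and "v \<in> D \<Longrightarrow> Ea c (resolvent M D E c f) v = L2_inner M f v"
proof -
  have "\<exists>g. g \<in> D \<and> (\<forall>v\<in>D. E g v + c * L2_inner M g v = L2_inner M f v)"
    using resolvent_exists[OF assms] by (auto simp: Ea_def E_eq)
  from someI_ex[OF this]
  have *: "resolvent M D E c f \<in> D \<and> (\<forall>v\<in>D. E (resolvent M D E c f) v +
      c * L2_inner M (resolvent M D E c f) v = L2_inner M f v)"
    unfolding resolvent_def .
  then show RD: "resolvent M D E c f \<in> D" by simp
  show "Ea c (resolvent M D E c f) v = L2_inner M f v" if "v \<in> D"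
    using *[THEN conjunct2, rule_format, OF that] unfolding E_eq[OF RD that] Ea_def .
qed

text \<open>The difference of both sides pairs u - max 0 u with max 0 u. Increments of these two
  functions never have opposite signs, because both are monotone functions of u.\<close>

lemma Ea_pos_ge:
  assumes u: "u \<in> D" and c: "0 \<le> c"
  shows "Ea c (\<lambda>x. max 0 (u x)) (\<lambda>x. max 0 (u x)) \<le> Ea c u (\<lambda>x. max 0 (u x))"
proof -
  note p = D_pos[OF u]
  note d = DmaxD[OF D_Dmax[OF u]] and e = DmaxD[OF D_Dmax[OF p]]
  have "L2_inner M (\<lambda>x. max 0 (u x)) (\<lambda>x. max 0 (u x)) \<le> L2_inner M u (\<lambda>x. max 0 (u x))"
    unfolding L2_inner_def using d(1) e(1) by (intro integral_mono L2_integrable_mult) (auto simp: max_def)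
  moreover have "L2_inner Lam (grad (\<lambda>x. max 0 (u x))) (grad (\<lambda>x. max 0 (u x))) \<le>
      L2_inner Lam (grad u) (grad (\<lambda>x. max 0 (u x)))"
    unfolding L2_inner_def
  proof (intro integral_mono L2_integrable_mult d(2) e(2))
    fix z
    have "(max 0 s - max 0 t) * (max 0 s - max 0 t) \<le> (s - t) * (max 0 s - max 0 t)" for s t :: real
    proof -
      have "0 \<le> (s - t - (max 0 s - max 0 t)) * (max 0 s - max 0 t)"
        by (cases "s \<le> t") (auto simp: max_def intro: mult_nonneg_nonneg mult_nonpos_nonpos mult_nonpos_nonneg)
      then show ?thesis by (simp add: left_diff_distrib)
    qed
    then show "grad (\<lambda>x. max 0 (u x)) z * grad (\<lambda>x. max 0 (u x)) z \<le> grad u z * grad (\<lambda>x. max 0 (u x)) z"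
      unfolding grad_def .
  qed
  ultimately show ?thesis unfolding Ea_def nrg_def using c by (intro add_mono mult_left_mono) auto
qed

text \<open>The comparison principle behind every almost everywhere inequality below: by
  \<open>Ea_pos_ge\<close> the positive part of u has E_1-norm 0.\<close>

lemma AE_nonpos_of_Ea_pos:
  assumes u: "u \<in> D" and le: "Ea 1 u (\<lambda>x. max 0 (u x)) \<le> 0"
  shows "AE x in M. u x \<le> 0"
proof -
  have "L2_inner M (\<lambda>x. max 0 (u x)) (\<lambda>x. max 0 (u x)) \<le> 0"
    using Ea_pos_ge[OF u, of 1] le nrg_nonneg[of "\<lambda>x. max 0 (u x)"] by (simp add: Ea_def)
  from L2_inner_zero_AE[OF D_L2[OF D_pos[OF u]] this] show ?thesis
    by eventually_elim (simp add: max_def split: if_splits)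
qed

text \<open>The weak form of being 1-superharmonic. On \<open>D\<close> it agrees with
  \<open>excessive1\<close>, which speaks of resolvents and is less suited to testing.\<close>

definition super :: "('a \<Rightarrow> real) \<Rightarrow> bool" where
  "super e \<longleftrightarrow> (\<forall>w\<in>D. (AE x in M. 0 \<le> w x) \<longrightarrow> 0 \<le> Ea 1 e w)"

text \<open>\<open>r\<close> is the Yosida approximation of \<open>g\<close> for E_1, whose
  resolvent at \<open>c\<close> is that of E at c + 1. The identity translates inequalities between
  \<open>r\<close> and \<open>g\<close> into signs of E_1.\<close>

lemma resolvent_identity:
  fixes c :: real
  assumes g: "g \<in> D" and b: "0 < c" and v: "v \<in> D"
  defines "r \<equiv> \<lambda>x. c * resolvent M D E (c + 1) g x"
  shows "r \<in> D" and "Ea 1 r v = c * L2_inner M (\<lambda>x. g x - r x) v"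
proof -
  have b1: "0 < c + 1" using b by simp
  note R = resolvent[OF b1 D_L2[OF g]]
  show rD: "r \<in> D" unfolding r_def by (rule D_scale[OF R(1)])
  let ?R = "resolvent M D E (c + 1) g"
  have 1: "L2_inner M g v = nrg ?R v + (c + 1) * L2_inner M ?R v" using R(2)[OF v] by (simp add: Ea_def)
  have 2: "L2_inner M (\<lambda>x. g x - r x) v = L2_inner M g v - c * L2_inner M ?R v"
    using L2_inner_lin[OF D_L2[OF g] D_L2[OF R(1)] D_L2[OF v], of 1 "-c"] by (simp add: r_def)
  have 3: "Ea 1 r v = c * (nrg ?R v + L2_inner M ?R v)"
    unfolding r_def using Ea_scale[OF R(1) v, of 1 c] by (simp add: Ea_def)
  show "Ea 1 r v = c * L2_inner M (\<lambda>x. g x - r x) v"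
    unfolding 3 2 1 by (simp add: algebra_simps)
qed

text \<open>Tested with the positive part p of d = r - e: E_1(r, p) = -b (d, p) \<le> 0 \<le> E_1(e,
  p), and the comparison principle gives d \<le> 0.\<close>

lemma super_imp_excessive:
  assumes e: "e \<in> D" "super e"
  shows "excessive1 M D E e"
  unfolding excessive1_def
proof (intro conjI allI impI)
  show "e \<in> L2 M" by (rule D_L2[OF e(1)])
  fix b :: real assume b: "b > 0"
  define r where "r = (\<lambda>x. b * resolvent M D E (b + 1) e x)"
  define d where "d = (\<lambda>x. r x - e x)"
  have rD: "r \<in> D" using resolvent_identity(1)[OF e(1) b e(1)] by (simp add: r_def)
  have dD: "d \<in> D" unfolding d_def by (rule D_diff[OF rD e(1)])
  let ?p = "\<lambda>x. max 0 (d x)"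
  have pD: "?p \<in> D" by (rule D_pos[OF dD])
  have "Ea 1 r ?p = b * L2_inner M (\<lambda>x. e x - r x) ?p"
    using resolvent_identity(2)[OF e(1) b pD] by (simp add: r_def)
  also have "\<dots> \<le> 0"
  proof -
    have "0 \<le> L2_inner M (\<lambda>x. r x - e x) ?p"
      unfolding L2_inner_def by (rule Bochner_Integration.integral_nonneg) (auto simp: d_def max_def zero_le_mult_iff)
    then have "L2_inner M (\<lambda>x. e x - r x) ?p \<le> 0" by (simp add: L2_inner_diff_swap[of M e r])
    then show ?thesis using b by (simp add: mult_le_0_iff)
  qed
  finally have "Ea 1 r ?p \<le> 0" .
  moreover have "0 \<le> Ea 1 e ?p" using e(2) pD by (auto simp: super_def)
  ultimately have "Ea 1 d ?p \<le> 0" unfolding d_def Ea_diff[OF rD e(1) pD[unfolded d_def]] by simp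
  from AE_nonpos_of_Ea_pos[OF dD this]
  show "AE x in M. b * resolvent M D E (b + 1) e x \<le> e x"
    by eventually_elim (simp add: d_def r_def)
qed

text \<open>\<open>b G\<^bsub>b+1\<^esub> g\<close> minimises \<open>E\<^sub>1(v) + b \<parallel>v - g\<parallel>\<^sup>2\<close>; as these minima increase with \<open>b\<close> and are bounded by
  \<open>E\<^sub>1(g)\<close>, the minimisers converge to \<open>g\<close> in energy.\<close>

lemma resolvent_nconv:
  assumes g: "g \<in> D"
  shows "nconv (\<lambda>n x. (real n + 1) * resolvent M D E (real n + 1 + 1) g x) g"
proof -
  define r where "r n = (\<lambda>x. (real n + 1) * resolvent M D E (real n + 1 + 1) g x)" for n
  define q where "q v = L2_inner M (\<lambda>x. v x - g x) (\<lambda>x. v x - g x)" for v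
  define P where "P n v = nrg1 v + (real n + 1) * q v" for n v
  have b: "0 < real n + 1" for n by simp
  have rD: "r n \<in> D" for n using resolvent_identity(1)[OF g b g] by (simp add: r_def)
  \<comment> \<open>Expansion of the quadratic functional around its minimiser r_n; the first order
    terms cancel by the resolvent identity.\<close>
  have P: "P n v = P n (r n) + nrg1 (\<lambda>x. v x - r n x) + (real n + 1) * L2_inner M (\<lambda>x. v x - r n x) (\<lambda>x. v x - r n x)"
    if v: "v \<in> D" for n v
  proof -
    let ?d = "\<lambda>x. v x - r n x" and ?s = "\<lambda>x. r n x - g x"
    have dD: "?d \<in> D" and sD: "?s \<in> D" by (auto intro!: D_diff v rD g)
    have "nrg1 v = nrg1 (r n) + 2 * Ea 1 (r n) ?d + nrg1 ?d"
      using Ea_square_lin[OF rD[of n] dD, of 1 1 1] by (simp add: Ea_1)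
    moreover have "q v = q (r n) + 2 * L2_inner M ?s ?d + L2_inner M ?d ?d"
      using L2_inner_square_lin[OF D_L2[OF sD] D_L2[OF dD], of 1 1] by (simp add: q_def)
    moreover have "Ea 1 (r n) ?d = - ((real n + 1) * L2_inner M ?s ?d)"
    proof -
      have "L2_inner M (\<lambda>x. g x - r n x) ?d = - L2_inner M ?s ?d" by (rule L2_inner_diff_swap)
      then show ?thesis using resolvent_identity(2)[OF g b dD, of n] by (simp add: r_def)
    qed
    ultimately show ?thesis by (simp add: P_def algebra_simps)
  qed
  have q0: "0 \<le> q v" for v by (simp add: q_def L2_inner_nonneg)
  define m where "m n = P n (r n)" for n
  \<comment> \<open>A larger weight only raises \<open>P\<close>, so P_n(r_k) \<le> m_k. Expanding
    P_n(r_k) around r_n then bounds the energy distance by the growth of the minima.\<close>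
  have step: "nrg1 (\<lambda>x. r k x - r n x) \<le> m k - m n" if "n \<le> k" for n k
  proof -
    have "P n (r k) \<le> P k (r k)" using that q0 by (simp add: P_def mult_right_mono)
    moreover have "0 \<le> (real n + 1) * L2_inner M (\<lambda>x. r k x - r n x) (\<lambda>x. r k x - r n x)"
      by (simp add: L2_inner_nonneg)
    ultimately show ?thesis using P[OF rD, of n k] unfolding m_def by linarith
  qed
  have inc: "incseq m"
    by (intro incseq_SucI) (use step nrg1_nonneg in \<open>smt (verit) le_SucI order_refl\<close>)
  have ub: "m n \<le> nrg1 g" for n
  proof -
    have "P n g = nrg1 g" by (simp add: P_def q_def L2_inner_def)
    then show ?thesis
      using P[OF g, of n] nrg1_nonneg[of "\<lambda>x. g x - r n x"]
        mult_nonneg_nonneg[OF less_imp_le[OF b[of n]] L2_inner_nonneg[of M "\<lambda>x. g x - r n x"]]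
      unfolding m_def by linarith
  qed
  obtain l where l: "m \<longlonglongrightarrow> l" using incseq_convergent[OF inc] ub by blast
  have "\<exists>u\<in>Dmax. nconv r u"
  proof (rule Dmax_complete[OF D_Dmax[OF rD]])
    fix e :: real assume e: "e > 0"
    obtain N where N: "\<forall>j\<ge>N. \<forall>k\<ge>N. norm (m j - m k) < e"
      using CauchyD[OF LIMSEQ_imp_Cauchy[OF l] e] by blast
    have "nrg1 (\<lambda>x. r j x - r k x) < e" if "j \<ge> N" "k \<ge> N" for j k
    proof (cases "j \<le> k")
      case True
      then show ?thesis
        using step[OF True] N[rule_format, OF that(2,1)] nrg1_diff_commute[of "r j" "r k"] by (simp add: abs_if split: if_splits)
    next
      case False
      then show ?thesis
        using step[of k j] N[rule_format, OF that] by (simp add: abs_if split: if_splits)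
    qed
    then show "\<exists>N. \<forall>j\<ge>N. \<forall>k\<ge>N. nrg1 (\<lambda>x. r j x - r k x) < e" by blast
  qed
  then obtain u where u: "u \<in> Dmax" "nconv r u" by blast
  \<comment> \<open>The penalty (n + 1) q(r_n) is at most E_1(g, g), so r_n tends to g in
    \<open>L2\<close>; this identifies the energy limit \<open>u\<close> with g.\<close>
  have "(\<lambda>n. q (r n)) \<longlonglongrightarrow> 0"
  proof (rule Lim_null_comparison)
    have "q (r n) \<le> nrg1 g * (1 / (real n + 1))" for n
    proof -
      have "(real n + 1) * q (r n) \<le> nrg1 g"
        using ub[of n] nrg1_nonneg[of "r n"] by (simp add: m_def P_def)
      then show ?thesis by (simp add: field_simps)
    qed
    then show "\<forall>\<^sub>F n in sequentially. norm (q (r n)) \<le> nrg1 g * (1 / (real n + 1))" using q0 by simp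
    show "(\<lambda>n. nrg1 g * (1 / (real n + 1))) \<longlonglongrightarrow> 0"
      using LIMSEQ_inverse_real_of_nat
      by (intro tendsto_mult_right_zero) (simp add: inverse_eq_divide add.commute)
  qed
  then have AE: "AE x in M. g x = u x"
    using D_Dmax[OF rD] D_L2[OF g] u by (intro nconv_AE_eq[of r g u]) (auto simp: q_def)
  have "nrg1 (\<lambda>x. r n x - g x) = nrg1 (\<lambda>x. r n x - u x)" for n
    using DmaxD(3)[OF D_Dmax[OF rD[of n]]] DmaxD(3)[OF D_Dmax[OF g]] DmaxD(3)[OF u(1)] AE
    by (intro nrg1_cong_AE) (auto elim: eventually_mono)
  then show ?thesis using u(2) by (simp add: nconv_def r_def)
qed

text \<open>For the Yosida approximations r_n \<le> g, E_1(r_n, w) is a positive multiple of (g -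
  r_n, w), hence nonnegative. Convergence in energy carries the sign over to g.\<close>

lemma excessive_imp_super:
  assumes g: "g \<in> D" "excessive1 M D E g"
  shows "super g"
  unfolding super_def
proof (intro ballI impI)
  fix w assume w: "w \<in> D" "AE x in M. 0 \<le> w x"
  define r where "r n = (\<lambda>x. (real n + 1) * resolvent M D E (real n + 1 + 1) g x)" for n
  have b: "0 < real n + 1" for n by simp
  have rD: "r n \<in> D" for n using resolvent_identity(1)[OF g(1) b g(1)] by (simp add: r_def)
  have "0 \<le> Ea 1 (r n) w" for n
  proof -
    have "Ea 1 (r n) w = (real n + 1) * L2_inner M (\<lambda>x. g x - r n x) w"
      using resolvent_identity(2)[OF g(1) b w(1), of n] by (simp add: r_def)
    moreover have "AE x in M. r n x \<le> g x"
      using g(2) b unfolding excessive1_def r_def by blast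
    then have "0 \<le> L2_inner M (\<lambda>x. g x - r n x) w"
      unfolding L2_inner_def using w(2) by (intro integral_nonneg_AE) (auto elim: eventually_elim2)
    ultimately show ?thesis by simp
  qed
  moreover have "(\<lambda>n. Ea 1 (r n) w) \<longlonglongrightarrow> Ea 1 g w"
    using resolvent_nconv[OF g(1)] by (intro Ea_tendsto rD g w nconv_const) (simp add: r_def)
  ultimately show "0 \<le> Ea 1 g w" by (intro LIMSEQ_le_const) auto
qed

text \<open>Tested with the negative part of e.\<close>

lemma super_nonneg:
  assumes e: "e \<in> D" "super e"
  shows "AE x in M. 0 \<le> e x"
proof -
  let ?d = "\<lambda>x. (-1) * e x"
  have dD: "?d \<in> D" by (rule D_scale[OF e(1)])
  have pD: "(\<lambda>x. max 0 (?d x)) \<in> D" by (rule D_pos[OF dD])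
  have "0 \<le> Ea 1 e (\<lambda>x. max 0 (?d x))" using e(2) pD by (auto simp: super_def)
  then have "Ea 1 ?d (\<lambda>x. max 0 (?d x)) \<le> 0" using Ea_scale[OF e(1) pD, of 1 "-1"] by simp
  from AE_nonpos_of_Ea_pos[OF dD this] show ?thesis by eventually_elim simp
qed

text \<open>\<open>e\<close> minimises E_1 among the functions of the domain that dominate
  \<open>h\<close> on \<open>U\<close>. Adding a nonnegative function keeps the constraint, so the
  variational inequality makes \<open>e\<close> a \<open>super\<close> function; the constraint
  passes to energy limits along an almost everywhere convergent subsequence.\<close>

lemma obstacle:
  assumes h: "h \<in> D"
  obtains e where "e \<in> D" "super e" "AE x in M. x \<in> U \<longrightarrow> h x \<le> e x"
    "\<And>v. v \<in> D \<Longrightarrow> AE x in M. x \<in> U \<longrightarrow> h x \<le> v x \<Longrightarrow> 0 \<le> Ea 1 e (\<lambda>x. v x - e x)"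
proof -
  define C where "C = {v \<in> D. AE x in M. x \<in> U \<longrightarrow> h x \<le> v x}"
  have "\<exists>u\<in>C. \<forall>v\<in>C. L2_inner M (\<lambda>x. 0) (\<lambda>x. v x - u x) \<le> Ea 1 u (\<lambda>x. v x - u x)"
  proof (rule variational)
    show "C \<subseteq> D" by (auto simp: C_def)
    show "C \<noteq> {}" using h by (auto simp: C_def)
    show "(\<lambda>x. (1 - t) * u x + t * v x) \<in> C" if uv: "u \<in> C" "v \<in> C" and t: "0 \<le> t" "t \<le> 1" for u v t
    proof -
      have "AE x in M. x \<in> U \<longrightarrow> h x \<le> u x" "AE x in M. x \<in> U \<longrightarrow> h x \<le> v x" using uv by (auto simp: C_def)
      then have "AE x in M. x \<in> U \<longrightarrow> h x \<le> (1 - t) * u x + t * v x"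
      proof eventually_elim
        case (elim x)
        show ?case
        proof
          assume "x \<in> U"
          then have "(1 - t) * h x + t * h x \<le> (1 - t) * u x + t * v x"
            using elim t by (intro add_mono mult_left_mono) auto
          then show "h x \<le> (1 - t) * u x + t * v x" by (simp add: algebra_simps)
        qed
      qed
      then show ?thesis using uv by (auto simp: C_def intro: D_lin)
    qed
    show "u \<in> C" if w: "\<And>n. w n \<in> C" and u: "u \<in> D" "nconv w u" for w u
    proof -
      have wD: "w n \<in> Dmax" for n using w D_Dmax by (auto simp: C_def)
      obtain r where r: "AE x in M. (\<lambda>k. w (r k) x) \<longlonglongrightarrow> u x"
        using nconv_AE_subseq[OF wD D_Dmax[OF u(1)] u(2)] by metis
      have "AE x in M. \<forall>n. x \<in> U \<longrightarrow> h x \<le> w n x"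
        unfolding AE_all_countable using w by (auto simp: C_def)
      with r have "AE x in M. x \<in> U \<longrightarrow> h x \<le> u x"
        by eventually_elim (auto intro!: LIMSEQ_le_const)
      then show ?thesis using u(1) by (simp add: C_def)
    qed
  qed (auto simp: L2_def)
  then obtain e where e: "e \<in> C" "\<And>v. v \<in> C \<Longrightarrow> 0 \<le> Ea 1 e (\<lambda>x. v x - e x)"
    by (auto simp: L2_inner_def)
  have eD: "e \<in> D" and eU: "AE x in M. x \<in> U \<longrightarrow> h x \<le> e x" using e(1) by (auto simp: C_def)
  have "super e"
    unfolding super_def
  proof (intro ballI impI)
    fix w assume w: "w \<in> D" "AE x in M. 0 \<le> w x"
    have "AE x in M. x \<in> U \<longrightarrow> h x \<le> e x + w x" using eU w(2) by eventually_elim auto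
    then have "(\<lambda>x. e x + w x) \<in> C" using eD w(1) by (simp add: C_def D_add)
    from e(2)[OF this] show "0 \<le> Ea 1 e w" by simp
  qed
  with eD eU e(2) show ?thesis by (intro that) (auto simp: C_def)
qed

text \<open>The minimiser \<open>e\<close> lies below every \<open>super\<close> majorant, so a
  smallest majorant exists and the choice in \<open>reduced\<close> picks it up to null
  sets.\<close>

lemma reduced:
  fixes U :: "'a set"
  assumes h: "h \<in> D"
  defines "R \<equiv> reduced M D E h U"
  shows "R \<in> D" and "super R"
    and "\<And>g. g \<in> D \<Longrightarrow> super g \<Longrightarrow> AE x in M. x \<in> U \<longrightarrow> h x \<le> g x \<Longrightarrow> AE x in M. R x \<le> g x"
proof -
  have maj: "excessive_majorants M D E h U = {g \<in> D. super g \<and> (AE x in M. x \<in> U \<longrightarrow> h x \<le> g x)}"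
    unfolding excessive_majorants_def using super_imp_excessive excessive_imp_super by blast
  obtain e where e: "e \<in> D" "super e" "AE x in M. x \<in> U \<longrightarrow> h x \<le> e x"
    "\<And>v. v \<in> D \<Longrightarrow> AE x in M. x \<in> U \<longrightarrow> h x \<le> v x \<Longrightarrow> 0 \<le> Ea 1 e (\<lambda>x. v x - e x)"
    using obstacle[OF h, of U] by blast
  have "AE x in M. e x \<le> g x" if g: "g \<in> D" "super g" "AE x in M. x \<in> U \<longrightarrow> h x \<le> g x" for g
  proof -
    let ?d = "\<lambda>x. e x - g x"
    let ?p = "\<lambda>x. max 0 (?d x)"
    have dD: "?d \<in> D" by (rule D_diff[OF e(1) g(1)])
    have pD: "?p \<in> D" by (rule D_pos[OF dD])
    \<comment> \<open>e - max 0 (e - g) is the minimum of e and g, which still dominates h on U and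
      so may be compared with the minimiser e.\<close>
    have "AE x in M. x \<in> U \<longrightarrow> h x \<le> e x - ?p x" using e(3) g(3) by eventually_elim (auto simp: max_def)
    from e(4)[OF D_diff[OF e(1) pD] this] have "0 \<le> Ea 1 e (\<lambda>x. (-1) * ?p x)" by simp
    then have "Ea 1 e ?p \<le> 0" using Ea_scale[OF pD e(1), of 1 "-1"]
      unfolding Ea_commute[of 1 e "\<lambda>x. (-1) * ?p x"] Ea_commute[of 1 e ?p] by simp
    moreover have "0 \<le> Ea 1 g ?p" using g(2) pD by (auto simp: super_def)
    ultimately have "Ea 1 ?d ?p \<le> 0" using Ea_diff[OF e(1) g(1) pD] by simp
    from AE_nonpos_of_Ea_pos[OF dD this] show ?thesis by eventually_elim simp
  qed
  then have "\<exists>g. g \<in> excessive_majorants M D E h U \<and>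
        (\<forall>g' \<in> excessive_majorants M D E h U. AE x in M. g x \<le> g' x)"
    using e by (intro exI[of _ e]) (auto simp: maj)
  from someI_ex[OF this] have R: "R \<in> excessive_majorants M D E h U \<and>
        (\<forall>g' \<in> excessive_majorants M D E h U. AE x in M. R x \<le> g' x)"
    unfolding R_def reduced_def .
  show "R \<in> D" "super R" using R by (auto simp: maj)
  show "AE x in M. R x \<le> g x" if "g \<in> D" "super g" "AE x in M. x \<in> U \<longrightarrow> h x \<le> g x" for g
    using R that by (auto simp: maj)
qed

text \<open>By the resolvent equation the quantity in the supremum is (\<phi>, h_U). For h \<le> 1
  the function h_U is at most the minimiser \<open>e\<close> for the obstacle 1 on U, and
  Cauchy-Schwarz applies with \<phi> of norm at most 1. The lower bound uses the competitor h =
  0.\<close>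

lemma Cap_bounds:
  assumes v: "v \<in> D" "AE x in M. x \<in> U \<longrightarrow> 1 \<le> v x"
    and phi: "\<phi> \<in> L2 M" "AE x in M. 0 < \<phi> x \<and> \<phi> x \<le> 1"
  shows "0 \<le> Cap M D E \<phi> U" and "Cap M D E \<phi> U \<le> ereal (sqrt (nrg1 v))"
proof -
  have pot: "E1 M E (reduced M D E h U) (resolvent M D E 1 \<phi>) = L2_inner M \<phi> (reduced M D E h U)"
    if h: "h \<in> D" for h
    using resolvent[OF zero_less_one phi(1)] reduced(1)[OF h, of U]
    by (simp add: E1_def E_eq Ea_def nrg_commute L2_inner_commute)
  have zD: "(\<lambda>x. 0) \<in> D" using D_const[of 0] .
  have "super (\<lambda>x. 0)" by (simp add: super_def Ea_def nrg_def grad_def[abs_def] L2_inner_def)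
  then have z: "(\<lambda>x. 0) \<in> {h \<in> D. excessive1 M D E h \<and> (AE x in M. h x \<le> 1)}"
    using zD super_imp_excessive[OF zD] by simp
  have "0 \<le> L2_inner M \<phi> (reduced M D E (\<lambda>x. 0) U)"
    unfolding L2_inner_def
    using phi(2) super_nonneg[OF reduced(1,2)[OF zD, of U]]
    by (intro integral_nonneg_AE) (auto elim!: eventually_elim2)
  then show "0 \<le> Cap M D E \<phi> U"
    unfolding Cap_def by (intro SUP_upper2[OF z]) (simp add: pot[OF zD])
  obtain e where e: "e \<in> D" "super e" "AE x in M. x \<in> U \<longrightarrow> 1 \<le> e x"
    "\<And>v. v \<in> D \<Longrightarrow> AE x in M. x \<in> U \<longrightarrow> 1 \<le> v x \<Longrightarrow> 0 \<le> Ea 1 e (\<lambda>x. v x - e x)"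
    using obstacle[OF one_D, of U] by blast
  \<comment> \<open>Minimality gives E_1(e, e) \<le> E_1(e, v); this is combined with nonnegativity
    of E_1 on e - v.\<close>
  have "nrg1 e \<le> nrg1 v"
  proof -
    have "0 \<le> Ea 1 e v - Ea 1 e e"
      using e(4)[OF v] Ea_diff[OF v(1) e(1) e(1), of 1]
      by (simp add: Ea_commute[of 1 e "\<lambda>x. v x - e x"] Ea_commute[of 1 e v])
    moreover have "0 \<le> Ea 1 e e - 2 * Ea 1 e v + Ea 1 v v"
      using Ea_nonneg[of 1 "\<lambda>x. e x - v x"] Ea_diff_square[OF e(1) v(1), of 1] by simp
    ultimately show ?thesis by (simp add: Ea_1)
  qed
  show "Cap M D E \<phi> U \<le> ereal (sqrt (nrg1 v))"
    unfolding Cap_def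
  proof (rule SUP_least)
    fix h assume "h \<in> {h \<in> D. excessive1 M D E h \<and> (AE x in M. h x \<le> 1)}"
    then have h: "h \<in> D" "AE x in M. h x \<le> 1" by auto
    have "AE x in M. x \<in> U \<longrightarrow> h x \<le> e x" using h(2) e(3) by eventually_elim auto
    note Re = reduced(3)[OF h(1) e(1,2) this]
    have "L2_inner M \<phi> (reduced M D E h U) \<le> L2_inner M \<phi> e"
      unfolding L2_inner_def
      using Re phi(2) D_L2[OF reduced(1)[OF h(1), of U]] D_L2[OF e(1)] phi(1)
      by (intro integral_mono_AE L2_integrable_mult) (auto elim!: eventually_elim2 intro: mult_left_mono)
    also have "\<dots> \<le> sqrt (L2_inner M \<phi> \<phi>) * sqrt (L2_inner M e e)"
      using L2_Cauchy_Schwarz[OF phi(1) D_L2[OF e(1)]] by simp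
    also have "\<dots> \<le> 1 * sqrt (nrg1 v)"
    proof (intro mult_mono)
      have "AE x in M. \<phi> x * \<phi> x \<le> 1" using phi(2) by eventually_elim (auto intro: mult_le_one)
      then have "L2_inner M \<phi> \<phi> \<le> (\<integral>x. 1 \<partial>M)"
        unfolding L2_inner_def using phi(1) by (intro integral_mono_AE L2_integrable_mult) auto
      then show "sqrt (L2_inner M \<phi> \<phi>) \<le> 1" by (simp add: prob_space)
      show "sqrt (L2_inner M e e) \<le> sqrt (nrg1 v)"
        using \<open>nrg1 e \<le> nrg1 v\<close> nrg_nonneg[of e] by (simp add: nrg1_def)
    qed (auto simp: L2_inner_nonneg)
    finally show "ereal (E1 M E (reduced M D E h U) (resolvent M D E 1 \<phi>)) \<le> ereal (sqrt (nrg1 v))"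
      by (simp add: pot[OF h(1)])
  qed
qed

end

section \<open>Quasi-regularity from cutoffs\<close>

text \<open>The added point is isolated, so any value there preserves continuity.\<close>

lemma continuous_map_adjoin_point:
  assumes "continuous_map X euclideanreal f"
  shows "continuous_map (subtopology (adjoin_point X) A) euclideanreal (extend0 f)"
proof -
  have "continuous_map (adjoin_point X) euclideanreal (extend0 f)"
    unfolding continuous_map_alt
  proof (intro conjI allI impI)
    fix V :: "real set" assume "openin euclideanreal V"
    then have "openin X (f -` V \<inter> topspace X)"
      using assms by (simp add: continuous_map_alt)
    moreover have "Some -` (extend0 f -` V \<inter> topspace (adjoin_point X)) = f -` V \<inter> topspace X"
      by (auto simp: topspace_adjoin_point extend0_def)
    ultimately show "openin (adjoin_point X) (extend0 f -` V \<inter> topspace (adjoin_point X))"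
      by (simp add: openin_adjoin_point)
  qed auto
  then show ?thesis by (rule continuous_map_from_subtopology)
qed

lemma compactin_adjoin_point:
  assumes "compactin X K"
  shows "compactin (adjoin_point X) (insert None (Some ` K))"
proof -
  have "continuous_map X (adjoin_point X) Some"
    unfolding continuous_map_alt
  proof (intro conjI allI impI)
    fix V assume V: "openin (adjoin_point X) V"
    then have "openin X (Some -` V)" by (simp add: openin_adjoin_point)
    then show "openin X (Some -` V \<inter> topspace X)" by blast
  qed (auto simp: topspace_adjoin_point)
  from image_compactin[OF assms this] have "compactin (adjoin_point X) ({None} \<union> Some ` K)"
    by (intro compactin_Un) (auto simp: topspace_adjoin_point)
  then show ?thesis by simp
qed

text \<open>The last condition on \<open>s\<close> serves the strict notion: extended functions
  vanish at the added point, and some s_n has to tell a given point from it.\<close>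

locale jump_nest = jump_dirichlet +
  fixes X :: "'a topology" and F :: "nat \<Rightarrow> 'a set" and \<eta> :: "nat \<Rightarrow> 'a \<Rightarrow> real"
    and s :: "nat \<Rightarrow> 'a \<Rightarrow> real"
  assumes F: "incseq F" "\<And>k. compactin X (F k)" "\<And>k. closedin X (F k)"
    and space_X: "space M = topspace X"
    and chi: "\<And>k. \<eta> k \<in> D" "\<And>k x. x \<in> space M \<Longrightarrow> x \<notin> F k \<Longrightarrow> \<eta> k x = 0" "nconv \<eta> (\<lambda>x. 1)"
    and chi_mult: "\<And>k w. w \<in> D0 \<Longrightarrow> (\<lambda>x. w x * \<eta> k x) \<in> D" "\<And>w. w \<in> D0 \<Longrightarrow> nconv (\<lambda>k x. w x * \<eta> k x) w"
    and D0_continuous: "\<And>w. w \<in> D0 \<Longrightarrow> continuous_map X euclideanreal w"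
    and s: "\<And>n. s n \<in> D0" "\<And>x y. x \<in> topspace X \<Longrightarrow> y \<in> topspace X \<Longrightarrow> x \<noteq> y \<Longrightarrow> \<exists>n. s n x \<noteq> s n y"
      "\<And>x. x \<in> topspace X \<Longrightarrow> \<exists>n. s n x \<noteq> 0"
begin

lemma nest_F: "nest X M D E F"
  unfolding nest_def form_dense_in_def
proof (intro conjI allI F ballI impI)
  show "(\<Union>k. vanishing_off M D (F k)) \<subseteq> D" by (auto simp: vanishing_off_def)
  fix u and e :: real assume u: "u \<in> D" and e: "e > 0"
  \<comment> \<open>Two errors below \<open>d\<close> enter with factor 2 each, so the sum is below
    4 d = e^2/5, within the e^2/4 that \<open>form_norm_less\<close> asks for.\<close>
  define d where "d = e\<^sup>2 / 20"
  have d: "d > 0" using e by (simp add: d_def)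
  obtain w where w: "\<And>n. w n \<in> D0" "nconv w u" using u by (auto simp: D_iff)
  obtain n where n: "nrg1 (\<lambda>x. w n x - u x) < d"
    using order_tendstoD(2)[OF w(2)[unfolded nconv_def] d] by (auto simp: eventually_sequentially)
  obtain k where k: "nrg1 (\<lambda>x. w n x * \<eta> k x - w n x) < d"
    using order_tendstoD(2)[OF chi_mult(2)[OF w(1)[of n], unfolded nconv_def] d]
    by (auto simp: eventually_sequentially)
  let ?v = "\<lambda>x. w n x * \<eta> k x"
  have vD: "?v \<in> D" by (rule chi_mult(1)[OF w(1)])
  have "nrg1 (\<lambda>x. u x - ?v x) \<le> 2 * nrg1 (\<lambda>x. u x - w n x) + 2 * nrg1 (\<lambda>x. w n x - ?v x)"
    by (intro nrg1_triangle D_Dmax u D0_D w vD)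
  also have "\<dots> < e\<^sup>2 / 4"
  proof -
    have "e\<^sup>2 = 20 * d" by (simp add: d_def)
    then show ?thesis
      using n k d unfolding nrg1_diff_commute[of u] nrg1_diff_commute[of "w n" ?v] by linarith
  qed
  finally have "form_norm M E (\<lambda>x. u x - ?v x) < e"
    using e by (intro form_norm_less E_eq D_diff u vD)
  moreover have "?v \<in> vanishing_off M D (F k)"
    using vD chi(2) by (auto simp: vanishing_off_def)
  ultimately show "\<exists>v\<in>\<Union>k. vanishing_off M D (F k). form_norm M E (\<lambda>x. u x - v x) < e"
    by (intro bexI[of _ ?v]) auto
qed

lemma quasi_regular_form: "quasi_regular X M D E"
proof -
  have qc: "quasi_continuous X M D E w" if "w \<in> D0" for w
    unfolding quasi_continuous_def
    using nest_F continuous_map_from_subtopology[OF D0_continuous[OF that]] by blast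
  show ?thesis
    unfolding quasi_regular_def
  proof (intro conjI)
    show "\<exists>F. nest X M D E F \<and> (\<forall>k. compactin X (F k))" using nest_F F(2) by blast
    show "\<exists>C. form_dense_in M E C D \<and> (\<forall>u\<in>C. \<exists>f. quasi_continuous X M D E f \<and> (AE x in M. f x = u x))"
      using D0_form_dense qc by (intro exI[of _ D0] conjI ballI) auto
    show "\<exists>u f N. (\<forall>n. u n \<in> D \<and> quasi_continuous X M D E (f n) \<and> (AE x in M. f n x = u n x)) \<and>
        exceptional X M D E N \<and> separates_points f (topspace X - N)"
    proof (intro exI conjI allI)
      show "s n \<in> D" for n by (rule D0_D[OF s(1)])
      show "quasi_continuous X M D E (s n)" for n by (rule qc[OF s(1)])
      show "exceptional X M D E {}" unfolding exceptional_def using nest_F by blast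
      show "separates_points s (topspace X - {})" unfolding separates_points_def using s(2) by auto
    qed auto
  qed
qed

lemma strict_nest_F:
  assumes phi: "\<phi> \<in> L2 M" "AE x in M. 0 < \<phi> x \<and> \<phi> x \<le> 1"
  shows "strict_nest X M D E \<phi> F"
  unfolding strict_nest_def
proof (intro conjI allI F)
  define c where "c k = sqrt (nrg1 (\<lambda>x. 1 - \<eta> k x))" for k
  have "(\<lambda>k. nrg1 (\<lambda>x. 1 - \<eta> k x)) \<longlonglongrightarrow> 0"
    using chi(3) by (simp add: nconv_def nrg1_diff_commute[of "\<lambda>x. 1"])
  from tendsto_real_sqrt[OF this] have "(\<lambda>k. ereal (c k)) \<longlonglongrightarrow> ereal 0"
    unfolding c_def by (intro tendsto_ereal) simp
  moreover have "0 \<le> Cap M D E \<phi> (topspace X - F k) \<and> Cap M D E \<phi> (topspace X - F k) \<le> ereal (c k)" for k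
  proof -
    have 1: "(\<lambda>x. 1 - \<eta> k x) \<in> D" by (rule D_diff[OF one_D chi(1)])
    have 2: "AE x in M. x \<in> topspace X - F k \<longrightarrow> 1 \<le> 1 - \<eta> k x"
      using chi(2) by (auto simp: space_X)
    show ?thesis using Cap_bounds[OF 1 2 phi] by (simp add: c_def)
  qed
  ultimately show "(\<lambda>k. Cap M D E \<phi> (topspace X - F k)) \<longlonglongrightarrow> 0"
    by (intro tendsto_sandwich[of "\<lambda>_. 0" "\<lambda>k. Cap M D E \<phi> (topspace X - F k)" _ "\<lambda>k. ereal (c k)"])
       (auto simp: zero_ereal_def)
qed

lemma strictly_quasi_regular_form:
  assumes phi: "\<phi> \<in> L2 M" "AE x in M. 0 < \<phi> x \<and> \<phi> x \<le> 1"
  shows "strictly_quasi_regular X M D E \<phi>"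
proof -
  note n = strict_nest_F[OF phi]
  have qc: "strictly_quasi_continuous X M D E \<phi> w" if "w \<in> D0" for w
    unfolding strictly_quasi_continuous_def
    using n continuous_map_adjoin_point[OF D0_continuous[OF that]] by blast
  show ?thesis
    unfolding strictly_quasi_regular_def
  proof (intro conjI)
    show "\<exists>F. strict_nest X M D E \<phi> F \<and> (\<forall>k. compactin (adjoin_point X) (insert None (Some ` F k)))"
      using n F(2) compactin_adjoin_point by blast
    show "\<exists>C. form_dense_in M E C D \<and>
        (\<forall>u\<in>C. \<exists>f. strictly_quasi_continuous X M D E \<phi> f \<and> (AE x in M. f x = u x))"
      using D0_form_dense qc by (intro exI[of _ D0] conjI ballI) auto
    show "\<exists>u f N. (\<forall>n. u n \<in> D \<and> strictly_quasi_continuous X M D E \<phi> (f n) \<and> (AE x in M. f n x = u n x)) \<and>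
        strictly_exceptional X M D E \<phi> N \<and>
        separates_points (\<lambda>n. extend0 (f n)) (insert None (Some ` topspace X) - Some ` N)"
    proof (intro exI conjI allI)
      show "s n \<in> D" for n by (rule D0_D[OF s(1)])
      show "strictly_quasi_continuous X M D E \<phi> (s n)" for n by (rule qc[OF s(1)])
      show "strictly_exceptional X M D E \<phi> {}" unfolding strictly_exceptional_def using n by blast
      show "separates_points (\<lambda>n. extend0 (s n)) (insert None (Some ` topspace X) - Some ` {})"
        unfolding separates_points_def
      proof (intro ballI impI)
        fix x y assume x: "x \<in> insert None (Some ` topspace X) - Some ` {}"
          and y: "y \<in> insert None (Some ` topspace X) - Some ` {}" and "x \<noteq> y"
        then show "\<exists>n. extend0 (s n) x \<noteq> extend0 (s n) y"
        proof (cases x; cases y)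
          fix x' y' assume "x = Some x'" "y = Some y'"
          with x y \<open>x \<noteq> y\<close> show ?thesis using s(2)[of x' y'] by (auto simp: extend0_def)
        next
          fix x' assume "x = Some x'" "y = None"
          with x show ?thesis using s(3)[of x'] by (auto simp: extend0_def)
        next
          fix y' assume "x = None" "y = Some y'"
          with y show ?thesis using s(3)[of y'] by (auto simp: extend0_def eq_commute[of 0])
        qed (use \<open>x \<noteq> y\<close> in simp)
      qed
    qed auto
  qed
qed

end

section \<open>Smooth functions of one variable\<close>

text \<open>The derivative is quantified existentially, so closure under an operation is shown by
  exhibiting a derivative of class \<open>sm k\<close>.\<close>

primrec sm :: "nat \<Rightarrow> (real \<Rightarrow> real) \<Rightarrow> bool" where
  "sm 0 f \<longleftrightarrow> continuous_on UNIV f"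
| "sm (Suc k) f \<longleftrightarrow> (\<exists>f'. (\<forall>x. (f has_real_derivative f' x) (at x)) \<and> sm k f')"

lemma sm_SucI: "(\<And>x. (f has_real_derivative f' x) (at x)) \<Longrightarrow> sm k f' \<Longrightarrow> sm (Suc k) f"
  by auto

lemma sm_continuous: "sm k f \<Longrightarrow> continuous_on UNIV f"
  by (cases k) (auto intro: DERIV_continuous_on has_field_derivative_at_within)

lemma sm_Suc_imp: "sm (Suc k) f \<Longrightarrow> sm k f"
proof (induction k arbitrary: f)
  case 0
  then show ?case using sm_continuous[of "Suc 0" f] by simp
next
  case (Suc k)
  then show ?case by (metis sm.simps(2))
qed

lemma sm_const: "sm k (\<lambda>_. c)"
proof (induction k arbitrary: c)
  case (Suc k)
  show ?case by (rule sm_SucI[OF _ Suc]) (rule DERIV_const)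
qed simp

lemma sm_ident: "sm k (\<lambda>x. x)"
proof (cases k)
  case (Suc m)
  show ?thesis unfolding Suc by (rule sm_SucI[OF _ sm_const]) (rule DERIV_ident)
qed simp

lemma sm_add: "sm k f \<Longrightarrow> sm k g \<Longrightarrow> sm k (\<lambda>x. f x + g x)"
proof (induction k arbitrary: f g)
  case (Suc k)
  then obtain f' g' where "\<And>x. (f has_real_derivative f' x) (at x)" "sm k f'"
    "\<And>x. (g has_real_derivative g' x) (at x)" "sm k g'" by auto
  then show ?case
    by (intro sm_SucI[of _ "\<lambda>x. f' x + g' x"] Suc.IH) (auto intro: DERIV_add)
qed (auto intro: continuous_on_add)

lemma sm_mult: "sm k f \<Longrightarrow> sm k g \<Longrightarrow> sm k (\<lambda>x. f x * g x)"
proof (induction k arbitrary: f g)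
  case (Suc k)
  then obtain f' g' where "\<And>x. (f has_real_derivative f' x) (at x)" "sm k f'"
    "\<And>x. (g has_real_derivative g' x) (at x)" "sm k g'" by auto
  then show ?case
    by (intro sm_SucI[of _ "\<lambda>x. f' x * g x + g' x * f x"] Suc.IH sm_add)
       (use Suc.prems in \<open>auto intro: DERIV_mult sm_Suc_imp simp del: sm.simps\<close>)
qed (auto intro: continuous_on_mult)

lemma sm_compose: "sm k f \<Longrightarrow> sm k g \<Longrightarrow> sm k (\<lambda>x. f (g x))"
proof (induction k arbitrary: f g)
  case 0
  then show ?case using continuous_on_compose2[of UNIV f UNIV g] by simp
next
  case (Suc k)
  then obtain f' g' where d: "\<And>x. (f has_real_derivative f' x) (at x)" "sm k f'"
    "\<And>x. (g has_real_derivative g' x) (at x)" "sm k g'" by auto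
  have "sm k (\<lambda>x. f' (g x))" by (rule Suc.IH[OF d(2) sm_Suc_imp[OF Suc.prems(2)]])
  from sm_SucI[OF DERIV_chain2[OF d(1) d(3)] sm_mult[OF this d(4)]] show ?case .
qed

lemma sm_inverse: "sm k f \<Longrightarrow> (\<And>x. f x \<noteq> 0) \<Longrightarrow> sm k (\<lambda>x. inverse (f x))"
proof (induction k arbitrary: f)
  case (Suc k)
  from Suc.prems(1) obtain f' where f': "\<And>x. (f has_real_derivative f' x) (at x)" "sm k f'" by auto
  have "sm k (\<lambda>x. inverse (f x))" by (rule Suc.IH[OF sm_Suc_imp[OF Suc.prems(1)] Suc.prems(2)])
  then have "sm k (\<lambda>x. (- 1) * (inverse (f x) * f' x * inverse (f x)))"
    by (intro sm_mult sm_const f'(2))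
  then show ?case
    by (rule sm_SucI[rotated]) (use DERIV_inverse'[OF f'(1) Suc.prems(2)] in simp)
qed (auto intro: continuous_on_inverse)

definition smooth :: "(real \<Rightarrow> real) \<Rightarrow> bool" where "smooth f \<longleftrightarrow> (\<forall>k. sm k f)"

lemma smooth_const: "smooth (\<lambda>x. c)"
  by (simp add: smooth_def sm_const)

lemma smooth_ident: "smooth (\<lambda>x. x)"
  by (simp add: smooth_def sm_ident)

lemma smooth_add: "smooth f \<Longrightarrow> smooth g \<Longrightarrow> smooth (\<lambda>x. f x + g x)"
  by (simp add: smooth_def sm_add)

lemma smooth_mult: "smooth f \<Longrightarrow> smooth g \<Longrightarrow> smooth (\<lambda>x. f x * g x)"
  by (simp add: smooth_def sm_mult)

lemma smooth_compose: "smooth f \<Longrightarrow> smooth g \<Longrightarrow> smooth (\<lambda>x. f (g x))"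
  unfolding smooth_def using sm_compose[of _ f g] by simp

lemma smooth_inverse: "smooth f \<Longrightarrow> (\<And>x. f x \<noteq> 0) \<Longrightarrow> smooth (\<lambda>x. inverse (f x))"
  unfolding smooth_def using sm_inverse[of _ f] by simp

text \<open>The derivative is t times the inverse of the same function, so the induction closes on
  itself.\<close>

lemma smooth_sqrt:
  assumes e: "e > (0::real)"
  shows "smooth (\<lambda>t. sqrt (t\<^sup>2 + e\<^sup>2))"
proof -
  have pos: "t\<^sup>2 + e\<^sup>2 > 0" for t :: real using e by (simp add: add_nonneg_pos)
  have "sm k (\<lambda>t. sqrt (t\<^sup>2 + e\<^sup>2))" for k
  proof (induction k)
    case 0
    have "continuous_on UNIV (\<lambda>t::real. sqrt (t\<^sup>2 + e\<^sup>2))"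
      by (intro continuous_intros)
    then show ?case by simp
  next
    case (Suc k)
    have "sm k (\<lambda>t. t * inverse (sqrt (t\<^sup>2 + e\<^sup>2)))"
    proof (intro sm_mult sm_ident sm_inverse Suc)
      show "sqrt (t\<^sup>2 + e\<^sup>2) \<noteq> 0" for t using e by simp
    qed
    moreover have "((\<lambda>t. sqrt (t\<^sup>2 + e\<^sup>2)) has_real_derivative t * inverse (sqrt (t\<^sup>2 + e\<^sup>2))) (at t)" for t
    proof -
      have "((\<lambda>t. t\<^sup>2 + e\<^sup>2) has_real_derivative 2 * t) (at t)"
        by (auto intro!: derivative_eq_intros)
      from DERIV_chain2[OF DERIV_real_sqrt[OF pos] this] show ?thesis
        by (simp add: mult.commute)
    qed
    ultimately show ?case by (rule sm_SucI[rotated])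
  qed
  then show ?thesis by (simp add: smooth_def)
qed

text \<open>The classical exp(-1/t) with a polynomial factor in 1/t. The factor is a parameter
  because the family has to be closed under differentiation.\<close>

definition flat :: "real poly \<Rightarrow> real \<Rightarrow> real" where
  "flat P t = (if t > 0 then poly P (1 / t) * exp (- (1 / t)) else 0)"

lemma flat_tendsto: "(flat P \<longlongrightarrow> 0) (at 0)"
proof (rule filterlim_split_at)
  have "\<forall>\<^sub>F t in at_left (0::real). flat P t = 0"
    unfolding eventually_at_left_field by (intro exI[of _ "-1"]) (auto simp: flat_def)
  then show "(flat P \<longlongrightarrow> 0) (at_left 0)" by (rule tendsto_eventually)
  have "((\<lambda>s. \<Sum>i\<le>degree P. coeff P i * (s ^ i / exp s)) \<longlongrightarrow> (\<Sum>i\<le>degree P. coeff P i * 0)) at_top"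
    by (intro tendsto_intros tendsto_power_div_exp_0)
  then have "((\<lambda>s. poly P s * exp (- s)) \<longlongrightarrow> 0) at_top"
    by (simp add: poly_altdef sum_divide_distrib exp_minus divide_inverse[symmetric])
  moreover have "filterlim (\<lambda>t::real. 1 / t) at_top (at_right 0)"
    using filterlim_inverse_at_top_right by (simp add: inverse_eq_divide)
  ultimately have "((\<lambda>t. poly P (1 / t) * exp (- (1 / t))) \<longlongrightarrow> 0) (at_right (0::real))"
    by (rule filterlim_compose)
  moreover have "\<forall>\<^sub>F t in at_right (0::real). poly P (1 / t) * exp (- (1 / t)) = flat P t"
    unfolding eventually_at_right_field by (intro exI[of _ 1]) (auto simp: flat_def)
  ultimately show "(flat P \<longlongrightarrow> 0) (at_right 0)" by (rule Lim_transform_eventually)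
qed

text \<open>With s = 1/t the operator d/dt is -s^2 d/ds, and P(s) exp(-s) becomes s^2 (P(s) - P'(s))
  exp(-s). At 0 the difference quotient is again flat, with the polynomial s P(s), and
  \<open>flat_tendsto\<close> applies.\<close>

lemma flat_deriv: "(flat P has_real_derivative flat ([:0, 0, 1:] * (P - pderiv P)) t) (at t)"
proof (cases t "0 :: real" rule: linorder_cases)
  case greater
  have D: "((\<lambda>t. 1 / t) has_real_derivative - (1 / (t * t))) (at t)"
    using greater by (auto intro!: derivative_eq_intros)
  have "((\<lambda>t. poly P (1 / t) * exp (- (1 / t))) has_real_derivative
      flat ([:0, 0, 1:] * (P - pderiv P)) t) (at t)"
    by (rule DERIV_cong[OF DERIV_mult[OF DERIV_chain2[OF poly_DERIV D]
            DERIV_chain2[OF DERIV_exp DERIV_minus[OF D]]]])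
       (use greater in \<open>simp add: flat_def left_diff_distrib right_diff_distrib\<close>)
  then show ?thesis
    by (rule has_field_derivative_transform_within[OF _ greater]) (auto simp: flat_def dist_real_def)
next
  case less
  have "((\<lambda>t. 0) has_real_derivative flat ([:0, 0, 1:] * (P - pderiv P)) t) (at t)"
    using less by (simp add: flat_def)
  then show ?thesis
    by (rule has_field_derivative_transform_within[of _ _ _ _ "- t"])
       (use less in \<open>auto simp: flat_def dist_real_def\<close>)
next
  case equal
  have "((\<lambda>h. (flat P (0 + h) - flat P 0) / h) \<longlongrightarrow> 0) (at 0)"
  proof (rule Lim_transform_eventually[OF flat_tendsto[of "[:0, 1:] * P"]])
    show "\<forall>\<^sub>F h in at 0. flat ([:0, 1:] * P) h = (flat P (0 + h) - flat P 0) / h"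
      by (rule eventually_at_ball'[of 1, THEN eventually_mono]) (auto simp: flat_def)
  qed
  then show ?thesis using equal by (simp add: DERIV_def flat_def)
qed

lemma smooth_flat: "smooth (flat P)"
proof -
  have "sm k (flat P)" for k
  proof (induction k arbitrary: P)
    case 0
    show ?case using flat_deriv[of P] by (auto intro: DERIV_continuous_on has_field_derivative_at_within)
  next
    case (Suc k)
    show ?case by (rule sm_SucI[OF flat_deriv Suc])
  qed
  then show ?thesis by (simp add: smooth_def)
qed

text \<open>A smooth plateau: 1 for |t| \<le> 1/2, where the second summand of the denominator is 0,
  and 0 for |t| \<ge> 1, where the numerator is 0. The two never vanish at the same t.\<close>

definition bump :: "real \<Rightarrow> real" where
  "bump t = flat 1 (1 - t\<^sup>2) / (flat 1 (1 - t\<^sup>2) + flat 1 (t\<^sup>2 - 1/4))"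

lemma flat_1: "0 \<le> flat 1 t" "flat 1 t > 0 \<longleftrightarrow> t > 0" "flat 1 t = 0 \<longleftrightarrow> t \<le> 0"
  by (auto simp: flat_def)

lemma bump_denominator: "flat 1 (1 - t\<^sup>2) + flat 1 (t\<^sup>2 - 1/4) > 0"
proof (cases "t\<^sup>2 < 1")
  case True
  then have "flat 1 (1 - t\<^sup>2) > 0" by (simp add: flat_1)
  then show ?thesis using flat_1(1)[of "t\<^sup>2 - 1/4"] by linarith
next
  case False
  then have "flat 1 (t\<^sup>2 - 1/4) > 0" by (simp add: flat_1)
  then show ?thesis using flat_1(1)[of "1 - t\<^sup>2"] by linarith
qed

lemma smooth_bump: "smooth bump"
proof -
  have sq: "smooth (\<lambda>t. c + d * (t * t))" for c d :: real
    by (intro smooth_add smooth_mult smooth_const smooth_ident)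
  note 1 = smooth_compose[OF smooth_flat[of 1] sq[of 1 "-1"]] smooth_compose[OF smooth_flat[of 1] sq[of "-1/4" 1]]
  have "flat 1 (1 + - 1 * (t * t)) + flat 1 (- 1 / 4 + 1 * (t * t)) \<noteq> 0" for t
    using bump_denominator[of t] by (simp add: power2_eq_square)
  from smooth_mult[OF 1(1) smooth_inverse[OF smooth_add[OF 1] this]]
  have "smooth (\<lambda>t. flat 1 (1 + - 1 * (t * t)) *
      inverse (flat 1 (1 + - 1 * (t * t)) + flat 1 (- 1 / 4 + 1 * (t * t))))" .
  moreover have "bump = (\<lambda>t. flat 1 (1 + - 1 * (t * t)) *
      inverse (flat 1 (1 + - 1 * (t * t)) + flat 1 (- 1 / 4 + 1 * (t * t))))"
  proof (rule ext)
    fix t :: real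
    have e: "1 + - 1 * (t * t) = 1 - t\<^sup>2" "- 1 / 4 + 1 * (t * t) = t\<^sup>2 - 1/4"
      by (simp_all add: power2_eq_square)
    show "bump t = flat 1 (1 + - 1 * (t * t)) *
        inverse (flat 1 (1 + - 1 * (t * t)) + flat 1 (- 1 / 4 + 1 * (t * t)))"
      unfolding e bump_def by (rule divide_inverse)
  qed
  ultimately show ?thesis by (simp only:)
qed

lemma bump_nonneg: "0 \<le> bump t"
  using flat_1(1) bump_denominator[of t] by (simp add: bump_def less_imp_le)

lemma bump_le_1: "bump t \<le> 1"
  using flat_1(1)[of "t\<^sup>2 - 1/4"] bump_denominator[of t] by (simp add: bump_def)

lemma bump_eq_1: "\<bar>t\<bar> \<le> 1/2 \<Longrightarrow> bump t = 1"
proof -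
  assume "\<bar>t\<bar> \<le> 1/2"
  then have "t\<^sup>2 \<le> (1/2)\<^sup>2" using abs_le_square_iff[of t "1/2"] by simp
  then have "flat 1 (t\<^sup>2 - 1/4) = 0" by (simp add: flat_1 power2_eq_square)
  then show ?thesis using bump_denominator[of t] by (simp add: bump_def)
qed

lemma bump_eq_0: "1 \<le> \<bar>t\<bar> \<Longrightarrow> bump t = 0"
proof -
  assume "1 \<le> \<bar>t\<bar>"
  then have "1 \<le> t\<^sup>2" using abs_le_square_iff[of 1 t] by simp
  then show ?thesis by (simp add: bump_def flat_1)
qed

text \<open>The derivative is continuous and vanishes off [-1, 1]. The normalisation L \<ge> 1 lets
  \<open>L\<close> also bound the oscillation of \<open>bump\<close>, so that L min(1, |s - t|)
  bounds its increments.\<close>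

lemma bump_Lipschitz: obtains L where "L \<ge> 1" "\<And>s t. \<bar>bump s - bump t\<bar> \<le> L * \<bar>s - t\<bar>"
proof -
  have "sm (Suc 0) bump" using smooth_bump by (simp add: smooth_def del: sm.simps)
  then obtain f' where f': "\<And>x. (bump has_real_derivative f' x) (at x)" "continuous_on UNIV f'" by auto
  have "compact (f' ` {-1..1})" using f'(2) by (intro compact_continuous_image) (auto intro: continuous_on_subset)
  then have "bounded (f' ` {-1..1})" by (rule compact_imp_bounded)
  then obtain K where "\<forall>x\<in>{-1..1}. \<bar>f' x\<bar> \<le> K" by (auto simp: bounded_iff)
  then have K: "\<And>x. x \<in> {-1..1} \<Longrightarrow> \<bar>f' x\<bar> \<le> K" by blast
  have out: "f' x = 0" if "x \<notin> {-1..1}" for x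
  proof (rule DERIV_unique[OF f'(1)])
    have "((\<lambda>_. 0) has_real_derivative 0) (at x)" by simp
    then show "(bump has_real_derivative 0) (at x)"
      by (rule has_field_derivative_transform_within_open[where S = "- {-1..1}"])
         (use that in \<open>auto simp: bump_eq_0\<close>)
  qed
  have K0: "K \<ge> 0" using K[of 0] by auto
  have bd: "\<bar>f' x\<bar> \<le> max 1 K" for x using K[of x] out[of x] by (cases "x \<in> {-1..1}") auto
  have "norm (bump s - bump t) \<le> max 1 K * norm (s - t)" for s t
    using f'(1) bd by (intro field_differentiable_bound[of UNIV bump f']) (simp_all add: has_field_derivative_at_within)
  then show ?thesis by (intro that[of "max 1 K"]) auto
qed

section \<open>Smooth cylinder functions\<close>

definition trunc :: "nat \<Rightarrow> (nat \<Rightarrow> real) \<Rightarrow> nat \<Rightarrow> real" where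
  "trunc n x = (\<lambda>i. if i < n then x i else 0)"

abbreviation ES :: "nat \<Rightarrow> (nat \<Rightarrow> real) set" where "ES n \<equiv> topspace (Euclidean_space n)"

lemma ES_upd: "x \<in> ES n \<Longrightarrow> i < n \<Longrightarrow> x(i := t) \<in> ES n"
  by (auto simp: topspace_Euclidean_space)

lemma trunc_ES: "trunc n x \<in> ES n"
  by (auto simp: trunc_def topspace_Euclidean_space)

lemma trunc_trunc: "m \<le> n \<Longrightarrow> trunc m (trunc n x) = trunc m x"
  by (auto simp: trunc_def)

lemma trunc_upd: "trunc n (x(i := t)) = (if i < n then (trunc n x)(i := t) else trunc n x)"
  by (auto simp: trunc_def)

lemma trunc_continuous: "continuous_on S (trunc n)"
proof (rule continuous_on_coordinatewise_then_product)
  show "continuous_on S (\<lambda>x. trunc n x i)" for i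
    by (cases "i < n") (simp_all add: trunc_def continuous_on_subset[OF continuous_on_product_coordinates])
qed

lemma line_continuous: "continuous_on S (\<lambda>t. (x::nat \<Rightarrow> real)(i := t))"
proof (rule continuous_on_coordinatewise_then_product)
  show "continuous_on S (\<lambda>t. (x(i := t)) j)" for j
    by (cases "j = i") simp_all
qed

section \<open>Calculus of the classes \<open>C_k\<close>\<close>

lemma C_k_continuous: "C_k n k f \<Longrightarrow> continuous_on (ES n) f"
  by (cases k) (auto simp: continuous_map_Euclidean_space_iff)

text \<open>Lines in the first n coordinate directions through points of \<open>ES n\<close> stay in
  \<open>ES n\<close>, so agreement there carries over to all partial derivatives.\<close>

lemma C_k_cong: "(\<And>x. x \<in> ES n \<Longrightarrow> f x = g x) \<Longrightarrow> C_k n k f \<Longrightarrow> C_k n k g"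
proof (induction k arbitrary: f g)
  case 0
  then show ?case using continuous_on_cong[of "ES n" "ES n" f g] by (simp add: continuous_map_Euclidean_space_iff)
next
  case (Suc k)
  have cont: "continuous_on (ES n) g"
    using C_k_continuous[OF Suc.prems(2)] continuous_on_cong[of "ES n" "ES n" f g] Suc.prems(1) by simp
  have line: "(\<lambda>t. f (x(i := t))) = (\<lambda>t. g (x(i := t)))" if "x \<in> ES n" "i < n" for x i
    using Suc.prems(1)[OF ES_upd[OF that]] by blast
  have "C_k n k (partial_deriv i g)" if i: "i < n" for i
  proof (rule Suc.IH)
    show "C_k n k (partial_deriv i f)" using Suc.prems(2) i by simp
    show "partial_deriv i f x = partial_deriv i g x" if "x \<in> ES n" for x
      using line[OF that i] by (simp add: partial_deriv_def)
  qed
  moreover have "(\<lambda>t. g (x(i := t))) differentiable (at (x i))" if "x \<in> ES n" "i < n" for x i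
  proof -
    have "(\<lambda>t. f (x(i := t))) differentiable (at (x i))" using Suc.prems(2) that by simp
    then show ?thesis unfolding line[OF that] .
  qed
  ultimately show ?case using cont by (simp add: continuous_map_Euclidean_space_iff)
qed

text \<open>Any explicit formula for the partial derivatives may stand in for
  \<open>partial_deriv\<close>, so the closure properties follow the pattern of
  \<open>sm\<close>.\<close>

lemma C_k_SucI:
  assumes "continuous_on (ES n) f"
    and "\<And>i x. i < n \<Longrightarrow> x \<in> ES n \<Longrightarrow> ((\<lambda>t. f (x(i := t))) has_real_derivative f' i x) (at (x i))"
    and "\<And>i. i < n \<Longrightarrow> C_k n k (f' i)"
  shows "C_k n (Suc k) f"
proof -
  have "C_k n k (partial_deriv i f)" if i: "i < n" for i
    by (rule C_k_cong[OF _ assms(3)[OF i]]) (simp add: partial_deriv_def DERIV_imp_deriv[OF assms(2)[OF i]])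
  moreover have "(\<lambda>t. f (x(i := t))) differentiable (at (x i))" if "x \<in> ES n" "i < n" for x i
    using assms(2)[OF that(2,1)] by (auto simp: real_differentiable_def)
  ultimately show ?thesis using assms(1) by (simp add: continuous_map_Euclidean_space_iff)
qed

lemma C_k_SucD:
  assumes "C_k n (Suc k) f" "i < n"
  shows "x \<in> ES n \<Longrightarrow> ((\<lambda>t. f (x(i := t))) has_real_derivative partial_deriv i f x) (at (x i))"
    and "C_k n k (partial_deriv i f)"
proof -
  show "C_k n k (partial_deriv i f)" using assms by simp
  assume "x \<in> ES n"
  then have "(\<lambda>t. f (x(i := t))) differentiable (at (x i))" using assms by simp
  then show "((\<lambda>t. f (x(i := t))) has_real_derivative partial_deriv i f x) (at (x i))"
    unfolding partial_deriv_def by (simp add: DERIV_deriv_iff_real_differentiable)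
qed

lemma C_k_Suc_imp: "C_k n (Suc k) f \<Longrightarrow> C_k n k f"
proof (induction k arbitrary: f)
  case 0
  then show ?case by simp
next
  case (Suc k)
  show ?case
    by (rule C_k_SucI[OF C_k_continuous[OF Suc.prems] C_k_SucD(1)[OF Suc.prems] Suc.IH[OF C_k_SucD(2)[OF Suc.prems]]])
qed

lemma C_k_const: "C_k n k (\<lambda>_. c)"
proof (induction k arbitrary: c)
  case (Suc k)
  show ?case by (rule C_k_SucI[OF continuous_on_const DERIV_const Suc])
qed simp

lemma C_k_coord: "C_k n k (\<lambda>x. x j)"
proof -
  have c: "continuous_on (ES n) (\<lambda>x. x j)"
    by (rule continuous_on_subset[OF continuous_on_product_coordinates]) simp
  show ?thesis
  proof (cases k)
    case 0
    then show ?thesis using c by (simp add: continuous_map_Euclidean_space_iff)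
  next
    case (Suc m)
    show ?thesis unfolding Suc
    proof (rule C_k_SucI[OF c])
      show "((\<lambda>t. (x(i := t)) j) has_real_derivative (if i = j then 1 else 0)) (at (x i))" for i and x :: "nat \<Rightarrow> real"
        by (auto intro: derivative_eq_intros)
    qed (rule C_k_const)
  qed
qed

lemma C_k_add: "C_k n k f \<Longrightarrow> C_k n k g \<Longrightarrow> C_k n k (\<lambda>x. f x + g x)"
proof (induction k arbitrary: f g)
  case 0
  then show ?case by (simp add: continuous_map_Euclidean_space_iff continuous_on_add)
next
  case (Suc k)
  show ?case
  proof (rule C_k_SucI)
    show "continuous_on (ES n) (\<lambda>x. f x + g x)"
      using Suc.prems by (intro continuous_on_add C_k_continuous)
    show "((\<lambda>t. f (x(i := t)) + g (x(i := t))) has_real_derivative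
        partial_deriv i f x + partial_deriv i g x) (at (x i))" if "i < n" "x \<in> ES n" for i x
      by (rule DERIV_add[OF C_k_SucD(1)[OF Suc.prems(1) that] C_k_SucD(1)[OF Suc.prems(2) that]])
    show "C_k n k (\<lambda>x. partial_deriv i f x + partial_deriv i g x)" if "i < n" for i
      by (intro Suc.IH C_k_SucD(2) Suc.prems that)
  qed
qed

lemma C_k_mult: "C_k n k f \<Longrightarrow> C_k n k g \<Longrightarrow> C_k n k (\<lambda>x. f x * g x)"
proof (induction k arbitrary: f g)
  case 0
  then show ?case by (simp add: continuous_map_Euclidean_space_iff continuous_on_mult)
next
  case (Suc k)
  show ?case
  proof (rule C_k_SucI)
    show "continuous_on (ES n) (\<lambda>x. f x * g x)"
      using Suc.prems by (intro continuous_on_mult C_k_continuous)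
    show "((\<lambda>t. f (x(i := t)) * g (x(i := t))) has_real_derivative
        partial_deriv i f x * g x + partial_deriv i g x * f x) (at (x i))" if "i < n" "x \<in> ES n" for i x
      using DERIV_mult[OF C_k_SucD(1)[OF Suc.prems(1) that] C_k_SucD(1)[OF Suc.prems(2) that]]
      unfolding fun_upd_triv .
    show "C_k n k (\<lambda>x. partial_deriv i f x * g x + partial_deriv i g x * f x)" if "i < n" for i
      by (rule C_k_add[OF Suc.IH[OF C_k_SucD(2)[OF Suc.prems(1) that] C_k_Suc_imp[OF Suc.prems(2)]]
            Suc.IH[OF C_k_SucD(2)[OF Suc.prems(2) that] C_k_Suc_imp[OF Suc.prems(1)]]])
  qed
qed

lemma C_k_compose: "C_k n k f \<Longrightarrow> sm k \<phi> \<Longrightarrow> C_k n k (\<lambda>x. \<phi> (f x))"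
proof (induction k arbitrary: f \<phi>)
  case 0
  then show ?case using continuous_on_compose2[of UNIV \<phi> "ES n" f] by (simp add: continuous_map_Euclidean_space_iff)
next
  case (Suc k)
  from Suc.prems(2) obtain \<phi>' where d: "\<And>x. (\<phi> has_real_derivative \<phi>' x) (at x)" "sm k \<phi>'" by auto
  show ?case
  proof (rule C_k_SucI)
    show "continuous_on (ES n) (\<lambda>x. \<phi> (f x))"
      using continuous_on_compose2[OF sm_continuous[OF Suc.prems(2)] C_k_continuous[OF Suc.prems(1)]] by simp
    show "((\<lambda>t. \<phi> (f (x(i := t)))) has_real_derivative \<phi>' (f x) * partial_deriv i f x) (at (x i))"
      if "i < n" "x \<in> ES n" for i x
      using DERIV_chain2[OF d(1) C_k_SucD(1)[OF Suc.prems(1) that]] unfolding fun_upd_triv .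
    show "C_k n k (\<lambda>x. \<phi>' (f x) * partial_deriv i f x)" if "i < n" for i
      by (rule C_k_mult[OF Suc.IH[OF C_k_Suc_imp[OF Suc.prems(1)] d(2)] C_k_SucD(2)[OF Suc.prems(1) that]])
  qed
qed

lemma C_k_lift: "C_k m k f \<Longrightarrow> C_k n k (\<lambda>x. f (trunc m x))"
proof (induction k arbitrary: f)
  case 0
  then show ?case
    using continuous_on_compose2[OF C_k_continuous[OF 0] trunc_continuous[of "ES n"]] trunc_ES
    by (auto simp: continuous_map_Euclidean_space_iff)
next
  case (Suc k)
  show ?case
  proof (rule C_k_SucI)
    show "continuous_on (ES n) (\<lambda>x. f (trunc m x))"
      using continuous_on_compose2[OF C_k_continuous[OF Suc.prems] trunc_continuous[of "ES n"]] trunc_ES by auto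
    show "((\<lambda>t. f (trunc m (x(i := t)))) has_real_derivative
        (if i < m then partial_deriv i f (trunc m x) else 0)) (at (x i))" for i x
    proof (cases "i < m")
      case True
      have "trunc m x i = x i" using True by (simp add: trunc_def)
      from C_k_SucD(1)[OF Suc.prems True trunc_ES, of x]
      have "((\<lambda>t. f ((trunc m x)(i := t))) has_real_derivative partial_deriv i f (trunc m x)) (at (x i))"
        unfolding \<open>trunc m x i = x i\<close> .
      then show ?thesis using True by (simp only: trunc_upd if_True)
    qed (simp add: trunc_upd)
    show "C_k n k (\<lambda>x. if i < m then partial_deriv i f (trunc m x) else 0)" for i
      using Suc.IH[OF C_k_SucD(2)[OF Suc.prems]] by (cases "i < m") (auto intro: C_k_const)
  qed
qed

lemma C_k_sum: "(\<And>j. j \<in> A \<Longrightarrow> C_k n k (f j)) \<Longrightarrow> C_k n k (\<lambda>x. \<Sum>j\<in>A. f j x)"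
  by (induction A rule: infinite_finite_induct) (simp_all add: C_k_const C_k_add)

lemma C_k_prod: "(\<And>j. j \<in> A \<Longrightarrow> C_k n k (f j)) \<Longrightarrow> C_k n k (\<lambda>x. \<Prod>j\<in>A. f j x)"
  by (induction A rule: infinite_finite_induct) (simp_all add: C_k_const C_k_mult)

section \<open>Smooth functions with compact support\<close>

lemma compactin_ES: "compactin (Euclidean_space n) K \<longleftrightarrow> compact K \<and> K \<subseteq> ES n"
  by (auto simp: Euclidean_space_def compactin_subtopology euclidean_product_topology)

text \<open>Compact sets are closed in the Hausdorff space \<open>Euclidean_space n\<close>, so the
  closure of the nonzero set stays inside any compact \<open>K\<close> containing that set.\<close>

lemma C0_infinityI:
  assumes "\<And>k. C_k n k f" "compact K" "\<And>x. x \<in> ES n \<Longrightarrow> f x \<noteq> 0 \<Longrightarrow> x \<in> K"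
  shows "f \<in> C0_infinity n"
proof -
  have H: "Hausdorff_space (Euclidean_space n)"
    unfolding Euclidean_space_def euclidean_product_topology
    by (intro Hausdorff_space_subtopology) simp
  have cl: "closed (ES n)"
    using closedin_Euclidean_space by (simp add: euclidean_product_topology)
  have K: "compactin (Euclidean_space n) (K \<inter> ES n)"
    using assms(2) cl by (auto simp: compactin_ES intro: compact_Int_closed)
  have "Euclidean_space n closure_of {x \<in> ES n. f x \<noteq> 0} \<subseteq> K \<inter> ES n"
    by (rule closure_of_minimal) (use assms(3) compactin_imp_closedin[OF H K] in auto)
  then have "compactin (Euclidean_space n) (Euclidean_space n closure_of {x \<in> ES n. f x \<noteq> 0})"
    by (rule closed_compactin[OF K]) simp
  then show ?thesis using assms(1) by (simp add: C0_infinity_def)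
qed

lemma C0_infinityE:
  assumes "f \<in> C0_infinity n"
  obtains K where "compact K" "K \<subseteq> ES n" "\<And>x. x \<in> ES n \<Longrightarrow> f x \<noteq> 0 \<Longrightarrow> x \<in> K"
proof -
  let ?K = "Euclidean_space n closure_of {x \<in> ES n. f x \<noteq> 0}"
  have "compact ?K" "?K \<subseteq> ES n" using assms by (auto simp: C0_infinity_def compactin_ES)
  moreover have "x \<in> ?K" if "x \<in> ES n" "f x \<noteq> 0" for x
    using closure_of_subset[of "{x \<in> ES n. f x \<noteq> 0}" "Euclidean_space n"] that by auto
  ultimately show ?thesis by (rule that)
qed

lemma C0_infinity_C_k: "f \<in> C0_infinity n \<Longrightarrow> C_k n k f"
  by (simp add: C0_infinity_def)

lemma C0_infinity_mult:
  assumes "f \<in> C0_infinity n" "\<And>k. C_k n k g" "\<And>x. x \<in> ES n \<Longrightarrow> f x = 0 \<Longrightarrow> g x = 0"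
  shows "g \<in> C0_infinity n"
proof -
  obtain K where "compact K" "\<And>x. x \<in> ES n \<Longrightarrow> f x \<noteq> 0 \<Longrightarrow> x \<in> K" using C0_infinityE[OF assms(1)] by metis
  then show ?thesis using assms(2,3) by (intro C0_infinityI[of n g K]) blast+
qed

lemma C0_infinity_lin:
  assumes "f \<in> C0_infinity n" "g \<in> C0_infinity n"
  shows "(\<lambda>x. s * f x + t * g x) \<in> C0_infinity n"
proof -
  obtain K where K: "compact K" "\<And>x. x \<in> ES n \<Longrightarrow> f x \<noteq> 0 \<Longrightarrow> x \<in> K" using C0_infinityE[OF assms(1)] by metis
  obtain K' where K': "compact K'" "\<And>x. x \<in> ES n \<Longrightarrow> g x \<noteq> 0 \<Longrightarrow> x \<in> K'" using C0_infinityE[OF assms(2)] by metis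
  show ?thesis
  proof (rule C0_infinityI[of _ _ "K \<union> K'"])
    show "C_k n k (\<lambda>x. s * f x + t * g x)" for k
      using assms by (intro C_k_add C_k_mult C_k_const C0_infinity_C_k)
    show "x \<in> K \<union> K'" if "x \<in> ES n" "s * f x + t * g x \<noteq> 0" for x
      using K(2)[OF that(1)] K'(2)[OF that(1)] that(2) by (cases "f x = 0"; cases "g x = 0"; auto)
  qed (use K K' in auto)
qed

lemma C0_infinity_zero: "(\<lambda>x. 0) \<in> C0_infinity n"
  by (rule C0_infinityI[of _ _ "{}"]) (auto intro: C_k_const)

lemma C0_infinity_bounded:
  assumes "f \<in> C0_infinity n"
  obtains B where "B \<ge> 0" "\<And>x. x \<in> ES n \<Longrightarrow> \<bar>f x\<bar> \<le> B"
proof -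
  obtain K where K: "compact K" "K \<subseteq> ES n" "\<And>x. x \<in> ES n \<Longrightarrow> f x \<noteq> 0 \<Longrightarrow> x \<in> K"
    using C0_infinityE[OF assms] by metis
  have "continuous_on K f" using C_k_continuous[OF C0_infinity_C_k[OF assms, of 0]] K(2) by (rule continuous_on_subset)
  then have "bounded (f ` K)" using K(1) by (intro compact_imp_bounded compact_continuous_image)
  then obtain B where "\<forall>x\<in>K. \<bar>f x\<bar> \<le> B" by (auto simp: bounded_iff)
  then have "\<bar>f x\<bar> \<le> max 0 B" if "x \<in> ES n" for x
    using K(3)[OF that] by (cases "f x = 0") auto
  then show ?thesis by (intro that[of "max 0 B"]) auto
qed

text \<open>At a point off the compact set \<open>K\<close> the function vanishes on an open piece
  of each coordinate line, so its derivative there is 0.\<close>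

lemma C0_infinity_partial_deriv:
  assumes "f \<in> C0_infinity n" "i < n"
  shows "partial_deriv i f \<in> C0_infinity n"
proof -
  obtain K where K: "compact K" "K \<subseteq> ES n" "\<And>x. x \<in> ES n \<Longrightarrow> f x \<noteq> 0 \<Longrightarrow> x \<in> K"
    using C0_infinityE[OF assms(1)] by metis
  show ?thesis
  proof (rule C0_infinityI[OF _ K(1)])
    show "C_k n k (partial_deriv i f)" for k
      by (rule C_k_SucD(2)[OF C0_infinity_C_k[OF assms(1)] assms(2)])
    show "x \<in> K" if x: "x \<in> ES n" and ne: "partial_deriv i f x \<noteq> 0" for x
    proof (rule ccontr)
      assume "x \<notin> K"
      let ?U = "(\<lambda>t. x(i := t)) -` (- K)"
      have "open ?U"
        using compact_imp_closed[OF K(1)] line_continuous[of UNIV x i]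
        by (intro open_vimage) (auto simp: continuous_on_eq_continuous_within)
      moreover have "x i \<in> ?U" using \<open>x \<notin> K\<close> by simp
      moreover have "0 = f (x(i := t))" if "t \<in> ?U" for t
        using K(3)[OF ES_upd[OF x assms(2)], of t] that by auto
      ultimately have "((\<lambda>t. f (x(i := t))) has_real_derivative 0) (at (x i))"
        using DERIV_const by (rule has_field_derivative_transform_within_open[rotated])
      with ne show False by (simp add: partial_deriv_def DERIV_imp_deriv)
    qed
  qed
qed

lemma C0_infinity_Lipschitz:
  assumes f: "f \<in> C0_infinity n"
  obtains L where "L \<ge> 0" "\<And>x i y. x \<in> ES n \<Longrightarrow> i < n \<Longrightarrow> \<bar>f (x(i := y)) - f x\<bar> \<le> L * \<bar>y - x i\<bar>"
proof -
  have "\<forall>i. \<exists>B. B \<ge> 0 \<and> (i < n \<longrightarrow> (\<forall>x\<in>ES n. \<bar>partial_deriv i f x\<bar> \<le> B))"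
    using C0_infinity_bounded[OF C0_infinity_partial_deriv[OF f]] by (metis order_refl)
  then obtain B where B: "\<And>i. B i \<ge> 0" "\<And>i x. i < n \<Longrightarrow> x \<in> ES n \<Longrightarrow> \<bar>partial_deriv i f x\<bar> \<le> B i" by metis
  \<comment> \<open>The sum of the bounds serves all n directions at once.\<close>
  define L where "L = (\<Sum>i<n. B i)"
  have "\<bar>f (x(i := y)) - f x\<bar> \<le> L * \<bar>y - x i\<bar>" if x: "x \<in> ES n" and i: "i < n" for x i y
  proof -
    have BL: "B i \<le> L" unfolding L_def using B(1) i by (intro member_le_sum) auto
    have "norm ((\<lambda>t. f (x(i := t))) y - (\<lambda>t. f (x(i := t))) (x i)) \<le> L * norm (y - x i)"
    proof (rule field_differentiable_bound[of UNIV _ "\<lambda>t. partial_deriv i f (x(i := t))"])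
      fix t
      show "((\<lambda>t. f (x(i := t))) has_field_derivative partial_deriv i f (x(i := t))) (at t within UNIV)"
        using C_k_SucD(1)[OF C0_infinity_C_k[OF f] i ES_upd[OF x i, of t]] by simp
      show "norm (partial_deriv i f (x(i := t))) \<le> L"
        using B(2)[OF i ES_upd[OF x i]] BL by (metis order_trans real_norm_def)
    qed auto
    then show ?thesis by simp
  qed
  then show ?thesis using B(1) by (intro that[of L]) (auto simp: L_def intro: sum_nonneg)
qed

lemma C0_infinity_tensor:
  assumes "\<And>i. i < n \<Longrightarrow> smooth (p i)" "\<And>i t. i < n \<Longrightarrow> p i t \<noteq> 0 \<Longrightarrow> \<bar>t\<bar> \<le> R i"
  shows "(\<lambda>x. \<Prod>i<n. p i (x i)) \<in> C0_infinity n"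
proof (rule C0_infinityI)
  show "C_k n k (\<lambda>x. \<Prod>i<n. p i (x i))" for k
    by (rule C_k_prod, rule C_k_compose[OF C_k_coord]) (use assms(1) in \<open>simp add: smooth_def\<close>)
  let ?K = "PiE UNIV (\<lambda>i. if i < n then {- R i..R i} else {0})"
  have "compactin (powertop_real UNIV) ?K"
    by (simp add: compactin_PiE)
  then show "compact ?K" by (simp add: euclidean_product_topology)
  show "x \<in> ?K" if "x \<in> ES n" "(\<Prod>i<n. p i (x i)) \<noteq> 0" for x
  proof -
    have "\<bar>x i\<bar> \<le> R i" if "i < n" for i
      using \<open>(\<Prod>i<n. p i (x i)) \<noteq> 0\<close> that by (intro assms(2)) auto
    then show ?thesis
      using that(1) by (auto simp: topspace_Euclidean_space abs_le_iff minus_le_iff)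
  qed
qed

text \<open>Grades the span by the number of variables, with one summand for each n. A compactly
  supported function of n variables loses compact support when read as one of more variables, so the
  summands cannot be merged; the grading makes induction on the largest n possible.\<close>

definition FCN :: "nat \<Rightarrow> ((nat \<Rightarrow> real) \<Rightarrow> real) set" where
  "FCN N = {w. \<exists>h. (\<forall>n\<in>{1..N}. h n \<in> C0_infinity n) \<and> w = (\<lambda>x. \<Sum>n=1..N. h n (trunc n x))}"

lemma FCN_lin:
  assumes "u \<in> FCN N" "v \<in> FCN N"
  shows "(\<lambda>x. s * u x + t * v x) \<in> FCN N"
proof -
  obtain h g where "\<forall>n\<in>{1..N}. h n \<in> C0_infinity n" "u = (\<lambda>x. \<Sum>n=1..N. h n (trunc n x))"
    "\<forall>n\<in>{1..N}. g n \<in> C0_infinity n" "v = (\<lambda>x. \<Sum>n=1..N. g n (trunc n x))"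
    using assms by (auto simp: FCN_def)
  then show ?thesis
    unfolding FCN_def
    by (intro CollectI exI[of _ "\<lambda>n x. s * h n x + t * g n x"])
       (auto simp: sum.distrib sum_distrib_left intro: C0_infinity_lin)
qed

lemma FCN_mono:
  assumes "u \<in> FCN N" "N \<le> N'"
  shows "u \<in> FCN N'"
proof -
  obtain h where h: "\<forall>n\<in>{1..N}. h n \<in> C0_infinity n" "u = (\<lambda>x. \<Sum>n=1..N. h n (trunc n x))"
    using assms by (auto simp: FCN_def)
  let ?h = "\<lambda>n. if n \<le> N then h n else (\<lambda>x. 0)"
  have "(\<Sum>n=1..N'. ?h n (trunc n x)) = (\<Sum>n=1..N. h n (trunc n x))" for x
    using assms(2) by (intro sum.mono_neutral_cong_right) auto
  then show ?thesis
    unfolding FCN_def using h by (intro CollectI exI[of _ ?h]) (auto intro: C0_infinity_zero)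
qed

lemma FCN_cylinder:
  assumes "f \<in> C0_infinity n" "n \<ge> 1"
  shows "(\<lambda>x. f (trunc n x)) \<in> FCN n"
proof -
  let ?h = "\<lambda>m. if m = n then f else (\<lambda>x. 0)"
  have "(\<Sum>m=1..n. ?h m (trunc m x)) = f (trunc n x)" for x
  proof -
    have "(\<Sum>m=1..n. ?h m (trunc m x)) = (\<Sum>m=1..n. if m = n then f (trunc n x) else 0)"
      by (intro sum.cong) auto
    then show ?thesis using assms(2) by simp
  qed
  then show ?thesis
    unfolding FCN_def using assms by (intro CollectI exI[of _ ?h]) (auto intro: C0_infinity_zero)
qed

lemma zero_FCN: "(\<lambda>x. 0) \<in> FCN N"
  by (rule FCN_mono[of _ 0]) (auto simp: FCN_def)

lemma FC0_infinity_eq: "FC0_infinity = (\<Union>N. FCN N)"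
proof (intro equalityI subsetI)
  fix w assume "w \<in> FC0_infinity"
  then obtain k :: nat and c g where w: "w = (\<lambda>x. \<Sum>j<k. c j * g j x)" and g: "\<forall>j<k. g j \<in> cylinder"
    by (auto simp: FC0_infinity_def)
  have "\<exists>N. (\<lambda>x. \<Sum>j<k. c j * g j x) \<in> FCN N" using g
  proof (induction k)
    case 0
    then show ?case using zero_FCN by auto
  next
    case (Suc k)
    then obtain N where N: "(\<lambda>x. \<Sum>j<k. c j * g j x) \<in> FCN N" by auto
    have "g k \<in> cylinder" using Suc.prems by simp
    then obtain f n where f: "g k = (\<lambda>x. f (trunc n x))" "n \<ge> 1" "f \<in> C0_infinity n"
      by (auto simp: cylinder_def trunc_def)
    have "(\<lambda>x. 1 * (\<Sum>j<k. c j * g j x) + c k * g k x) \<in> FCN (max N n)"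
      using FCN_mono[OF N, of "max N n"] FCN_mono[OF FCN_cylinder[OF f(3,2)], of "max N n"] f(1)
      by (intro FCN_lin) auto
    then show ?case by (auto intro!: exI[of _ "max N n"])
  qed
  then show "w \<in> (\<Union>N. FCN N)" using w by auto
next
  fix w assume "w \<in> (\<Union>N. FCN N)"
  then obtain N h where h: "\<forall>n\<in>{1..N}. h n \<in> C0_infinity n" "w = (\<lambda>x. \<Sum>n=1..N. h n (trunc n x))"
    by (auto simp: FCN_def)
  have "w = (\<lambda>x. \<Sum>j<N. 1 * (h (Suc j) (trunc (Suc j) x)))"
    unfolding h(2) by (simp add: sum.atLeast1_atMost_eq)
  moreover have "\<forall>j<N. (\<lambda>x. h (Suc j) (trunc (Suc j) x)) \<in> cylinder"
    using h(1) unfolding cylinder_def trunc_def by fastforce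
  ultimately show "w \<in> FC0_infinity"
    unfolding FC0_infinity_def
    by (intro CollectI exI[of _ N] exI[of _ "\<lambda>_. 1::real"] exI[of _ "\<lambda>j x. h (Suc j) (trunc (Suc j) x)"]) simp
qed

lemma FCN_C_k:
  assumes "w \<in> FCN N"
  shows "C_k n k w"
proof -
  obtain h where h: "\<forall>n\<in>{1..N}. h n \<in> C0_infinity n" "w = (\<lambda>x. \<Sum>n=1..N. h n (trunc n x))"
    using assms by (auto simp: FCN_def)
  show ?thesis unfolding h(2) using h(1) by (intro C_k_sum C_k_lift) (auto simp: C0_infinity_C_k)
qed

lemma FCN_trunc: "w \<in> FCN N \<Longrightarrow> N \<le> n \<Longrightarrow> w (trunc n x) = w x"
  by (auto simp: FCN_def trunc_trunc intro!: sum.cong)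

lemma FC0_lin: "u \<in> FC0_infinity \<Longrightarrow> v \<in> FC0_infinity \<Longrightarrow> (\<lambda>x. s * u x + t * v x) \<in> FC0_infinity"
proof -
  assume "u \<in> FC0_infinity" "v \<in> FC0_infinity"
  then obtain N N' where "u \<in> FCN N" "v \<in> FCN N'" by (auto simp: FC0_infinity_eq)
  then have "(\<lambda>x. s * u x + t * v x) \<in> FCN (max N N')" by (intro FCN_lin) (auto intro: FCN_mono)
  then show ?thesis by (auto simp: FC0_infinity_eq)
qed

text \<open>The summand \<open>h\<close> of the largest index has compact support in its variables, hence so has
  \<open>\<phi> (w + h) - \<phi> w\<close>, although neither term has.\<close>

lemma FCN_compose: "w \<in> FCN N \<Longrightarrow> smooth \<phi> \<Longrightarrow> \<phi> 0 = 0 \<Longrightarrow> (\<lambda>x. \<phi> (w x)) \<in> FCN N"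
proof (induction N arbitrary: w)
  case 0
  then show ?case by (auto simp: FCN_def)
next
  case (Suc N)
  obtain h where h: "\<forall>n\<in>{1..Suc N}. h n \<in> C0_infinity n" "w = (\<lambda>x. \<Sum>n=1..Suc N. h n (trunc n x))"
    using Suc.prems(1) by (auto simp: FCN_def)
  define v where "v x = (\<Sum>n=1..N. h n (trunc n x))" for x
  have v: "v \<in> FCN N" unfolding FCN_def v_def[abs_def] using h(1) by (intro CollectI exI[of _ h]) auto
  let ?h = "h (Suc N)"
  have hC: "?h \<in> C0_infinity (Suc N)" using h(1) by auto
  define g where "g x = \<phi> (v x + ?h x) + (-1) * \<phi> (v x)" for x
  have "g \<in> C0_infinity (Suc N)"
  proof (rule C0_infinity_mult[OF hC])
    show "C_k (Suc N) k g" for k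
    proof -
      have sm: "sm k \<phi>" using Suc.prems(2) by (simp add: smooth_def)
      show ?thesis unfolding g_def[abs_def]
        by (rule C_k_add[OF C_k_compose[OF C_k_add[OF FCN_C_k[OF v] C0_infinity_C_k[OF hC]] sm]
              C_k_mult[OF C_k_const C_k_compose[OF FCN_C_k[OF v] sm]]])
    qed
  qed (simp add: g_def)
  then have "(\<lambda>x. g (trunc (Suc N) x)) \<in> FCN (Suc N)" by (rule FCN_cylinder) simp
  moreover have "(\<lambda>x. \<phi> (v x)) \<in> FCN (Suc N)" by (rule FCN_mono[OF Suc.IH[OF v Suc.prems(2,3)]]) simp
  ultimately have "(\<lambda>x. 1 * \<phi> (v x) + 1 * g (trunc (Suc N) x)) \<in> FCN (Suc N)" by (intro FCN_lin)
  moreover have "1 * \<phi> (v x) + 1 * g (trunc (Suc N) x) = \<phi> (w x)" for x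
    using FCN_trunc[OF v, of "Suc N"] by (simp add: g_def h(2) v_def)
  ultimately show ?case by simp
qed

lemma FC0_compose: "w \<in> FC0_infinity \<Longrightarrow> smooth \<phi> \<Longrightarrow> \<phi> 0 = 0 \<Longrightarrow> (\<lambda>x. \<phi> (w x)) \<in> FC0_infinity"
  using FCN_compose by (auto simp: FC0_infinity_eq)

text \<open>Multiplication by \<open>f\<close> gives all summands of \<open>w\<close> compact
  support in the same n variables.\<close>

lemma FC0_mult_tensor:
  assumes "w \<in> FCN N" "f \<in> C0_infinity n" "N \<le> n" "1 \<le> n"
  shows "(\<lambda>x. w x * f (trunc n x)) \<in> FC0_infinity"
proof -
  have "(\<lambda>x. w x * f x) \<in> C0_infinity n"
    by (rule C0_infinity_mult[OF assms(2)]) (auto intro!: C_k_mult FCN_C_k[OF assms(1)] C0_infinity_C_k[OF assms(2)])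
  from FCN_cylinder[OF this assms(4)] show ?thesis
    using FCN_trunc[OF assms(1,3)] by (auto simp: FC0_infinity_eq)
qed

lemma FC0_cylinder: "f \<in> C0_infinity n \<Longrightarrow> n \<ge> 1 \<Longrightarrow> (\<lambda>x. f (trunc n x)) \<in> FC0_infinity"
  using FCN_cylinder by (auto simp: FC0_infinity_eq)

lemma FCN_continuous: "w \<in> FCN N \<Longrightarrow> continuous_on UNIV w"
proof -
  assume w: "w \<in> FCN N"
  have "continuous_on UNIV (\<lambda>x. w (trunc N x))"
    using continuous_on_compose2[OF C_k_continuous[OF FCN_C_k[OF w, of N 0]] trunc_continuous[of UNIV]] trunc_ES by auto
  then show ?thesis using FCN_trunc[OF w order_refl] by simp
qed

lemma FCN_bounds:
  assumes "w \<in> FCN N"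
  obtains B L where "B \<ge> 0" "L \<ge> 0" "\<And>x. \<bar>w x\<bar> \<le> B"
    "\<And>x i y. \<bar>w (x(i := y)) - w x\<bar> \<le> L * \<bar>y - x i\<bar>"
    "\<And>x i y. i \<ge> N \<Longrightarrow> w (x(i := y)) = w x"
proof -
  obtain h where h: "\<forall>n\<in>{1..N}. h n \<in> C0_infinity n" "w = (\<lambda>x. \<Sum>n=1..N. h n (trunc n x))"
    using assms by (auto simp: FCN_def)
  have "\<forall>n. \<exists>b. b \<ge> 0 \<and> (n \<in> {1..N} \<longrightarrow> (\<forall>x\<in>ES n. \<bar>h n x\<bar> \<le> b))"
    using C0_infinity_bounded h(1) by (metis order_refl)
  then obtain b where b: "\<And>n. b n \<ge> 0" "\<And>n x. n \<in> {1..N} \<Longrightarrow> x \<in> ES n \<Longrightarrow> \<bar>h n x\<bar> \<le> b n" by metis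
  have "\<forall>n. \<exists>l. l \<ge> 0 \<and> (n \<in> {1..N} \<longrightarrow> (\<forall>x i y. x \<in> ES n \<longrightarrow> i < n \<longrightarrow> \<bar>h n (x(i := y)) - h n x\<bar> \<le> l * \<bar>y - x i\<bar>))"
    using C0_infinity_Lipschitz h(1) by (metis order_refl)
  then obtain l where l: "\<And>n. l n \<ge> 0" "\<And>n x i y. n \<in> {1..N} \<Longrightarrow> x \<in> ES n \<Longrightarrow> i < n \<Longrightarrow>
      \<bar>h n (x(i := y)) - h n x\<bar> \<le> l n * \<bar>y - x i\<bar>" by metis
  show ?thesis
  proof (rule that[of "\<Sum>n=1..N. b n" "\<Sum>n=1..N. l n"])
    show "\<bar>w x\<bar> \<le> (\<Sum>n=1..N. b n)" for x
      unfolding h(2) by (rule order_trans[OF sum_abs]) (intro sum_mono b(2) trunc_ES)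
    show "\<bar>w (x(i := y)) - w x\<bar> \<le> (\<Sum>n=1..N. l n) * \<bar>y - x i\<bar>" for x i y
    proof -
      have "\<bar>h n (trunc n (x(i := y))) - h n (trunc n x)\<bar> \<le> l n * \<bar>y - x i\<bar>" if n: "n \<in> {1..N}" for n
      proof (cases "i < n")
        case True
        then show ?thesis using l(2)[OF n trunc_ES True, of x y] by (simp only: trunc_upd if_True) (simp add: trunc_def)
      next
        case False
        then show ?thesis using l(1)[of n] by (simp only: trunc_upd if_False) simp
      qed
      then have "(\<Sum>n=1..N. \<bar>h n (trunc n (x(i := y))) - h n (trunc n x)\<bar>) \<le> (\<Sum>n=1..N. l n * \<bar>y - x i\<bar>)"
        by (intro sum_mono) auto
      moreover have "\<bar>w (x(i := y)) - w x\<bar> \<le> (\<Sum>n=1..N. \<bar>h n (trunc n (x(i := y))) - h n (trunc n x)\<bar>)"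
        unfolding h(2) sum_subtractf[symmetric] by (rule sum_abs)
      ultimately show ?thesis by (simp add: sum_distrib_right)
    qed
    show "w (x(i := y)) = w x" if "i \<ge> N" for x i y
      unfolding h(2) using that by (intro sum.cong) (auto simp: trunc_upd)
  qed (auto intro: sum_nonneg b l)
qed

section \<open>Resampling one coordinate\<close>

lemma borel_measurable_borel_of:
  assumes "continuous_map X euclideanreal f" "sets M = sets (borel_of X)"
  shows "f \<in> borel_measurable M"
proof -
  have Pow: "{U. openin X U} \<subseteq> Pow (topspace X)" using openin_subset by auto
  have "f \<in> borel_measurable (borel_of X)"
  proof (rule borel_measurableI)
    fix V :: "real set" assume "open V"
    then have "openin X (f -` V \<inter> topspace X)"
      using assms(1) by (simp add: continuous_map_alt)
    then show "f -` V \<inter> space (borel_of X) \<in> sets (borel_of X)"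
      using Pow by (simp add: borel_of_def)
  qed
  then show ?thesis by (simp cong: measurable_cong_sets add: assms(2))
qed

lemma space_eq_topspace:
  assumes "sets M = sets (borel_of X)"
  shows "space M = topspace X"
proof -
  have "{U. openin X U} \<subseteq> Pow (topspace X)" using openin_subset by auto
  then have "space (borel_of X) = topspace X" by (simp add: borel_of_def)
  then show ?thesis using sets_eq_imp_space_eq[OF assms] by simp
qed

text \<open>For t \<le> 1 this is t^2 \<le> t^(\<alpha>+1), where \<alpha> \<le> 1 enters; for t
  \<ge> 1 the right side is at least 1.\<close>

lemma min_square_le_powr:
  assumes "0 \<le> (t::real)" "0 < \<alpha>" "\<alpha> \<le> 1"
  shows "(min 1 t)\<^sup>2 \<le> t powr (\<alpha> + 1)"
proof (cases "t \<le> 1")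
  case True
  show ?thesis
  proof (cases "t = 0")
    case False
    then have "t powr 2 \<le> t powr (\<alpha> + 1)" using assms True by (intro powr_mono') auto
    then show ?thesis using True False assms by (simp add: powr_numeral)
  qed simp
next
  case False
  then show ?thesis using assms ge_one_powr_ge_zero[of t "\<alpha> + 1"] by simp
qed

text \<open>What the three state spaces have in common. \<open>box_continuous\<close> makes the
  topology of \<open>S\<close> on a box coarser than the product topology and \<open>coord\<close>
  makes it finer, so they coincide there. By \<open>upd\<close> a point with one coordinate
  resampled stays in the space.\<close>

locale path_space =
  fixes S :: "(nat \<Rightarrow> real) topology" and \<mu> :: "(nat \<Rightarrow> real) measure"
    and \<kappa> :: "nat \<Rightarrow> (nat \<Rightarrow> real) \<Rightarrow> real measure"
    and \<alpha> :: real and b :: "nat \<Rightarrow> real" and M0 :: real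
  assumes alpha: "0 < \<alpha>" "\<alpha> \<le> 1"
    and prob: "prob_space \<mu>" and sets_mu: "sets \<mu> = sets (borel_of S)"
    and kappa: "regular_cond_dist \<mu> i (\<kappa> i)"
    and coord: "continuous_map S euclideanreal (\<lambda>x. x i)"
    and upd: "x \<in> topspace S \<Longrightarrow> x(i := y) \<in> topspace S"
    and b_pos: "b i > 0" and M0: "M0 > 0"
    and box_continuous: "continuous_map (subtopology (powertop_real UNIV) {x. \<forall>i. \<bar>x i\<bar> \<le> real m * b i}) S (\<lambda>x. x)"
    and tails: "summable (\<lambda>i. b i powr (- (\<alpha> + 1)) * measure \<mu> {x \<in> space \<mu>. \<bar>x i\<bar> > M0 * b i})"
    and boxes: "measure \<mu> (\<Union>m::nat. {x. \<forall>i. \<bar>x i\<bar> \<le> real m * b i}) = 1"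
begin

sublocale prob_space \<mu> by (rule prob)

section \<open>Boxes, cylinder sets and Borel sets\<close>

definition box :: "nat \<Rightarrow> (nat \<Rightarrow> real) set" where
  "box m = {x. \<forall>i. \<bar>x i\<bar> \<le> real m * b i}"

definition boxU :: "(nat \<Rightarrow> real) set" where "boxU = (\<Union>m. box m)"

lemma space_mu: "space \<mu> = topspace S"
  by (rule space_eq_topspace[OF sets_mu])

lemma box_subset: "box m \<subseteq> topspace S"
  using continuous_map_image_subset_topspace[OF box_continuous[of m]] by (simp add: box_def)

lemma coord_measurable[measurable]: "(\<lambda>x. x i) \<in> borel_measurable \<mu>"
  by (rule borel_measurable_borel_of[OF coord sets_mu])

text \<open>The sigma-field of all coordinates, on which conditional distributions give information;
  it may be smaller than the Borel field.\<close>

definition cyl :: "(nat \<Rightarrow> real) measure" where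
  "cyl = sigma (space \<mu>) {{x \<in> space \<mu>. x j \<in> A} | j A. A \<in> sets borel}"

lemma cyl_Pow: "{{x \<in> space \<mu>. x j \<in> A} | j A. A \<in> sets borel} \<subseteq> Pow (space \<mu>)"
  by auto

lemma space_cyl[simp]: "space cyl = space \<mu>"
  unfolding cyl_def using cyl_Pow by simp

lemma sets_cyl: "sets cyl = sigma_sets (space \<mu>) {{x \<in> space \<mu>. x j \<in> A} | j A. A \<in> sets borel}"
  unfolding cyl_def using cyl_Pow by simp

lemma space_in_cyl[simp]: "space \<mu> \<in> sets cyl"
  using sets.top[of cyl] unfolding space_cyl .

lemma sets_cyl_subset: "sets cyl \<subseteq> sets \<mu>"
proof -
  have "{x \<in> space \<mu>. x j \<in> A} \<in> sets \<mu>" if "A \<in> sets borel" for j A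
    using measurable_sets[OF coord_measurable[of j] that] by (simp add: vimage_def Int_def conj_commute)
  then show ?thesis unfolding sets_cyl by (intro sets.sigma_sets_subset) auto
qed

lemma cyl_coord_measurable[measurable]: "(\<lambda>x. x j) \<in> borel_measurable cyl"
proof (rule measurableI)
  fix A :: "real set" assume "A \<in> sets borel"
  then have "{x \<in> space \<mu>. x j \<in> A} \<in> sets cyl" unfolding sets_cyl by (intro sigma_sets.Basic) auto
  then show "(\<lambda>x. x j) -` A \<inter> space cyl \<in> sets cyl" by (simp add: vimage_def Int_def conj_commute)
qed simp

lemma measurable_cylI:
  assumes "\<And>z. z \<in> space L \<Longrightarrow> f z \<in> space \<mu>" "\<And>j. (\<lambda>z. f z j) \<in> borel_measurable L"
  shows "f \<in> L \<rightarrow>\<^sub>M cyl"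
  unfolding cyl_def
proof (rule measurable_measure_of[OF cyl_Pow])
  show "f \<in> space L \<rightarrow> space \<mu>" using assms(1) by auto
  fix X assume "X \<in> {{x \<in> space \<mu>. x j \<in> A} | j A. A \<in> sets borel}"
  then obtain j A where X: "X = {x \<in> space \<mu>. x j \<in> A}" "A \<in> sets borel" by auto
  have "f -` X \<inter> space L = (\<lambda>z. f z j) -` A \<inter> space L" using assms(1) by (auto simp: X)
  then show "f -` X \<inter> space L \<in> sets L" using measurable_sets[OF assms(2) X(2)] by simp
qed

lemma measurable_cyl_imp: "f \<in> cyl \<rightarrow>\<^sub>M L \<Longrightarrow> f \<in> \<mu> \<rightarrow>\<^sub>M L"
  using measurable_mono[of L L cyl \<mu>] sets_cyl_subset by auto

lemma open_cyl:
  assumes "open V"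
  shows "V \<inter> space \<mu> \<in> sets cyl"
proof -
  have "(\<lambda>x. x) \<in> cyl \<rightarrow>\<^sub>M (\<Pi>\<^sub>M i\<in>UNIV. (borel :: real measure))"
    by (rule measurable_PiM_single') auto
  moreover have "V \<in> sets (\<Pi>\<^sub>M i\<in>UNIV. (borel :: real measure))"
    using assms by (simp add: sets_PiM_equal_borel)
  ultimately have "(\<lambda>x. x) -` V \<inter> space cyl \<in> sets cyl" by (rule measurable_sets)
  then show ?thesis by simp
qed

lemma continuous_cyl_measurable:
  fixes f :: "(nat \<Rightarrow> real) \<Rightarrow> real"
  assumes "continuous_on UNIV f"
  shows "f \<in> borel_measurable cyl"
proof (rule borel_measurableI)
  fix V :: "real set" assume "open V"
  then have "open (f -` V)" using assms by (rule continuous_on_open_vimage[THEN iffD1, rule_format, OF open_UNIV, simplified, rotated])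
  from open_cyl[OF this] show "f -` V \<inter> space cyl \<in> sets cyl" by simp
qed

lemma box_cyl: "box m \<in> sets cyl"
proof -
  have "{x \<in> space cyl. \<forall>i. \<bar>x i\<bar> \<le> real m * b i} \<in> sets cyl" by measurable
  moreover have "{x \<in> space cyl. \<forall>i. \<bar>x i\<bar> \<le> real m * b i} = box m"
    using box_subset[of m] by (auto simp: box_def space_mu)
  ultimately show ?thesis by simp
qed

lemma boxU_cyl: "boxU \<in> sets cyl"
  unfolding boxU_def using box_cyl by auto

lemma AE_boxU: "AE x in \<mu>. x \<in> boxU"
proof (rule AE_in_set_eq_1[THEN iffD2])
  show "boxU \<in> sets \<mu>" using boxU_cyl sets_cyl_subset by auto
  show "measure \<mu> boxU = 1" using boxes by (simp add: boxU_def box_def)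
qed

text \<open>On a box every open set of \<open>S\<close> is the trace of a product-open set, and
  there are countably many boxes. The sets whose trace on \<open>boxU\<close> is that of a cylinder
  set form a sigma-field.\<close>

lemma sets_mu_cyl:
  assumes "B \<in> sets \<mu>"
  shows "\<exists>B'\<in>sets cyl. B \<inter> boxU = B' \<inter> boxU"
proof -
  have Pow: "{U. openin S U} \<subseteq> Pow (topspace S)" using openin_subset by auto
  have "B \<in> sigma_sets (topspace S) {U. openin S U}"
    using assms Pow unfolding sets_mu borel_of_def by simp
  then show ?thesis
  proof induction
    case (Basic U)
    then have U: "openin S U" by simp
    have "\<exists>V. open V \<and> U \<inter> box m = V \<inter> box m" for m
    proof -
      have "openin (subtopology (powertop_real UNIV) (box m)) {x \<in> box m. x \<in> U}"
        using openin_continuous_map_preimage[OF box_continuous[of m] U] by (simp add: box_def)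
      then obtain V where "open V" "{x \<in> box m. x \<in> U} = V \<inter> box m"
        by (auto simp: openin_subtopology euclidean_product_topology)
      then show ?thesis by blast
    qed
    then obtain V where V: "\<And>m. open (V m)" "\<And>m. U \<inter> box m = V m \<inter> box m" by metis
    have "(\<Union>m. (V m \<inter> space \<mu>) \<inter> box m) \<in> sets cyl" using open_cyl[OF V(1)] box_cyl by auto
    moreover have "U \<inter> boxU = (\<Union>m. (V m \<inter> space \<mu>) \<inter> box m) \<inter> boxU"
      using V(2) box_subset unfolding boxU_def space_mu by blast
    ultimately show ?case by blast
  next
    case Empty
    then show ?case by auto
  next
    case (Compl B)
    then obtain B' where "B' \<in> sets cyl" "B \<inter> boxU = B' \<inter> boxU" by blast
    then have "space cyl - B' \<in> sets cyl" "(topspace S - B) \<inter> boxU = (space cyl - B') \<inter> boxU"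
      using sets.compl_sets[of B' cyl] by (auto simp flip: space_mu)
    then show ?case by blast
  next
    case (Union B)
    then obtain B' where "\<And>i. B' i \<in> sets cyl" "\<And>i. B i \<inter> boxU = B' i \<inter> boxU" by metis
    then show ?case by (intro bexI[of _ "\<Union>i. B' i"]) auto
  qed
qed

section \<open>Invariance of the law under resampling\<close>

lemma upd_space: "x \<in> space \<mu> \<Longrightarrow> x(i := y) \<in> space \<mu>"
  using upd by (simp add: space_mu)

lemma sigma_compl_Pow: "{{x \<in> space \<mu>. x j \<in> A} | j A. j \<noteq> i \<and> A \<in> sets borel} \<subseteq> Pow (space \<mu>)"
  by auto

lemma space_sigma_compl[simp]: "space (sigma_compl \<mu> i) = space \<mu>"
  unfolding sigma_compl_def using sigma_compl_Pow by simp

lemma space_in_sigma_compl[simp]: "space \<mu> \<in> sets (sigma_compl \<mu> i)"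
  using sets.top[of "sigma_compl \<mu> i"] unfolding space_sigma_compl .

lemma sets_sigma_compl: "sets (sigma_compl \<mu> i) =
    sigma_sets (space \<mu>) {{x \<in> space \<mu>. x j \<in> A} | j A. j \<noteq> i \<and> A \<in> sets borel}"
  unfolding sigma_compl_def using sigma_compl_Pow by simp

lemma sets_sigma_compl_subset: "sets (sigma_compl \<mu> i) \<subseteq> sets cyl"
  unfolding sets_sigma_compl sets_cyl by (rule sigma_sets_mono') auto

lemma sigma_compl_upd:
  assumes "C \<in> sets (sigma_compl \<mu> i)" "x \<in> space \<mu>"
  shows "x(i := y) \<in> C \<longleftrightarrow> x \<in> C"
  using assms(1) unfolding sets_sigma_compl
proof induction
  case (Basic a)
  then show ?case using assms(2) upd_space[OF assms(2), of i y] by (auto simp del: fun_upd_apply simp: fun_upd_other)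
next
  case (Compl a)
  then show ?case using assms(2) upd_space[OF assms(2), of i y] by (auto simp del: fun_upd_apply)
qed auto

lemma kernel_measurable[measurable]: "\<kappa> i \<in> \<mu> \<rightarrow>\<^sub>M subprob_algebra borel"
proof -
  have "\<kappa> i \<in> sigma_compl \<mu> i \<rightarrow>\<^sub>M prob_algebra borel" using kappa by (simp add: regular_cond_dist_def)
  then have "\<kappa> i \<in> sigma_compl \<mu> i \<rightarrow>\<^sub>M subprob_algebra borel" by (rule measurable_prob_algebraD)
  then show ?thesis
    using measurable_mono[of "subprob_algebra borel" "subprob_algebra borel" "sigma_compl \<mu> i" \<mu>]
      sets_sigma_compl_subset[of i] sets_cyl_subset by auto
qed

lemma kernel_prob: "x \<in> space \<mu> \<Longrightarrow> prob_space (\<kappa> i x) \<and> sets (\<kappa> i x) = sets borel"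
proof -
  assume x: "x \<in> space \<mu>"
  have "\<kappa> i \<in> sigma_compl \<mu> i \<rightarrow>\<^sub>M prob_algebra borel" using kappa by (simp add: regular_cond_dist_def)
  from measurable_space[OF this] x show ?thesis by (simp add: space_prob_algebra)
qed

lemma kernel_emeasure:
  assumes "A \<in> sets borel" "C \<in> sets (sigma_compl \<mu> i)"
  shows "(\<integral>\<^sup>+x. emeasure (\<kappa> i x) A * indicator C x \<partial>\<mu>) = emeasure \<mu> ({x \<in> space \<mu>. x i \<in> A} \<inter> C)"
  using kappa[of i] assms by (simp add: regular_cond_dist_def)

text \<open>For {x_i in A} intersected with a set C that does not depend on x_i, this is the
  defining property of the conditional distribution. Such sets are stable under intersection and
  generate \<open>cyl\<close>, so two measures on \<open>cyl\<close> are compared.\<close>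

lemma resample_emeasure:
  assumes B: "B \<in> sets cyl"
  shows "(\<integral>\<^sup>+x. emeasure (\<kappa> i x) {y. x(i := y) \<in> B} \<partial>\<mu>) = emeasure \<mu> B"
proof -
  have upd_meas: "(\<lambda>(x, y). x(i := y)) \<in> \<mu> \<Otimes>\<^sub>M borel \<rightarrow>\<^sub>M cyl"
  proof (rule measurable_cylI)
    show "(case z of (x, y) \<Rightarrow> x(i := y)) \<in> space \<mu>" if "z \<in> space (\<mu> \<Otimes>\<^sub>M borel)" for z
      using that upd_space by (auto simp: space_pair_measure)
    show "(\<lambda>z. (case z of (x, y) \<Rightarrow> x(i := y)) j) \<in> borel_measurable (\<mu> \<Otimes>\<^sub>M borel)" for j
      by (cases "j = i") (simp_all add: case_prod_beta')
  qed
  \<comment> \<open>The law of the resampled point given x; \<open>\<mu> \<bind> k\<close> is the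
    law after resampling.\<close>
  define k where "k x = distr (\<kappa> i x) cyl (\<lambda>y. x(i := y))" for x
  have k: "k \<in> \<mu> \<rightarrow>\<^sub>M subprob_algebra cyl"
    unfolding k_def[abs_def] by (rule measurable_distr2[OF upd_meas kernel_measurable])
  have k_eq: "emeasure (k x) C = emeasure (\<kappa> i x) {y. x(i := y) \<in> C}" if "C \<in> sets cyl" "x \<in> space \<mu>" for C x
  proof -
    have sp: "space (\<kappa> i x) = UNIV" using kernel_prob[OF that(2), of i] sets_eq_imp_space_eq by fastforce
    have "(\<lambda>y. x(i := y)) \<in> \<kappa> i x \<rightarrow>\<^sub>M cyl"
      using measurable_compose[OF measurable_Pair1'[OF that(2), of borel] upd_meas] kernel_prob[OF that(2), of i]
      by (simp cong: measurable_cong_sets)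
    then show ?thesis unfolding k_def using that by (subst emeasure_distr) (auto simp: sp vimage_def)
  qed
  have ne: "space \<mu> \<noteq> {}" by (rule not_empty)
  define G where "G = {{x \<in> space \<mu>. x i \<in> A} \<inter> C | A C. A \<in> sets borel \<and> C \<in> sets (sigma_compl \<mu> i)}"
  have GI: "{x \<in> space \<mu>. x i \<in> A} \<inter> C \<in> G" if "A \<in> sets borel" "C \<in> sets (sigma_compl \<mu> i)" for A C
    unfolding G_def by (rule CollectI, intro exI conjI) (rule refl, (rule that)+)
  have G_cyl: "{x \<in> space \<mu>. x i \<in> A} \<inter> C \<in> sets cyl" if "A \<in> sets borel" "C \<in> sets (sigma_compl \<mu> i)" for A C
  proof -
    have "{x \<in> space \<mu>. x i \<in> A} \<in> sets cyl" unfolding sets_cyl using that by (intro sigma_sets.Basic) auto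
    then show ?thesis using that(2) sets_sigma_compl_subset by auto
  qed
  have "\<mu> \<bind> k = distr \<mu> cyl (\<lambda>x. x)"
  proof (rule measure_eqI_generator_eq[where E = G and \<Omega> = "space \<mu>" and A = "\<lambda>_. space \<mu>"])
    show "Int_stable G"
    proof (rule Int_stableI)
      fix X Y assume "X \<in> G" "Y \<in> G"
      then obtain A C A' C' where *: "X = {x \<in> space \<mu>. x i \<in> A} \<inter> C" "A \<in> sets borel" "C \<in> sets (sigma_compl \<mu> i)"
        "Y = {x \<in> space \<mu>. x i \<in> A'} \<inter> C'" "A' \<in> sets borel" "C' \<in> sets (sigma_compl \<mu> i)"
        unfolding G_def by blast
      then have eq: "X \<inter> Y = {x \<in> space \<mu>. x i \<in> A \<inter> A'} \<inter> (C \<inter> C')" by auto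
      show "X \<inter> Y \<in> G" unfolding eq by (intro GI sets.Int *)
    qed
    show "G \<subseteq> Pow (space \<mu>)" unfolding G_def by auto
    have "sets cyl = sigma_sets (space \<mu>) G"
    proof (rule antisym)
      have "{x \<in> space \<mu>. x j \<in> A} \<in> G" if "A \<in> sets borel" for j A
      proof (cases "j = i")
        case True
        have "{x \<in> space \<mu>. x i \<in> A} \<inter> space (sigma_compl \<mu> i) \<in> G" using that by (intro GI) auto
        moreover have "{x \<in> space \<mu>. x i \<in> A} \<inter> space (sigma_compl \<mu> i) = {x \<in> space \<mu>. x j \<in> A}"
          using True by auto
        ultimately show ?thesis by simp
      next
        case False
        then have "{x \<in> space \<mu>. x j \<in> A} \<in> sets (sigma_compl \<mu> i)"
          unfolding sets_sigma_compl using that by (intro sigma_sets.Basic) auto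
        moreover have eq: "{x \<in> space \<mu>. x j \<in> A} = {x \<in> space \<mu>. x i \<in> UNIV} \<inter> {x \<in> space \<mu>. x j \<in> A}" by auto
        ultimately show ?thesis by (subst eq) (intro GI, simp)
      qed
      then show "sets cyl \<subseteq> sigma_sets (space \<mu>) G" unfolding sets_cyl by (intro sigma_sets_mono') auto
      have "G \<subseteq> sets cyl" unfolding G_def using G_cyl by auto
      then show "sigma_sets (space \<mu>) G \<subseteq> sets cyl" using sets.sigma_sets_subset[of G cyl] by simp
    qed
    then show "sets (\<mu> \<bind> k) = sigma_sets (space \<mu>) G" "sets (distr \<mu> cyl (\<lambda>x. x)) = sigma_sets (space \<mu>) G"
      using sets_bind[OF _ ne, of k cyl] k by (auto simp: sets_kernel[OF k])
    have idm: "(\<lambda>x. x) \<in> \<mu> \<rightarrow>\<^sub>M cyl" by (rule measurable_cylI) auto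
    have bind_eq: "emeasure (\<mu> \<bind> k) X = (\<integral>\<^sup>+x. emeasure (\<kappa> i x) {y. x(i := y) \<in> X} \<partial>\<mu>)" if "X \<in> sets cyl" for X
      using emeasure_bind[OF ne k that] k_eq[OF that] by (simp cong: nn_integral_cong)
    have dist_eq: "emeasure (distr \<mu> cyl (\<lambda>x. x)) X = emeasure \<mu> X" if "X \<in> sets cyl" for X
    proof -
      have "X \<subseteq> space \<mu>" using sets.sets_into_space[OF that] by simp
      then show ?thesis using emeasure_distr[OF idm that] by (simp add: vimage_def Int_absorb2)
    qed
    show GG: "emeasure (\<mu> \<bind> k) X = emeasure (distr \<mu> cyl (\<lambda>x. x)) X" if XG: "X \<in> G" for X
    proof -
      obtain A C where X: "X = {x \<in> space \<mu>. x i \<in> A} \<inter> C" and A: "A \<in> sets borel" and C: "C \<in> sets (sigma_compl \<mu> i)"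
        using XG unfolding G_def by blast
      have Xc: "X \<in> sets cyl" unfolding X by (rule G_cyl[OF A C])
      have "emeasure (\<kappa> i x) {y. x(i := y) \<in> X} = emeasure (\<kappa> i x) A * indicator C x" if "x \<in> space \<mu>" for x
      proof -
        \<comment> \<open>Changing x_i does not affect membership in \<open>C\<close>, so the
          section is either \<open>A\<close> or empty.\<close>
        have "{y. x(i := y) \<in> X} = (if x \<in> C then A else {})"
          using that upd_space sigma_compl_upd[OF C that] by (auto simp: X)
        then show ?thesis by (auto simp: indicator_def)
      qed
      then have "emeasure (\<mu> \<bind> k) X = (\<integral>\<^sup>+x. emeasure (\<kappa> i x) A * indicator C x \<partial>\<mu>)"
        unfolding bind_eq[OF Xc] by (intro nn_integral_cong) auto
      also have "\<dots> = emeasure \<mu> X" unfolding kernel_emeasure[OF A C] X ..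
      finally show ?thesis using dist_eq[OF Xc] by simp
    qed
    have "{x \<in> space \<mu>. x i \<in> UNIV} \<inter> space (sigma_compl \<mu> i) \<in> G" by (intro GI) auto
    then have spG: "space \<mu> \<in> G" by simp
    then show "range (\<lambda>_. space \<mu>) \<subseteq> G" by auto
    show "emeasure (\<mu> \<bind> k) (space \<mu>) \<noteq> \<infinity>" for j :: nat
      using GG[OF spG] dist_eq[of "space \<mu>"] emeasure_space_1 by simp
  qed simp
  then have "emeasure (\<mu> \<bind> k) B = emeasure (distr \<mu> cyl (\<lambda>x. x)) B" by simp
  moreover have "emeasure (\<mu> \<bind> k) B = (\<integral>\<^sup>+x. emeasure (\<kappa> i x) {y. x(i := y) \<in> B} \<partial>\<mu>)"
    using emeasure_bind[OF ne k B] k_eq[OF B] by (simp cong: nn_integral_cong)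
  moreover have "emeasure (distr \<mu> cyl (\<lambda>x. x)) B = emeasure \<mu> B"
  proof -
    have "(\<lambda>x. x) \<in> \<mu> \<rightarrow>\<^sub>M cyl" by (rule measurable_cylI) auto
    then show ?thesis
      using emeasure_distr[of "\<lambda>x. x" \<mu> cyl B] B sets.sets_into_space[OF B] by (simp add: vimage_def Int_absorb2)
  qed
  ultimately show ?thesis by simp
qed

end

section \<open>The jump measure\<close>

context path_space
begin

text \<open>A jump is coded as ((i, x), y): the coordinate, the old point and the new value of that
  coordinate.\<close>

definition Z :: "((nat \<times> (nat \<Rightarrow> real)) \<times> real) measure" where
  "Z = (count_space UNIV \<Otimes>\<^sub>M \<mu>) \<Otimes>\<^sub>M borel"

definition old :: "(nat \<times> (nat \<Rightarrow> real)) \<times> real \<Rightarrow> nat \<Rightarrow> real" where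
  "old z = snd (fst z)"

definition new :: "(nat \<times> (nat \<Rightarrow> real)) \<times> real \<Rightarrow> nat \<Rightarrow> real" where
  "new z = (snd (fst z))(fst (fst z) := snd z)"

definition gap :: "(nat \<times> (nat \<Rightarrow> real)) \<times> real \<Rightarrow> real" where
  "gap z = \<bar>snd z - old z (fst (fst z))\<bar>"

text \<open>Weight 0 for a vanishing gap takes the place of the indicator of y_i different from x_i
  in the form.\<close>

definition wt :: "(nat \<times> (nat \<Rightarrow> real)) \<times> real \<Rightarrow> real" where
  "wt z = (if gap z = 0 then 0 else 1 / gap z powr (\<alpha> + 1))"

definition Lam0 :: "((nat \<times> (nat \<Rightarrow> real)) \<times> real) measure" where
  "Lam0 = (count_space UNIV \<Otimes>\<^sub>M \<mu>) \<bind> (\<lambda>p. distr (\<kappa> (fst p) (snd p)) Z (Pair p))"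

definition Lam1 :: "((nat \<times> (nat \<Rightarrow> real)) \<times> real) measure" where
  "Lam1 = density Lam0 (\<lambda>z. ennreal (wt z))"

text \<open>The map \<open>new\<close> need not be measurable for the Borel sets of \<open>S\<close>, only for the cylinder sets \<open>cyl\<close>.
  Since the two agree on the boxes, it becomes measurable after completion.\<close>

definition Lam :: "((nat \<times> (nat \<Rightarrow> real)) \<times> real) measure" where
  "Lam = completion Lam1"

lemma space_Z: "space Z = {z. old z \<in> space \<mu>}"
  by (auto simp: Z_def space_pair_measure old_def)

lemma new_space: "z \<in> space Z \<Longrightarrow> new z \<in> space \<mu>"
  using upd_space[of "old z" "fst (fst z)" "snd z"] by (simp add: space_Z old_def new_def)

lemma Z_measurable_projections[measurable]:
  "(\<lambda>z. fst (fst z)) \<in> Z \<rightarrow>\<^sub>M count_space UNIV" "old \<in> Z \<rightarrow>\<^sub>M \<mu>" "snd \<in> Z \<rightarrow>\<^sub>M borel"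
  unfolding Z_def old_def[abs_def] by measurable

lemma old_coord_measurable[measurable]: "(\<lambda>z. old z j) \<in> borel_measurable Z"
  by (rule measurable_compose[OF Z_measurable_projections(2) coord_measurable])

lemma old_idx_measurable[measurable]: "(\<lambda>z. old z (fst (fst z))) \<in> borel_measurable Z"
  by (rule measurable_compose_countable[where f = "\<lambda>i z. old z i" and g = "\<lambda>z. fst (fst z)"])
     (auto intro: old_coord_measurable Z_measurable_projections)

lemma new_measurable[measurable]: "new \<in> Z \<rightarrow>\<^sub>M cyl"
proof (rule measurable_cylI)
  show "new z \<in> space \<mu>" if "z \<in> space Z" for z by (rule new_space[OF that])
  fix j
  have "(\<lambda>z. if fst (fst z) = j then snd z else old z j) \<in> borel_measurable Z" by measurable
  then show "(\<lambda>z. new z j) \<in> borel_measurable Z"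
    by (rule back_subst[of "\<lambda>f. f \<in> borel_measurable Z"]) (auto simp: new_def old_def)
qed

lemma gap_measurable[measurable]: "gap \<in> borel_measurable Z"
  unfolding gap_def[abs_def] by measurable

lemma wt_measurable[measurable]: "wt \<in> borel_measurable Z"
  unfolding wt_def[abs_def] by measurable

lemma wt_nonneg: "0 \<le> wt z"
  by (simp add: wt_def)

lemma gap_nonneg: "0 \<le> gap z"
  by (simp add: gap_def)

lemma kernel_Z: "(\<lambda>p. distr (\<kappa> (fst p) (snd p)) Z (Pair p)) \<in> count_space UNIV \<Otimes>\<^sub>M \<mu> \<rightarrow>\<^sub>M subprob_algebra Z"
proof (rule measurable_distr2[where M = borel])
  show "case_prod Pair \<in> (count_space UNIV \<Otimes>\<^sub>M \<mu>) \<Otimes>\<^sub>M borel \<rightarrow>\<^sub>M Z"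
    unfolding Z_def by simp
  show "(\<lambda>p. \<kappa> (fst p) (snd p)) \<in> count_space UNIV \<Otimes>\<^sub>M \<mu> \<rightarrow>\<^sub>M subprob_algebra borel"
    by (rule measurable_pair_measure_countable1) auto
qed

lemma space_count_mu_nonempty: "space (count_space (UNIV :: nat set) \<Otimes>\<^sub>M \<mu>) \<noteq> {}"
  using not_empty by (auto simp: space_pair_measure)

lemma sets_Lam0[simp, measurable_cong]: "sets Lam0 = sets Z"
  unfolding Lam0_def
  by (rule sets_bind[OF _ space_count_mu_nonempty]) simp

lemma space_Lam0[simp]: "space Lam0 = space Z"
  by (rule sets_eq_imp_space_eq) simp

lemma sets_Lam1[simp, measurable_cong]: "sets Lam1 = sets Z" and space_Lam1[simp]: "space Lam1 = space Z"
  by (simp_all add: Lam1_def)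

lemma space_Lam[simp]: "space Lam = space Z"
  by (simp add: Lam_def)

lemma measurable_Lam: "f \<in> Z \<rightarrow>\<^sub>M N \<Longrightarrow> f \<in> Lam \<rightarrow>\<^sub>M N"
  unfolding Lam_def by (rule measurable_completion) (simp cong: measurable_cong_sets)

section \<open>Integration against the jump measure and its null sets\<close>

lemma slice_measurable:
  assumes "F \<in> Z \<rightarrow>\<^sub>M N" "x \<in> space \<mu>"
  shows "(\<lambda>y. F ((i, x), y)) \<in> borel \<rightarrow>\<^sub>M N"
proof -
  have "(\<lambda>y. ((i, x), y)) \<in> borel \<rightarrow>\<^sub>M Z"
    unfolding Z_def by (rule measurable_Pair1') (use assms(2) in \<open>auto simp: space_pair_measure\<close>)
  from measurable_compose[OF this assms(1)] show ?thesis by simp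
qed

lemma pair_slice_measurable:
  assumes "F \<in> Z \<rightarrow>\<^sub>M N"
  shows "(\<lambda>(x, y). F ((i, x), y)) \<in> \<mu> \<Otimes>\<^sub>M borel \<rightarrow>\<^sub>M N"
proof -
  have "(\<lambda>p. ((i, fst p), snd p)) \<in> \<mu> \<Otimes>\<^sub>M borel \<rightarrow>\<^sub>M Z"
    unfolding Z_def by measurable
  from measurable_compose[OF this assms] show ?thesis by (simp add: case_prod_beta')
qed

lemma nn_integral_Lam0:
  assumes F: "F \<in> borel_measurable Z"
  shows "(\<integral>\<^sup>+z. F z \<partial>Lam0) = (\<Sum>i. \<integral>\<^sup>+x. \<integral>\<^sup>+y. F ((i, x), y) \<partial>\<kappa> i x \<partial>\<mu>)"
proof -
  let ?P = "count_space (UNIV :: nat set) \<Otimes>\<^sub>M \<mu>"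
  have k: "(\<lambda>p. \<kappa> (fst p) (snd p)) \<in> ?P \<rightarrow>\<^sub>M subprob_algebra borel"
    by (rule measurable_pair_measure_countable1) auto
  have "(\<lambda>(p, y). F (p, y)) \<in> borel_measurable (?P \<Otimes>\<^sub>M borel)"
    using F by (simp add: Z_def)
  from nn_integral_measurable_subprob_algebra2[OF this k]
  have inner: "(\<lambda>p. \<integral>\<^sup>+y. F (p, y) \<partial>\<kappa> (fst p) (snd p)) \<in> borel_measurable ?P" .
  have "(\<integral>\<^sup>+z. F z \<partial>Lam0) = (\<integral>\<^sup>+p. \<integral>\<^sup>+z. F z \<partial>distr (\<kappa> (fst p) (snd p)) Z (Pair p) \<partial>?P)"
    unfolding Lam0_def by (rule nn_integral_bind[OF F kernel_Z])
  also have "\<dots> = (\<integral>\<^sup>+p. \<integral>\<^sup>+y. F (p, y) \<partial>\<kappa> (fst p) (snd p) \<partial>?P)"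
  proof (rule nn_integral_cong)
    fix p assume p: "p \<in> space ?P"
    then have "snd p \<in> space \<mu>" by (auto simp: space_pair_measure)
    have "Pair p \<in> borel \<rightarrow>\<^sub>M Z" unfolding Z_def by (rule measurable_Pair1'[OF p])
    then have "Pair p \<in> \<kappa> (fst p) (snd p) \<rightarrow>\<^sub>M Z"
      using kernel_prob[OF \<open>snd p \<in> space \<mu>\<close>, of "fst p"] by (simp cong: measurable_cong_sets)
    then show "(\<integral>\<^sup>+z. F z \<partial>distr (\<kappa> (fst p) (snd p)) Z (Pair p)) = (\<integral>\<^sup>+y. F (p, y) \<partial>\<kappa> (fst p) (snd p))"
      using F by (simp add: nn_integral_distr)
  qed
  also have "\<dots> = (\<integral>\<^sup>+i. \<integral>\<^sup>+x. \<integral>\<^sup>+y. F ((i, x), y) \<partial>\<kappa> i x \<partial>\<mu> \<partial>count_space UNIV)"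
    using nn_integral_fst[OF inner] by simp
  finally show ?thesis by (simp add: nn_integral_count_space_nat)
qed

lemma nn_integral_Lam:
  assumes F: "F \<in> borel_measurable Z"
  shows "(\<integral>\<^sup>+z. F z \<partial>Lam) = (\<Sum>i. \<integral>\<^sup>+x. \<integral>\<^sup>+y. ennreal (wt ((i, x), y)) * F ((i, x), y) \<partial>\<kappa> i x \<partial>\<mu>)"
proof -
  have wF: "(\<lambda>z. ennreal (wt z) * F z) \<in> borel_measurable Z" using F by measurable
  have "(\<integral>\<^sup>+z. F z \<partial>Lam) = (\<integral>\<^sup>+z. ennreal (wt z) * F z \<partial>Lam0)"
    unfolding Lam_def nn_integral_completion Lam1_def using F by (simp add: nn_integral_density)
  then show ?thesis by (simp add: nn_integral_Lam0[OF wF])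
qed

lemma null_sets_Lam1:
  assumes "N \<in> null_sets Lam0"
  shows "N \<in> null_sets Lam1"
proof -
  have "AE z in Lam0. z \<in> N \<longrightarrow> ennreal (wt z) = 0"
    using AE_not_in[OF assms] by eventually_elim simp
  then show ?thesis
    unfolding Lam1_def using null_setsD2[OF assms] by (subst null_sets_density_iff) auto
qed

text \<open>Coordinate i contributes the mass of \<open>C\<close> under the law resampled at i,
  which is \<mu>(C) = 0.\<close>

lemma new_null_cyl:
  assumes "C \<in> sets cyl" "emeasure \<mu> C = 0"
  shows "new -` C \<inter> space Z \<in> null_sets Lam1"
proof -
  have m: "new -` C \<inter> space Z \<in> sets Z" by (rule measurable_sets[OF new_measurable assms(1)])
  have "emeasure Lam0 (new -` C \<inter> space Z) = (\<integral>\<^sup>+z. indicator (new -` C \<inter> space Z) z \<partial>Lam0)"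
    using m by simp
  also have "\<dots> = (\<Sum>i. \<integral>\<^sup>+x. \<integral>\<^sup>+y. indicator (new -` C \<inter> space Z) ((i, x), y) \<partial>\<kappa> i x \<partial>\<mu>)"
    using m by (intro nn_integral_Lam0) simp
  also have "\<dots> = (\<Sum>i. \<integral>\<^sup>+x. emeasure (\<kappa> i x) {y. x(i := y) \<in> C} \<partial>\<mu>)"
  proof (intro arg_cong[where f = suminf] ext nn_integral_cong)
    fix i x assume x: "x \<in> space \<mu>"
    have "{y. x(i := y) \<in> C} = (\<lambda>y. new ((i, x), y)) -` C" by (auto simp: new_def)
    also have "\<dots> \<in> sets borel"
      using measurable_sets[OF slice_measurable[OF new_measurable x, of i] assms(1)] by simp
    finally have meas: "{y. x(i := y) \<in> C} \<in> sets (\<kappa> i x)" using kernel_prob[OF x, of i] by simp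
    have "(\<integral>\<^sup>+y. indicator (new -` C \<inter> space Z) ((i, x), y) \<partial>\<kappa> i x) = (\<integral>\<^sup>+y. indicator {y. x(i := y) \<in> C} y \<partial>\<kappa> i x)"
      using x by (intro nn_integral_cong) (auto simp: new_def space_Z old_def indicator_def simp del: fun_upd_apply)
    then show "(\<integral>\<^sup>+y. indicator (new -` C \<inter> space Z) ((i, x), y) \<partial>\<kappa> i x) = emeasure (\<kappa> i x) {y. x(i := y) \<in> C}"
      using meas by simp
  qed
  also have "\<dots> = 0" by (simp add: resample_emeasure[OF assms(1)] assms(2))
  finally have "new -` C \<inter> space Z \<in> null_sets Lam0" using m by auto
  then show ?thesis by (rule null_sets_Lam1)
qed

lemma old_null:
  assumes "A \<in> null_sets \<mu>"
  shows "old -` A \<inter> space Z \<in> null_sets Lam1"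
proof -
  have m: "old -` A \<inter> space Z \<in> sets Z"
    using assms by (intro measurable_sets[OF Z_measurable_projections(2)]) auto
  have "emeasure Lam0 (old -` A \<inter> space Z) = (\<integral>\<^sup>+z. indicator (old -` A \<inter> space Z) z \<partial>Lam0)"
    using m by simp
  also have "\<dots> = (\<Sum>i. \<integral>\<^sup>+x. \<integral>\<^sup>+y. indicator (old -` A \<inter> space Z) ((i, x), y) \<partial>\<kappa> i x \<partial>\<mu>)"
    using m by (intro nn_integral_Lam0) simp
  also have "\<dots> = (\<Sum>i. 0)"
  proof (intro arg_cong[where f = suminf] ext)
    fix i
    have AE0: "AE x in \<mu>. (\<integral>\<^sup>+y. indicator (old -` A \<inter> space Z) ((i, x), y) \<partial>\<kappa> i x) = 0"
      using AE_not_in[OF assms] by eventually_elim (simp add: old_def indicator_def)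
    show "(\<integral>\<^sup>+x. \<integral>\<^sup>+y. indicator (old -` A \<inter> space Z) ((i, x), y) \<partial>\<kappa> i x \<partial>\<mu>) = 0"
      using nn_integral_cong_AE[OF AE0] by simp
  qed
  finally have "old -` A \<inter> space Z \<in> null_sets Lam0" using m by auto
  then show ?thesis by (rule null_sets_Lam1)
qed

lemma new_off_boxU: "new -` (space \<mu> - boxU) \<inter> space Z \<in> null_sets Lam1"
proof (rule new_null_cyl)
  show "space \<mu> - boxU \<in> sets cyl" using boxU_cyl sets.compl_sets[of boxU cyl] by simp
  have "measure \<mu> boxU = 1" using boxes by (simp add: boxU_def box_def)
  then have "measure \<mu> (space \<mu> - boxU) = 0"
    using prob_compl[of boxU] boxU_cyl sets_cyl_subset by auto
  then show "emeasure \<mu> (space \<mu> - boxU) = 0" by (simp add: emeasure_eq_measure)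
qed

sublocale jump_space \<mu> Lam new old
proof
  show "old \<in> Lam \<rightarrow>\<^sub>M \<mu>" by (intro measurable_Lam Z_measurable_projections)
  show "new \<in> Lam \<rightarrow>\<^sub>M \<mu>"
  proof (rule measurableI)
    show "new z \<in> space \<mu>" if "z \<in> space Lam" for z using new_space that by simp
    fix B assume B: "B \<in> sets \<mu>"
    obtain B' where B': "B' \<in> sets cyl" "B \<inter> boxU = B' \<inter> boxU" using sets_mu_cyl[OF B] by blast
    \<comment> \<open>\<open>B\<close> splits into a cylinder part inside \<open>boxU\<close> and a
      rest whose preimage is contained in a null set of \<open>Lam1\<close>, hence belongs to the
      completion.\<close>
    have "B' \<inter> boxU \<in> sets cyl" using B' boxU_cyl by auto
    then have 1: "new -` (B' \<inter> boxU) \<inter> space Z \<in> sets Z" by (rule measurable_sets[OF new_measurable])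
    have "new -` (B - boxU) \<inter> space Z \<subseteq> new -` (space \<mu> - boxU) \<inter> space Z"
      using sets.sets_into_space[OF B] by auto
    then have 2: "new -` (B - boxU) \<inter> space Z \<in> sets Lam"
      unfolding Lam_def by (rule null_sets_completion[OF new_off_boxU])
    have "new -` B \<inter> space Lam = (new -` (B' \<inter> boxU) \<inter> space Z) \<union> (new -` (B - boxU) \<inter> space Z)"
      using B'(2) by auto
    moreover have "new -` (B' \<inter> boxU) \<inter> space Z \<in> sets Lam" using 1 by (simp add: Lam_def)
    ultimately show "new -` B \<inter> space Lam \<in> sets Lam" using 2 by auto
  qed
  fix A assume A: "A \<in> null_sets \<mu>"
  show "old -` A \<inter> space Lam \<in> null_sets Lam"
    using old_null[OF A] by (simp add: Lam_def null_sets_completionI)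
  obtain A' where A': "A' \<in> sets cyl" "A \<inter> boxU = A' \<inter> boxU" using sets_mu_cyl[of A] A by auto
  have "emeasure \<mu> (A' \<inter> boxU) = 0"
    using A A'(2)[symmetric] boxU_cyl sets_cyl_subset by (simp add: null_sets_def) (metis A emeasure_mono inf_le1 le_zero_eq null_setsD1 null_setsD2)
  then have 1: "new -` (A' \<inter> boxU) \<inter> space Z \<in> null_sets Lam1"
    using A' boxU_cyl by (intro new_null_cyl) auto
  have "new -` A \<inter> space Lam \<subseteq> (new -` (A' \<inter> boxU) \<inter> space Z) \<union> (new -` (space \<mu> - boxU) \<inter> space Z)"
    using A'(2) new_space by auto
  moreover have "\<dots> \<in> null_sets (completion Lam1)"
    using 1 new_off_boxU by (intro null_sets.Un null_sets_completionI)
  ultimately show "new -` A \<inter> space Lam \<in> null_sets Lam"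
    unfolding Lam_def using null_sets_completion_subset by blast
qed

lemma grad_bound:
  assumes "w \<in> FCN N"
  obtains c where "c \<ge> 0" "\<And>z. \<bar>grad w z\<bar> \<le> c * min 1 (gap z)" "\<And>z. N \<le> fst (fst z) \<Longrightarrow> grad w z = 0"
proof -
  obtain B L where BL: "B \<ge> 0" "L \<ge> 0" "\<And>x. \<bar>w x\<bar> \<le> B"
    "\<And>x i y. \<bar>w (x(i := y)) - w x\<bar> \<le> L * \<bar>y - x i\<bar>" "\<And>x i y. i \<ge> N \<Longrightarrow> w (x(i := y)) = w x"
    using FCN_bounds[OF assms] by metis
  show ?thesis
  \<comment> \<open>2 B bounds the increment across large gaps and L times the gap bounds it across
    small ones.\<close>
  proof (rule that[of "2 * B + L"])
    show "0 \<le> 2 * B + L" using BL by simp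
    fix z :: "(nat \<times> (nat \<Rightarrow> real)) \<times> real"
    have g: "grad w z = w ((snd (fst z))(fst (fst z) := snd z)) - w (snd (fst z))"
      by (simp add: grad_def new_def old_def del: fun_upd_apply)
    have 1: "\<bar>grad w z\<bar> \<le> L * gap z" unfolding g gap_def old_def by (rule BL(4))
    have 2: "\<bar>grad w z\<bar> \<le> 2 * B"
      unfolding g using BL(3)[of "(snd (fst z))(fst (fst z) := snd z)"] BL(3)[of "snd (fst z)"] by linarith
    show "\<bar>grad w z\<bar> \<le> (2 * B + L) * min 1 (gap z)"
    proof (cases "gap z \<le> 1")
      case True
      have "L * gap z \<le> (2 * B + L) * gap z" using BL gap_nonneg[of z] by (intro mult_right_mono) auto
      then show ?thesis using 1 True by (simp add: min_def split: if_splits)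
    next
      case False
      then show ?thesis using 2 BL by (simp add: min_def)
    qed
    show "grad w z = 0" if "N \<le> fst (fst z)" unfolding g using BL(5)[OF that] by (simp del: fun_upd_apply)
  qed
qed

lemma wt_gap_le: "wt z * (min 1 (gap z))\<^sup>2 \<le> 1"
proof (cases "gap z = 0")
  case False
  then have g: "gap z > 0" using gap_nonneg[of z] by linarith
  then have "gap z powr (\<alpha> + 1) > 0" by simp
  then show ?thesis
    using min_square_le_powr[OF gap_nonneg alpha, of z] False by (simp add: wt_def divide_le_eq)
qed (simp add: wt_def)

text \<open>\<open>min_square_le_powr\<close> applied to gap/t; the factor t^(-(\<alpha>+1)) that
  comes out at scale t makes the energy of the cutoffs decay.\<close>

lemma wt_le: "t > 0 \<Longrightarrow> wt z * (min 1 (gap z / t))\<^sup>2 \<le> t powr (- (\<alpha> + 1))"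
proof (cases "gap z = 0")
  case False
  assume t: "t > 0"
  from False have g: "gap z > 0" using gap_nonneg[of z] by linarith
  have "(min 1 (gap z / t))\<^sup>2 \<le> (gap z / t) powr (\<alpha> + 1)"
    using t g alpha by (intro min_square_le_powr) auto
  also have "\<dots> = gap z powr (\<alpha> + 1) / t powr (\<alpha> + 1)" using t g by (simp add: powr_divide)
  finally have "wt z * (min 1 (gap z / t))\<^sup>2 \<le> wt z * (gap z powr (\<alpha> + 1) / t powr (\<alpha> + 1))"
    by (intro mult_left_mono wt_nonneg)
  also have "\<dots> = t powr (- (\<alpha> + 1))" using False g t unfolding powr_minus by (simp add: wt_def divide_inverse)
  finally show ?thesis .
qed (simp add: wt_def)

section \<open>The energy of cylinder functions as an integral over jumps\<close>

lemma FCN_cyl_measurable: "w \<in> FCN N \<Longrightarrow> w \<in> borel_measurable cyl"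
  by (rule continuous_cyl_measurable[OF FCN_continuous])

lemma FCN_measurable: "w \<in> FCN N \<Longrightarrow> w \<in> borel_measurable \<mu>"
  by (rule measurable_cyl_imp[OF FCN_cyl_measurable])

lemma grad_Z_measurable:
  assumes "w \<in> FCN N"
  shows "grad w \<in> borel_measurable Z"
  unfolding grad_def[abs_def]
  by (intro borel_measurable_diff measurable_compose[OF new_measurable FCN_cyl_measurable[OF assms]]
      measurable_compose[OF Z_measurable_projections(2) FCN_measurable[OF assms]])

text \<open>\<open>energy_i\<close> is an iterated Bochner integral, which is meaningful only once
  both integrations are known to exist. All densities that occur are bounded and the kernels are
  probability measures.\<close>

lemma inner_integrable:
  fixes F :: "(nat \<times> (nat \<Rightarrow> real)) \<times> real \<Rightarrow> real"
  assumes F: "F \<in> borel_measurable Z" and bd: "\<And>z. \<bar>F z\<bar> \<le> C"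
  shows "x \<in> space \<mu> \<Longrightarrow> integrable (\<kappa> i x) (\<lambda>y. F ((i, x), y))"
    and "integrable \<mu> (\<lambda>x. \<integral>y. F ((i, x), y) \<partial>\<kappa> i x)"
proof -
  have C: "0 \<le> C" using bd[of undefined] by linarith
  show int: "integrable (\<kappa> i x) (\<lambda>y. F ((i, x), y))" if x: "x \<in> space \<mu>" for x
  proof -
    interpret k: prob_space "\<kappa> i x" using kernel_prob[OF x] by simp
    show ?thesis
      by (rule k.integrable_const_bound[of _ C])
         (use bd slice_measurable[OF F x, of i] kernel_prob[OF x, of i] in \<open>auto cong: measurable_cong_sets\<close>)
  qed
  \<comment> \<open>Pushed to pairs (x, y), the kernel is integrated against one fixed function of
    the pair, which gives measurability of the inner integral in x.\<close>
  let ?k = "\<lambda>x. distr (\<kappa> i x) (\<mu> \<Otimes>\<^sub>M borel) (Pair x)"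
  have k: "?k \<in> \<mu> \<rightarrow>\<^sub>M subprob_algebra (\<mu> \<Otimes>\<^sub>M borel)"
    by (rule measurable_distr2[OF _ kernel_measurable]) simp
  have F': "(\<lambda>(x, y). F ((i, x), y)) \<in> borel_measurable (\<mu> \<Otimes>\<^sub>M borel)" by (rule pair_slice_measurable[OF F])
  have "(\<lambda>x. integral\<^sup>L (?k x) (\<lambda>(x, y). F ((i, x), y))) \<in> borel_measurable \<mu>"
    by (rule measurable_compose[OF k integral_measurable_subprob_algebra[OF F']])
  moreover have "integral\<^sup>L (?k x) (\<lambda>(x, y). F ((i, x), y)) = (\<integral>y. F ((i, x), y) \<partial>\<kappa> i x)" if x: "x \<in> space \<mu>" for x
  proof -
    have "Pair x \<in> \<kappa> i x \<rightarrow>\<^sub>M \<mu> \<Otimes>\<^sub>M borel"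
      using measurable_Pair1'[OF x, of borel] kernel_prob[OF x, of i] by (simp cong: measurable_cong_sets)
    from integral_distr[OF this F'] show ?thesis by simp
  qed
  ultimately have m: "(\<lambda>x. \<integral>y. F ((i, x), y) \<partial>\<kappa> i x) \<in> borel_measurable \<mu>"
    by (simp cong: measurable_cong)
  show "integrable \<mu> (\<lambda>x. \<integral>y. F ((i, x), y) \<partial>\<kappa> i x)"
  proof (rule integrable_const_bound[of _ C])
    have "\<bar>\<integral>y. F ((i, x), y) \<partial>\<kappa> i x\<bar> \<le> C" if x: "x \<in> space \<mu>" for x
    proof -
      interpret k: prob_space "\<kappa> i x" using kernel_prob[OF x] by simp
      have "\<bar>\<integral>y. F ((i, x), y) \<partial>\<kappa> i x\<bar> \<le> (\<integral>y. \<bar>F ((i, x), y)\<bar> \<partial>\<kappa> i x)" by (rule integral_abs_bound)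
      also have "\<dots> \<le> (\<integral>y. C \<partial>\<kappa> i x)" using int[OF x] bd by (intro integral_mono) auto
      finally show ?thesis by (simp add: k.prob_space)
    qed
    then show "AE x in \<mu>. norm (\<integral>y. F ((i, x), y) \<partial>\<kappa> i x) \<le> C" by (intro AE_I2) simp
  qed (rule m)
qed

lemma iterated_integral_nonneg:
  fixes F :: "(nat \<times> (nat \<Rightarrow> real)) \<times> real \<Rightarrow> real"
  assumes F: "F \<in> borel_measurable Z" and bd: "\<And>z. \<bar>F z\<bar> \<le> C" and nn: "\<And>z. 0 \<le> F z"
  shows "ennreal (\<integral>x. (\<integral>y. F ((i, x), y) \<partial>\<kappa> i x) \<partial>\<mu>) = (\<integral>\<^sup>+x. \<integral>\<^sup>+y. ennreal (F ((i, x), y)) \<partial>\<kappa> i x \<partial>\<mu>)"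
proof -
  note int = inner_integrable[OF F bd]
  have "(\<integral>\<^sup>+x. \<integral>\<^sup>+y. ennreal (F ((i, x), y)) \<partial>\<kappa> i x \<partial>\<mu>) = (\<integral>\<^sup>+x. ennreal (\<integral>y. F ((i, x), y) \<partial>\<kappa> i x) \<partial>\<mu>)"
    using int(1) nn by (intro nn_integral_cong nn_integral_eq_integral) auto
  also have "\<dots> = ennreal (\<integral>x. (\<integral>y. F ((i, x), y) \<partial>\<kappa> i x) \<partial>\<mu>)"
    using nn by (intro nn_integral_eq_integral int(2)) (auto intro!: AE_I2 integral_nonneg_AE)
  finally show ?thesis by simp
qed

lemma Phi_eq: "indicator {y. y \<noteq> x i} y * Phi \<alpha> i u v y (x i) x = wt ((i, x), y) * (grad u ((i, x), y) * grad v ((i, x), y))"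
proof -
  have g: "grad w ((i, x), y) = w (x(i := y)) - w x" for w
    by (simp add: grad_def new_def old_def del: fun_upd_apply)
  show ?thesis
    unfolding g Phi_def by (simp add: wt_def gap_def old_def indicator_def del: fun_upd_apply)
qed

lemma energy_density_bounded:
  assumes "u \<in> FCN N" "v \<in> FCN N"
  shows "\<exists>C. \<forall>z. \<bar>wt z * (grad u z * grad v z)\<bar> \<le> C"
proof -
  obtain c where c: "c \<ge> 0" "\<And>z. \<bar>grad u z\<bar> \<le> c * min 1 (gap z)" using grad_bound[OF assms(1)] by metis
  obtain d where d: "d \<ge> 0" "\<And>z. \<bar>grad v z\<bar> \<le> d * min 1 (gap z)" using grad_bound[OF assms(2)] by metis
  have "\<bar>wt z * (grad u z * grad v z)\<bar> \<le> c * d" for z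
  proof -
    have "\<bar>grad u z\<bar> * \<bar>grad v z\<bar> \<le> (c * min 1 (gap z)) * (d * min 1 (gap z))"
      using c d gap_nonneg[of z] by (intro mult_mono) auto
    then have "wt z * (\<bar>grad u z\<bar> * \<bar>grad v z\<bar>) \<le> wt z * ((c * min 1 (gap z)) * (d * min 1 (gap z)))"
      by (intro mult_left_mono wt_nonneg)
    also have "\<dots> = c * d * (wt z * (min 1 (gap z))\<^sup>2)" by (simp add: power2_eq_square)
    also have "\<dots> \<le> c * d * 1" using c(1) d(1) by (intro mult_left_mono wt_gap_le) auto
    finally show ?thesis by (simp add: abs_mult wt_nonneg)
  qed
  then show ?thesis by blast
qed

lemma energy_i_eq: "energy_i \<alpha> \<mu> \<kappa> i u v = (\<integral>x. (\<integral>y. wt ((i, x), y) * (grad u ((i, x), y) * grad v ((i, x), y)) \<partial>\<kappa> i x) \<partial>\<mu>)"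
  unfolding energy_i_def Phi_eq ..

lemma energy_i_zero: "u \<in> FCN N \<Longrightarrow> N \<le> i \<Longrightarrow> energy_i \<alpha> \<mu> \<kappa> i u v = 0"
proof -
  assume u: "u \<in> FCN N" and i: "N \<le> i"
  have "grad u ((i, x), y) = 0" for x y
    using grad_bound[OF u] i by (metis fst_conv)
  then show ?thesis unfolding energy_i_eq by simp
qed

text \<open>Polarisation reduces the bilinear identity to its diagonal, where integrands are
  nonnegative and iterated integrals can be compared with the integral over
  \<open>Lam\<close>.\<close>

lemma energy_i_polar:
  assumes u: "u \<in> FCN N" and v: "v \<in> FCN N"
  shows "4 * energy_i \<alpha> \<mu> \<kappa> i u v = energy_i \<alpha> \<mu> \<kappa> i (\<lambda>x. 1 * u x + 1 * v x) (\<lambda>x. 1 * u x + 1 * v x)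
    - energy_i \<alpha> \<mu> \<kappa> i (\<lambda>x. 1 * u x + (-1) * v x) (\<lambda>x. 1 * u x + (-1) * v x)"
proof -
  define F where "F w w' z = wt z * (grad w z * grad w' z)" for w w' z
  have Fm: "F w w' \<in> borel_measurable Z" if "w \<in> FCN N" "w' \<in> FCN N" for w w'
    unfolding F_def[abs_def]
    by (intro borel_measurable_times wt_measurable grad_Z_measurable[OF that(1)] grad_Z_measurable[OF that(2)])
  let ?p = "\<lambda>x. 1 * u x + 1 * v x" and ?m = "\<lambda>x. 1 * u x + (-1) * v x"
  have pF: "?p \<in> FCN N" and mF: "?m \<in> FCN N" by (intro FCN_lin u v)+
  obtain C1 where C1: "\<And>z. \<bar>F ?p ?p z\<bar> \<le> C1" using energy_density_bounded[OF pF pF, folded F_def] by blast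
  obtain C2 where C2: "\<And>z. \<bar>F ?m ?m z\<bar> \<le> C2" using energy_density_bounded[OF mF mF, folded F_def] by blast
  have pt: "F ?p ?p z - F ?m ?m z = 4 * F u v z" for z
  proof -
    have "(1 * s + 1 * t) * (1 * s + 1 * t) = (1 * s + - 1 * t) * (1 * s + - 1 * t) + 4 * (s * t)" for s t :: real
      by (simp add: algebra_simps)
    from this[of "grad u z" "grad v z"] show ?thesis
      unfolding F_def grad_lin right_diff_distrib[symmetric] by (simp only:) simp
  qed
  have "(\<integral>y. F ?p ?p ((i, x), y) \<partial>\<kappa> i x) - (\<integral>y. F ?m ?m ((i, x), y) \<partial>\<kappa> i x) = 4 * (\<integral>y. F u v ((i, x), y) \<partial>\<kappa> i x)"
    if x: "x \<in> space \<mu>" for x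
    unfolding Bochner_Integration.integral_diff[OF inner_integrable(1)[OF Fm[OF pF pF] C1 x]
        inner_integrable(1)[OF Fm[OF mF mF] C2 x], symmetric] pt
    by simp
  then have "(\<integral>x. (\<integral>y. F ?p ?p ((i, x), y) \<partial>\<kappa> i x) - (\<integral>y. F ?m ?m ((i, x), y) \<partial>\<kappa> i x) \<partial>\<mu>) =
      (\<integral>x. 4 * (\<integral>y. F u v ((i, x), y) \<partial>\<kappa> i x) \<partial>\<mu>)"
    by (rule Bochner_Integration.integral_cong[OF refl])
  then show ?thesis
    unfolding energy_i_eq F_def[symmetric]
      Bochner_Integration.integral_diff[OF inner_integrable(2)[OF Fm[OF pF pF] C1]
        inner_integrable(2)[OF Fm[OF mF mF] C2]]
    by (simp only: integral_mult_right_zero)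
qed

text \<open>The diagonal density is bounded and nonnegative, so each \<open>energy_i\<close> equals
  a nonnegative integral and these add up to the one over \<open>Lam\<close>. Indices from
  \<open>N\<close> on contribute 0, which makes the total finite.\<close>

lemma energy_square:
  assumes u: "u \<in> FCN N"
  shows "grad u \<in> L2 Lam" and "energy \<alpha> \<mu> \<kappa> u u = nrg u u"
proof -
  define F where "F z = wt z * (grad u z * grad u z)" for z
  note gm = grad_Z_measurable[OF u]
  have Fm: "F \<in> borel_measurable Z"
    unfolding F_def[abs_def] by (intro borel_measurable_times wt_measurable gm)
  obtain C where C: "\<And>z. \<bar>F z\<bar> \<le> C" using energy_density_bounded[OF u u, folded F_def] by blast
  have Fnn: "0 \<le> F z" for z by (simp add: F_def wt_nonneg)
  let ?e = "\<lambda>i. energy_i \<alpha> \<mu> \<kappa> i u u"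
  have e: "ennreal (?e i) = (\<integral>\<^sup>+x. \<integral>\<^sup>+y. ennreal (F ((i, x), y)) \<partial>\<kappa> i x \<partial>\<mu>)" for i
    unfolding energy_i_eq F_def[symmetric] by (rule iterated_integral_nonneg[OF Fm C Fnn])
  have e0: "0 \<le> ?e i" for i
    unfolding energy_i_eq F_def[symmetric] using Fnn by (intro integral_nonneg_AE) (auto intro!: AE_I2 integral_nonneg_AE)
  have summ: "summable ?e" by (rule summable_finite[of "{..<N}"]) (auto intro: energy_i_zero[OF u])
  have "(\<integral>\<^sup>+z. ennreal ((grad u z)\<^sup>2) \<partial>Lam) = (\<Sum>i. \<integral>\<^sup>+x. \<integral>\<^sup>+y. ennreal (F ((i, x), y)) \<partial>\<kappa> i x \<partial>\<mu>)"
    using gm by (subst nn_integral_Lam) (auto simp: F_def power2_eq_square ennreal_mult'[OF wt_nonneg])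
  also have "\<dots> = ennreal (\<Sum>i. ?e i)" unfolding e[symmetric] by (rule suminf_ennreal2[OF e0 summ])
  finally have nn: "(\<integral>\<^sup>+z. ennreal ((grad u z)\<^sup>2) \<partial>Lam) = ennreal (\<Sum>i. ?e i)" .
  have gL: "grad u \<in> borel_measurable Lam" by (rule measurable_Lam[OF gm])
  have int: "integrable Lam (\<lambda>z. (grad u z)\<^sup>2)"
    using gL nn by (intro integrableI_nonneg) auto
  then show "grad u \<in> L2 Lam" using gL by (simp add: L2_def)
  have "ennreal (nrg u u) = ennreal (energy \<alpha> \<mu> \<kappa> u u)"
    using nn nn_integral_eq_integral[OF int] by (simp add: nrg_def L2_inner_square energy_def)
  then show "energy \<alpha> \<mu> \<kappa> u u = nrg u u"
    using suminf_nonneg[OF summ e0] nrg_nonneg[of u] by (simp add: energy_def)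
qed

lemma FCN_Dmax:
  assumes "u \<in> FCN N"
  shows "u \<in> Dmax"
proof -
  obtain B where B: "\<And>x. \<bar>u x\<bar> \<le> B" using FCN_bounds[OF assms] by metis
  have 1: "(\<lambda>x. B) \<in> L2 \<mu>" by (simp add: L2_def)
  have 2: "AE x in \<mu>. \<bar>u x\<bar> \<le> \<bar>B\<bar>" 
  proof (rule AE_I2)
    show "\<bar>u x\<bar> \<le> \<bar>B\<bar>" for x using B[of x] by linarith
  qed
  have "u \<in> L2 \<mu>" by (rule L2_bound[OF 1 FCN_measurable[OF assms] 2])
  then show ?thesis using energy_square(1)[OF assms] by (simp add: Dmax_def)
qed

lemma energy_eq:
  assumes u: "u \<in> FCN N" and v: "v \<in> FCN N"
  shows "energy \<alpha> \<mu> \<kappa> u v = nrg u v"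
proof -
  let ?p = "\<lambda>x. 1 * u x + 1 * v x" and ?m = "\<lambda>x. 1 * u x + (-1) * v x"
  have pF: "?p \<in> FCN N" and mF: "?m \<in> FCN N" by (intro FCN_lin u v)+
  have s: "summable (\<lambda>i. energy_i \<alpha> \<mu> \<kappa> i w w)" if "w \<in> FCN N" for w
    by (rule summable_finite[of "{..<N}"]) (auto intro: energy_i_zero[OF that])
  have "4 * energy \<alpha> \<mu> \<kappa> u v = energy \<alpha> \<mu> \<kappa> ?p ?p - energy \<alpha> \<mu> \<kappa> ?m ?m"
  proof -
    have "summable (\<lambda>i. energy_i \<alpha> \<mu> \<kappa> i u v)"
      by (rule summable_finite[of "{..<N}"]) (auto intro: energy_i_zero[OF u])
    then have "4 * energy \<alpha> \<mu> \<kappa> u v = (\<Sum>i. 4 * energy_i \<alpha> \<mu> \<kappa> i u v)"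
      unfolding energy_def by (rule suminf_mult[symmetric])
    also have "\<dots> = energy \<alpha> \<mu> \<kappa> ?p ?p - energy \<alpha> \<mu> \<kappa> ?m ?m"
      unfolding energy_i_polar[OF u v] energy_def by (rule suminf_diff[OF s[OF pF] s[OF mF], symmetric])
    finally show ?thesis .
  qed
  also have "\<dots> = nrg ?p ?p - nrg ?m ?m" using energy_square(2) pF mF by simp
  also have "\<dots> = 4 * nrg u v"
    using L2_inner_square_lin[OF energy_square(1)[OF u] energy_square(1)[OF v], of 1 1]
      L2_inner_square_lin[OF energy_square(1)[OF u] energy_square(1)[OF v], of 1 "-1"]
    unfolding nrg_def grad_lin by simp
  finally show ?thesis by simp
qed

sublocale jump_core \<mu> Lam new old FC0_infinity "energy \<alpha> \<mu> \<kappa>"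
proof
  show "u \<in> Dmax" if "u \<in> FC0_infinity" for u using that FCN_Dmax by (auto simp: FC0_infinity_eq)
  show "energy \<alpha> \<mu> \<kappa> u v = nrg u v" if uv: "u \<in> FC0_infinity" "v \<in> FC0_infinity" for u v
  proof -
    obtain N N' where "u \<in> FCN N" "v \<in> FCN N'" using uv by (auto simp: FC0_infinity_eq)
    then show ?thesis by (intro energy_eq[of _ "max N N'"]) (auto intro: FCN_mono)
  qed
qed (rule FC0_lin)

end

section \<open>Density of smooth cylinder functions\<close>

lemma flat_le_1: "flat 1 t \<le> 1"
  by (simp add: flat_def)

context path_space
begin

definition approximable :: "((nat \<Rightarrow> real) \<Rightarrow> real) \<Rightarrow> bool" where
  "approximable f \<longleftrightarrow> f \<in> L2 \<mu> \<and>
     (\<forall>e>0. \<exists>u\<in>FC0_infinity. L2_inner \<mu> (\<lambda>x. f x - u x) (\<lambda>x. f x - u x) < e)"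

lemma FC0_L2: "u \<in> FC0_infinity \<Longrightarrow> u \<in> L2 \<mu>"
  using D0_Dmax DmaxD(1) by blast

lemma approximableD:
  assumes "approximable f" "e > 0"
  obtains u where "u \<in> FC0_infinity" "L2_inner \<mu> (\<lambda>x. f x - u x) (\<lambda>x. f x - u x) < e"
  using assms unfolding approximable_def by blast

lemma approximable_FC0: "u \<in> FC0_infinity \<Longrightarrow> approximable u"
  unfolding approximable_def using FC0_L2 by (auto intro!: bexI[of _ u] simp: L2_inner_def)

lemma approximable_limit:
  assumes f: "\<And>k. approximable (f k)" and f': "f' \<in> L2 \<mu>"
    and lim: "(\<lambda>k. L2_inner \<mu> (\<lambda>x. f k x - f' x) (\<lambda>x. f k x - f' x)) \<longlonglongrightarrow> 0"
  shows "approximable f'"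
  unfolding approximable_def
proof (intro conjI f' allI impI)
  fix e :: real assume e: "e > 0"
  then have e4: "e / 4 > 0" by simp
  obtain k where k: "L2_inner \<mu> (\<lambda>x. f k x - f' x) (\<lambda>x. f k x - f' x) < e / 4"
    using order_tendstoD(2)[OF lim e4] by (auto simp: eventually_sequentially)
  obtain u where u: "u \<in> FC0_infinity" "L2_inner \<mu> (\<lambda>x. f k x - u x) (\<lambda>x. f k x - u x) < e / 4"
    by (rule approximableD[OF f e4])
  have fL: "f k \<in> L2 \<mu>" using f[of k] by (simp add: approximable_def)
  have "L2_inner \<mu> (\<lambda>x. (f' x - f k x) + (f k x - u x)) (\<lambda>x. (f' x - f k x) + (f k x - u x))
      \<le> 2 * L2_inner \<mu> (\<lambda>x. f' x - f k x) (\<lambda>x. f' x - f k x) + 2 * L2_inner \<mu> (\<lambda>x. f k x - u x) (\<lambda>x. f k x - u x)"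
    by (intro L2_inner_add_square_le L2_diff f' fL FC0_L2 u)
  moreover have "L2_inner \<mu> (\<lambda>x. f' x - f k x) (\<lambda>x. f' x - f k x) = L2_inner \<mu> (\<lambda>x. f k x - f' x) (\<lambda>x. f k x - f' x)"
    by (simp add: L2_inner_square power2_commute)
  ultimately have "L2_inner \<mu> (\<lambda>x. f' x - u x) (\<lambda>x. f' x - u x) < e" using k u(2) by simp
  then show "\<exists>u\<in>FC0_infinity. L2_inner \<mu> (\<lambda>x. f' x - u x) (\<lambda>x. f' x - u x) < e" using u(1) by blast
qed

lemma approximable_scale:
  assumes f: "approximable f"
  shows "approximable (\<lambda>x. s * f x)"
proof -
  have fL: "f \<in> L2 \<mu>" using f by (simp add: approximable_def)
  show ?thesis
    unfolding approximable_def
  proof (intro conjI allI impI L2_scale[OF fL])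
    fix e :: real assume e: "e > 0"
    then have "e / (s\<^sup>2 + 1) > 0" by (simp add: add_nonneg_pos)
    then obtain u where u: "u \<in> FC0_infinity" "L2_inner \<mu> (\<lambda>x. f x - u x) (\<lambda>x. f x - u x) < e / (s\<^sup>2 + 1)"
      by (rule approximableD[OF f])
    have uF: "(\<lambda>x. s * u x + 0 * u x) \<in> FC0_infinity" by (rule FC0_lin[OF u(1) u(1)])
    have "L2_inner \<mu> (\<lambda>x. s * f x - s * u x) (\<lambda>x. s * f x - s * u x) = s\<^sup>2 * L2_inner \<mu> (\<lambda>x. f x - u x) (\<lambda>x. f x - u x)"
      by (simp add: L2_inner_square power_mult_distrib flip: right_diff_distrib)
    also have "\<dots> \<le> (s\<^sup>2 + 1) * L2_inner \<mu> (\<lambda>x. f x - u x) (\<lambda>x. f x - u x)"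
      by (intro mult_right_mono L2_inner_nonneg) simp
    also have "\<dots> < e"
      using u(2) by (simp add: pos_less_divide_eq add_nonneg_pos mult.commute)
    finally show "\<exists>u\<in>FC0_infinity. L2_inner \<mu> (\<lambda>x. s * f x - u x) (\<lambda>x. s * f x - u x) < e"
      using uF by (intro bexI[of _ "\<lambda>x. s * u x + 0 * u x"]) auto
  qed
qed

lemma approximable_add:
  assumes f: "approximable f" and g: "approximable g"
  shows "approximable (\<lambda>x. f x + g x)"
proof -
  have fL: "f \<in> L2 \<mu>" and gL: "g \<in> L2 \<mu>" using f g by (auto simp: approximable_def)
  show ?thesis
    unfolding approximable_def
  proof (intro conjI allI impI L2_add[OF fL gL])
    fix e :: real assume e: "e > 0"
    then have e4: "e / 4 > 0" by simp
    obtain u where u: "u \<in> FC0_infinity" "L2_inner \<mu> (\<lambda>x. f x - u x) (\<lambda>x. f x - u x) < e / 4"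
      by (rule approximableD[OF f e4])
    obtain v where v: "v \<in> FC0_infinity" "L2_inner \<mu> (\<lambda>x. g x - v x) (\<lambda>x. g x - v x) < e / 4"
      by (rule approximableD[OF g e4])
    have uF: "(\<lambda>x. 1 * u x + 1 * v x) \<in> FC0_infinity" by (rule FC0_lin[OF u(1) v(1)])
    have "L2_inner \<mu> (\<lambda>x. (f x - u x) + (g x - v x)) (\<lambda>x. (f x - u x) + (g x - v x))
      \<le> 2 * L2_inner \<mu> (\<lambda>x. f x - u x) (\<lambda>x. f x - u x) + 2 * L2_inner \<mu> (\<lambda>x. g x - v x) (\<lambda>x. g x - v x)"
      by (intro L2_inner_add_square_le L2_diff fL gL FC0_L2 u v)
    also have "\<dots> < e" using u(2) v(2) by simp
    also have "(\<lambda>x. (f x - u x) + (g x - v x)) = (\<lambda>x. f x + g x - (1 * u x + 1 * v x))" by auto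
    finally show "\<exists>u\<in>FC0_infinity. L2_inner \<mu> (\<lambda>x. f x + g x - u x) (\<lambda>x. f x + g x - u x) < e"
      using uF by (intro bexI[of _ "\<lambda>x. 1 * u x + 1 * v x"])
  qed
qed

lemma approximable_zero: "approximable (\<lambda>x. 0)"
  using approximable_FC0[of "\<lambda>x. 0"] zero_FCN[of 0] by (auto simp: FC0_infinity_eq)

lemma approximable_sum:
  "finite A \<Longrightarrow> (\<And>j. j \<in> A \<Longrightarrow> approximable (f j)) \<Longrightarrow> approximable (\<lambda>x. \<Sum>j\<in>A. f j x)"
  by (induction A rule: finite_induct) (simp_all add: approximable_zero approximable_add)

text \<open>Dominated convergence with the constant majorant 1, which lies in \<open>L2\<close> of a
  probability measure.\<close>

lemma approximable_bounded_limit: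
  assumes f: "\<And>k. approximable (f k)" and m: "f' \<in> borel_measurable \<mu>"
    and lim: "AE x in \<mu>. (\<lambda>k. f k x) \<longlonglongrightarrow> f' x" and bd: "\<And>k. AE x in \<mu>. \<bar>f k x\<bar> \<le> 1"
  shows "approximable f'"
proof -
  have one: "(\<lambda>x. 1) \<in> L2 \<mu>" by (simp add: L2_def)
  have fm: "f k \<in> borel_measurable \<mu>" for k using f[of k] by (auto simp: approximable_def L2_def)
  note * = L2_dominated_convergence[where g = "\<lambda>k x. 1" and g' = "\<lambda>x. 1", OF fm m lim one one]
  have "f' \<in> L2 \<mu>" "(\<lambda>k. L2_inner \<mu> (\<lambda>x. f k x - f' x) (\<lambda>x. f k x - f' x)) \<longlonglongrightarrow> 0"
    using * bd by (simp_all add: L2_inner_def)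
  then show ?thesis by (rule approximable_limit[of f, OF f])
qed

text \<open>An intersection-stable generator of \<open>cyl\<close> whose indicators are pointwise
  limits of smooth products.\<close>

definition orthants :: "(nat \<Rightarrow> real) set set" where
  "orthants = {{x \<in> space \<mu>. \<forall>i\<in>J. c i < x i} | J c. finite J}"

lemma orthantsI: "finite J \<Longrightarrow> {x \<in> space \<mu>. \<forall>i\<in>J. c i < x i} \<in> orthants"
  unfolding orthants_def by blast

lemma Int_stable_orthants: "Int_stable orthants"
proof (rule Int_stableI)
  fix X Y assume "X \<in> orthants" "Y \<in> orthants"
  then obtain J c J' c' where X: "X = {x \<in> space \<mu>. \<forall>i\<in>J. c i < x i}" "finite J"
    and Y: "Y = {x \<in> space \<mu>. \<forall>i\<in>J'. c' i < x i}" "finite J'" unfolding orthants_def by blast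
  let ?d = "\<lambda>i. if i \<in> J then if i \<in> J' then max (c i) (c' i) else c i else c' i"
  have "X \<inter> Y = {x \<in> space \<mu>. \<forall>i\<in>J \<union> J'. ?d i < x i}"
    unfolding X(1) Y(1) by (auto split: if_splits)
  also have "\<dots> \<in> orthants" using X(2) Y(2) by (intro orthantsI) simp
  finally show "X \<inter> Y \<in> orthants" .
qed

lemma sets_cyl_orthants: "sets cyl = sigma_sets (space \<mu>) orthants"
proof (rule antisym)
  have Pow: "orthants \<subseteq> Pow (space \<mu>)" unfolding orthants_def by auto
  let ?G = "sigma (space \<mu>) orthants"
  have sp: "space ?G = space \<mu>" and se: "sets ?G = sigma_sets (space \<mu>) orthants" using Pow by auto
  have "(\<lambda>x. x j) \<in> borel_measurable ?G" for j
  proof (subst borel_measurable_iff_greater, intro allI)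
    fix a
    have "{x \<in> space \<mu>. \<forall>i\<in>{j}. a < x i} \<in> orthants" by (rule orthantsI) simp
    then have "{x \<in> space \<mu>. a < x j} \<in> sigma_sets (space \<mu>) orthants" by (intro sigma_sets.Basic) simp
    then show "{x \<in> space ?G. a < x j} \<in> sets ?G" by (simp add: sp se)
  qed
  then have "{x \<in> space \<mu>. x j \<in> A} \<in> sets ?G" if "A \<in> sets borel" for j A
    using measurable_sets[of "\<lambda>x. x j" ?G borel A] that by (simp add: sp vimage_def Int_def conj_commute)
  then show "sets cyl \<subseteq> sigma_sets (space \<mu>) orthants"
  proof -
    have "sigma_sets (space ?G) {{x \<in> space \<mu>. x j \<in> A} | j A. A \<in> sets borel} \<subseteq> sets ?G"
      using \<open>\<And>j A. A \<in> sets borel \<Longrightarrow> {x \<in> space \<mu>. x j \<in> A} \<in> sets ?G\<close>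
      by (intro sets.sigma_sets_subset) auto
    then show ?thesis unfolding sets_cyl sp se .
  qed
  have "{x \<in> space \<mu>. \<forall>i\<in>J. c i < x i} \<in> sets cyl" if "finite J" for J c
  proof -
    have "{x \<in> space cyl. \<forall>i\<in>J. c i < x i} \<in> sets cyl"
      by (rule sets.sets_Collect_finite_All[OF _ that]) (rule borel_measurable_less, auto)
    then show ?thesis by simp
  qed
  then have "orthants \<subseteq> sets cyl" unfolding orthants_def by auto
  then show "sigma_sets (space \<mu>) orthants \<subseteq> sets cyl" using sets.sigma_sets_subset[of orthants cyl] by simp
qed

lemma approximable_orthant:
  assumes J: "finite J"
  shows "approximable (indicator {x \<in> space \<mu>. \<forall>i\<in>J. c i < x i})"
proof -
  let ?X = "{x \<in> space \<mu>. \<forall>i\<in>J. c i < x i}"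
  \<comment> \<open>A cylinder has at least one variable, while \<open>J\<close> may be
    empty.\<close>
  obtain n where n: "J \<subseteq> {..<n}" "n \<ge> 1"
    using finite_nat_bounded[OF J] by (metis Suc_eq_plus1 le_add2 lessThan_subset_iff order_trans le_SucI order_refl)
  \<comment> \<open>The first factor gives compact support and tends to 1. The second is
    exp(-1/((k+1)(t - c_i))) for t > c_i and 0 otherwise, so it tends to the indicator of t >
    c_i.\<close>
  define p where "p k i t = bump (t / (real k + 1)) * (if i \<in> J then flat 1 ((real k + 1) * (t - c i)) else 1)" for k i t
  define f where "f k x = (\<Prod>i<n. p k i (x i))" for k :: nat and x :: "nat \<Rightarrow> real"
  have p01: "0 \<le> p k i t" "p k i t \<le> 1" for k i t
    using bump_nonneg bump_le_1 flat_le_1 flat_1(1) by (auto simp: p_def intro!: mult_le_one)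
  have lin: "smooth (\<lambda>t. a * t + d)" for a d :: real
    by (intro smooth_add smooth_mult smooth_const smooth_ident)
  have psm: "smooth (p k i)" for k i
  proof -
    have 1: "smooth (\<lambda>t. bump ((1 / (real k + 1)) * t + 0))" by (rule smooth_compose[OF smooth_bump lin])
    have 2: "smooth (\<lambda>t. flat 1 ((real k + 1) * t + - ((real k + 1) * c i)))" by (rule smooth_compose[OF smooth_flat lin])
    have "smooth (\<lambda>t. bump ((1 / (real k + 1)) * t + 0) *
        (if i \<in> J then flat 1 ((real k + 1) * t + - ((real k + 1) * c i)) else 1))"
      using smooth_mult[OF 1 2] 1 by (cases "i \<in> J") simp_all
    moreover have "bump ((1 / (real k + 1)) * t + 0) *
        (if i \<in> J then flat 1 ((real k + 1) * t + - ((real k + 1) * c i)) else 1) = p k i t" for t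
      unfolding p_def by (simp only: right_diff_distrib) simp
    ultimately show ?thesis by (simp only:)
  qed
  have supp: "\<bar>t\<bar> \<le> real k + 1" if "p k i t \<noteq> 0" for k i t
  proof -
    have "bump (t / (real k + 1)) \<noteq> 0" using that by (auto simp: p_def)
    then have "\<bar>t / (real k + 1)\<bar> < 1" using bump_eq_0 by force
    then show ?thesis by (simp add: abs_divide divide_less_eq)
  qed
  have plim: "(\<lambda>k. p k i t) \<longlonglongrightarrow> (if i \<in> J then if c i < t then 1 else 0 else 1)" for i t
  proof -
    have inv: "(\<lambda>k. 1 / (real k + 1)) \<longlonglongrightarrow> 0"
      using LIMSEQ_inverse_real_of_nat by (simp add: inverse_eq_divide add.commute)
    have "(\<lambda>k. \<bar>t * (1 / (real k + 1))\<bar>) \<longlonglongrightarrow> \<bar>t * 0\<bar>" by (intro tendsto_intros inv)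
    then have "\<forall>\<^sub>F k in sequentially. \<bar>t * (1 / (real k + 1))\<bar> < 1/2"
      by (rule order_tendstoD) simp
    then have "\<forall>\<^sub>F k in sequentially. bump (t / (real k + 1)) = 1"
      by eventually_elim (intro bump_eq_1, simp)
    then have b: "(\<lambda>k. bump (t / (real k + 1))) \<longlonglongrightarrow> 1" by (rule tendsto_eventually)
    have "(\<lambda>k. if i \<in> J then flat 1 ((real k + 1) * (t - c i)) else 1) \<longlonglongrightarrow> (if i \<in> J then if c i < t then 1 else 0 else 1)"
    proof (cases "i \<in> J \<and> c i < t")
      case True
      have "(\<lambda>k. exp (- (1 / (real k + 1) * (1 / (t - c i))))) \<longlonglongrightarrow> exp (- (0 * (1 / (t - c i))))"
        by (intro tendsto_intros inv)
      moreover have "flat 1 ((real k + 1) * (t - c i)) = exp (- (1 / (real k + 1) * (1 / (t - c i))))" for k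
        using True by (simp add: flat_def)
      ultimately show ?thesis using True by simp
    next
      case False
      then have "flat 1 ((real k + 1) * (t - c i)) = 0" if "i \<in> J" for k
        using that by (simp add: flat_1 mult_le_0_iff)
      then show ?thesis using False by (cases "i \<in> J") simp_all
    qed
    from tendsto_mult[OF b this] show ?thesis by (simp add: p_def)
  qed
  have fF: "f k \<in> FC0_infinity" for k
  proof -
    have "(\<lambda>x. \<Prod>i<n. p k i (x i)) \<in> C0_infinity n"
      by (rule C0_infinity_tensor[where R = "\<lambda>_. real k + 1"]) (auto intro: psm supp)
    from FC0_cylinder[OF this n(2)] show ?thesis by (simp add: f_def[abs_def] trunc_def)
  qed
  show ?thesis
  proof (rule approximable_bounded_limit[OF approximable_FC0[OF fF]])
    have "?X \<in> sets cyl" using orthantsI[OF J, of c] unfolding sets_cyl_orthants by (rule sigma_sets.Basic)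
    then show "indicator ?X \<in> borel_measurable \<mu>" using sets_cyl_subset by auto
    have "(\<lambda>k. f k x) \<longlonglongrightarrow> indicator ?X x" if x: "x \<in> space \<mu>" for x
    proof -
      have "(\<lambda>k. f k x) \<longlonglongrightarrow> (\<Prod>i<n. if i \<in> J then if c i < x i then 1 else 0 else 1)"
        unfolding f_def by (intro tendsto_prod plim)
      also have "(\<Prod>i<n. if i \<in> J then if c i < x i then 1 else 0 else 1) = (indicator ?X x :: real)"
      proof (cases "\<forall>i\<in>J. c i < x i")
        case True
        then have "(\<Prod>i<n. if i \<in> J then if c i < x i then 1 else 0 else 1) = (1::real)" by (intro prod.neutral) auto
        then show ?thesis using True x by simp
      next
        case False
        then obtain i where "i \<in> J" "\<not> c i < x i" by blast
        then show ?thesis using n(1) x by (auto simp: indicator_def intro!: prod_zero bexI[of _ i])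
      qed
      finally show ?thesis .
    qed
    then show "AE x in \<mu>. (\<lambda>k. f k x) \<longlonglongrightarrow> indicator ?X x" by (rule AE_I2)
    have "\<bar>f k x\<bar> \<le> 1" for k x
      unfolding f_def using p01 by (simp add: abs_prod prod_le_1)
    then show "AE x in \<mu>. \<bar>f k x\<bar> \<le> 1" for k by simp
  qed
qed

lemma approximable_cyl:
  assumes "B \<in> sets cyl"
  shows "approximable (indicator B)"
proof -
  have Pow: "orthants \<subseteq> Pow (space \<mu>)" unfolding orthants_def by auto
  have "B \<in> sigma_sets (space \<mu>) orthants" using assms sets_cyl_orthants by simp
  then show ?thesis
  proof (induction rule: sigma_sets_induct_disjoint[OF Int_stable_orthants Pow, consumes 1, case_names basic empty compl union])
    case (basic A)
    then show ?case using approximable_orthant unfolding orthants_def by blast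
  next
    case empty
    then show ?case using approximable_zero by (simp add: indicator_def[abs_def])
  next
    case (compl A)
    \<comment> \<open>The orthant without constraints is the whole space; complements are taken by
      subtraction from its indicator.\<close>
    have "approximable (indicator {x \<in> space \<mu>. \<forall>i\<in>{}. (0::real) < x i})"
      by (rule approximable_orthant[of "{}" "\<lambda>_. 0"]) simp
    then have "approximable (indicator (space \<mu>))" by simp
    from approximable_add[OF this approximable_scale[OF compl.IH, of "-1"]]
    have "approximable (\<lambda>x. indicator (space \<mu>) x + -1 * indicator A x)" .
    moreover have "A \<subseteq> space \<mu>" using compl.hyps sigma_sets_into_sp[OF Pow] by blast
    then have eq: "(\<lambda>x. indicator (space \<mu>) x + -1 * indicator A x) = (indicator (space \<mu> - A) :: _ \<Rightarrow> real)"
      by (auto simp: indicator_def fun_eq_iff)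
    ultimately show ?case unfolding eq by blast
  next
    case (union A)
    let ?f = "\<lambda>n x. \<Sum>i<n. indicator (A i) x :: real"
    have f: "?f n x = indicator (\<Union>i<n. A i) x" for n x
    proof -
      have "(indicator (\<Union>i<n. A i) x :: real) = (\<Sum>i<n. indicator (A i) x)"
        by (rule indicator_UN_disjoint) (use union(1) in \<open>auto simp: disjoint_family_on_def\<close>)
      then show ?thesis by simp
    qed
    show ?case
    proof (rule approximable_bounded_limit[of ?f])
      show "approximable (?f n)" for n by (intro approximable_sum union(3)) simp
      have "A i \<in> sets cyl" for i using union(2) sets_cyl_orthants by auto
      then show "indicator (\<Union>i. A i) \<in> borel_measurable \<mu>" using sets_cyl_subset by (intro borel_measurable_indicator) auto
      have "(\<lambda>n. indicator (\<Union>i<n. A i) x) \<longlonglongrightarrow> (indicator (\<Union>i. A i) x :: real)" for x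
        by (rule LIMSEQ_indicator_UN)
      then show "AE x in \<mu>. (\<lambda>n. ?f n x) \<longlonglongrightarrow> indicator (\<Union>i. A i) x" by (simp add: f)
      have "\<bar>?f n x\<bar> \<le> 1" for n x unfolding f by (simp add: indicator_def)
      then show "AE x in \<mu>. \<bar>?f n x\<bar> \<le> 1" for n by (rule AE_I2)
    qed
  qed
qed

text \<open>\<open>B\<close> agrees on \<open>boxU\<close>, hence almost everywhere, with a cylinder
  set \<open>B'\<close>; the constant sequence of the indicator of \<open>B'\<close> is fed into the
  limit lemma.\<close>

lemma approximable_indicator:
  assumes B: "B \<in> sets \<mu>"
  shows "approximable (indicator B)"
proof -
  obtain B' where B': "B' \<in> sets cyl" "B \<inter> boxU = B' \<inter> boxU" using sets_mu_cyl[OF B] by blast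
  show ?thesis
  proof (rule approximable_bounded_limit[OF approximable_cyl[OF B'(1)]])
    show "indicator B \<in> borel_measurable \<mu>" using B by simp
    show "AE x in \<mu>. (\<lambda>k. indicator B' x) \<longlonglongrightarrow> (indicator B x :: real)"
      using AE_boxU
    proof eventually_elim
      case (elim x)
      then have "x \<in> B \<longleftrightarrow> x \<in> B'" using B'(2) by blast
      then show ?case by (simp add: indicator_def)
    qed
  qed (simp add: indicator_def)
qed

lemma approximable_L2:
  assumes f: "f \<in> L2 \<mu>"
  shows "approximable f"
proof -
  obtain F where F: "\<And>i. simple_function \<mu> (F i)" "\<And>x. x \<in> space \<mu> \<Longrightarrow> (\<lambda>i. F i x) \<longlonglongrightarrow> f x"
    "\<And>i x. x \<in> space \<mu> \<Longrightarrow> dist (F i x) 0 \<le> 2 * dist (f x) 0"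
    using borel_measurable_implies_sequence_metric[OF L2_measurable[OF f], of 0] by blast
  have s: "approximable (F i)" for i
  proof -
    define G where "G y x = y * indicator (F i -` {y} \<inter> space \<mu>) x" for y x :: _
    define g where "g x = (\<Sum>y\<in>F i ` space \<mu>. G y x)" for x
    have fin: "finite (F i ` space \<mu>)" by (rule simple_functionD(1)[OF F(1)])
    have "F i -` {y} \<inter> space \<mu> \<in> sets \<mu>" for y by (rule simple_functionD(2)[OF F(1)])
    then have "approximable (G y)" for y
      unfolding G_def[abs_def] by (intro approximable_scale[OF approximable_indicator])
    then have g: "approximable g" unfolding g_def[abs_def] by (intro approximable_sum[OF fin])
    show ?thesis
    \<comment> \<open>\<open>g\<close> and \<open>F i\<close> agree only on the space of \<mu>, so
      \<open>g\<close> is used as a constant sequence with \<open>L2\<close> limit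
      \<open>F i\<close>.\<close>
    proof (rule approximable_limit[where f = "\<lambda>_. g"])
      show "approximable g" by (rule g)
      have eq: "g x = F i x" if "x \<in> space \<mu>" for x
        unfolding simple_function_indicator_representation_banach[OF F(1) that, of i] g_def G_def
        by (rule sum.cong[OF refl]) (simp only: real_scaleR_def, rule mult.commute)
      show "F i \<in> L2 \<mu>"
        by (rule L2_bound[OF L2_scale[OF f, of 2] borel_measurable_simple_function[OF F(1)]])
           (use F(3) in \<open>auto simp: dist_real_def abs_mult intro!: AE_I2\<close>)
      show "(\<lambda>k. L2_inner \<mu> (\<lambda>x. g x - F i x) (\<lambda>x. g x - F i x)) \<longlonglongrightarrow> 0"
        using eq unfolding L2_inner_def by (simp cong: Bochner_Integration.integral_cong)
    qed
  qed
  show ?thesis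
  proof (rule approximable_limit[of F, OF s f])
    have m: "F k \<in> borel_measurable \<mu>" for k by (rule borel_measurable_simple_function[OF F(1)])
    have g: "(\<lambda>x. 2 * f x) \<in> L2 \<mu>" by (rule L2_scale[OF f])
    have "(\<lambda>k. L2_inner \<mu> (\<lambda>x. F k x - f x) (\<lambda>x. F k x - f x)) \<longlonglongrightarrow> 0"
    proof (rule L2_dominated_convergence(2)[where g = "\<lambda>k x. 2 * f x" and g' = "\<lambda>x. 2 * f x", OF m L2_measurable[OF f] _ g g])
      show "AE x in \<mu>. (\<lambda>k. F k x) \<longlonglongrightarrow> f x" using F(2) by (rule AE_I2)
      show "AE x in \<mu>. \<bar>F k x\<bar> \<le> \<bar>2 * f x\<bar>" for k
        using F(3) by (intro AE_I2) (simp add: dist_real_def abs_mult)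
    qed (simp_all add: L2_inner_def)
    then show "(\<lambda>k. L2_inner \<mu> (\<lambda>x. F k x - f x) (\<lambda>x. F k x - f x)) \<longlonglongrightarrow> 0" .
  qed
qed

lemma FC0_dense:
  assumes "f \<in> L2 \<mu>" "e > 0"
  shows "\<exists>u\<in>FC0_infinity. L2_norm \<mu> (\<lambda>x. f x - u x) < e"
proof -
  obtain u where "u \<in> FC0_infinity" "L2_inner \<mu> (\<lambda>x. f x - u x) (\<lambda>x. f x - u x) < e\<^sup>2"
    using approximable_L2[OF assms(1)] assms(2) unfolding approximable_def by (meson zero_less_power)
  then show ?thesis
    using assms(2) by (intro bexI[of _ u]) (auto simp: L2_norm_def intro: real_less_lsqrt)
qed

end

section \<open>Cutoff functions\<close>

context path_space
begin

text \<open>The bump leaves the value 1 only beyond half its scale, so scale/2 \<ge> M0 b_i is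
  wanted for every k; the summand 1 makes the factor positive.\<close>

definition k0 :: nat where "k0 = nat \<lceil>2 * M0\<rceil> + 1"

definition scale :: "nat \<Rightarrow> nat \<Rightarrow> real" where "scale k i = real (k + k0) * b i"

definition cut :: "nat \<Rightarrow> nat \<Rightarrow> (nat \<Rightarrow> real) \<Rightarrow> real" where
  "cut k n x = (\<Prod>i<n. bump (x i / scale k i))"

text \<open>The infinite product. The finite products decrease and are nonnegative, so the limit
  exists. It depends on all coordinates and is reached only through the closure.\<close>

definition chi :: "nat \<Rightarrow> (nat \<Rightarrow> real) \<Rightarrow> real" where
  "chi k x = lim (\<lambda>n. cut k n x)"

text \<open>The increment of the one factor affected by a jump. The other factors are unchanged and
  lie in [0, 1], so \<open>gk k\<close> dominates the increments of \<open>cut k n\<close> for all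
  n, and of \<open>chi k\<close>.\<close>

definition gk :: "nat \<Rightarrow> (nat \<times> (nat \<Rightarrow> real)) \<times> real \<Rightarrow> real" where
  "gk k z = bump (snd z / scale k (fst (fst z))) - bump (old z (fst (fst z)) / scale k (fst (fst z)))"

lemma k0: "2 * M0 \<le> real (k + k0)" "0 < real (k + k0)"
proof -
  have "2 * M0 \<le> real (nat \<lceil>2 * M0\<rceil>)" by (rule real_nat_ceiling_ge)
  then show "2 * M0 \<le> real (k + k0)" by (simp add: k0_def)
  show "0 < real (k + k0)" by (simp add: k0_def)
qed

lemma scale_pos: "scale k i > 0"
  unfolding scale_def by (intro mult_pos_pos k0 b_pos)

lemma cut_01: "0 \<le> cut k n x" "cut k n x \<le> 1"
  unfolding cut_def using bump_nonneg bump_le_1 by (auto intro!: prod_nonneg prod_le_1)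

lemma cut_decseq: "decseq (\<lambda>n. cut k n x)"
proof (rule decseq_SucI)
  show "cut k (Suc n) x \<le> cut k n x" for n
    using mult_left_le[OF bump_le_1[of "x n / scale k n"] cut_01(1)[of k n x]] by (simp add: cut_def)
qed

lemma cut_tendsto: "(\<lambda>n. cut k n x) \<longlonglongrightarrow> chi k x"
proof -
  obtain l where "(\<lambda>n. cut k n x) \<longlonglongrightarrow> l" "\<forall>n. l \<le> cut k n x"
    by (rule decseq_convergent[OF cut_decseq allI[OF cut_01(1)]])
  then show ?thesis unfolding chi_def by (simp add: limI)
qed

lemma chi_01: "0 \<le> chi k x" "chi k x \<le> 1"
  by (rule LIMSEQ_le_const[OF cut_tendsto], simp add: cut_01, rule LIMSEQ_le_const2[OF cut_tendsto], simp add: cut_01)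

lemma chi_off_box:
  assumes "x \<notin> box (k + k0)"
  shows "chi k x = 0"
proof -
  obtain i where i: "\<not> \<bar>x i\<bar> \<le> scale k i" using assms by (auto simp: box_def scale_def)
  have "1 \<le> \<bar>x i / scale k i\<bar>" using i scale_pos[of k i] by (simp add: abs_divide pos_le_divide_eq)
  then have "bump (x i / scale k i) = 0" by (rule bump_eq_0)
  then have "cut k n x = 0" if "n \<ge> Suc i" for n
    unfolding cut_def using that by (intro prod_zero bexI[of _ i]) auto
  then have "\<forall>\<^sub>F n in sequentially. cut k n x = 0" unfolding eventually_sequentially by blast
  then have "(\<lambda>n. cut k n x) \<longlonglongrightarrow> 0" by (rule tendsto_eventually)
  then show ?thesis by (rule LIMSEQ_unique[OF cut_tendsto])
qed

lemma chi_on_box: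
  assumes "x \<in> box m" "2 * m \<le> k"
  shows "chi k x = 1"
proof -
  have "bump (x i / scale k i) = 1" for i
  proof (rule bump_eq_1)
    have "\<bar>x i\<bar> \<le> real m * b i" using assms(1) by (simp add: box_def)
    also have "\<dots> \<le> (1/2 * real (k + k0)) * b i"
      using assms(2) b_pos[of i] by (intro mult_right_mono) auto
    finally have "\<bar>x i\<bar> \<le> 1/2 * scale k i" by (simp add: scale_def)
    then show "\<bar>x i / scale k i\<bar> \<le> 1/2" using scale_pos[of k i] by (simp add: abs_divide pos_divide_le_eq)
  qed
  then have "cut k n x = 1" for n by (simp add: cut_def)
  then show ?thesis using cut_tendsto[of k x] LIMSEQ_unique[OF _ tendsto_const] by simp
qed

lemma chi_tendsto: "x \<in> boxU \<Longrightarrow> (\<lambda>k. chi k x) \<longlonglongrightarrow> 1"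
proof -
  assume "x \<in> boxU"
  then obtain m where "x \<in> box m" by (auto simp: boxU_def)
  then have "\<forall>\<^sub>F k in sequentially. chi k x = 1"
    using chi_on_box unfolding eventually_sequentially by blast
  then show ?thesis by (rule tendsto_eventually)
qed

lemma grad_cut: "\<bar>grad (cut k n) z\<bar> \<le> \<bar>gk k z\<bar>"
proof -
  let ?i = "fst (fst z)"
  let ?B = "\<lambda>x j. bump (x j / scale k j)"
  have same: "new z j = old z j" if "j \<noteq> ?i" for j using that by (simp add: new_def old_def)
  show ?thesis
  proof (cases "?i < n")
    case True
    let ?R = "\<Prod>j\<in>{..<n} - {?i}. ?B (old z) j"
    have "cut k n x = ?B x ?i * (\<Prod>j\<in>{..<n} - {?i}. ?B x j)" for x
      unfolding cut_def using True by (intro prod.remove) auto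
    moreover have "(\<Prod>j\<in>{..<n} - {?i}. ?B (new z) j) = ?R"
      by (intro prod.cong) (auto simp: same)
    moreover have "new z ?i = snd z" by (simp add: new_def)
    ultimately have "grad (cut k n) z = gk k z * ?R" by (simp add: grad_def gk_def left_diff_distrib)
    moreover have "\<bar>?R\<bar> \<le> 1" using bump_nonneg bump_le_1 by (simp add: abs_prod prod_le_1)
    ultimately show ?thesis using mult_left_le[of "\<bar>?R\<bar>" "\<bar>gk k z\<bar>"] by (simp add: abs_mult)
  next
    case False
    then have "cut k n (new z) = cut k n (old z)" unfolding cut_def by (intro prod.cong) (auto simp: same)
    then show ?thesis by (simp add: grad_def)
  qed
qed

lemma grad_chi: "\<bar>grad (chi k) z\<bar> \<le> \<bar>gk k z\<bar>"
proof (rule LIMSEQ_le_const2)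
  show "(\<lambda>n. \<bar>grad (cut k n) z\<bar>) \<longlonglongrightarrow> \<bar>grad (chi k) z\<bar>"
    unfolding grad_def by (intro tendsto_intros cut_tendsto)
qed (use grad_cut in blast)

lemma gk_tendsto: "(\<lambda>k. gk k z) \<longlonglongrightarrow> 0"
proof -
  let ?i = "fst (fst z)"
  have "(\<lambda>k. bump (t / scale k ?i)) \<longlonglongrightarrow> 1" for t
  proof (rule tendsto_eventually)
    have "filterlim (\<lambda>k. real (k + k0)) at_top sequentially"
      by (intro filterlim_compose[OF filterlim_real_sequentially] filterlim_add_const_nat_at_top)
    then have "filterlim (\<lambda>k. scale k ?i) at_top sequentially"
      unfolding scale_def using b_pos by (intro filterlim_at_top_mult_tendsto_pos[of "\<lambda>k. b ?i" "b ?i"]) (auto simp: mult.commute)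
    then have "\<forall>\<^sub>F k in sequentially. 2 * \<bar>t\<bar> \<le> scale k ?i" by (simp add: filterlim_at_top)
    then show "\<forall>\<^sub>F k in sequentially. bump (t / scale k ?i) = 1"
    proof eventually_elim
      case (elim k)
      then show ?case using scale_pos[of k ?i]
        by (intro bump_eq_1) (simp add: abs_divide pos_divide_le_eq)
    qed
  qed
  from tendsto_diff[OF this this] show ?thesis by (simp add: gk_def)
qed

lemma gk_measurable: "gk k \<in> borel_measurable Z"
proof -
  have [measurable]: "bump \<in> borel_measurable borel"
    using smooth_bump sm_continuous[of 0 bump] unfolding smooth_def
    by (intro borel_measurable_continuous_onI) blast
  have [measurable]: "(\<lambda>z. scale k (fst (fst z))) \<in> borel_measurable Z"
    by (rule measurable_compose[OF Z_measurable_projections(1)]) simp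
  show ?thesis unfolding gk_def[abs_def] by measurable
qed

text \<open>The resampled value and the old value both have the law of X_i, whence the factor
  2.\<close>

lemma energy_tail:
  assumes c: "c > 0"
  shows "(\<integral>\<^sup>+x. \<integral>\<^sup>+y. (if \<bar>y\<bar> > c then 1 else 0) + (if \<bar>x i\<bar> > c then 1 else 0) \<partial>\<kappa> i x \<partial>\<mu>)
    = 2 * emeasure \<mu> {x \<in> space \<mu>. \<bar>x i\<bar> > c}"
proof -
  let ?A = "{y::real. \<bar>y\<bar> > c}"
  have A: "?A \<in> sets borel" by measurable
  have meas: "{x \<in> space \<mu>. \<bar>x i\<bar> > c} \<in> sets \<mu>" by measurable
  have "(\<integral>\<^sup>+y. (if \<bar>y\<bar> > c then 1 else 0) + (if \<bar>x i\<bar> > c then 1 else 0) \<partial>\<kappa> i x) =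
      emeasure (\<kappa> i x) ?A + indicator {x \<in> space \<mu>. \<bar>x i\<bar> > c} x" if x: "x \<in> space \<mu>" for x
  proof -
    interpret k: prob_space "\<kappa> i x" using kernel_prob[OF x] by simp
    have A': "?A \<in> sets (\<kappa> i x)" using A kernel_prob[OF x] by simp
    have "(\<integral>\<^sup>+y. (if \<bar>y\<bar> > c then 1 else 0) + (if \<bar>x i\<bar> > c then 1 else 0) \<partial>\<kappa> i x) =
      (\<integral>\<^sup>+y. indicator ?A y + (if \<bar>x i\<bar> > c then 1 else 0) \<partial>\<kappa> i x)"
      by (intro nn_integral_cong) (simp add: indicator_def)
    also have "\<dots> = emeasure (\<kappa> i x) ?A + (if \<bar>x i\<bar> > c then 1 else 0)"
      using A' by (subst nn_integral_add) (auto simp: k.emeasure_space_1)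
    finally show ?thesis using x by (simp add: indicator_def)
  qed
  then have "(\<integral>\<^sup>+x. \<integral>\<^sup>+y. (if \<bar>y\<bar> > c then 1 else 0) + (if \<bar>x i\<bar> > c then 1 else 0) \<partial>\<kappa> i x \<partial>\<mu>) =
      (\<integral>\<^sup>+x. emeasure (\<kappa> i x) ?A + indicator {x \<in> space \<mu>. \<bar>x i\<bar> > c} x \<partial>\<mu>)"
    by (rule nn_integral_cong)
  also have "\<dots> = (\<integral>\<^sup>+x. emeasure (\<kappa> i x) ?A \<partial>\<mu>) + emeasure \<mu> {x \<in> space \<mu>. \<bar>x i\<bar> > c}"
    using meas measurable_compose[OF kernel_measurable measurable_emeasure_subprob_algebra[OF A]]
    by (subst nn_integral_add) auto
  also have "(\<integral>\<^sup>+x. emeasure (\<kappa> i x) ?A \<partial>\<mu>) = (\<integral>\<^sup>+x. emeasure (\<kappa> i x) ?A * indicator (space \<mu>) x \<partial>\<mu>)"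
    by (intro nn_integral_cong) simp
  also have "\<dots> = emeasure \<mu> {x \<in> space \<mu>. \<bar>x i\<bar> > c}"
    by (subst kernel_emeasure[OF A]) (auto intro!: arg_cong[where f = "emeasure \<mu>"])
  finally show ?thesis by (simp add: mult_2)
qed

text \<open>The energy is paid only by jumps with one end in a tail of X_i. There the weighted
  square is at most L^2 scale^(-(\<alpha>+1)); the tail masses are summed over i by
  \<open>tails\<close>, and the factor (k + k0)^(-(\<alpha>+1)) comes out.\<close>

lemma gk_energy: obtains C where "C \<ge> 0" "\<And>k. gk k \<in> L2 Lam"
  "\<And>k. L2_inner Lam (gk k) (gk k) \<le> C * real (k + k0) powr (- (\<alpha> + 1))"
proof -
  obtain L where L: "L \<ge> 1" "\<And>s t. \<bar>bump s - bump t\<bar> \<le> L * \<bar>s - t\<bar>" using bump_Lipschitz by metis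
  define T where "T i = b i powr (- (\<alpha> + 1)) * measure \<mu> {x \<in> space \<mu>. \<bar>x i\<bar> > M0 * b i}" for i
  have T0: "0 \<le> T i" for i by (simp add: T_def)
  have Tsum: "summable T" unfolding T_def using tails .
  define C where "C = 2 * L\<^sup>2 * (\<Sum>i. T i)"
  have C: "C \<ge> 0" using suminf_nonneg[OF Tsum T0] by (simp add: C_def)
  \<comment> \<open>If neither value exceeds half the scale, both bumps are 1 and
    \<open>gk k z\<close> vanishes. Otherwise |gk| \<le> L min(1, gap/scale) and
    \<open>wt_le\<close> applies.\<close>
  have pt: "wt z * (gk k z)\<^sup>2 \<le> L\<^sup>2 * scale k (fst (fst z)) powr (- (\<alpha> + 1)) *
      ((if \<bar>snd z\<bar> > scale k (fst (fst z)) / 2 then 1 else 0) + (if \<bar>old z (fst (fst z))\<bar> > scale k (fst (fst z)) / 2 then 1 else 0))"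
    (is "_ \<le> _ * ?I") for k z
  proof (cases "?I = 0")
    case True
    let ?c = "scale k (fst (fst z))"
    have "\<bar>snd z\<bar> \<le> ?c / 2" "\<bar>old z (fst (fst z))\<bar> \<le> ?c / 2" using True by (auto split: if_splits)
    then have "\<bar>snd z / ?c\<bar> \<le> 1/2" "\<bar>old z (fst (fst z)) / ?c\<bar> \<le> 1/2"
      using scale_pos[of k "fst (fst z)"] by (auto simp: abs_divide pos_divide_le_eq)
    then have "gk k z = 0" by (simp add: gk_def bump_eq_1)
    then show ?thesis using True by simp
  next
    case False
    let ?c = "scale k (fst (fst z))"
    have I: "1 \<le> ?I" using False by (auto split: if_splits)
    have "\<bar>snd z / ?c - old z (fst (fst z)) / ?c\<bar> = gap z / ?c"
      using scale_pos[of k "fst (fst z)"] by (simp add: gap_def flip: diff_divide_distrib)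
    then have 1: "\<bar>gk k z\<bar> \<le> L * (gap z / ?c)"
      unfolding gk_def using L(2)[of "snd z / ?c" "old z (fst (fst z)) / ?c"] by simp
    have 2: "\<bar>gk k z\<bar> \<le> L"
      unfolding gk_def using L(1) bump_nonneg[of "snd z / ?c"] bump_le_1[of "snd z / ?c"]
        bump_nonneg[of "old z (fst (fst z)) / ?c"] bump_le_1[of "old z (fst (fst z)) / ?c"] by linarith
    have "\<bar>gk k z\<bar> \<le> L * min 1 (gap z / ?c)" using 1 2 by (simp add: min_def)
    then have "\<bar>gk k z\<bar>\<^sup>2 \<le> (L * min 1 (gap z / ?c))\<^sup>2" by (intro power_mono) auto
    then have "wt z * (gk k z)\<^sup>2 \<le> wt z * (L\<^sup>2 * (min 1 (gap z / ?c))\<^sup>2)"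
      by (intro mult_left_mono wt_nonneg) (simp add: power_mult_distrib)
    also have "\<dots> = L\<^sup>2 * (wt z * (min 1 (gap z / ?c))\<^sup>2)" by simp
    also have "\<dots> \<le> L\<^sup>2 * ?c powr (- (\<alpha> + 1))" by (intro mult_left_mono wt_le scale_pos) simp
    also have "\<dots> \<le> L\<^sup>2 * ?c powr (- (\<alpha> + 1)) * ?I"
      using mult_left_mono[OF I, of "L\<^sup>2 * ?c powr (- (\<alpha> + 1))"] by simp
    finally show ?thesis .
  qed
  have nn: "(\<integral>\<^sup>+z. ennreal ((gk k z)\<^sup>2) \<partial>Lam) \<le> ennreal (C * real (k + k0) powr (- (\<alpha> + 1)))" for k
  proof -
    let ?K = "real (k + k0)"
    have m: "(\<lambda>z. ennreal ((gk k z)\<^sup>2)) \<in> borel_measurable Z" using gk_measurable[of k] by measurable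
    have tm: "(\<integral>\<^sup>+x. \<integral>\<^sup>+y. ennreal (wt ((i, x), y)) * ennreal ((gk k ((i, x), y))\<^sup>2) \<partial>\<kappa> i x \<partial>\<mu>)
        \<le> ennreal (2 * L\<^sup>2 * ?K powr (- (\<alpha> + 1)) * T i)" for i
    proof -
      let ?c = "scale k i" and ?d = "L\<^sup>2 * scale k i powr (- (\<alpha> + 1))"
      let ?J = "\<lambda>x y. (if \<bar>y\<bar> > ?c / 2 then 1 else 0) + (if \<bar>x i\<bar> > ?c / 2 then 1 else 0)"
      have "(\<integral>\<^sup>+x. \<integral>\<^sup>+y. ennreal (wt ((i, x), y)) * ennreal ((gk k ((i, x), y))\<^sup>2) \<partial>\<kappa> i x \<partial>\<mu>)
          \<le> (\<integral>\<^sup>+x. \<integral>\<^sup>+y. ennreal ?d * ?J x y \<partial>\<kappa> i x \<partial>\<mu>)"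
      proof (intro nn_integral_mono)
        fix x y
        have "ennreal (wt ((i, x), y)) * ennreal ((gk k ((i, x), y))\<^sup>2) = ennreal (wt ((i, x), y) * (gk k ((i, x), y))\<^sup>2)"
          by (simp add: ennreal_mult wt_nonneg)
        also have "\<dots> \<le> ennreal (?d * ?J x y)"
          using pt[of "((i, x), y)" k] by (intro ennreal_leI) (simp add: old_def)
        also have "\<dots> = ennreal ?d * ?J x y" by (auto simp: ennreal_mult)
        finally show "ennreal (wt ((i, x), y)) * ennreal ((gk k ((i, x), y))\<^sup>2) \<le> ennreal ?d * ?J x y" .
      qed
      also have "\<dots> = (\<integral>\<^sup>+x. ennreal ?d * (\<integral>\<^sup>+y. ?J x y \<partial>\<kappa> i x) \<partial>\<mu>)"
        using kernel_prob by (intro nn_integral_cong nn_integral_cmult) (auto cong: measurable_cong_sets)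
      also have "\<dots> = ennreal ?d * (\<integral>\<^sup>+x. \<integral>\<^sup>+y. ?J x y \<partial>\<kappa> i x \<partial>\<mu>)"
      proof (rule nn_integral_cmult)
        show "(\<lambda>x. \<integral>\<^sup>+y. ?J x y \<partial>\<kappa> i x) \<in> borel_measurable \<mu>"
          by (rule nn_integral_measurable_subprob_algebra2[OF _ kernel_measurable]) measurable
      qed
      also have "\<dots> = ennreal ?d * (2 * emeasure \<mu> {x \<in> space \<mu>. \<bar>x i\<bar> > ?c / 2})"
        using scale_pos[of k i] by (subst energy_tail) auto
      also have "\<dots> \<le> ennreal ?d * (2 * emeasure \<mu> {x \<in> space \<mu>. \<bar>x i\<bar> > M0 * b i})"
      proof (intro mult_left_mono emeasure_mono)
        have "M0 * b i \<le> ?c / 2"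
          using mult_right_mono[OF k0(1)[of k] less_imp_le[OF b_pos[of i]]] by (simp add: scale_def)
        then show "{x \<in> space \<mu>. \<bar>x i\<bar> > ?c / 2} \<subseteq> {x \<in> space \<mu>. \<bar>x i\<bar> > M0 * b i}" by auto
      qed auto
      also have "\<dots> = ennreal (?d * (2 * measure \<mu> {x \<in> space \<mu>. \<bar>x i\<bar> > M0 * b i}))"
        by (simp add: emeasure_eq_measure ennreal_mult)
      also have "?d * (2 * measure \<mu> {x \<in> space \<mu>. \<bar>x i\<bar> > M0 * b i}) = 2 * L\<^sup>2 * ?K powr (- (\<alpha> + 1)) * T i"
        using k0(2)[of k] b_pos[of i] by (simp add: T_def scale_def powr_mult)
      finally show ?thesis .
    qed
    have "(\<integral>\<^sup>+z. ennreal ((gk k z)\<^sup>2) \<partial>Lam) \<le> (\<Sum>i. ennreal (2 * L\<^sup>2 * ?K powr (- (\<alpha> + 1)) * T i))"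
      unfolding nn_integral_Lam[OF m] by (intro suminf_le tm) auto
    also have "\<dots> = ennreal (\<Sum>i. 2 * L\<^sup>2 * ?K powr (- (\<alpha> + 1)) * T i)"
      using T0 Tsum by (intro suminf_ennreal2 summable_mult) auto
    also have "(\<Sum>i. 2 * L\<^sup>2 * ?K powr (- (\<alpha> + 1)) * T i) = C * ?K powr (- (\<alpha> + 1))"
      using suminf_mult[OF Tsum, of "2 * L\<^sup>2 * ?K powr (- (\<alpha> + 1))"] by (simp add: C_def)
    finally show ?thesis .
  qed
  have m: "gk k \<in> borel_measurable Lam" for k by (rule measurable_Lam[OF gk_measurable])
  have int: "integrable Lam (\<lambda>z. (gk k z)\<^sup>2)" for k
    using m[of k] nn[of k] by (intro integrableI_nonneg) (auto simp: less_top[symmetric] top_unique)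
  show ?thesis
  proof (rule that[OF C])
    show "gk k \<in> L2 Lam" for k using m int by (simp add: L2_def)
    fix k
    have "ennreal (\<integral>z. (gk k z)\<^sup>2 \<partial>Lam) \<le> ennreal (C * real (k + k0) powr (- (\<alpha> + 1)))"
      using nn[of k] nn_integral_eq_integral[OF int[of k]] by simp
    then show "L2_inner Lam (gk k) (gk k) \<le> C * real (k + k0) powr (- (\<alpha> + 1))"
      using C by (simp add: L2_inner_square)
  qed
qed

lemma gk_L2: "gk k \<in> L2 Lam"
  by (rule gk_energy) blast

lemma gk_L2_tendsto: "(\<lambda>k. L2_inner Lam (gk k) (gk k)) \<longlonglongrightarrow> 0"
proof -
  obtain C where C: "\<And>k. L2_inner Lam (gk k) (gk k) \<le> C * real (k + k0) powr (- (\<alpha> + 1))"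
    by (rule gk_energy) blast
  have "filterlim (\<lambda>k. real (k + k0)) at_top sequentially"
    by (intro filterlim_compose[OF filterlim_real_sequentially] filterlim_add_const_nat_at_top)
  then have "(\<lambda>k. real (k + k0) powr (- (\<alpha> + 1))) \<longlonglongrightarrow> 0" using alpha by (intro tendsto_neg_powr) auto
  then have "(\<lambda>k. C * real (k + k0) powr (- (\<alpha> + 1))) \<longlonglongrightarrow> 0" by (rule tendsto_mult_right_zero)
  then show ?thesis
    by (rule Lim_null_comparison[rotated]) (use C in \<open>simp add: L2_inner_nonneg always_eventually\<close>)
qed

section \<open>Cutoffs in the domain\<close>

lemma tensor_C0:
  assumes "\<And>i. smooth (p i)"
  shows "(\<lambda>x. \<Prod>i<n. bump (x i / scale k i) * p i (x i)) \<in> C0_infinity n"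
proof (rule C0_infinity_tensor[where R = "scale k" and p = "\<lambda>i t. bump (t / scale k i) * p i t"])
  show "smooth (\<lambda>t. bump (t / scale k i) * p i t)" for i
  proof -
    have "smooth (\<lambda>t. bump ((1 / scale k i) * t))"
      by (rule smooth_compose[OF smooth_bump smooth_mult[OF smooth_const smooth_ident]])
    then show ?thesis using assms by (intro smooth_mult) simp_all
  qed
  show "\<bar>t\<bar> \<le> scale k i" if "bump (t / scale k i) * p i t \<noteq> 0" for i t
  proof -
    have "\<bar>t / scale k i\<bar> < 1" using that bump_eq_0[of "t / scale k i"] by force
    then show ?thesis using scale_pos[of k i] by (simp add: abs_divide pos_divide_less_eq)
  qed
qed

lemma cut_C0: "cut k n \<in> C0_infinity n"
  using tensor_C0[of "\<lambda>i t. 1" k n] smooth_const by (simp add: cut_def[abs_def])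

lemma cut_trunc: "cut k n (trunc n x) = cut k n x"
  by (simp add: cut_def trunc_def)

lemma cut_FC0: "n \<ge> 1 \<Longrightarrow> cut k n \<in> FC0_infinity"
  using FC0_cylinder[OF cut_C0, of n k] by (simp add: cut_trunc)

lemma cut_mult_FC0:
  assumes "w \<in> FCN N"
  shows "(\<lambda>x. w x * cut k (n + N + 1) x) \<in> FC0_infinity"
  using FC0_mult_tensor[OF assms cut_C0, of "n + N + 1" k] by (simp add: cut_trunc)

lemma chi_measurable: "chi k \<in> borel_measurable \<mu>"
proof (rule borel_measurable_LIMSEQ_real[where u = "\<lambda>n. cut k (Suc n)"])
  show "(\<lambda>n. cut k (Suc n) x) \<longlonglongrightarrow> chi k x" for x by (rule LIMSEQ_Suc[OF cut_tendsto])
  show "cut k (Suc n) \<in> borel_measurable \<mu>" for n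
    using DmaxD(3)[OF D0_Dmax[OF cut_FC0[of "Suc n" k]]] by simp
qed

lemma const_L2: "(\<lambda>x. c) \<in> L2 \<mu>"
  by (simp add: L2_def)

text \<open>By the product rule the increment of w h is grad w h(new) + w(old) grad h, so |grad w| +
  B |gk k| is a majorant. It is fixed as n grows and, as k grows, converges in \<open>L2\<close> to
  |grad w|.\<close>

lemma chi_mult_D:
  assumes w: "w \<in> FCN N"
  shows "(\<lambda>x. w x * chi k x) \<in> D" and "nconv (\<lambda>k x. w x * chi k x) w"
proof -
  obtain B where B: "\<And>x. \<bar>w x\<bar> \<le> B" using FCN_bounds[OF w] by metis
  note wL = DmaxD[OF FCN_Dmax[OF w]]
  have G: "(\<lambda>z. 1 * \<bar>grad w z\<bar> + B * \<bar>gk k z\<bar>) \<in> L2 Lam" for k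
  proof (rule L2_lin)
    show "(\<lambda>z. \<bar>grad w z\<bar>) \<in> L2 Lam"
      by (rule L2_bound[OF wL(2)]) (use L2_measurable[OF wL(2)] in auto)
    show "(\<lambda>z. \<bar>gk k z\<bar>) \<in> L2 Lam"
      by (rule L2_bound[OF gk_L2]) (use L2_measurable[OF gk_L2] in auto)
  qed
  have B0: "0 \<le> B" using B[of undefined] by linarith
  have bdM: "\<bar>w x * t\<bar> \<le> \<bar>B\<bar>" if "0 \<le> t" "t \<le> 1" for x t
    using mult_mono[OF B[of x], of t 1] that B0 by (simp add: abs_mult)
  have bdG: "\<bar>grad (\<lambda>x. w x * h x) z\<bar> \<le> \<bar>1 * \<bar>grad w z\<bar> + B * \<bar>gk k z\<bar>\<bar>"
    if h: "\<And>x. 0 \<le> h x" "\<And>x. h x \<le> 1" "\<bar>grad h z\<bar> \<le> \<bar>gk k z\<bar>" for h k z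
  proof -
    have "grad (\<lambda>x. w x * h x) z = grad w z * h (new z) + w (old z) * grad h z"
      by (simp add: grad_def algebra_simps)
    then have "\<bar>grad (\<lambda>x. w x * h x) z\<bar> \<le> \<bar>grad w z\<bar> * \<bar>h (new z)\<bar> + \<bar>w (old z)\<bar> * \<bar>grad h z\<bar>"
      using abs_triangle_ineq[of "grad w z * h (new z)" "w (old z) * grad h z"] by (simp only: abs_mult)
    also have "\<dots> \<le> \<bar>grad w z\<bar> * 1 + B * \<bar>gk k z\<bar>"
      using h B B0 by (intro add_mono mult_mono) auto
    finally show ?thesis using B0 by simp
  qed
  show D: "(\<lambda>x. w x * chi k x) \<in> D" for k
  proof (rule D_dominated_fixed(1)[where v = "\<lambda>n x. w x * cut k (n + N + 1) x"])
    show "(\<lambda>x. w x * cut k (n + N + 1) x) \<in> D" for n by (rule D0_D[OF cut_mult_FC0[OF w]])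
    show "(\<lambda>x. w x * chi k x) \<in> borel_measurable \<mu>" using wL(3) chi_measurable by measurable
    have "(\<lambda>n. w x * cut k (n + (N + 1)) x) \<longlonglongrightarrow> w x * chi k x" for x
      by (intro tendsto_mult tendsto_const LIMSEQ_ignore_initial_segment cut_tendsto)
    then show "AE x in \<mu>. (\<lambda>n. w x * cut k (n + N + 1) x) \<longlonglongrightarrow> w x * chi k x" by (simp add: add.assoc)
    show "(\<lambda>x. B) \<in> L2 \<mu>" by (rule const_L2)
    show "(\<lambda>z. 1 * \<bar>grad w z\<bar> + B * \<bar>gk k z\<bar>) \<in> L2 Lam" by (rule G)
    show "AE x in \<mu>. \<bar>w x * cut k (n + N + 1) x\<bar> \<le> \<bar>B\<bar>" for n by (intro AE_I2 bdM cut_01)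
    show "AE z in Lam. \<bar>grad (\<lambda>x. w x * cut k (n + N + 1) x) z\<bar> \<le> \<bar>1 * \<bar>grad w z\<bar> + B * \<bar>gk k z\<bar>\<bar>" for n
      by (intro AE_I2 bdG cut_01 grad_cut)
  qed
  show "nconv (\<lambda>k x. w x * chi k x) w"
  proof (rule D_dominated(2)[where H = "\<lambda>_ x. B" and H' = "\<lambda>x. B" and
        G = "\<lambda>k z. 1 * \<bar>grad w z\<bar> + B * \<bar>gk k z\<bar>" and G' = "\<lambda>z. \<bar>grad w z\<bar>"])
    show "w \<in> borel_measurable \<mu>" by (rule wL(3))
    show "AE x in \<mu>. (\<lambda>k. w x * chi k x) \<longlonglongrightarrow> w x"
      using AE_boxU
    proof eventually_elim
      case (elim x)
      show ?case using tendsto_mult[OF tendsto_const chi_tendsto[OF elim], of "w x"] by simp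
    qed
    show "(\<lambda>z. \<bar>grad w z\<bar>) \<in> L2 Lam"
      by (rule L2_bound[OF wL(2)]) (use L2_measurable[OF wL(2)] in auto)
    have "(\<lambda>k. 1 * \<bar>grad w z\<bar> + B * \<bar>gk k z\<bar>) \<longlonglongrightarrow> 1 * \<bar>grad w z\<bar> + B * \<bar>0\<bar>" for z
      by (intro tendsto_intros gk_tendsto)
    then show "AE z in Lam. (\<lambda>k. 1 * \<bar>grad w z\<bar> + B * \<bar>gk k z\<bar>) \<longlonglongrightarrow> \<bar>grad w z\<bar>" by simp
    show "AE x in \<mu>. \<bar>w x * chi k x\<bar> \<le> \<bar>B\<bar>" for k by (intro AE_I2 bdM chi_01)
    show "AE z in Lam. \<bar>grad (\<lambda>x. w x * chi k x) z\<bar> \<le> \<bar>1 * \<bar>grad w z\<bar> + B * \<bar>gk k z\<bar>\<bar>" for k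
      by (intro AE_I2 bdG chi_01 grad_chi)
    have "L2_inner Lam (\<lambda>x. 1 * \<bar>grad w x\<bar> + B * \<bar>gk k x\<bar> - \<bar>grad w x\<bar>) (\<lambda>x. 1 * \<bar>grad w x\<bar> + B * \<bar>gk k x\<bar> - \<bar>grad w x\<bar>)
       = B\<^sup>2 * L2_inner Lam (gk k) (gk k)" for k
      by (simp add: L2_inner_square power_mult_distrib)
    then show "(\<lambda>k. L2_inner Lam (\<lambda>x. 1 * \<bar>grad w x\<bar> + B * \<bar>gk k x\<bar> - \<bar>grad w x\<bar>) (\<lambda>x. 1 * \<bar>grad w x\<bar> + B * \<bar>gk k x\<bar> - \<bar>grad w x\<bar>)) \<longlonglongrightarrow> 0"
      using tendsto_mult_right_zero[OF gk_L2_tendsto, of "B\<^sup>2"] by simp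
  qed (use D const_L2 G in \<open>auto simp: L2_inner_def\<close>)
qed

lemma chi_D: "chi k \<in> D"
proof (rule D_dominated_fixed(1)[where v = "\<lambda>n. cut k (Suc n)" and H = "\<lambda>x. 1" and G = "gk k"])
  show "cut k (Suc n) \<in> D" for n by (rule D0_D[OF cut_FC0]) simp
  show "AE x in \<mu>. (\<lambda>n. cut k (Suc n) x) \<longlonglongrightarrow> chi k x" by (intro AE_I2 LIMSEQ_Suc cut_tendsto)
  show "AE x in \<mu>. \<bar>cut k (Suc n) x\<bar> \<le> \<bar>1\<bar>" for n using cut_01 by auto
qed (use chi_measurable const_L2 gk_L2 grad_cut in auto)

text \<open>The constant has no increments, so energy convergence of the cutoffs to 1 amounts to gk
  k tending to 0 in \<open>L2\<close>.\<close>

lemma one_D_nconv: "(\<lambda>x. 1) \<in> D" and chi_nconv: "nconv chi (\<lambda>x. 1)"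
proof -
  have AE: "AE x in \<mu>. (\<lambda>k. chi k x) \<longlonglongrightarrow> 1" using AE_boxU by eventually_elim (rule chi_tendsto)
  have zero: "(\<lambda>z. 0) \<in> L2 Lam" by (simp add: L2_def)
  have l0: "(\<lambda>k. L2_inner Lam (\<lambda>z. gk k z - 0) (\<lambda>z. gk k z - 0)) \<longlonglongrightarrow> 0" using gk_L2_tendsto by simp
  have l1: "(\<lambda>k::nat. L2_inner \<mu> (\<lambda>x. 1 - 1) (\<lambda>x. 1 - 1)) \<longlonglongrightarrow> 0" by (simp add: L2_inner_def)
  have b1: "AE x in \<mu>. \<bar>chi k x\<bar> \<le> \<bar>1\<bar>" for k using chi_01 by auto
  have b2: "AE z in Lam. \<bar>grad (chi k) z\<bar> \<le> \<bar>gk k z\<bar>" for k using grad_chi by auto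
  note * = D_dominated[where v = chi and v' = "\<lambda>x. 1" and H = "\<lambda>_ x. 1" and H' = "\<lambda>x. 1" and G = gk and G' = "\<lambda>z. 0",
      OF chi_D _ AE const_L2 const_L2 _ l1 gk_L2 zero _ l0 b1 b2]
  show "(\<lambda>x. 1) \<in> D" "nconv chi (\<lambda>x. 1)" using * gk_tendsto by auto
qed

sublocale jump_dirichlet \<mu> Lam new old FC0_infinity "energy \<alpha> \<mu> \<kappa>"
proof
  show "(\<lambda>x. sqrt ((w x)\<^sup>2 + e\<^sup>2) - e) \<in> FC0_infinity" if "w \<in> FC0_infinity" "e > 0" for w e
  proof -
    have "smooth (\<lambda>t. sqrt (t\<^sup>2 + e\<^sup>2) + - e)" by (intro smooth_add smooth_sqrt smooth_const that)
    then have "smooth (\<lambda>t. sqrt (t\<^sup>2 + e\<^sup>2) - e)" by simp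
    from FC0_compose[OF that(1) this] show ?thesis using that(2) by simp
  qed
qed (use FC0_dense one_D_nconv in auto)

text \<open>The code n stands for a coordinate i and a number m: m div 2 is the scale index, and
  parity chooses between the cutoff alone and the cutoff times x_i. Odd codes separate points, even
  ones separate a point from the added one.\<close>

definition sep :: "nat \<Rightarrow> (nat \<Rightarrow> real) \<Rightarrow> real" where
  "sep n x = (let (i, m) = prod_decode n in
     \<Prod>j<Suc i. bump (x j / scale (m div 2) j) * (if j = i \<and> odd m then x j else 1))"

lemma sep_FC0: "sep n \<in> FC0_infinity"
proof -
  obtain i m where im: "prod_decode n = (i, m)" by fastforce
  let ?f = "\<lambda>x. \<Prod>j<Suc i. bump (x j / scale (m div 2) j) * (if j = i \<and> odd m then x j else 1)"
  have "smooth (\<lambda>t. if j = i \<and> odd m then t else 1)" for j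
    by (cases "j = i \<and> odd m", simp add: smooth_ident, simp only: if_False smooth_const)
  then have "?f \<in> C0_infinity (Suc i)" by (rule tensor_C0)
  from FC0_cylinder[OF this] have "(\<lambda>x. ?f (trunc (Suc i) x)) \<in> FC0_infinity" by simp
  moreover have "?f (trunc (Suc i) x) = sep n x" for x
    unfolding sep_def im by (auto simp: trunc_def intro!: prod.cong)
  ultimately show ?thesis by simp
qed

text \<open>At a large enough scale the first i + 1 coordinates of both points lie where the bumps
  equal 1.\<close>

lemma sep_value:
  obtains m where "sep (prod_encode (i, 2 * m)) x = 1" "sep (prod_encode (i, 2 * m)) y = 1"
    "sep (prod_encode (i, 2 * m + 1)) x = x i" "sep (prod_encode (i, 2 * m + 1)) y = y i"
proof -
  have "\<exists>m. \<forall>j\<le>i. 2 * \<bar>x j\<bar> \<le> scale m j \<and> 2 * \<bar>y j\<bar> \<le> scale m j"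
  proof -
    have "\<exists>m. 2 * max \<bar>x j\<bar> \<bar>y j\<bar> / b j \<le> real m" for j by (rule real_arch_simple)
    then obtain m where m: "\<And>j. 2 * max \<bar>x j\<bar> \<bar>y j\<bar> / b j \<le> real (m j)" by metis
    let ?M = "Max (m ` {..i})"
    have "2 * max \<bar>x j\<bar> \<bar>y j\<bar> \<le> scale ?M j" if "j \<le> i" for j
    proof -
      have "m j \<le> ?M" using that by (intro Max_ge) auto
      then have "2 * max \<bar>x j\<bar> \<bar>y j\<bar> / b j \<le> real (?M + k0)" using m[of j] by linarith
      then show ?thesis using b_pos[of j] by (simp add: scale_def pos_divide_le_eq)
    qed
    then have "2 * \<bar>x j\<bar> \<le> scale ?M j \<and> 2 * \<bar>y j\<bar> \<le> scale ?M j" if "j \<le> i" for j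
      using that by (smt (verit))
    then show ?thesis by blast
  qed
  then obtain m where m: "\<And>j. j \<le> i \<Longrightarrow> 2 * \<bar>x j\<bar> \<le> scale m j" "\<And>j. j \<le> i \<Longrightarrow> 2 * \<bar>y j\<bar> \<le> scale m j" by blast
  have b1: "bump (v j / scale m j) = 1" if "\<And>j. j \<le> i \<Longrightarrow> 2 * \<bar>v j\<bar> \<le> scale m j" "j \<le> i" for v :: "nat \<Rightarrow> real" and j
    using that(1)[OF that(2)] scale_pos[of m j] by (intro bump_eq_1) (simp add: abs_divide pos_divide_le_eq)
  have e: "sep (prod_encode (i, 2 * m)) v = 1" and o: "sep (prod_encode (i, 2 * m + 1)) v = v i"
    if v: "\<And>j. j \<le> i \<Longrightarrow> 2 * \<bar>v j\<bar> \<le> scale m j" for v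
  proof -
    note bv = b1[of v, OF v]
    show "sep (prod_encode (i, 2 * m)) v = 1"
      unfolding sep_def by (simp add: bv del: prod.lessThan_Suc)
    have "sep (prod_encode (i, 2 * m + 1)) v = (\<Prod>j<Suc i. if j = i then v j else 1)"
      unfolding sep_def by (simp add: bv del: prod.lessThan_Suc)
    also have "\<dots> = v i" by (simp add: prod.delta del: prod.lessThan_Suc)
    finally show "sep (prod_encode (i, 2 * m + 1)) v = v i" .
  qed
  show ?thesis by (rule that[OF e[OF m(1)] e[OF m(2)] o[OF m(1)] o[OF m(2)]])
qed

section \<open>The boxes as a nest\<close>

lemma FC0_continuous_map:
  assumes "w \<in> FC0_infinity"
  shows "continuous_map S euclideanreal w"
proof -
  have "continuous_map S (powertop_real UNIV) (\<lambda>x. x)"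
    unfolding continuous_map_componentwise_UNIV using coord by simp
  moreover have "continuous_map (powertop_real UNIV) euclideanreal w"
    using FCN_continuous assms by (auto simp: FC0_infinity_eq euclidean_product_topology)
  ultimately have "continuous_map S euclideanreal (w \<circ> (\<lambda>x. x))" by (rule continuous_map_compose)
  then show ?thesis by (simp add: comp_def)
qed

lemma box_compact: "compactin S (box m)"
proof -
  have "box m = PiE UNIV (\<lambda>i. {- (real m * b i)..real m * b i})"
    by (auto simp: box_def abs_le_iff minus_le_iff)
  moreover have "compactin (powertop_real UNIV) (PiE UNIV (\<lambda>i. {- (real m * b i)..real m * b i}))"
    by (simp add: compactin_PiE)
  ultimately have "compactin (powertop_real UNIV) (box m)" by simp
  then have "compactin (subtopology (powertop_real UNIV) (box m)) (box m)"
    by (simp add: compactin_subtopology)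
  from image_compactin[OF this box_continuous[of m, folded box_def]] show ?thesis by simp
qed

lemma box_closed: "closedin S (box m)"
proof -
  have "closedin S {x \<in> topspace S. x i \<in> {- (real m * b i)..real m * b i}}" for i
    by (rule closedin_continuous_map_preimage[OF coord]) simp
  then have "closedin S (\<Inter>i. {x \<in> topspace S. x i \<in> {- (real m * b i)..real m * b i}})"
    by (intro closedin_Inter) auto
  moreover have "(\<Inter>i. {x \<in> topspace S. x i \<in> {- (real m * b i)..real m * b i}}) = box m"
    using box_subset[of m] by (auto simp: box_def abs_le_iff minus_le_iff)
  ultimately show ?thesis by simp
qed

sublocale jump_nest \<mu> Lam new old FC0_infinity "energy \<alpha> \<mu> \<kappa>" S "\<lambda>k. box (k + k0)" chi sep
proof
  show "incseq (\<lambda>k. box (k + k0))"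
  proof (rule incseq_SucI)
    show "box (k + k0) \<subseteq> box (Suc k + k0)" for k
    proof
      fix x assume x: "x \<in> box (k + k0)"
      have "real (k + k0) * b i \<le> real (Suc k + k0) * b i" for i
        using b_pos[of i] by (intro mult_right_mono) auto
      then show "x \<in> box (Suc k + k0)" using x unfolding box_def by (blast intro: order_trans)
    qed
  qed
  show "(\<lambda>x. w x * chi k x) \<in> D" if "w \<in> FC0_infinity" for k w
    using that chi_mult_D(1) by (auto simp: FC0_infinity_eq)
  show "nconv (\<lambda>k x. w x * chi k x) w" if "w \<in> FC0_infinity" for w
    using that chi_mult_D(2) by (auto simp: FC0_infinity_eq)
  show "\<exists>n. sep n x \<noteq> sep n y" if xy: "x \<noteq> y" for x y
  proof -
    obtain i where "x i \<noteq> y i" using xy by (auto simp: fun_eq_iff)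
    then show ?thesis using sep_value[of i x y] by metis
  qed
  show "\<exists>n. sep n x \<noteq> 0" for x using sep_value[of 0 x x] by (metis zero_neq_one)
qed (use box_compact box_closed space_mu chi_D chi_off_box chi_nconv FC0_continuous_map sep_FC0 in auto)

end

section \<open>Passage to the concrete spaces\<close>

lemma path_space_conclusion:
  assumes "path_space S \<mu> \<kappa> \<alpha> b M0"
  shows "dirichlet_form \<mu> (energy_dom \<alpha> \<mu> \<kappa>) (energy_form \<alpha> \<mu> \<kappa>)"
    and "quasi_regular S \<mu> (energy_dom \<alpha> \<mu> \<kappa>) (energy_form \<alpha> \<mu> \<kappa>)"
    and "\<phi> \<in> L2 \<mu> \<Longrightarrow> AE x in \<mu>. 0 < \<phi> x \<and> \<phi> x \<le> 1 \<Longrightarrow>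
      strictly_quasi_regular S \<mu> (energy_dom \<alpha> \<mu> \<kappa>) (energy_form \<alpha> \<mu> \<kappa>) \<phi>"
proof -
  interpret path_space S \<mu> \<kappa> \<alpha> b M0 by fact
  show "dirichlet_form \<mu> (energy_dom \<alpha> \<mu> \<kappa>) (energy_form \<alpha> \<mu> \<kappa>)"
    using dirichlet unfolding energy_dom_def energy_form_def .
  show "quasi_regular S \<mu> (energy_dom \<alpha> \<mu> \<kappa>) (energy_form \<alpha> \<mu> \<kappa>)"
    using quasi_regular_form unfolding energy_dom_def energy_form_def .
  show "strictly_quasi_regular S \<mu> (energy_dom \<alpha> \<mu> \<kappa>) (energy_form \<alpha> \<mu> \<kappa>) \<phi>"
    if "\<phi> \<in> L2 \<mu>" "AE x in \<mu>. 0 < \<phi> x \<and> \<phi> x \<le> 1"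
    using strictly_quasi_regular_form[OF that] unfolding energy_dom_def energy_form_def .
qed

lemma (in Metric_space) continuous_map_real:
  assumes "C > 0" "\<And>x y. x \<in> M \<Longrightarrow> y \<in> M \<Longrightarrow> \<bar>f x - f y\<bar> \<le> C * d x y"
  shows "continuous_map mtopology euclideanreal f"
  unfolding continuous_map_alt
proof (intro conjI allI impI)
  fix V :: "real set" assume V: "openin euclideanreal V"
  show "openin mtopology (f -` V \<inter> topspace mtopology)"
    unfolding openin_mtopology
  proof (intro conjI allI impI)
    fix x assume "x \<in> f -` V \<inter> topspace mtopology"
    then have x: "f x \<in> V" "x \<in> M" by auto
    obtain e where e: "e > 0" "\<And>t. \<bar>t - f x\<bar> < e \<Longrightarrow> t \<in> V"
      using V x(1) unfolding open_openin[symmetric] open_dist by (auto simp: dist_real_def)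
    have "mball x (e / C) \<subseteq> f -` V \<inter> topspace mtopology"
    proof
      fix y assume "y \<in> mball x (e / C)"
      then have y: "y \<in> M" "d x y < e / C" by auto
      have "\<bar>f y - f x\<bar> \<le> C * d x y" using assms(2)[OF x(2) y(1)] by (simp add: abs_minus_commute)
      also have "\<dots> < e" using y(2) assms(1) by (simp add: pos_less_divide_eq mult.commute)
      finally show "y \<in> f -` V \<inter> topspace mtopology" using e(2) y(1) by simp
    qed
    then show "\<exists>r>0. mball x r \<subseteq> f -` V \<inter> topspace mtopology"
      using e(1) assms(1) by (intro exI[of _ "e / C"]) auto
  qed auto
qed auto

text \<open>Applied to boxes, where the tails of the coordinates are uniformly small and finitely
  many coordinates control the distance.\<close>

lemma continuous_map_into_metric:
  fixes K :: "(nat \<Rightarrow> real) set"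
  assumes "Metric_space M d" "K \<subseteq> M"
    and uc: "\<And>e. e > 0 \<Longrightarrow> \<exists>N \<delta>. \<delta> > 0 \<and> (\<forall>x\<in>K. \<forall>y\<in>K. (\<forall>i<N. \<bar>x i - y i\<bar> < \<delta>) \<longrightarrow> d x y < e)"
  shows "continuous_map (subtopology (powertop_real UNIV) K) (Metric_space.mtopology M d) (\<lambda>x. x)"
proof -
  interpret Metric_space M d by fact
  show ?thesis
    unfolding continuous_map_alt
  proof (intro conjI allI impI)
    fix U assume U: "openin mtopology U"
    show "openin (subtopology (powertop_real UNIV) K) ((\<lambda>x. x) -` U \<inter> topspace (subtopology (powertop_real UNIV) K))"
    proof (subst openin_subopen, intro ballI)
      fix x assume "x \<in> (\<lambda>x. x) -` U \<inter> topspace (subtopology (powertop_real UNIV) K)"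
      then have x: "x \<in> U" "x \<in> K" by auto
      obtain r where r: "r > 0" "mball x r \<subseteq> U" using U x(1) by (auto simp: openin_mtopology)
      obtain N \<delta> where N: "\<delta> > 0" "\<And>y. y \<in> K \<Longrightarrow> \<forall>i<N. \<bar>x i - y i\<bar> < \<delta> \<Longrightarrow> d x y < r"
        using uc[OF r(1)] x(2) by blast
      define V where "V = (\<Inter>i\<in>{..<N}. (\<lambda>y::nat \<Rightarrow> real. y i) -` ball (x i) \<delta>)"
      have "open ((\<lambda>y::nat \<Rightarrow> real. y i) -` ball (x i) \<delta>)" for i
        by (intro open_vimage continuous_on_product_coordinates) simp
      then have "open V" unfolding V_def by (intro open_INT) auto
      then have "openin (subtopology (powertop_real UNIV) K) (V \<inter> K)"
        by (auto simp: openin_subtopology euclidean_product_topology)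
      moreover have "x \<in> V \<inter> K" using x(2) N(1) by (simp add: V_def)
      moreover have "V \<inter> K \<subseteq> (\<lambda>x. x) -` U \<inter> topspace (subtopology (powertop_real UNIV) K)"
      proof
        fix y assume y: "y \<in> V \<inter> K"
        then have "d x y < r" by (intro N(2)) (auto simp: V_def dist_real_def)
        then have "y \<in> mball x r" using x(2) y assms(2) by auto
        then show "y \<in> (\<lambda>x. x) -` U \<inter> topspace (subtopology (powertop_real UNIV) K)" using r(2) y by auto
      qed
      ultimately show "\<exists>T. openin (subtopology (powertop_real UNIV) K) T \<and> x \<in> T \<and>
          T \<subseteq> (\<lambda>x. x) -` U \<inter> topspace (subtopology (powertop_real UNIV) K)" by blast
    qed
  qed (use assms(2) in auto)
qed

section \<open>Weighted sequence spaces\<close>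

text \<open>At a = 0 or c = 0 convexity reduces to (s v)^p \<le> s v^p for s in [0, 1], since 0
  \<open>powr\<close> p is 0.\<close>

lemma powr_convex_nonneg:
  fixes a c p t :: real
  assumes p: "1 \<le> p" and "0 \<le> a" "0 \<le> c" "0 \<le> t" "t \<le> 1"
  shows "(t * a + (1 - t) * c) powr p \<le> t * a powr p + (1 - t) * c powr p"
proof -
  have shrink: "(s * v) powr p \<le> s * v powr p" if "0 \<le> s" "s \<le> 1" "0 \<le> v" for s v :: real
  proof (cases "s = 0")
    case False
    then have "s powr p \<le> s powr 1" using that p by (intro powr_mono') auto
    then have "s powr p * v powr p \<le> s * v powr p" using that False by (intro mult_right_mono) auto
    then show ?thesis using that by (simp add: powr_mult)
  qed simp
  consider "a = 0" | "c = 0" | "a > 0" "c > 0" using assms by linarith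
  then show ?thesis
  proof cases
    case 1
    then show ?thesis using shrink[of "1 - t" c] assms by simp
  next
    case 2
    then show ?thesis using shrink[of t a] assms by simp
  next
    case 3
    show ?thesis
      using convex_onD[OF powr_convex[OF p], of "1 - t" a c] 3 assms by simp
  qed
qed

section \<open>The weighted spaces with finite exponent\<close>

locale weighted_lp =
  fixes \<beta> :: "nat \<Rightarrow> real" and p :: real
  assumes p: "1 \<le> p" and beta: "\<And>i. \<beta> i > 0"
begin

definition lsum :: "(nat \<Rightarrow> real) \<Rightarrow> real" where
  "lsum x = (\<Sum>i. \<beta> i * \<bar>x i\<bar> powr p)"

lemma lp_norm_eq: "lp_norm \<beta> p x = lsum x powr (1 / p)"
  by (simp add: lp_norm_def lsum_def)

lemma lsum_nonneg: "x \<in> lp_space \<beta> p \<Longrightarrow> 0 \<le> lsum x"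
  unfolding lsum_def lp_space_def using beta by (auto intro!: suminf_nonneg simp: less_imp_le)

lemma lsum_eq_norm: "x \<in> lp_space \<beta> p \<Longrightarrow> lsum x = lp_norm \<beta> p x powr p"
  using lsum_nonneg p by (simp add: lp_norm_eq powr_powr)

lemma lp_norm_nonneg: "0 \<le> lp_norm \<beta> p x"
  by (simp add: lp_norm_def)

lemma lp_coord:
  assumes "x \<in> lp_space \<beta> p"
  shows "\<bar>x i\<bar> \<le> \<beta> i powr (- 1 / p) * lp_norm \<beta> p x"
proof -
  have "\<beta> i * \<bar>x i\<bar> powr p \<le> lsum x"
    unfolding lsum_def using assms beta sum_le_suminf[of "\<lambda>i. \<beta> i * \<bar>x i\<bar> powr p" "{i}"]
    by (auto simp: lp_space_def less_imp_le)
  then have "(\<beta> i * \<bar>x i\<bar> powr p) powr (1 / p) \<le> lsum x powr (1 / p)"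
    using beta[of i] p by (intro powr_mono2) auto
  then have "\<beta> i powr (1 / p) * \<bar>x i\<bar> \<le> lp_norm \<beta> p x"
    using beta[of i] p by (simp add: lp_norm_eq powr_mult powr_powr)
  then have "\<beta> i powr (- 1 / p) * (\<beta> i powr (1 / p) * \<bar>x i\<bar>) \<le> \<beta> i powr (- 1 / p) * lp_norm \<beta> p x"
    by (rule mult_left_mono) simp
  moreover have "\<beta> i powr (- 1 / p) * \<beta> i powr (1 / p) = 1"
    using beta[of i] by (simp flip: powr_add)
  ultimately show ?thesis by (simp flip: mult.assoc)
qed

text \<open>Minkowski by convexity: for positive a and c above the two norms, |x_i + y_i|/(a + c) is
  at most a convex combination of |x_i|/a and |y_i|/c. Strictly positive a and c allow for vanishing
  norms and are then moved down to the norms.\<close>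

lemma lp_add:
  assumes x: "x \<in> lp_space \<beta> p" and y: "y \<in> lp_space \<beta> p"
  shows "(\<lambda>i. x i + y i) \<in> lp_space \<beta> p"
    and "lp_norm \<beta> p (\<lambda>i. x i + y i) \<le> lp_norm \<beta> p x + lp_norm \<beta> p y"
proof -
  have sx: "summable (\<lambda>i. \<beta> i * \<bar>x i\<bar> powr p)" and sy: "summable (\<lambda>i. \<beta> i * \<bar>y i\<bar> powr p)"
    using x y by (auto simp: lp_space_def)
  have bd: "\<beta> i * \<bar>x i + y i\<bar> powr p \<le> (a + c) powr p * (a / (a + c) / a powr p * (\<beta> i * \<bar>x i\<bar> powr p)
      + c / (a + c) / c powr p * (\<beta> i * \<bar>y i\<bar> powr p))" if "a > 0" "c > 0" for a c i
  proof -
    let ?t = "a / (a + c)"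
    have t: "0 \<le> ?t" "?t \<le> 1" "1 - ?t = c / (a + c)" using that by (auto simp: field_simps)
    have "\<bar>x i + y i\<bar> \<le> (a + c) * (?t * (\<bar>x i\<bar> / a) + (1 - ?t) * (\<bar>y i\<bar> / c))"
    proof -
      have "(a + c) * (?t * (\<bar>x i\<bar> / a) + (1 - ?t) * (\<bar>y i\<bar> / c)) = \<bar>x i\<bar> + \<bar>y i\<bar>"
      proof -
        have "a + c \<noteq> 0" using that by linarith
        then show ?thesis unfolding t(3) distrib_left using that by simp
      qed
      then show ?thesis by simp
    qed
    then have "\<bar>x i + y i\<bar> powr p \<le> ((a + c) * (?t * (\<bar>x i\<bar> / a) + (1 - ?t) * (\<bar>y i\<bar> / c))) powr p"
      using p by (intro powr_mono2) auto
    also have "\<dots> = (a + c) powr p * (?t * (\<bar>x i\<bar> / a) + (1 - ?t) * (\<bar>y i\<bar> / c)) powr p"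
      using that t by (intro powr_mult)
    also have "\<dots> \<le> (a + c) powr p * (?t * (\<bar>x i\<bar> / a) powr p + (1 - ?t) * (\<bar>y i\<bar> / c) powr p)"
      using that t p by (intro mult_left_mono powr_convex_nonneg) auto
    also have "\<dots> = (a + c) powr p * (?t / a powr p * \<bar>x i\<bar> powr p + c / (a + c) / c powr p * \<bar>y i\<bar> powr p)"
      unfolding t(3) using that by (simp add: powr_divide)
    finally have "\<beta> i * \<bar>x i + y i\<bar> powr p \<le> \<beta> i * ((a + c) powr p * (?t / a powr p * \<bar>x i\<bar> powr p + c / (a + c) / c powr p * \<bar>y i\<bar> powr p))"
      using beta[of i] by (intro mult_left_mono) auto
    also have "\<dots> = (a + c) powr p * (?t / a powr p * (\<beta> i * \<bar>x i\<bar> powr p) + c / (a + c) / c powr p * (\<beta> i * \<bar>y i\<bar> powr p))"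
      by (simp add: distrib_left mult.left_commute)
    finally show ?thesis .
  qed
  have sb: "summable (\<lambda>i. (a + c) powr p * (a / (a + c) / a powr p * (\<beta> i * \<bar>x i\<bar> powr p)
      + c / (a + c) / c powr p * (\<beta> i * \<bar>y i\<bar> powr p)))" for a c
    by (intro summable_mult summable_add sx sy)
  have s: "summable (\<lambda>i. \<beta> i * \<bar>x i + y i\<bar> powr p)"
    by (rule summable_comparison_test'[OF sb[of 1 1], of 0]) (use bd[of 1 1] beta in \<open>simp add: less_imp_le\<close>)
  then show xy: "(\<lambda>i. x i + y i) \<in> lp_space \<beta> p" by (simp add: lp_space_def)
  have key: "lp_norm \<beta> p (\<lambda>i. x i + y i) \<le> a + c"
    if ac: "a > 0" "c > 0" "lp_norm \<beta> p x \<le> a" "lp_norm \<beta> p y \<le> c" for a c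
  proof -
    have X: "lsum x \<le> a powr p" and Y: "lsum y \<le> c powr p"
      unfolding lsum_eq_norm[OF x] lsum_eq_norm[OF y] using ac p lp_norm_nonneg by (auto intro!: powr_mono2)
    have "lsum (\<lambda>i. x i + y i) \<le> (\<Sum>i. (a + c) powr p * (a / (a + c) / a powr p * (\<beta> i * \<bar>x i\<bar> powr p)
      + c / (a + c) / c powr p * (\<beta> i * \<bar>y i\<bar> powr p)))"
      unfolding lsum_def by (intro suminf_le bd ac s sb)
    also have "\<dots> = (a + c) powr p * (a / (a + c) / a powr p * lsum x + c / (a + c) / c powr p * lsum y)"
      unfolding lsum_def suminf_mult[OF summable_add[OF summable_mult[OF sx] summable_mult[OF sy]]]
        suminf_add[OF summable_mult[OF sx] summable_mult[OF sy], symmetric] suminf_mult[OF sx] suminf_mult[OF sy] ..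
    also have "\<dots> \<le> (a + c) powr p * (a / (a + c) / a powr p * a powr p + c / (a + c) / c powr p * c powr p)"
      using ac X Y by (intro mult_left_mono add_mono) auto
    also have "a / (a + c) / a powr p * a powr p + c / (a + c) / c powr p * c powr p = 1"
      using ac by (simp flip: add_divide_distrib)
    finally have "lsum (\<lambda>i. x i + y i) \<le> (a + c) powr p" by simp
    then have "lsum (\<lambda>i. x i + y i) powr (1 / p) \<le> ((a + c) powr p) powr (1 / p)"
      using p lsum_nonneg[OF xy] by (intro powr_mono2) auto
    then show ?thesis using ac p by (simp add: lp_norm_eq powr_powr)
  qed
  show "lp_norm \<beta> p (\<lambda>i. x i + y i) \<le> lp_norm \<beta> p x + lp_norm \<beta> p y"
  proof (rule field_le_epsilon)
    fix e :: real assume "e > 0"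
    then show "lp_norm \<beta> p (\<lambda>i. x i + y i) \<le> lp_norm \<beta> p x + lp_norm \<beta> p y + e"
      using key[of "lp_norm \<beta> p x + e / 2" "lp_norm \<beta> p y + e / 2"] lp_norm_nonneg[of x] lp_norm_nonneg[of y] by simp
  qed
qed

lemma lp_uminus: "x \<in> lp_space \<beta> p \<Longrightarrow> (\<lambda>i. - x i) \<in> lp_space \<beta> p"
  by (simp add: lp_space_def)

lemma lp_diff: "x \<in> lp_space \<beta> p \<Longrightarrow> y \<in> lp_space \<beta> p \<Longrightarrow> (\<lambda>i. x i - y i) \<in> lp_space \<beta> p"
  using lp_add(1)[OF _ lp_uminus, of x y] by simp

lemma lp_Metric_space: "Metric_space (lp_space \<beta> p) (\<lambda>x y. lp_norm \<beta> p (\<lambda>i. x i - y i))"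
proof
  show "0 \<le> lp_norm \<beta> p (\<lambda>i. x i - y i)" for x y by (rule lp_norm_nonneg)
  show "lp_norm \<beta> p (\<lambda>i. x i - y i) = lp_norm \<beta> p (\<lambda>i. y i - x i)" for x y
    by (simp add: lp_norm_def abs_minus_commute)
  show "lp_norm \<beta> p (\<lambda>i. x i - y i) = 0 \<longleftrightarrow> x = y" if "x \<in> lp_space \<beta> p" "y \<in> lp_space \<beta> p" for x y
  proof
    assume "lp_norm \<beta> p (\<lambda>i. x i - y i) = 0"
    then show "x = y" using lp_coord[OF lp_diff[OF that]] by (auto simp: fun_eq_iff)
  qed (simp add: lp_norm_def)
  show "lp_norm \<beta> p (\<lambda>i. x i - z i) \<le> lp_norm \<beta> p (\<lambda>i. x i - y i) + lp_norm \<beta> p (\<lambda>i. y i - z i)"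
    if "x \<in> lp_space \<beta> p" "y \<in> lp_space \<beta> p" "z \<in> lp_space \<beta> p" for x y z
    using lp_add(2)[OF lp_diff[OF that(1,2)] lp_diff[OF that(2,3)]] by simp
qed

lemma lp_topspace: "topspace (lp_topology \<beta> p) = lp_space \<beta> p"
  unfolding lp_topology_def by (rule Metric_space.topspace_mtopology[OF lp_Metric_space])

lemma lp_coord_continuous: "continuous_map (lp_topology \<beta> p) euclideanreal (\<lambda>x. x i)"
  unfolding lp_topology_def
  by (rule Metric_space.continuous_map_real[OF lp_Metric_space, of "\<beta> i powr (- 1 / p)"])
     (use beta[of i] lp_coord[OF lp_diff] in auto)

lemma lp_upd:
  assumes "x \<in> lp_space \<beta> p"
  shows "x(j := y) \<in> lp_space \<beta> p"
proof -
  have "\<forall>\<^sub>F i in sequentially. \<beta> i * \<bar>(x(j := y)) i\<bar> powr p = \<beta> i * \<bar>x i\<bar> powr p"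
    using eventually_gt_at_top[of j] by eventually_elim simp
  from summable_cong[OF this] show ?thesis using assms by (simp add: lp_space_def del: fun_upd_apply)
qed

text \<open>\<beta>_i b_i^p = 1/\<gamma>_i is summable, so the tails of the norm are uniformly small
  on a box and the first N coordinates decide.\<close>

lemma lp_box:
  fixes m :: nat
  assumes g: "\<And>i. \<gamma> i > 0" "summable (\<lambda>i. 1 / \<gamma> i)"
  defines "b \<equiv> \<lambda>i. \<beta> i powr (- 1 / p) * \<gamma> i powr (- 1 / p)"
  shows "{x. \<forall>i. \<bar>x i\<bar> \<le> real m * b i} \<subseteq> lp_space \<beta> p"
    and "continuous_map (subtopology (powertop_real UNIV) {x. \<forall>i. \<bar>x i\<bar> \<le> real m * b i}) (lp_topology \<beta> p) (\<lambda>x. x)"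
proof -
  have b: "\<beta> i * b i powr p = 1 / \<gamma> i" for i
  proof -
    have "b i powr p = \<beta> i powr (- 1 / p * p) * \<gamma> i powr (- 1 / p * p)"
      unfolding b_def powr_powr[symmetric] by (rule powr_mult)
    also have "- 1 / p * p = - 1" using p by simp
    finally show ?thesis using beta[of i] g(1)[of i] by (simp add: powr_minus_divide)
  qed
  have tm: "\<beta> i * \<bar>t\<bar> powr p \<le> M powr p * (1 / \<gamma> i)" if "\<bar>t\<bar> \<le> M * b i" "M \<ge> 0" for M t i
  proof -
    have "\<bar>t\<bar> powr p \<le> (M * b i) powr p" using that p by (intro powr_mono2) auto
    then have "\<beta> i * \<bar>t\<bar> powr p \<le> \<beta> i * (M * b i) powr p" using beta[of i] by (intro mult_left_mono) auto
    also have "\<dots> = M powr p * (\<beta> i * b i powr p)" using that by (simp add: powr_mult b_def)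
    finally show ?thesis by (simp add: b)
  qed
  show sub: "{x. \<forall>i. \<bar>x i\<bar> \<le> real m * b i} \<subseteq> lp_space \<beta> p"
  proof
    fix x assume x: "x \<in> {x. \<forall>i. \<bar>x i\<bar> \<le> real m * b i}"
    show "x \<in> lp_space \<beta> p"
      unfolding lp_space_def mem_Collect_eq
      by (rule summable_comparison_test'[OF summable_mult[OF g(2), of "real m powr p"], of 0])
         (use x tm beta in \<open>auto simp: less_imp_le\<close>)
  qed
  show "continuous_map (subtopology (powertop_real UNIV) {x. \<forall>i. \<bar>x i\<bar> \<le> real m * b i}) (lp_topology \<beta> p) (\<lambda>x. x)"
    unfolding lp_topology_def
  proof (rule continuous_map_into_metric[OF lp_Metric_space sub])
    fix e :: real assume e: "e > 0"
    \<comment> \<open>The difference of two points of the box lies in the box of twice the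
      size.\<close>
    let ?M = "2 * real m"
    define G where "G i = ?M powr p * (1 / \<gamma> i)" for i
    have G: "summable G" unfolding G_def by (rule summable_mult[OF g(2)])
    have ep: "e powr p / 2 > 0" using e by simp
    obtain N where N: "\<And>n. n \<ge> N \<Longrightarrow> norm (\<Sum>i. G (i + n)) < e powr p / 2"
      using suminf_exist_split[OF ep G] by blast
    define B where "B = (\<Sum>i<N. \<beta> i)"
    have B: "B \<ge> 0" unfolding B_def using beta by (intro sum_nonneg) (simp add: less_imp_le)
    \<comment> \<open>The first N coordinates then contribute at most B/(B + 1) times e^p/2; B + 1
      stays positive even for N = 0.\<close>
    define \<delta> where "\<delta> = (e powr p / 2 / (B + 1)) powr (1 / p)"
    have \<delta>: "\<delta> > 0" "\<delta> powr p = e powr p / 2 / (B + 1)"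
      using ep B p by (simp_all add: \<delta>_def powr_powr)
    have "lp_norm \<beta> p (\<lambda>i. x i - y i) < e"
      if x: "\<forall>i. \<bar>x i\<bar> \<le> real m * b i" and y: "\<forall>i. \<bar>y i\<bar> \<le> real m * b i" and d: "\<forall>i<N. \<bar>x i - y i\<bar> < \<delta>" for x y
    proof -
      have xy: "(\<lambda>i. x i - y i) \<in> lp_space \<beta> p" using x y sub by (intro lp_diff) auto
      let ?f = "\<lambda>i. \<beta> i * \<bar>x i - y i\<bar> powr p"
      have sf: "summable ?f" using xy by (simp add: lp_space_def)
      have fG: "?f i \<le> G i" for i
        unfolding G_def using x[rule_format, of i] y[rule_format, of i] by (intro tm) (auto simp: algebra_simps)
      have "lsum (\<lambda>i. x i - y i) = (\<Sum>i. ?f (i + N)) + (\<Sum>i<N. ?f i)"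
        unfolding lsum_def by (rule suminf_split_initial_segment[OF sf])
      moreover have "(\<Sum>i. ?f (i + N)) \<le> (\<Sum>i. G (i + N))"
        by (intro suminf_le fG summable_ignore_initial_segment sf G)
      moreover have "(\<Sum>i. G (i + N)) < e powr p / 2" using N[of N] by simp
      moreover have "(\<Sum>i<N. ?f i) \<le> (\<Sum>i<N. \<beta> i * \<delta> powr p)"
        using d beta p by (intro sum_mono mult_left_mono powr_mono2) (auto simp: less_imp_le)
      moreover have "(\<Sum>i<N. \<beta> i * \<delta> powr p) = B / (B + 1) * (e powr p / 2)"
        unfolding B_def[symmetric] sum_distrib_right[symmetric] \<delta>(2) by simp
      moreover have "B / (B + 1) * (e powr p / 2) \<le> 1 * (e powr p / 2)"
        using B ep by (intro mult_right_mono) auto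
      ultimately have "lsum (\<lambda>i. x i - y i) < e powr p" by linarith
      then have "lsum (\<lambda>i. x i - y i) powr (1 / p) < (e powr p) powr (1 / p)"
        using p lsum_nonneg[OF xy] by (intro powr_less_mono2) auto
      then show ?thesis using e p by (simp add: lp_norm_eq powr_powr)
    qed
    then show "\<exists>N \<delta>. \<delta> > 0 \<and> (\<forall>x\<in>{x. \<forall>i. \<bar>x i\<bar> \<le> real m * b i}. \<forall>y\<in>{x. \<forall>i. \<bar>x i\<bar> \<le> real m * b i}.
        (\<forall>i<N. \<bar>x i - y i\<bar> < \<delta>) \<longrightarrow> lp_norm \<beta> p (\<lambda>i. x i - y i) < e)"
      using \<delta>(1) by blast
  qed
qed

end

lemma lp_path_space:
  assumes alpha: "0 < \<alpha>" "\<alpha> \<le> 1" and p: "1 \<le> p" and beta: "\<forall>i. \<beta> i > 0"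
    and mu: "prob_space \<mu>" "sets \<mu> = sets (borel_of (lp_topology \<beta> p))"
    and kappa: "\<forall>i. regular_cond_dist \<mu> i (\<kappa> i)"
    and cond: "lp_condition \<alpha> p \<beta> \<mu>"
  shows "\<exists>b M0. path_space (lp_topology \<beta> p) \<mu> \<kappa> \<alpha> b M0"
proof -
  interpret weighted_lp \<beta> p using p beta by unfold_locales auto
  obtain \<gamma> M0 where M0: "M0 > 0" and g: "\<And>i. \<gamma> i > 0" "summable (\<lambda>i. 1 / \<gamma> i)"
    and A: "summable (\<lambda>i. (\<beta> i * \<gamma> i) powr ((\<alpha> + 1) / p) *
          measure \<mu> {x \<in> space \<mu>. \<beta> i powr (1 / p) * \<bar>x i\<bar> > M0 * \<gamma> i powr (- 1 / p)})"
    and B: "measure \<mu> (\<Union>m::nat. {x \<in> space \<mu>.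
          \<forall>i. \<bar>x i\<bar> \<le> real m * \<beta> i powr (- 1 / p) * \<gamma> i powr (- 1 / p)}) = 1"
    using cond unfolding lp_condition_def by blast
  define b where "b i = \<beta> i powr (- 1 / p) * \<gamma> i powr (- 1 / p)" for i
  have sp: "space \<mu> = lp_space \<beta> p" using space_eq_topspace[OF mu(2)] lp_topspace by simp
  note box = lp_box[OF g, folded b_def]
  have "path_space (lp_topology \<beta> p) \<mu> \<kappa> \<alpha> b M0"
  proof (rule path_space.intro)
    show "0 < \<alpha>" "\<alpha> \<le> 1" "prob_space \<mu>" "sets \<mu> = sets (borel_of (lp_topology \<beta> p))" by fact+
    show "regular_cond_dist \<mu> i (\<kappa> i)" for i using kappa by simp
    show "continuous_map (lp_topology \<beta> p) euclideanreal (\<lambda>x. x i)" for i by (rule lp_coord_continuous)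
    show "x(i := y) \<in> topspace (lp_topology \<beta> p)" if "x \<in> topspace (lp_topology \<beta> p)" for x i y
      using that unfolding lp_topspace by (rule lp_upd)
    show "b i > 0" for i
    proof -
      have "\<beta> i \<noteq> 0" "\<gamma> i \<noteq> 0" using beta[of i] g(1)[of i] by auto
      then show ?thesis unfolding b_def by (intro mult_pos_pos) simp_all
    qed
    show "M0 > 0" by fact
    show "continuous_map (subtopology (powertop_real UNIV) {x. \<forall>i. \<bar>x i\<bar> \<le> real m * b i}) (lp_topology \<beta> p) (\<lambda>x. x)" for m
      by (rule box(2))
    have "(\<beta> i * \<gamma> i) powr ((\<alpha> + 1) / p) = b i powr (- (\<alpha> + 1))" for i
    proof -
      have "b i powr (- (\<alpha> + 1)) = \<beta> i powr (- 1 / p * - (\<alpha> + 1)) * \<gamma> i powr (- 1 / p * - (\<alpha> + 1))"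
        unfolding b_def powr_powr[symmetric] by (rule powr_mult)
      also have "- 1 / p * - (\<alpha> + 1) = (\<alpha> + 1) / p" using p by (simp add: field_simps)
      finally show ?thesis by (simp add: powr_mult)
    qed
    moreover have "\<beta> i powr (1 / p) * \<bar>t\<bar> > M0 * \<gamma> i powr (- 1 / p) \<longleftrightarrow> \<bar>t\<bar> > M0 * b i" for i t
    proof -
      have "\<beta> i powr (1 / p) > 0" using beta[of i] by simp
      moreover have "b i = \<gamma> i powr (- 1 / p) / \<beta> i powr (1 / p)"
        by (simp add: b_def powr_minus_divide)
      ultimately show ?thesis by (simp add: pos_divide_less_eq mult.commute)
    qed
    ultimately show "summable (\<lambda>i. b i powr (- (\<alpha> + 1)) * measure \<mu> {x \<in> space \<mu>. \<bar>x i\<bar> > M0 * b i})"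
      using A by simp
    have "(\<Union>m::nat. {x \<in> space \<mu>. \<forall>i. \<bar>x i\<bar> \<le> real m * \<beta> i powr (- 1 / p) * \<gamma> i powr (- 1 / p)}) =
        (\<Union>m::nat. {x. \<forall>i. \<bar>x i\<bar> \<le> real m * b i})"
      using box(1) unfolding sp b_def mult.assoc by blast
    then show "measure \<mu> (\<Union>m::nat. {x. \<forall>i. \<bar>x i\<bar> \<le> real m * b i}) = 1" using B by simp
  qed
  then show ?thesis by blast
qed

section \<open>The weighted space of bounded sequences\<close>

locale weighted_linf =
  fixes \<beta> :: "nat \<Rightarrow> real"
  assumes beta: "\<And>i. \<beta> i > 0"
begin

lemma linf_norm_upper: "x \<in> linf_space \<beta> \<Longrightarrow> \<beta> i * \<bar>x i\<bar> \<le> linf_norm \<beta> x"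
  by (auto simp: linf_norm_def linf_space_def intro: cSUP_upper)

lemma linf_norm_least: "(\<And>i. \<beta> i * \<bar>x i\<bar> \<le> c) \<Longrightarrow> x \<in> linf_space \<beta> \<and> linf_norm \<beta> x \<le> c"
  by (auto simp: linf_norm_def linf_space_def intro!: cSUP_least bdd_aboveI2)

lemma linf_norm_nonneg: "0 \<le> linf_norm \<beta> x"
proof (cases "x \<in> linf_space \<beta>")
  case True
  have "0 \<le> \<beta> 0 * \<bar>x 0\<bar>" using beta[of 0] by simp
  also have "\<dots> \<le> linf_norm \<beta> x" by (rule linf_norm_upper[OF True])
  finally show ?thesis .
qed (simp add: linf_norm_def)

lemma linf_diff:
  assumes "x \<in> linf_space \<beta>" "y \<in> linf_space \<beta>"
  shows "(\<lambda>i. x i - y i) \<in> linf_space \<beta>"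
proof -
  have "\<beta> i * \<bar>x i - y i\<bar> \<le> linf_norm \<beta> x + linf_norm \<beta> y" for i
  proof -
    have "\<beta> i * \<bar>x i - y i\<bar> \<le> \<beta> i * (\<bar>x i\<bar> + \<bar>y i\<bar>)" using beta[of i] by (intro mult_left_mono) auto
    then show ?thesis
      using linf_norm_upper[OF assms(1), of i] linf_norm_upper[OF assms(2), of i] by (simp add: distrib_left)
  qed
  from linf_norm_least[OF this] show ?thesis by blast
qed

lemma linf_Metric_space: "Metric_space (linf_space \<beta>) (\<lambda>x y. linf_norm \<beta> (\<lambda>i. x i - y i))"
proof
  show "0 \<le> linf_norm \<beta> (\<lambda>i. x i - y i)" for x y by (rule linf_norm_nonneg)
  show "linf_norm \<beta> (\<lambda>i. x i - y i) = linf_norm \<beta> (\<lambda>i. y i - x i)" for x y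
    by (simp add: linf_norm_def linf_space_def abs_minus_commute)
  show "linf_norm \<beta> (\<lambda>i. x i - y i) = 0 \<longleftrightarrow> x = y" if "x \<in> linf_space \<beta>" "y \<in> linf_space \<beta>" for x y
  proof
    assume *: "linf_norm \<beta> (\<lambda>i. x i - y i) = 0"
    have "x i = y i" for i
      using linf_norm_upper[OF linf_diff[OF that], of i] beta[of i] unfolding * by (simp add: mult_le_0_iff)
    then show "x = y" by auto
  qed (simp add: linf_norm_def)
  show "linf_norm \<beta> (\<lambda>i. x i - z i) \<le> linf_norm \<beta> (\<lambda>i. x i - y i) + linf_norm \<beta> (\<lambda>i. y i - z i)"
    if "x \<in> linf_space \<beta>" "y \<in> linf_space \<beta>" "z \<in> linf_space \<beta>" for x y z
  proof (rule linf_norm_least[THEN conjunct2])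
    fix i
    have "\<beta> i * \<bar>x i - z i\<bar> \<le> \<beta> i * (\<bar>x i - y i\<bar> + \<bar>y i - z i\<bar>)" using beta[of i] by (intro mult_left_mono) auto
    then show "\<beta> i * \<bar>x i - z i\<bar> \<le> linf_norm \<beta> (\<lambda>i. x i - y i) + linf_norm \<beta> (\<lambda>i. y i - z i)"
      using linf_norm_upper[OF linf_diff[OF that(1,2)], of i] linf_norm_upper[OF linf_diff[OF that(2,3)], of i]
      by (simp add: distrib_left)
  qed
qed

lemma linf_topspace: "topspace (linf_topology \<beta>) = linf_space \<beta>"
  unfolding linf_topology_def by (rule Metric_space.topspace_mtopology[OF linf_Metric_space])

lemma linf_coord_continuous: "continuous_map (linf_topology \<beta>) euclideanreal (\<lambda>x. x i)"
  unfolding linf_topology_def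
proof (rule Metric_space.continuous_map_real[OF linf_Metric_space, of "1 / \<beta> i"])
  show "\<bar>x i - y i\<bar> \<le> 1 / \<beta> i * linf_norm \<beta> (\<lambda>i. x i - y i)" if "x \<in> linf_space \<beta>" "y \<in> linf_space \<beta>" for x y
    using linf_norm_upper[OF linf_diff[OF that], of i] beta[of i] by (simp add: pos_le_divide_eq mult.commute)
qed (use beta in simp)

lemma linf_upd:
  assumes "x \<in> linf_space \<beta>"
  shows "x(j := y) \<in> linf_space \<beta>"
proof -
  have "\<beta> i * \<bar>(x(j := y)) i\<bar> \<le> max (linf_norm \<beta> x) (\<beta> j * \<bar>y\<bar>)" for i
    using linf_norm_upper[OF assms, of i] by (cases "i = j") auto
  from linf_norm_least[OF this] show ?thesis by blast
qed

text \<open>On a box \<beta>_i |x_i| \<le> m/\<gamma>_i: monotonicity of \<gamma> bounds this by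
  m/\<gamma>_0, and divergence of \<gamma> makes the tails uniformly small.\<close>

lemma linf_box:
  fixes m :: nat
  assumes g: "\<And>i. \<gamma> i > 0" "incseq \<gamma>" "filterlim \<gamma> at_top sequentially"
  defines "b \<equiv> \<lambda>i. inverse (\<beta> i) * inverse (\<gamma> i)"
  shows "{x. \<forall>i. \<bar>x i\<bar> \<le> real m * b i} \<subseteq> linf_space \<beta>"
    and "continuous_map (subtopology (powertop_real UNIV) {x. \<forall>i. \<bar>x i\<bar> \<le> real m * b i}) (linf_topology \<beta>) (\<lambda>x. x)"
proof -
  have tm: "\<beta> i * \<bar>t\<bar> \<le> M / \<gamma> i" if "\<bar>t\<bar> \<le> M * b i" for M t i
  proof -
    have "\<beta> i * \<bar>t\<bar> \<le> \<beta> i * (M * b i)" using that beta[of i] by (intro mult_left_mono) auto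
    also have "\<dots> = M / \<gamma> i" using beta[of i] by (simp add: b_def divide_inverse)
    finally show ?thesis .
  qed
  show sub: "{x. \<forall>i. \<bar>x i\<bar> \<le> real m * b i} \<subseteq> linf_space \<beta>"
  proof
    fix x assume x: "x \<in> {x. \<forall>i. \<bar>x i\<bar> \<le> real m * b i}"
    have "\<beta> i * \<bar>x i\<bar> \<le> real m / \<gamma> 0" for i
    proof -
      have "\<gamma> 0 \<le> \<gamma> i" using g(2) by (simp add: incseqD)
      then have "real m / \<gamma> i \<le> real m / \<gamma> 0" using g(1)[of 0] g(1)[of i] by (intro divide_left_mono) auto
      then show ?thesis using tm[of "x i" "real m" i] x by simp
    qed
    from linf_norm_least[OF this] show "x \<in> linf_space \<beta>" by blast
  qed
  show "continuous_map (subtopology (powertop_real UNIV) {x. \<forall>i. \<bar>x i\<bar> \<le> real m * b i}) (linf_topology \<beta>) (\<lambda>x. x)"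
    unfolding linf_topology_def
  proof (rule continuous_map_into_metric[OF linf_Metric_space sub])
    fix e :: real assume e: "e > 0"
    have "\<forall>\<^sub>F i in sequentially. 4 * real m / e \<le> \<gamma> i" using g(3) by (simp add: filterlim_at_top)
    \<comment> \<open>From N on, differences within the box contribute at most 2 m/\<gamma>_i \<le>
      e/2.\<close>
    then obtain N where N: "\<And>i. i \<ge> N \<Longrightarrow> 4 * real m / e \<le> \<gamma> i" by (auto simp: eventually_sequentially)
    define B where "B = (\<Sum>i<N. \<beta> i)"
    have B: "B \<ge> 0" unfolding B_def using beta by (intro sum_nonneg) (simp add: less_imp_le)
    define \<delta> where "\<delta> = e / 2 / (B + 1)"
    have \<delta>: "\<delta> > 0" using e B by (simp add: \<delta>_def)
    have "linf_norm \<beta> (\<lambda>i. x i - y i) < e"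
      if x: "\<forall>i. \<bar>x i\<bar> \<le> real m * b i" and y: "\<forall>i. \<bar>y i\<bar> \<le> real m * b i" and d: "\<forall>i<N. \<bar>x i - y i\<bar> < \<delta>" for x y
    proof -
      have "\<beta> i * \<bar>x i - y i\<bar> \<le> e / 2" for i
      proof (cases "i < N")
        case True
        have "\<beta> i \<le> B" unfolding B_def using True beta by (intro member_le_sum) (auto simp: less_imp_le)
        then have "\<beta> i * \<bar>x i - y i\<bar> \<le> (B + 1) * \<delta>"
          using d True beta[of i] B by (intro mult_mono) (auto simp: less_imp_le)
        moreover have "(B + 1) * \<delta> = e / 2" using B by (simp add: \<delta>_def field_simps)
        ultimately show ?thesis by simp
      next
        case False
        have "\<bar>x i - y i\<bar> \<le> (2 * real m) * b i"
          using x[rule_format, of i] y[rule_format, of i] by (simp add: algebra_simps)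
        then have "\<beta> i * \<bar>x i - y i\<bar> \<le> 2 * real m / \<gamma> i" by (rule tm)
        also have "\<dots> \<le> e / 2" using N[of i] False g(1)[of i] e by (simp add: field_simps)
        finally show ?thesis .
      qed
      from linf_norm_least[OF this] show ?thesis using e by auto
    qed
    then show "\<exists>N \<delta>. \<delta> > 0 \<and> (\<forall>x\<in>{x. \<forall>i. \<bar>x i\<bar> \<le> real m * b i}. \<forall>y\<in>{x. \<forall>i. \<bar>x i\<bar> \<le> real m * b i}.
        (\<forall>i<N. \<bar>x i - y i\<bar> < \<delta>) \<longrightarrow> linf_norm \<beta> (\<lambda>i. x i - y i) < e)"
      using \<delta> by blast
  qed
qed

end

lemma linf_path_space:
  assumes alpha: "0 < \<alpha>" "\<alpha> \<le> 1" and beta: "\<forall>i. \<beta> i > 0"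
    and mu: "prob_space \<mu>" "sets \<mu> = sets (borel_of (linf_topology \<beta>))"
    and kappa: "\<forall>i. regular_cond_dist \<mu> i (\<kappa> i)"
    and cond: "linf_condition \<alpha> \<beta> \<mu>"
  shows "\<exists>b M0. path_space (linf_topology \<beta>) \<mu> \<kappa> \<alpha> b M0"
proof -
  interpret weighted_linf \<beta> using beta by unfold_locales auto
  obtain \<gamma> M0 where M0: "M0 > 0" and g0: "0 < \<gamma> 0" "incseq \<gamma>" "filterlim \<gamma> at_top sequentially"
    and A: "summable (\<lambda>i. (\<beta> i * \<gamma> i) powr (\<alpha> + 1) *
          measure \<mu> {x \<in> space \<mu>. \<beta> i * \<bar>x i\<bar> > M0 * inverse (\<gamma> i)})"
    and B: "measure \<mu> (\<Union>m::nat. {x \<in> space \<mu>.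
          \<forall>i. \<bar>x i\<bar> \<le> real m * inverse (\<beta> i) * inverse (\<gamma> i)}) = 1"
    using cond unfolding linf_condition_def by blast
  have g1: "\<gamma> i > 0" for i using g0(1) incseqD[OF g0(2), of 0 i] by simp
  define b where "b i = inverse (\<beta> i) * inverse (\<gamma> i)" for i
  have sp: "space \<mu> = linf_space \<beta>" using space_eq_topspace[OF mu(2)] linf_topspace by simp
  note box = linf_box[OF g1 g0(2,3), folded b_def]
  have "path_space (linf_topology \<beta>) \<mu> \<kappa> \<alpha> b M0"
  proof (rule path_space.intro)
    show "0 < \<alpha>" "\<alpha> \<le> 1" "prob_space \<mu>" "sets \<mu> = sets (borel_of (linf_topology \<beta>))" by fact+
    show "regular_cond_dist \<mu> i (\<kappa> i)" for i using kappa by simp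
    show "continuous_map (linf_topology \<beta>) euclideanreal (\<lambda>x. x i)" for i by (rule linf_coord_continuous)
    show "x(i := y) \<in> topspace (linf_topology \<beta>)" if "x \<in> topspace (linf_topology \<beta>)" for x i y
      using that unfolding linf_topspace by (rule linf_upd)
    show "b i > 0" for i using beta g1[of i] by (simp add: b_def)
    show "M0 > 0" by fact
    show "continuous_map (subtopology (powertop_real UNIV) {x. \<forall>i. \<bar>x i\<bar> \<le> real m * b i}) (linf_topology \<beta>) (\<lambda>x. x)" for m
      by (rule box(2))
    have "(\<beta> i * \<gamma> i) powr (\<alpha> + 1) = b i powr (- (\<alpha> + 1))" for i
    proof -
      have "b i = inverse (\<beta> i * \<gamma> i)" by (simp add: b_def)
      then show ?thesis using beta g1[of i] by (simp only: powr_minus inverse_powr) simp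
    qed
    moreover have "\<beta> i * \<bar>t\<bar> > M0 * inverse (\<gamma> i) \<longleftrightarrow> \<bar>t\<bar> > M0 * b i" for i t
    proof -
      have "\<beta> i > 0" using beta by simp
      moreover have "b i = inverse (\<gamma> i) / \<beta> i" by (simp add: b_def divide_inverse)
      ultimately show ?thesis by (simp add: pos_divide_less_eq mult.commute)
    qed
    ultimately show "summable (\<lambda>i. b i powr (- (\<alpha> + 1)) * measure \<mu> {x \<in> space \<mu>. \<bar>x i\<bar> > M0 * b i})"
      using A by simp
    have "(\<Union>m::nat. {x \<in> space \<mu>. \<forall>i. \<bar>x i\<bar> \<le> real m * inverse (\<beta> i) * inverse (\<gamma> i)}) =
        (\<Union>m::nat. {x. \<forall>i. \<bar>x i\<bar> \<le> real m * b i})"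
      using box(1) unfolding sp b_def mult.assoc by blast
    then show "measure \<mu> (\<Union>m::nat. {x. \<forall>i. \<bar>x i\<bar> \<le> real m * b i}) = 1" using B by simp
  qed
  then show ?thesis by blast
qed

text \<open>On \<open>\<real>\<^sup>\<nat>\<close> no condition is needed: the scales \<open>b i\<close> are chosen with \<open>\<mu>(|X\<^sub>i| > b i) \<le> 2\<^sup>-\<^sup>i\<close>, and
  Borel-Cantelli gives the second condition.\<close>

lemma product_path_space:
  assumes alpha: "0 < \<alpha>" "\<alpha> \<le> 1"
    and mu: "prob_space \<mu>" "sets \<mu> = sets (borel_of (powertop_real UNIV))"
    and kappa: "\<forall>i. regular_cond_dist \<mu> i (\<kappa> i)"
  shows "\<exists>b M0. path_space (powertop_real UNIV) \<mu> \<kappa> \<alpha> b M0"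
proof -
  interpret prob_space \<mu> by fact
  have coord: "continuous_map (powertop_real UNIV) euclideanreal (\<lambda>x. x i)" for i
    by (rule continuous_map_product_projection) simp
  have [measurable]: "(\<lambda>x. x i) \<in> borel_measurable \<mu>" for i
    by (rule borel_measurable_borel_of[OF coord mu(2)])
  have sp: "space \<mu> = UNIV" using space_eq_topspace[OF mu(2)] by simp
  have "\<exists>n::nat. measure \<mu> {x \<in> space \<mu>. \<bar>x i\<bar> > real n + 1} \<le> (1/2) ^ i" for i
  proof -
    have "(\<lambda>n. measure \<mu> {x \<in> space \<mu>. \<bar>x i\<bar> > real n + 1}) \<longlonglongrightarrow> measure \<mu> (\<Inter>n. {x \<in> space \<mu>. \<bar>x i\<bar> > real n + 1})"
      by (rule finite_Lim_measure_decseq) (auto simp: decseq_def)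
    moreover have "(\<Inter>n. {x \<in> space \<mu>. \<bar>x i\<bar> > real n + 1}) = {}"
    proof -
      have "\<exists>n. \<not> \<bar>x i\<bar> > real n + 1" for x :: "nat \<Rightarrow> real"
      proof -
        obtain k :: nat where "\<bar>x i\<bar> \<le> real k" using real_arch_simple by blast
        then have "\<not> \<bar>x i\<bar> > real k + 1" by linarith
        then show ?thesis by blast
      qed
      then show ?thesis by auto
    qed
    ultimately have "(\<lambda>n. measure \<mu> {x \<in> space \<mu>. \<bar>x i\<bar> > real n + 1}) \<longlonglongrightarrow> 0" by simp
    then have "\<forall>\<^sub>F n in sequentially. measure \<mu> {x \<in> space \<mu>. \<bar>x i\<bar> > real n + 1} < (1/2) ^ i"
      by (rule order_tendstoD) simp
    then show ?thesis unfolding eventually_sequentially by (meson order_refl less_imp_le)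
  qed
  then have "\<forall>i. \<exists>n::nat. measure \<mu> {x \<in> space \<mu>. \<bar>x i\<bar> > real n + 1} \<le> (1/2) ^ i" by (rule allI)
  from choice[OF this] obtain n :: "nat \<Rightarrow> nat"
    where n: "measure \<mu> {x \<in> space \<mu>. \<bar>x i\<bar> > real (n i) + 1} \<le> (1/2) ^ i" for i by (elim exE) (rule that, rule spec)
  \<comment> \<open>The summand 1 gives b_i \<ge> 1, hence b_i^(-(\<alpha>+1)) \<le> 1, and
    summability of the tails carries over to the weighted tails with M0 = 1.\<close>
  define b where "b i = real (n i) + 1" for i
  have b1: "b i \<ge> 1" for i by (simp add: b_def)
  have summ: "summable (\<lambda>i. measure \<mu> {x \<in> space \<mu>. \<bar>x i\<bar> > b i})"
    by (rule summable_comparison_test'[OF summable_geometric[of "1/2"], of 0]) (use n in \<open>simp_all add: b_def\<close>)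
  have "AE x in \<mu>. \<forall>\<^sub>F i in sequentially. x \<in> space \<mu> - {x \<in> space \<mu>. \<bar>x i\<bar> > b i}"
    by (rule borel_cantelli_AE1[OF _ _ summ]) (auto simp: emeasure_eq_measure)
  then have AE: "AE x in \<mu>. x \<in> (\<Union>m::nat. {x. \<forall>i. \<bar>x i\<bar> \<le> real m * b i})"
  proof eventually_elim
    case (elim x)
    then obtain N where N: "\<And>i. i \<ge> N \<Longrightarrow> \<bar>x i\<bar> \<le> b i" by (auto simp: eventually_sequentially sp not_less)
    \<comment> \<open>\<open>m\<close> absorbs the finitely many coordinates before
      \<open>N\<close>, where b_i \<ge> 1 is used again.\<close>
    obtain m :: nat where m: "(\<Sum>i<N. \<bar>x i\<bar>) \<le> real m" using real_arch_simple by blast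
    have "\<bar>x i\<bar> \<le> real (m + 1) * b i" for i
    proof (cases "i < N")
      case True
      have "\<bar>x i\<bar> \<le> (\<Sum>i<N. \<bar>x i\<bar>)" using True by (intro member_le_sum) auto
      then have "\<bar>x i\<bar> \<le> real (m + 1) * 1" using m by simp
      also have "\<dots> \<le> real (m + 1) * b i" using b1 by (intro mult_left_mono) auto
      finally show ?thesis .
    next
      case False
      then have "\<bar>x i\<bar> \<le> 1 * b i" using N[of i] by simp
      also have "\<dots> \<le> real (m + 1) * b i" using b1[of i] by (intro mult_right_mono) auto
      finally show ?thesis .
    qed
    then show ?case by blast
  qed
  have "path_space (powertop_real UNIV) \<mu> \<kappa> \<alpha> b 1"
  proof (rule path_space.intro)
    show "0 < \<alpha>" "\<alpha> \<le> 1" "prob_space \<mu>" "sets \<mu> = sets (borel_of (powertop_real UNIV))" by fact+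
    show "regular_cond_dist \<mu> i (\<kappa> i)" for i using kappa by simp
    show "continuous_map (powertop_real UNIV) euclideanreal (\<lambda>x. x i)" for i by (rule coord)
    show "x(i := y) \<in> topspace (powertop_real UNIV)" for x :: "nat \<Rightarrow> real" and i y by simp
    show "b i > 0" for i using b1[of i] by linarith
    show "continuous_map (subtopology (powertop_real UNIV) {x. \<forall>i. \<bar>x i\<bar> \<le> real m * b i}) (powertop_real UNIV) (\<lambda>x. x)" for m
      by (intro continuous_map_from_subtopology) simp
    have "b i powr (- (\<alpha> + 1)) \<le> 1" for i
      using powr_mono[of "- (\<alpha> + 1)" 0 "b i"] alpha b1[of i] by simp
    then have "norm (b i powr (- (\<alpha> + 1)) * measure \<mu> {x \<in> space \<mu>. \<bar>x i\<bar> > 1 * b i}) \<le> measure \<mu> {x \<in> space \<mu>. \<bar>x i\<bar> > b i}" for i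
      using mult_right_mono[of "b i powr (- (\<alpha> + 1))" 1 "measure \<mu> {x \<in> space \<mu>. \<bar>x i\<bar> > b i}"] by simp
    then show "summable (\<lambda>i. b i powr (- (\<alpha> + 1)) * measure \<mu> {x \<in> space \<mu>. \<bar>x i\<bar> > 1 * b i})"
      by (intro summable_comparison_test'[OF summ, of 0]) auto
    have "{x \<in> space \<mu>. \<exists>m::nat. \<forall>i. \<bar>x i\<bar> \<le> real m * b i} \<in> sets \<mu>" by measurable
    also have "{x \<in> space \<mu>. \<exists>m::nat. \<forall>i. \<bar>x i\<bar> \<le> real m * b i} = (\<Union>m::nat. {x. \<forall>i. \<bar>x i\<bar> \<le> real m * b i})"
      by (auto simp: sp)
    finally have U: "(\<Union>m::nat. {x. \<forall>i. \<bar>x i\<bar> \<le> real m * b i}) \<in> sets \<mu>" .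
    show "measure \<mu> (\<Union>m::nat. {x. \<forall>i. \<bar>x i\<bar> \<le> real m * b i}) = 1"
      by (rule AE_in_set_eq_1[OF U, THEN iffD1, OF AE])
  qed simp
  then show ?thesis by blast
qed

theorem theorem2:
  fixes \<alpha> p :: real and \<beta> :: "nat \<Rightarrow> real"
    and S :: "(nat \<Rightarrow> real) topology"
    and \<mu> :: "(nat \<Rightarrow> real) measure"
    and \<kappa> :: "nat \<Rightarrow> (nat \<Rightarrow> real) \<Rightarrow> real measure"
    and \<phi> :: "(nat \<Rightarrow> real) \<Rightarrow> real"
  assumes alpha: "0 < \<alpha>" "\<alpha> \<le> 1"
    and p: "1 \<le> p" and beta: "\<forall>i. \<beta> i > 0"
    and S: "S \<in> {lp_topology \<beta> p, linf_topology \<beta>, powertop_real UNIV}"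
    and mu: "prob_space \<mu>" "sets \<mu> = sets (borel_of S)"
    and kappa: "\<forall>i. regular_cond_dist \<mu> i (\<kappa> i)"
    and phi: "\<phi> \<in> L2 \<mu>" "AE x in \<mu>. 0 < \<phi> x \<and> \<phi> x \<le> 1"
  shows
    "(S = lp_topology \<beta> p \<and> lp_condition \<alpha> p \<beta> \<mu> \<longrightarrow>
        dirichlet_form \<mu> (energy_dom \<alpha> \<mu> \<kappa>) (energy_form \<alpha> \<mu> \<kappa>) \<and>
        quasi_regular S \<mu> (energy_dom \<alpha> \<mu> \<kappa>) (energy_form \<alpha> \<mu> \<kappa>)) \<and>
     (S = linf_topology \<beta> \<and> linf_condition \<alpha> \<beta> \<mu> \<longrightarrow>
        dirichlet_form \<mu> (energy_dom \<alpha> \<mu> \<kappa>) (energy_form \<alpha> \<mu> \<kappa>) \<and>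
        quasi_regular S \<mu> (energy_dom \<alpha> \<mu> \<kappa>) (energy_form \<alpha> \<mu> \<kappa>)) \<and>
     (S = powertop_real UNIV \<longrightarrow>
        dirichlet_form \<mu> (energy_dom \<alpha> \<mu> \<kappa>) (energy_form \<alpha> \<mu> \<kappa>) \<and>
        quasi_regular S \<mu> (energy_dom \<alpha> \<mu> \<kappa>) (energy_form \<alpha> \<mu> \<kappa>)) \<and>
     ((S = lp_topology \<beta> p \<and> lp_condition \<alpha> p \<beta> \<mu>) \<or>
      (S = linf_topology \<beta> \<and> linf_condition \<alpha> \<beta> \<mu>) \<or>
      S = powertop_real UNIV \<longrightarrow>
        dirichlet_form \<mu> (energy_dom \<alpha> \<mu> \<kappa>) (energy_form \<alpha> \<mu> \<kappa>) \<and>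
        strictly_quasi_regular S \<mu> (energy_dom \<alpha> \<mu> \<kappa>) (energy_form \<alpha> \<mu> \<kappa>) \<phi>)"
proof -
  \<comment> \<open>All claims concern the same domain and form, so one instance of the common
    setting settles the quasi-regular and the strict statement together.\<close>
  have "\<exists>b M0. path_space S \<mu> \<kappa> \<alpha> b M0"
    if "(S = lp_topology \<beta> p \<and> lp_condition \<alpha> p \<beta> \<mu>) \<or>
      (S = linf_topology \<beta> \<and> linf_condition \<alpha> \<beta> \<mu>) \<or> S = powertop_real UNIV"
    using that lp_path_space[OF alpha p beta mu(1) _ kappa] linf_path_space[OF alpha beta mu(1) _ kappa]
      product_path_space[OF alpha mu(1) _ kappa] mu(2) by blast
  then show ?thesis
    using path_space_conclusion phi by blast
qed

end
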